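(* Let $\Omega\subset\mathbb{R}^n$ be a bounded domain with smooth boundary and $p\in(1,\infty)$. Assume $\mathbf{g}\in W^{1,p}_0(\Omega;\mathbb{R}^m)$ and suppose $\mathbf{v}$ is a weak solution of $$\begin{cases}|\mathbf{v}_t|^{p-2}\mathbf{v}_t=\operatorname{div}(|D\mathbf{v}|^{p-2}D\mathbf{v}), & \Omega\times(0,\infty)\\ \mathbf{v}=\mathbf{0}, & \partial\Omega\times[0,\infty)\\ \mathbf{v}=\mathbf{g}, & \Omega\times\{0\}\end{cases}$$ that satisfies $$\liminf_{t\to\infty}e^{p\Upsilon_pt}\int_\Omega|D\mathbf{v}(x,t)|^p\,dx>0.$$ Then $\mathbf{v}(\cdot,t)\neq\mathbf{0}$ for each $t\ge0$ and $$\Lambda_p=\lim_{t\to\infty}\frac{\int_\Omega|D\mathbf{v}(x,t)|^p\,dx}{\int_\Omega|\mathbf{v}(x,t)|^p\,dx}.$$ Moreover, for any increasing sequence of positive numbers $\{t_k\}_{k\in\mathbb{N}}$ tending to $\infty$, the sequence $\{e^{\Upsilon_pt_k}\mathbf{v}(\cdot,t_k)\}_{k\in\mathbb{N}}$ has a subsequence that converges to a $p$-ground state in $W^{1,p}_0(\Omega;\mathbb{R}^m)$.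
   Context: For matrices, $M\cdot N=\operatorname{tr}(M^tN)$ and $|M|=\sqrt{M\cdot M}$; $D\mathbf v=(v^i_{x_j})$ is the spatial gradient matrix. $$\Lambda_p:=\inf\left\{\frac{\int_\Omega|D\mathbf u|^pdx}{\int_\Omega|\mathbf u|^pdx}:\mathbf u\in W^{1,p}_0(\Omega;\mathbb R^m)\setminus\{\mathbf 0\}\right\},\qquad \Upsilon_p:=\Lambda_p^{\frac1{p-1}}.$$ A $p$-ground state is a (nonzero) minimizer in the definition of $\Lambda_p$. A weak solution of the initial value problem is a mapping $\mathbf v$ such that for every $T>0$: $\mathbf v_t\in L^p(\Omega\times(0,T);\mathbb R^m)$, $\mathbf v\in L^\infty([0,T];W^{1,p}_0(\Omega;\mathbb R^m))$, $$\int_\Omega|\mathbf v_t(x,t)|^{p-2}\mathbf v_t(x,t)\cdot\mathbf w(x)\,dx+\int_\Omega|D\mathbf v(x,t)|^{p-2}D\mathbf v(x,t)\cdot D\mathbf w(x)\,dx=0$$ for each $\mathbf w\in W^{1,p}_0(\Omega;\mathbb R^m)$ and a.e. $t\in[0,T]$; and $\mathbf v(\cdot,0)=\mathbf g$. Here $\mathbf v$ is identified with its representative in $C([0,\infty);L^p(\Omega;\mathbb R^m))$, and $|z|^{p-2}z:=0$ for $z=0$. *)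

theory Defs
  imports "HOL-Analysis.Analysis"
begin

section \<open>Smooth functions and smooth domains\<close>

primrec Ck_fun :: "nat \<Rightarrow> ('a::real_normed_vector \<Rightarrow> 'b::real_normed_vector) \<Rightarrow> bool" where
  "Ck_fun 0 f \<longleftrightarrow> continuous_on UNIV f"
| "Ck_fun (Suc k) f \<longleftrightarrow> (\<forall>x. f differentiable (at x)) \<and>
     (\<forall>h. Ck_fun k (\<lambda>x. frechet_derivative f (at x) h))"

definition smooth_fun :: "('a::real_normed_vector \<Rightarrow> 'b::real_normed_vector) \<Rightarrow> bool" where
  "smooth_fun f \<longleftrightarrow> (\<forall>k. Ck_fun k f)"

text \<open>
  Near each boundary point the domain is the region strictly above a smooth graph in some unit
  direction \<open>e\<close>. The graph function has arguments in the hyperplane orthogonal to \<open>e\<close>; it is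
  represented by a smooth function on the whole space evaluated at the orthogonal projection.
\<close>

definition smooth_boundary :: "'a::euclidean_space set \<Rightarrow> bool" where
  "smooth_boundary \<Omega> \<longleftrightarrow> (\<forall>x\<in>frontier \<Omega>. \<exists>r>0. \<exists>e. norm e = 1 \<and>
     (\<exists>\<gamma>::'a \<Rightarrow> real. smooth_fun \<gamma> \<and>
        \<Omega> \<inter> ball x r = {y \<in> ball x r. y \<bullet> e > \<gamma> (y - (y \<bullet> e) *\<^sub>R e)}))"

definition bounded_smooth_domain :: "'a::euclidean_space set \<Rightarrow> bool" where
  "bounded_smooth_domain \<Omega> \<longleftrightarrow>
     open \<Omega> \<and> connected \<Omega> \<and> \<Omega> \<noteq> {} \<and> bounded \<Omega> \<and> smooth_boundary \<Omega>"


section \<open>Weak derivatives\<close>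

definition test_fun :: "'a::euclidean_space set \<Rightarrow> ('a \<Rightarrow> 'b::real_normed_vector) \<Rightarrow> bool" where
  "test_fun U \<phi> \<longleftrightarrow> smooth_fun \<phi> \<and> compact (closure {x. \<phi> x \<noteq> 0}) \<and> closure {x. \<phi> x \<noteq> 0} \<subseteq> U"

definition loc_integrable :: "'a::euclidean_space set \<Rightarrow> ('a \<Rightarrow> 'b::euclidean_space) \<Rightarrow> bool" where
  "loc_integrable U u \<longleftrightarrow> (\<forall>K. compact K \<and> K \<subseteq> U \<longrightarrow> u absolutely_integrable_on K)"

definition has_weak_deriv ::
  "'a::euclidean_space set \<Rightarrow> 'a \<Rightarrow> ('a \<Rightarrow> 'b::euclidean_space) \<Rightarrow> ('a \<Rightarrow> 'b) \<Rightarrow> bool" where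
  "has_weak_deriv U e u w \<longleftrightarrow> loc_integrable U u \<and> loc_integrable U w \<and>
     (\<forall>\<phi>::'a \<Rightarrow> real. test_fun U \<phi> \<longrightarrow>
        (LINT x|lebesgue_on U. frechet_derivative \<phi> (at x) e *\<^sub>R u x) =
        - (LINT x|lebesgue_on U. \<phi> x *\<^sub>R w x))"

text \<open>
  The gradient of \<open>u\<close> at \<open>x\<close> is the matrix with entries \<open>V x $ i $ j\<close>, the derivative of the
  \<open>i\<close>-th component of \<open>u\<close> in the \<open>j\<close>-th coordinate. On matrices of type \<open>real ^ 'n ^ 'm\<close> the
  library's \<open>inner\<close> and \<open>norm\<close> are the Frobenius ones (see \<open>matrix_inner_eq_trace\<close>).
\<close>

definition has_weak_grad ::
  "(real ^ 'n::finite) set \<Rightarrow> (real ^ 'n \<Rightarrow> real ^ 'm::finite) \<Rightarrow> (real ^ 'n \<Rightarrow> real ^ 'n ^ 'm) \<Rightarrow> bool" where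
  "has_weak_grad \<Omega> u V \<longleftrightarrow> (\<forall>j. has_weak_deriv \<Omega> (axis j 1) u (\<lambda>x. column j (V x)))"

text \<open>Some representative of the weak gradient; it is unspecified if there is no weak gradient.\<close>

definition wgrad ::
  "(real ^ 'n::finite) set \<Rightarrow> (real ^ 'n \<Rightarrow> real ^ 'm::finite) \<Rightarrow> real ^ 'n \<Rightarrow> real ^ 'n ^ 'm" where
  "wgrad \<Omega> u = (SOME V. has_weak_grad \<Omega> u V)"

lemma matrix_inner_eq_trace:
  fixes M N :: "real ^ 'n::finite ^ 'm::finite"
  shows "M \<bullet> N = trace (transpose M ** N)"
proof -
  have "M \<bullet> N = (\<Sum>i\<in>UNIV. \<Sum>j\<in>UNIV. M $ i $ j * N $ i $ j)"
    by (simp add: inner_vec_def)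
  also have "\<dots> = (\<Sum>j\<in>UNIV. \<Sum>i\<in>UNIV. M $ i $ j * N $ i $ j)"
    by (rule sum.swap)
  finally show ?thesis
    by (simp add: trace_def transpose_def matrix_matrix_mult_def)
qed


section \<open>Function spaces\<close>

text \<open>Functions are not quotiented by equality almost everywhere.\<close>

definition Lp_space :: "'a::euclidean_space set \<Rightarrow> real \<Rightarrow> ('a \<Rightarrow> 'b::euclidean_space) set" where
  "Lp_space S p = {f. f \<in> borel_measurable (lebesgue_on S) \<and>
                      integrable (lebesgue_on S) (\<lambda>x. norm (f x) powr p)}"

definition Lp_norm :: "'a::euclidean_space set \<Rightarrow> real \<Rightarrow> ('a \<Rightarrow> 'b::euclidean_space) \<Rightarrow> real" where
  "Lp_norm S p f = (LINT x|lebesgue_on S. norm (f x) powr p) powr (1 / p)"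

definition W1p :: "(real ^ 'n::finite) set \<Rightarrow> real \<Rightarrow> (real ^ 'n \<Rightarrow> real ^ 'm::finite) set" where
  "W1p \<Omega> p = {u \<in> Lp_space \<Omega> p. \<exists>V. has_weak_grad \<Omega> u V \<and> V \<in> Lp_space \<Omega> p}"

definition W1p_norm :: "(real ^ 'n::finite) set \<Rightarrow> real \<Rightarrow> (real ^ 'n \<Rightarrow> real ^ 'm::finite) \<Rightarrow> real" where
  "W1p_norm \<Omega> p u = ((LINT x|lebesgue_on \<Omega>. norm (u x) powr p) +
                     (LINT x|lebesgue_on \<Omega>. norm (wgrad \<Omega> u x) powr p)) powr (1 / p)"

definition W01p :: "(real ^ 'n::finite) set \<Rightarrow> real \<Rightarrow> (real ^ 'n \<Rightarrow> real ^ 'm::finite) set" where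
  "W01p \<Omega> p = {u \<in> W1p \<Omega> p. \<exists>\<phi>. (\<forall>k. test_fun \<Omega> (\<phi> k)) \<and>
                  (\<lambda>k::nat. W1p_norm \<Omega> p (\<lambda>x. u x - \<phi> k x)) \<longlonglongrightarrow> 0}"

definition converges_W01p ::
  "(real ^ 'n::finite) set \<Rightarrow> real \<Rightarrow> (nat \<Rightarrow> real ^ 'n \<Rightarrow> real ^ 'm::finite) \<Rightarrow> (real ^ 'n \<Rightarrow> real ^ 'm) \<Rightarrow> bool" where
  "converges_W01p \<Omega> p f u \<longleftrightarrow> (\<forall>k. f k \<in> W01p \<Omega> p) \<and> u \<in> W01p \<Omega> p \<and>
     (\<lambda>k. W1p_norm \<Omega> p (\<lambda>x. f k x - u x)) \<longlonglongrightarrow> 0"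

text \<open>
  The Bochner space of strongly measurable, essentially bounded maps from \<open>[0, T]\<close> to
  the space \<open>W01p \<Omega> p\<close>.
\<close>

definition Linf_W01p ::
  "(real ^ 'n::finite) set \<Rightarrow> real \<Rightarrow> real \<Rightarrow> (real \<Rightarrow> real ^ 'n \<Rightarrow> real ^ 'm::finite) set" where
  "Linf_W01p \<Omega> p T = {v.
     (AE t in lebesgue_on {0..T}. v t \<in> W01p \<Omega> p) \<and>
     (\<exists>s::nat \<Rightarrow> real \<Rightarrow> real ^ 'n \<Rightarrow> real ^ 'm.
        (\<forall>k. simple_function (lebesgue_on {0..T}) (s k) \<and> (\<forall>t\<in>{0..T}. s k t \<in> W01p \<Omega> p)) \<and>
        (AE t in lebesgue_on {0..T}. (\<lambda>k. W1p_norm \<Omega> p (\<lambda>x. s k t x - v t x)) \<longlonglongrightarrow> 0)) \<and>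
     (\<exists>C. AE t in lebesgue_on {0..T}. W1p_norm \<Omega> p (v t) \<le> C)}"

definition continuous_Lp ::
  "'a::euclidean_space set \<Rightarrow> real \<Rightarrow> (real \<Rightarrow> 'a \<Rightarrow> 'b::euclidean_space) \<Rightarrow> bool" where
  "continuous_Lp \<Omega> p v \<longleftrightarrow> (\<forall>t\<ge>0. v t \<in> Lp_space \<Omega> p \<and>
     ((\<lambda>s. Lp_norm \<Omega> p (\<lambda>x. v s x - v t x)) \<longlongrightarrow> 0) (at t within {0..}))"


section \<open>The eigenvalue problem\<close>

definition nonzero_on :: "'a::euclidean_space set \<Rightarrow> ('a \<Rightarrow> 'b::real_vector) \<Rightarrow> bool" where
  "nonzero_on \<Omega> u \<longleftrightarrow> \<not> (AE x in lebesgue_on \<Omega>. u x = 0)"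

definition energy :: "(real ^ 'n::finite) set \<Rightarrow> real \<Rightarrow> (real ^ 'n \<Rightarrow> real ^ 'm::finite) \<Rightarrow> real" where
  "energy \<Omega> p u = (LINT x|lebesgue_on \<Omega>. norm (wgrad \<Omega> u x) powr p)"

definition rayleigh :: "(real ^ 'n::finite) set \<Rightarrow> real \<Rightarrow> (real ^ 'n \<Rightarrow> real ^ 'm::finite) \<Rightarrow> real" where
  "rayleigh \<Omega> p u = energy \<Omega> p u / (LINT x|lebesgue_on \<Omega>. norm (u x) powr p)"

text \<open>The type argument fixes the target space \<open>real ^ 'm\<close> of the competitors.\<close>

definition Lambda :: "'m::finite itself \<Rightarrow> (real ^ 'n::finite) set \<Rightarrow> real \<Rightarrow> real" where
  "Lambda _ \<Omega> p = Inf {rayleigh \<Omega> p u | u :: real ^ 'n \<Rightarrow> real ^ 'm. u \<in> W01p \<Omega> p \<and> nonzero_on \<Omega> u}"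

definition Upsilon :: "'m::finite itself \<Rightarrow> (real ^ 'n::finite) set \<Rightarrow> real \<Rightarrow> real" where
  "Upsilon M \<Omega> p = Lambda M \<Omega> p powr (1 / (p - 1))"

definition ground_state :: "(real ^ 'n::finite) set \<Rightarrow> real \<Rightarrow> (real ^ 'n \<Rightarrow> real ^ 'm::finite) \<Rightarrow> bool" where
  "ground_state \<Omega> p u \<longleftrightarrow>
     u \<in> W01p \<Omega> p \<and> nonzero_on \<Omega> u \<and> rayleigh \<Omega> p u = Lambda TYPE('m) \<Omega> p"


section \<open>The evolution equation\<close>

text \<open>
  \<open>v t x\<close> is the value at time \<open>t\<close> and position \<open>x\<close>. Since \<open>v\<close> is a pointwise function, condition
  \<open>continuous_Lp\<close> says that \<open>v\<close> is the representative that is continuous in time with values in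
  the Lebesgue space. Note that \<open>0 powr a = 0\<close>, in accordance with the
  convention that \<open>norm z powr (p - 2) *\<^sub>R z\<close> vanishes at \<open>z = 0\<close>.
\<close>

definition weak_solution ::
  "(real ^ 'n::finite) set \<Rightarrow> real \<Rightarrow> (real ^ 'n \<Rightarrow> real ^ 'm::finite) \<Rightarrow> (real \<Rightarrow> real ^ 'n \<Rightarrow> real ^ 'm) \<Rightarrow> bool" where
  "weak_solution \<Omega> p g v \<longleftrightarrow>
     continuous_Lp \<Omega> p v \<and>
     (AE x in lebesgue_on \<Omega>. v 0 x = g x) \<and>
     (\<exists>vt::real \<Rightarrow> real ^ 'n \<Rightarrow> real ^ 'm.
        has_weak_deriv (\<Omega> \<times> {0<..}) (0, 1) (\<lambda>(x, t). v t x) (\<lambda>(x, t). vt t x) \<and>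
        (\<forall>T>0.
           (\<lambda>(x, t). vt t x) \<in> Lp_space (\<Omega> \<times> {0<..<T}) p \<and>
           v \<in> Linf_W01p \<Omega> p T \<and>
           (\<forall>w\<in>W01p \<Omega> p. AE t in lebesgue_on {0..T}.
              (LINT x|lebesgue_on \<Omega>. (norm (vt t x) powr (p - 2) *\<^sub>R vt t x) \<bullet> w x) +
              (LINT x|lebesgue_on \<Omega>.
                 (norm (wgrad \<Omega> (v t) x) powr (p - 2) *\<^sub>R wgrad \<Omega> (v t) x) \<bullet> wgrad \<Omega> w x) = 0)))"

end

theory Submission
  imports Defs "HOL-Complex_Analysis.Great_Picard"
begin

text \<open>
  Write \<open>E t\<close> for the energy of \<open>v t\<close>, \<open>N t\<close> for its \<open>L\<^sup>p\<close> norm and \<open>D t\<close> for the integral of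
  \<open>|v\<^sub>t|\<^sup>p\<close> at time \<open>t\<close>. Two facts drive the proof. Testing the equation with \<open>v t\<close> gives
  \<open>E \<le> D\<^bsup>(p-1)/p\<^esup> N\<close> (\<open>energy_rate\<close>), and \<open>E\<close> decreases with speed at least \<open>p D\<close>, in the integrated
  form \<open>E t + p \<integral> D \<le> E s\<close> (\<open>energy_inequality\<close>). If \<open>c N\<^sup>p \<le> E\<close> on a time interval, the first fact
  becomes \<open>c\<^bsup>1/(p-1)\<^esup> E \<le> D\<close>, and the second one makes \<open>E\<close> decay there with the exponential rate
  \<open>p c\<^bsup>1/(p-1)\<^esup>\<close> (\<open>E_decay_if_quotient_ge\<close>).

  As \<open>c = \<Lambda>\<close> is always admissible, the rescaled energy \<open>G t = e\<^bsup>p\<Upsilon>t\<^esup> E t\<close> is nonincreasing, and the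
  assumption on the lower limit says that its limit \<open>S\<close> is positive. In particular \<open>v\<close> never
  vanishes. If the quotient \<open>E / N\<^sup>p\<close> exceeded \<open>\<Lambda> + \<epsilon>\<close> throughout a late time interval of length \<open>\<delta>\<close>,
  then \<open>G\<close> would lose a fixed factor there, which its convergence to \<open>S > 0\<close> forbids. Hence each late
  interval contains a time with a small quotient; from such a time on the energy does not increase,
  and \<open>N\<close> changes little in time \<open>\<delta>\<close>, so the quotient stays almost as small (\<open>quotient_eventually_small\<close>).
  This proves the convergence to \<open>\<Lambda>\<close>. The functions \<open>e\<^bsup>\<Upsilon>t\<^esup> v t\<close> therefore have energies tending to \<open>S\<close>
  and \<open>p\<close>-th powers of norms tending to \<open>S / \<Lambda>\<close>. Rellich compactness gives a subsequence that converges
  in \<open>L\<^sup>p\<close> to some \<open>u\<close>, and midpoints of late members have energy at least almost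
  \<open>\<Lambda> (S / \<Lambda>) = S\<close>; uniform convexity turns this into convergence of the gradients, and \<open>u\<close> has the
  quotient \<open>\<Lambda>\<close> (\<open>rescaled_subsequence_converges\<close>).

  The delicate part is the energy inequality, because the time derivative of the energy need not
  exist and the equation holds outside a null set of times that depends on the test function. Strong
  measurability makes values \<open>v r\<close> of the solution admissible as test functions at time \<open>t\<close>, for all \<open>t\<close>
  and \<open>r\<close> outside one null set (\<open>good_times\<close>). The subgradient inequality of the energy at time \<open>t\<close>,
  with the equation at the same time, bounds \<open>E t - E (t - h)\<close> by the pairing of \<open>v\<^sub>t\<close> with the
  increment of \<open>v\<close> over \<open>[t - h, t]\<close>, and this increment is \<open>h\<close> times a time average of \<open>v\<^sub>t\<close>.
  Integration over \<open>t\<close> telescopes the left side, and averages converge in \<open>L\<^sup>p\<close> as \<open>h\<close> tends to \<open>0\<close>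
  because translations are continuous there.

  The functional analysis is developed directly. Uniform convexity of \<open>L\<^sup>p\<close> comes from strict
  convexity of \<open>|z|\<^sup>p\<close> and compactness of a sphere; it also yields lower semicontinuity of the energy
  without weak topologies. Poincare's inequality and Rellich compactness both follow from the bound
  of a translation by the gradient.
\<close>


section \<open>Convexity of powers\<close>

lemma powr_convex_nonneg:
  fixes x y u v p :: real
  assumes "0 \<le> x" "0 \<le> y" "0 \<le> u" "0 \<le> v" "u + v = 1" "1 \<le> p"
  shows "(u * x + v * y) powr p \<le> u * x powr p + v * y powr p"
proof -
  have *: "(u * 0 + v * y) powr p \<le> u * 0 powr p + v * y powr p"
    if "0 \<le> y" "0 \<le> u" "0 \<le> v" "u + v = 1" for u v y :: real
  proof -
    have "v powr p \<le> v powr 1"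
      using that assms(6) by (intro powr_mono') auto
    then show ?thesis
      using that by (simp add: powr_mult mult_right_mono)
  qed
  show ?thesis
  proof (cases "x = 0 \<or> y = 0")
    case True
    then show ?thesis
      using *[of y u v] *[of x v u] assms by (auto simp: algebra_simps)
  next
    case False
    have u: "u = 1 - v" using assms by simp
    show ?thesis
      using convex_onD[OF powr_convex[OF assms(6)], of v x y] assms False
      unfolding u by simp
  qed
qed

lemma norm_powr_convex:
  fixes x y :: "'b::real_normed_vector"
  assumes "0 \<le> u" "0 \<le> v" "u + v = 1" "1 \<le> p"
  shows "norm (u *\<^sub>R x + v *\<^sub>R y) powr p \<le> u * norm x powr p + v * norm y powr p"
proof -
  have "norm (u *\<^sub>R x + v *\<^sub>R y) \<le> u * norm x + v * norm y"
    using norm_triangle_ineq[of "u *\<^sub>R x" "v *\<^sub>R y"] assms by simp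
  then have "norm (u *\<^sub>R x + v *\<^sub>R y) powr p \<le> (u * norm x + v * norm y) powr p"
    using assms by (intro powr_mono2) auto
  also have "\<dots> \<le> u * norm x powr p + v * norm y powr p"
    using assms by (intro powr_convex_nonneg) auto
  finally show ?thesis .
qed

lemma norm_add_powr_le:
  fixes x y :: "'b::real_normed_vector"
  assumes "1 \<le> p"
  shows "norm (x + y) powr p \<le> 2 powr p * (norm x powr p + norm y powr p)"
proof -
  have "norm (x + y) powr p = 2 powr p * norm ((1/2) *\<^sub>R x + (1/2) *\<^sub>R y) powr p"
    by (simp add: powr_mult[symmetric] flip: scaleR_add_right)
  also have "\<dots> \<le> 2 powr p * (1/2 * norm x powr p + 1/2 * norm y powr p)"
    using assms by (intro mult_left_mono norm_powr_convex) auto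
  also have "\<dots> \<le> 2 powr p * (norm x powr p + norm y powr p)"
    using powr_ge_zero[of "norm x" p] powr_ge_zero[of "norm y" p] by (intro mult_left_mono) (linarith, simp)
  finally show ?thesis .
qed

lemma powr_above_tangent:
  fixes u p :: real
  assumes "1 < p" "0 \<le> u" "u \<noteq> 1"
  shows "1 + p * (u - 1) < u powr p"
proof (cases "u = 0")
  case True then show ?thesis using assms by simp
next
  case False
  then have u: "0 < u" using assms by simp
  have der: "((\<lambda>x. x powr p - p * x) has_real_derivative (p * x powr (p - 1) - p)) (at x)" if "0 < x" for x
    using that by (auto intro!: derivative_eq_intros)
  consider "u < 1" | "1 < u" using assms by linarith
  then show ?thesis
  proof cases
    case 1
    then obtain z where z: "u < z" "z < 1" "(1 powr p - p * 1) - (u powr p - p * u) = (1 - u) * (p * z powr (p - 1) - p)"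
      using MVT2[OF 1, of "\<lambda>x. x powr p - p * x" "\<lambda>x. p * x powr (p - 1) - p"] der u by force
    have "z powr (p - 1) < 1 powr (p - 1)" using z u assms by (intro powr_less_mono2) auto
    then have "(1 - u) * (p * z powr (p - 1) - p) < 0" using 1 assms by (intro mult_pos_neg) auto
    then show ?thesis using z by (simp add: algebra_simps)
  next
    case 2
    then obtain z where z: "1 < z" "z < u" "(u powr p - p * u) - (1 powr p - p * 1) = (u - 1) * (p * z powr (p - 1) - p)"
      using MVT2[OF 2, of "\<lambda>x. x powr p - p * x" "\<lambda>x. p * x powr (p - 1) - p"] der by force
    have "1 powr (p - 1) < z powr (p - 1)" using z u assms by (intro powr_less_mono2) auto
    then have "(u - 1) * (p * z powr (p - 1) - p) > 0" using 2 assms by (intro mult_pos_pos) auto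
    then show ?thesis using z by (simp add: algebra_simps)
  qed
qed

lemma powr_midpoint_less:
  fixes a b p :: real
  assumes "1 < p" "0 \<le> a" "0 \<le> b" "a \<noteq> b"
  shows "((a + b) / 2) powr p < (a powr p + b powr p) / 2"
proof -
  define c where "c = (a + b) / 2"
  have c: "c > 0" using assms by (auto simp: c_def)
  \<comment> \<open>Both values are compared with the tangent at the midpoint; the linear terms cancel in the sum.\<close>
  have "1 + p * (a / c - 1) < (a / c) powr p" "1 + p * (b / c - 1) < (b / c) powr p"
    using assms c by (intro powr_above_tangent; simp add: c_def divide_eq_1_iff field_simps)+
  then have "2 + p * (a / c + b / c - 2) < (a powr p + b powr p) / c powr p"
    using assms c by (simp add: powr_divide add_divide_distrib algebra_simps)
  moreover have "a / c + b / c = 2"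
  proof -
    have "a + b = 2 * c" by (simp add: c_def)
    then show ?thesis using c by (simp add: add_divide_distrib[symmetric])
  qed
  ultimately show ?thesis using c by (simp add: c_def[symmetric] field_simps)
qed

text \<open>
  Different norms are separated by strict convexity of the power, equal norms by the parallelogram
  law; the latter is where the inner product enters.
\<close>

lemma norm_powr_midpoint_less:
  fixes x y :: "'b::real_inner"
  assumes "1 < p" "x \<noteq> y"
  shows "norm ((1/2) *\<^sub>R (x + y)) powr p < (norm x powr p + norm y powr p) / 2"
proof (cases "norm x = norm y")
  case False
  have "norm ((1/2) *\<^sub>R (x + y)) powr p \<le> ((norm x + norm y) / 2) powr p"
    using assms by (intro powr_mono2) (auto simp: norm_triangle_ineq)
  also have "\<dots> < (norm x powr p + norm y powr p) / 2"
    using assms False by (intro powr_midpoint_less) auto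
  finally show ?thesis .
next
  case True
  have "(norm ((1/2) *\<^sub>R (x + y)))\<^sup>2 < (norm x)\<^sup>2"
  proof -
    have "(norm (x + y))\<^sup>2 + (norm (x - y))\<^sup>2 = 4 * (norm x)\<^sup>2"
      using True by (simp add: power2_norm_eq_inner inner_diff inner_add inner_commute norm_eq algebra_simps)
    moreover have "(norm (x - y))\<^sup>2 > 0" using assms by simp
    moreover have "(norm ((1/2) *\<^sub>R (x + y)))\<^sup>2 = (norm (x + y))\<^sup>2 / 4"
      by (simp add: power_divide)
    ultimately show ?thesis by linarith
  qed
  then have "norm ((1/2) *\<^sub>R (x + y)) < norm x"
    by (rule power_less_imp_less_base) simp
  then have "norm ((1/2) *\<^sub>R (x + y)) powr p < norm x powr p"
    using assms by (intro powr_less_mono2) auto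
  then show ?thesis using True by simp
qed

text \<open>
  Strict convexity of \<open>norm x powr p\<close> becomes a quantitative statement because the unit sphere
  of the pairs \<open>(x, y)\<close> is compact and the inequality is homogeneous of degree \<open>p\<close>. Integrated over
  a measure space, it does the work of the Clarkson inequalities, for all exponents alike.
\<close>

lemma norm_powr_uniformly_convex:
  fixes p \<epsilon> :: real
  assumes "1 < p" "0 < \<epsilon>"
  obtains C where "0 \<le> C" "\<And>x y :: 'b::euclidean_space.
    norm (x - y) powr p \<le> \<epsilon> * (norm x powr p + norm y powr p)
      + C * ((norm x powr p + norm y powr p) / 2 - norm ((1/2) *\<^sub>R (x + y)) powr p)"
proof -
  define sphere' :: "('b \<times> 'b) set" where "sphere' = {z. norm (fst z) powr p + norm (snd z) powr p = 1}"
  \<comment> \<open>On \<open>K\<close> the two points are different, so the convexity defect \<open>d\<close> has a positive minimum.\<close>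
  define K where "K = sphere' \<inter> {z. \<epsilon> \<le> norm (fst z - snd z) powr p}"
  define d :: "'b \<times> 'b \<Rightarrow> real"
    where "d z = (norm (fst z) powr p + norm (snd z) powr p) / 2 - norm ((1/2) *\<^sub>R (fst z + snd z)) powr p" for z
  have cont: "continuous_on UNIV (\<lambda>z::'b\<times>'b. norm (fst z) powr p + norm (snd z) powr p)"
    "continuous_on UNIV (\<lambda>z::'b\<times>'b. norm (fst z - snd z) powr p)" "continuous_on UNIV d"
    unfolding d_def using assms by (auto intro!: continuous_intros continuous_on_powr')
  have "closed K"
    unfolding K_def sphere'_def
    using continuous_closed_vimage[of "{1}", OF _ ] cont
    by (intro closed_Int closed_Collect_eq closed_Collect_le continuous_on_const) auto
  moreover have "bounded K"
  proof (rule boundedI)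
    fix z assume "z \<in> K"
    then have eq: "norm (fst z) powr p + norm (snd z) powr p = 1" by (simp add: K_def sphere'_def)
    have "norm (fst z) powr p \<le> 1" "norm (snd z) powr p \<le> 1"
      using eq powr_ge_zero[of "norm (fst z)" p] powr_ge_zero[of "norm (snd z)" p] by linarith+
    then have "norm (fst z) \<le> 1" "norm (snd z) \<le> 1"
      using assms gr_one_powr[of "norm (fst z)" p] gr_one_powr[of "norm (snd z)" p] by (auto simp: not_less[symmetric])
    then show "norm z \<le> 2" using norm_Pair_le[of "fst z" "snd z"] by simp
  qed
  ultimately have K: "compact K" by (simp add: compact_eq_bounded_closed)
  have d0: "0 \<le> d z" for z
    unfolding d_def using norm_powr_midpoint_less[OF assms(1), of "fst z" "snd z"]
    by (cases "fst z = snd z") (auto simp: scaleR_2[symmetric])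
  have dpos: "0 < d z" if "z \<in> K" for z
    unfolding d_def using norm_powr_midpoint_less[OF assms(1), of "fst z" "snd z"] that assms
    by (cases "fst z = snd z") (auto simp: K_def)
  obtain \<delta> where \<delta>: "0 < \<delta>" "\<And>z. z \<in> K \<Longrightarrow> \<delta> \<le> d z"
  proof (cases "K = {}")
    case True then show ?thesis using that[of 1] by auto
  next
    case False
    then obtain z where "z \<in> K" "\<And>y. y \<in> K \<Longrightarrow> d z \<le> d y"
      using continuous_attains_inf[OF K False, of d] cont(3) continuous_on_subset by blast
    then show ?thesis using that[of "d z"] dpos by blast
  qed
  \<comment> \<open>On \<open>K\<close> the defect term alone dominates \<open>norm (x - y) powr p \<le> 2 powr p\<close>; off \<open>K\<close> the term \<open>\<epsilon>\<close> does.\<close>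
  define C where "C = 2 powr p / \<delta>"
  have main: "norm (x - y) powr p \<le> \<epsilon> * 1 + C * d (x, y)" if "(x, y) \<in> sphere'" for x y
  proof (cases "(x, y) \<in> K")
    case True
    have "norm (x + - y) powr p \<le> 2 powr p * (norm x powr p + norm (- y) powr p)"
      using assms by (intro norm_add_powr_le) auto
    then have "norm (x - y) powr p \<le> 2 powr p" using that by (simp add: sphere'_def)
    also have "\<dots> \<le> C * d (x, y)"
      using \<delta>(1) \<delta>(2)[OF True] by (simp add: C_def field_simps)
    finally show ?thesis using assms by simp
  next
    case False
    then show ?thesis using that \<delta> d0 by (auto simp: K_def C_def intro!: add_increasing2)
  qed
  show ?thesis
  proof
    show "0 \<le> C" using \<delta> by (simp add: C_def)
    fix x y :: 'b
    define s where "s = norm x powr p + norm y powr p"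
    show "norm (x - y) powr p \<le> \<epsilon> * (norm x powr p + norm y powr p)
      + C * ((norm x powr p + norm y powr p) / 2 - norm ((1/2) *\<^sub>R (x + y)) powr p)"
    proof (cases "s = 0")
      case True
      then have "norm x powr p = 0" "norm y powr p = 0"
        using powr_ge_zero[of "norm x" p] powr_ge_zero[of "norm y" p] unfolding s_def by linarith+
      then have "x = 0" "y = 0" by (simp_all only: powr_eq_0_iff norm_eq_zero)
      then show ?thesis by simp
    next
      case False
      then have s: "s > 0" using powr_ge_zero[of "norm x" p] powr_ge_zero[of "norm y" p] unfolding s_def by linarith
      \<comment> \<open>Scaling by \<open>c\<close> moves \<open>(x, y)\<close> onto the unit sphere.\<close>
      define c where "c = s powr (- 1 / p)"
      have c: "c > 0" "c powr p = 1 / s"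
        using s assms by (simp_all add: c_def powr_powr powr_minus_divide[of s 1])
      have sc: "norm (c *\<^sub>R z) powr p = norm z powr p / s" for z :: 'b
        using c by (simp add: powr_mult)
      have "(c *\<^sub>R x, c *\<^sub>R y) \<in> sphere'"
        unfolding sphere'_def using s by (simp only: sc mem_Collect_eq fst_conv snd_conv) (simp add: s_def[symmetric] flip: add_divide_distrib)
      note main = main[OF this]
      have h: "(A / s + B / s) / 2 - D / s = ((A + B) / 2 - D) / s" for A B D :: real
        by (simp add: diff_divide_distrib add_divide_distrib)
      from main
      have "norm (c *\<^sub>R (x - y)) powr p \<le> \<epsilon> + C * ((norm (c *\<^sub>R x) powr p + norm (c *\<^sub>R y) powr p) / 2 - norm (c *\<^sub>R ((1/2) *\<^sub>R (x + y))) powr p)"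
        by (simp add: d_def algebra_simps del: norm_scaleR)
      then have "norm (x - y) powr p / s \<le> \<epsilon> + C * ((norm x powr p + norm y powr p) / 2 - norm ((1/2) *\<^sub>R (x + y)) powr p) / s"
        unfolding sc h by (simp only: times_divide_eq_right)
      then have "norm (x - y) powr p \<le> (\<epsilon> + C * ((norm x powr p + norm y powr p) / 2 - norm ((1/2) *\<^sub>R (x + y)) powr p) / s) * s"
        using s by (simp only: pos_divide_le_eq)
      also have "\<dots> = \<epsilon> * s + C * ((norm x powr p + norm y powr p) / 2 - norm ((1/2) *\<^sub>R (x + y)) powr p)"
        using s by (simp add: field_simps)
      finally show ?thesis unfolding s_def .
    qed
  qed
qed


section \<open>Functions with integrable powers\<close>

text \<open>
  Over an arbitrary measure, so that the same lemmas serve the domain, the whole space, space-time,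
  and the small balls and time intervals over which averages are taken.
\<close>

definition Lp :: "'a measure \<Rightarrow> real \<Rightarrow> ('a \<Rightarrow> 'b::euclidean_space) set" where
  "Lp M p = {f \<in> borel_measurable M. integrable M (\<lambda>x. norm (f x) powr p)}"

definition pint :: "'a measure \<Rightarrow> real \<Rightarrow> ('a \<Rightarrow> 'b::euclidean_space) \<Rightarrow> real" where
  "pint M p f = (\<integral>x. norm (f x) powr p \<partial>M)"

definition pnorm :: "'a measure \<Rightarrow> real \<Rightarrow> ('a \<Rightarrow> 'b::euclidean_space) \<Rightarrow> real" where
  "pnorm M p f = pint M p f powr (1 / p)"

lemma Lp_space_eq: "Lp_space S p = Lp (lebesgue_on S) p"
  by (simp add: Lp_space_def Lp_def)

lemma Lp_norm_eq: "Lp_norm S p = pnorm (lebesgue_on S) p"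
  by (simp add: fun_eq_iff Lp_norm_def pnorm_def pint_def)

lemma LpD [dest]: "f \<in> Lp M p \<Longrightarrow> f \<in> borel_measurable M" "f \<in> Lp M p \<Longrightarrow> integrable M (\<lambda>x. norm (f x) powr p)"
  by (auto simp: Lp_def)

lemma LpI: "f \<in> borel_measurable M \<Longrightarrow> integrable M (\<lambda>x. norm (f x) powr p) \<Longrightarrow> f \<in> Lp M p"
  by (auto simp: Lp_def)

lemma Lp_bound:
  assumes "f \<in> borel_measurable M" "integrable M g" "AE x in M. norm (f x) powr p \<le> g x"
  shows "f \<in> Lp M p"
  using assms by (intro LpI Bochner_Integration.integrable_bound[OF assms(2)]) (auto elim!: eventually_mono)

lemma pint_nonneg [simp]: "0 \<le> pint M p f"
  by (simp add: pint_def)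

lemma pnorm_nonneg [simp]: "0 \<le> pnorm M p f"
  by (simp add: pnorm_def)

lemma pnorm_powr: "0 < p \<Longrightarrow> pnorm M p f powr p = pint M p f"
  by (simp add: pnorm_def powr_powr)

lemma pint_cong_AE:
  assumes "f \<in> borel_measurable M" "g \<in> borel_measurable M" "AE x in M. f x = g x"
  shows "pint M p f = pint M p g"
  unfolding pint_def by (rule integral_cong_AE) (use assms in auto)

lemma Lp_cong_AE:
  assumes "f \<in> Lp M p" "g \<in> borel_measurable M" "AE x in M. f x = g x"
  shows "g \<in> Lp M p"
proof -
  have "AE x in M. norm (g x) powr p \<le> norm (f x) powr p" using assms(3) by auto
  then show ?thesis by (intro Lp_bound[OF assms(2) LpD(2)[OF assms(1)]])
qed

lemma Lp_zero [simp]: "(\<lambda>x. 0) \<in> Lp M p"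
  by (simp add: Lp_def)

lemma Lp_scaleR [intro]:
  assumes "f \<in> Lp M p"
  shows "(\<lambda>x. c *\<^sub>R f x) \<in> Lp M p"
  using assms by (auto simp: Lp_def powr_mult)

lemma pint_scaleR: "pint M p (\<lambda>x. c *\<^sub>R f x) = \<bar>c\<bar> powr p * pint M p f"
  by (simp add: pint_def powr_mult)

lemma pnorm_scaleR: "0 < p \<Longrightarrow> pnorm M p (\<lambda>x. c *\<^sub>R f x) = \<bar>c\<bar> * pnorm M p f"
  by (simp add: pnorm_def pint_scaleR powr_mult powr_powr)

lemma Lp_add [intro]:
  assumes "f \<in> Lp M p" "g \<in> Lp M p" "1 \<le> p"
  shows "(\<lambda>x. f x + g x) \<in> Lp M p"
proof (rule Lp_bound)
  show "integrable M (\<lambda>x. 2 powr p * (norm (f x) powr p + norm (g x) powr p))"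
    using assms by auto
qed (use LpD(1)[OF assms(1)] LpD(1)[OF assms(2)] assms(3) in \<open>auto intro: norm_add_powr_le\<close>)

lemma Lp_uminus [intro]: "f \<in> Lp M p \<Longrightarrow> (\<lambda>x. - f x) \<in> Lp M p"
  by (auto simp: Lp_def)

lemma Lp_diff [intro]:
  assumes "f \<in> Lp M p" "g \<in> Lp M p" "1 \<le> p"
  shows "(\<lambda>x. f x - g x) \<in> Lp M p"
  using Lp_add[OF assms(1) Lp_uminus[OF assms(2)] assms(3)] by simp

lemma pint_eq_0_iff:
  assumes "f \<in> Lp M p"
  shows "pint M p f = 0 \<longleftrightarrow> (AE x in M. f x = 0)"
  unfolding pint_def using LpD(2)[OF assms] by (subst integral_nonneg_eq_0_iff_AE) auto

lemma pint_commute_diff: "pint M p (\<lambda>x. f x - g x) = pint M p (\<lambda>x. g x - f x)"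
  by (simp add: pint_def norm_minus_commute)

lemma pnorm_commute_diff: "pnorm M p (\<lambda>x. f x - g x) = pnorm M p (\<lambda>x. g x - f x)"
  by (simp add: pnorm_def pint_commute_diff[of M p f g])

lemma pint_le_pnorm_powr: "0 < p \<Longrightarrow> pnorm M p f \<le> c \<Longrightarrow> pint M p f \<le> c powr p"
  using powr_mono2[of p "pnorm M p f" c] by (simp add: pnorm_powr)

lemma pnorm_le: "0 < p \<Longrightarrow> pint M p f \<le> c powr p \<Longrightarrow> 0 \<le> c \<Longrightarrow> pnorm M p f \<le> c"
  using powr_mono2[of "1/p" "pint M p f" "c powr p"] by (simp add: pnorm_def powr_powr)

text \<open>
  Minkowski's inequality: \<open>f + g\<close> is a multiple of a convex combination of the normalized functions,
  to which the convexity of the power applies pointwise.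
\<close>

lemma pnorm_add:
  assumes f: "f \<in> Lp M p" and g: "g \<in> Lp M p" and p: "1 \<le> p"
  shows "pnorm M p (\<lambda>x. f x + g x) \<le> pnorm M p f + pnorm M p g"
proof (rule field_le_epsilon)
  fix e :: real assume e: "e > 0"
  \<comment> \<open>The summands \<open>e / 2\<close> keep both numbers positive when a norm vanishes.\<close>
  define a where "a = pnorm M p f + e / 2"
  define b where "b = pnorm M p g + e / 2"
  have pos: "a > 0" "b > 0" using e by (auto simp: a_def b_def add_nonneg_pos)
  have le: "pint M p f \<le> a powr p" "pint M p g \<le> b powr p"
    using p e by (auto intro!: pint_le_pnorm_powr simp: a_def b_def)
  define u v where "u = a / (a + b)" and "v = b / (a + b)"
  have uv: "u \<ge> 0" "v \<ge> 0" "u + v = 1" using pos by (auto simp: u_def v_def simp flip: add_divide_distrib)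
  have pt: "norm (f x + g x) powr p \<le> (a + b) powr p * (u * (norm (f x) powr p / a powr p) + v * (norm (g x) powr p / b powr p))" for x
  proof -
    have "norm (f x + g x) powr p = (a + b) powr p * norm (u *\<^sub>R ((1 / a) *\<^sub>R f x) + v *\<^sub>R ((1 / b) *\<^sub>R g x)) powr p"
    proof -
      have "u *\<^sub>R ((1 / a) *\<^sub>R f x) + v *\<^sub>R ((1 / b) *\<^sub>R g x) = (1 / (a + b)) *\<^sub>R (f x + g x)"
        using pos by (simp add: u_def v_def scaleR_add_right)
      then show ?thesis using pos by (simp add: powr_mult[symmetric])
    qed
    also have "\<dots> \<le> (a + b) powr p * (u * norm ((1 / a) *\<^sub>R f x) powr p + v * norm ((1 / b) *\<^sub>R g x) powr p)"
      using uv p by (intro mult_left_mono norm_powr_convex) auto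
    finally show ?thesis using pos by (simp add: powr_divide)
  qed
  have "pint M p (\<lambda>x. f x + g x) \<le> (\<integral>x. (a + b) powr p * (u * (norm (f x) powr p / a powr p) + v * (norm (g x) powr p / b powr p)) \<partial>M)"
    unfolding pint_def using LpD(2)[OF Lp_add[OF f g p]] LpD(2)[OF f] LpD(2)[OF g] pt
    by (intro integral_mono) auto
  also have "\<dots> = (a + b) powr p * (u * (pint M p f / a powr p) + v * (pint M p g / b powr p))"
    using LpD(2)[OF f] LpD(2)[OF g] by (simp add: pint_def)
  also have "\<dots> \<le> (a + b) powr p * (u * 1 + v * 1)"
    using le uv pos by (intro mult_left_mono add_mono) auto
  finally have "pint M p (\<lambda>x. f x + g x) \<le> (a + b) powr p" using uv by simp
  then have "pnorm M p (\<lambda>x. f x + g x) \<le> a + b" using p pos by (intro pnorm_le) auto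
  then show "pnorm M p (\<lambda>x. f x + g x) \<le> pnorm M p f + pnorm M p g + e" by (simp add: a_def b_def)
qed

lemma pnorm_triangle_diff:
  assumes f: "f \<in> Lp M p" and g: "g \<in> Lp M p" and p: "1 \<le> p"
  shows "\<bar>pnorm M p f - pnorm M p g\<bar> \<le> pnorm M p (\<lambda>x. f x - g x)"
  using pnorm_add[OF Lp_diff[OF f g p] g p] pnorm_add[OF Lp_diff[OF g f p] f p] pnorm_commute_diff[of M p f g]
  by auto

lemma pnorm_triangle3:
  assumes "f \<in> Lp M p" "g \<in> Lp M p" "h \<in> Lp M p" "1 \<le> p"
  shows "pnorm M p (\<lambda>x. f x - h x) \<le> pnorm M p (\<lambda>x. f x - g x) + pnorm M p (\<lambda>x. g x - h x)"
  using pnorm_add[OF Lp_diff[of f M p g] Lp_diff[of g M p h]] assms by simp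

lemma tendsto_pnorm_0_iff:
  assumes "0 < p"
  shows "((\<lambda>k. pnorm M p (f k)) \<longlongrightarrow> 0) F \<longleftrightarrow> ((\<lambda>k. pint M p (f k)) \<longlongrightarrow> 0) F"
proof
  assume "((\<lambda>k. pnorm M p (f k)) \<longlongrightarrow> 0) F"
  then have "((\<lambda>k. pnorm M p (f k) powr p) \<longlongrightarrow> 0 powr p) F"
    using assms by (intro tendsto_powr') auto
  then show "((\<lambda>k. pint M p (f k)) \<longlongrightarrow> 0) F" using assms by (simp add: pnorm_powr)
next
  assume "((\<lambda>k. pint M p (f k)) \<longlongrightarrow> 0) F"
  then have "((\<lambda>k. pint M p (f k) powr (1/p)) \<longlongrightarrow> 0 powr (1/p)) F"
    using assms by (intro tendsto_powr') auto
  then show "((\<lambda>k. pnorm M p (f k)) \<longlongrightarrow> 0) F" using assms by (simp add: pnorm_def)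
qed

lemma tendsto_pnorm:
  assumes "\<And>k. f k \<in> Lp M p" "g \<in> Lp M p" "1 \<le> p"
    and "((\<lambda>k. pnorm M p (\<lambda>x. f k x - g x)) \<longlongrightarrow> 0) F"
  shows "((\<lambda>k. pnorm M p (f k)) \<longlongrightarrow> pnorm M p g) F"
proof -
  have "((\<lambda>k. pnorm M p (f k) - pnorm M p g) \<longlongrightarrow> 0) F"
    by (rule Lim_null_comparison[OF _ assms(4)]) (use pnorm_triangle_diff[OF assms(1) assms(2,3)] in auto)
  then show ?thesis by (simp add: LIM_zero_iff)
qed

lemma tendsto_pint:
  assumes "\<And>k. f k \<in> Lp M p" "g \<in> Lp M p" "1 \<le> p"
    and "((\<lambda>k. pnorm M p (\<lambda>x. f k x - g x)) \<longlongrightarrow> 0) F"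
  shows "((\<lambda>k. pint M p (f k)) \<longlongrightarrow> pint M p g) F"
proof -
  have "((\<lambda>k. pnorm M p (f k) powr p) \<longlongrightarrow> pnorm M p g powr p) F"
    using assms(3) by (intro tendsto_powr' tendsto_pnorm[OF assms]) auto
  then show ?thesis using assms(3) by (simp add: pnorm_powr)
qed

text \<open>
  Hoelder's inequality, with the power \<open>p - 1\<close> of the first factor: this is the size of the fields
  \<open>norm (f x) powr (p - 2) *\<^sub>R f x\<close> in the equation.
\<close>

lemma Hoelder:
  fixes f :: "'a \<Rightarrow> 'b::euclidean_space" and g :: "'a \<Rightarrow> 'c::euclidean_space"
  assumes f: "f \<in> Lp M p" and g: "g \<in> Lp M p" and p: "1 < p"
  shows "integrable M (\<lambda>x. norm (f x) powr (p - 1) * norm (g x))"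
    and "(\<integral>x. norm (f x) powr (p - 1) * norm (g x) \<partial>M) \<le> pnorm M p f powr (p - 1) * pnorm M p g"
proof -
  have young: "s powr (p - 1) * t \<le> (p - 1) / p * s powr p + t powr p / p" if "0 \<le> s" "0 \<le> t" for s t :: real
  proof -
    have "1 / p + 1 / (p / (p - 1)) = 1" using p by (simp add: field_simps)
    from Youngs_inequality[OF p _ this, of t "s powr (p - 1)"]
    have "t * s powr (p - 1) \<le> t powr p / p + s powr p / (p / (p - 1))"
      using that p by (simp add: powr_powr)
    then show ?thesis by (simp add: mult.commute)
  qed
  show int: "integrable M (\<lambda>x. norm (f x) powr (p - 1) * norm (g x))"
  proof (rule Bochner_Integration.integrable_bound)
    show "integrable M (\<lambda>x. (p - 1) / p * norm (f x) powr p + norm (g x) powr p / p)"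
      using LpD(2)[OF f] LpD(2)[OF g] by auto
    show "AE x in M. norm (norm (f x) powr (p - 1) * norm (g x)) \<le> norm ((p - 1) / p * norm (f x) powr p + norm (g x) powr p / p)"
      using young p by (auto intro!: AE_I2 order_trans[OF _ abs_ge_self])
  qed (use LpD(1)[OF f] LpD(1)[OF g] in measurable)
  \<comment> \<open>Young's inequality for \<open>f / a\<close> and \<open>g / b\<close>; bounds \<open>a\<close> and \<open>b\<close> larger than the norms avoid
    division by zero.\<close>
  have main: "(\<integral>x. norm (f x) powr (p - 1) * norm (g x) \<partial>M) \<le> a powr (p - 1) * b"
    if a: "a > pnorm M p f" and b: "b > pnorm M p g" for a b
  proof -
    have pos: "a > 0" "b > 0" using a b pnorm_nonneg order_le_less_trans by blast+
    have le: "pint M p f \<le> a powr p" "pint M p g \<le> b powr p"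
      using p a b by (auto intro!: pint_le_pnorm_powr)
    have "(\<integral>x. norm (f x) powr (p - 1) * norm (g x) \<partial>M)
       \<le> (\<integral>x. a powr (p - 1) * b * ((p - 1) / p * (norm (f x) powr p / a powr p) + (norm (g x) powr p / b powr p) / p) \<partial>M)"
    proof (rule integral_mono[OF int])
      show "integrable M (\<lambda>x. a powr (p - 1) * b * ((p - 1) / p * (norm (f x) powr p / a powr p) + (norm (g x) powr p / b powr p) / p))"
        using LpD(2)[OF f] LpD(2)[OF g] by auto
      fix x
      have "norm (f x) powr (p - 1) * norm (g x) = a powr (p - 1) * b * ((norm (f x) / a) powr (p - 1) * (norm (g x) / b))"
        using pos by (simp add: powr_divide)
      also have "\<dots> \<le> a powr (p - 1) * b * ((p - 1) / p * (norm (f x) / a) powr p + (norm (g x) / b) powr p / p)"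
        using pos by (intro mult_left_mono young) auto
      finally show "norm (f x) powr (p - 1) * norm (g x) \<le> a powr (p - 1) * b * ((p - 1) / p * (norm (f x) powr p / a powr p) + (norm (g x) powr p / b powr p) / p)"
        using pos by (simp add: powr_divide)
    qed
    also have "\<dots> = a powr (p - 1) * b * ((p - 1) / p * (pint M p f / a powr p) + (pint M p g / b powr p) / p)"
      using LpD(2)[OF f] LpD(2)[OF g] by (simp add: pint_def)
    also have "\<dots> \<le> a powr (p - 1) * b * ((p - 1) / p * 1 + 1 / p)"
      using le pos p by (intro mult_left_mono add_mono divide_right_mono) auto
    also have "\<dots> = a powr (p - 1) * b" using p by (simp add: field_simps)
    finally show ?thesis .
  qed
  show "(\<integral>x. norm (f x) powr (p - 1) * norm (g x) \<partial>M) \<le> pnorm M p f powr (p - 1) * pnorm M p g"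
  proof (rule tendsto_lowerbound)
    show "((\<lambda>e. (pnorm M p f + e) powr (p - 1) * (pnorm M p g + e)) \<longlongrightarrow> pnorm M p f powr (p - 1) * pnorm M p g) (at_right 0)"
      using p by (auto intro!: tendsto_eq_intros tendsto_powr' simp: eventually_at_right_field intro: gt_ex)
    show "\<forall>\<^sub>F e in at_right 0. (\<integral>x. norm (f x) powr (p - 1) * norm (g x) \<partial>M) \<le> (pnorm M p f + e) powr (p - 1) * (pnorm M p g + e)"
      unfolding eventually_at_right_field by (intro exI[of _ 1]) (auto intro: main)
  qed auto
qed

lemma Lp_Fatou:
  assumes f: "\<And>k. f k \<in> Lp M p" and g: "g \<in> borel_measurable M"
    and lim: "AE x in M. (\<lambda>k. f k x) \<longlonglongrightarrow> g x"
    and bound: "\<forall>\<^sub>F k in sequentially. pnorm M p (f k) \<le> C" and p: "1 \<le> p"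
  shows "g \<in> Lp M p" and "pnorm M p g \<le> C"
proof -
  have C: "0 \<le> C" using bound pnorm_nonneg order_trans eventually_happens[OF bound] by (metis sequentially_bot)
  have "(\<integral>\<^sup>+x. ennreal (norm (g x) powr p) \<partial>M) = (\<integral>\<^sup>+x. liminf (\<lambda>k. ennreal (norm (f k x) powr p)) \<partial>M)"
  proof (rule nn_integral_cong_AE)
    show "AE x in M. ennreal (norm (g x) powr p) = liminf (\<lambda>k. ennreal (norm (f k x) powr p))"
      using lim
    proof eventually_elim
      case (elim x)
      have "(\<lambda>k. norm (f k x) powr p) \<longlonglongrightarrow> norm (g x) powr p"
        using elim p by (intro tendsto_powr' tendsto_norm tendsto_const) auto
      then show ?case using lim_imp_Liminf[OF sequentially_bot tendsto_ennrealI] by metis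
    qed
  qed
  also have "\<dots> \<le> liminf (\<lambda>k. \<integral>\<^sup>+x. ennreal (norm (f k x) powr p) \<partial>M)"
    using LpD(1)[OF f] by (intro nn_integral_liminf) auto
  also have "(\<lambda>k. \<integral>\<^sup>+x. ennreal (norm (f k x) powr p) \<partial>M) = (\<lambda>k. ennreal (pint M p (f k)))"
    unfolding pint_def by (intro ext nn_integral_eq_integral LpD(2)[OF f]) auto
  also have "liminf (\<lambda>k. ennreal (pint M p (f k))) \<le> ennreal (C powr p)"
    by (rule order_trans[OF Liminf_le_Limsup[OF sequentially_bot]], rule Limsup_bounded)
      (use bound p in \<open>auto elim!: eventually_mono intro!: ennreal_leI pint_le_pnorm_powr\<close>)
  finally have *: "(\<integral>\<^sup>+x. ennreal (norm (g x) powr p) \<partial>M) \<le> ennreal (C powr p)" .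
  then have "integrable M (\<lambda>x. norm (g x) powr p)"
    using g by (intro integrableI_nonneg) (auto simp: order_le_less_trans)
  then show gL: "g \<in> Lp M p" using g by (rule LpI[rotated])
  have "ennreal (pint M p g) \<le> ennreal (C powr p)"
    using * unfolding pint_def by (subst (asm) nn_integral_eq_integral) (use LpD(2)[OF gL] in auto)
  then have "pint M p g \<le> C powr p" by simp
  then show "pnorm M p g \<le> C" using p C by (intro pnorm_le) auto
qed

text \<open>
  The theorem of Riesz and Fischer: a rapidly Cauchy subsequence converges almost everywhere, and
  Fatou's lemma turns its pointwise limit into a limit in norm.
\<close>

lemma Lp_complete:
  assumes f: "\<And>k::nat. f k \<in> Lp M p" and p: "1 \<le> p"
    and Cau: "\<And>e. 0 < e \<Longrightarrow> \<exists>N. \<forall>m\<ge>N. \<forall>n\<ge>N. pnorm M p (\<lambda>x. f m x - f n x) < e"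
  obtains g where "g \<in> Lp M p" "(\<lambda>k. pnorm M p (\<lambda>x. f k x - g x)) \<longlonglongrightarrow> 0"
proof -
  have "\<exists>N. \<forall>m\<ge>N. \<forall>n\<ge>N. pnorm M p (\<lambda>x. f m x - f n x) < (1/4)^k" for k :: nat
    by (rule Cau) simp
  then obtain N where N: "\<And>k m n. m \<ge> N k \<Longrightarrow> n \<ge> N k \<Longrightarrow> pnorm M p (\<lambda>x. f m x - f n x) < (1/4)^k" for k :: nat
    by metis
  define r where "r k = (\<Sum>i\<le>k. N i) + k" for k
  have r: "N k \<le> r k" "N k \<le> r (Suc k)" "k \<le> r k" for k
    using member_le_sum[of k "{..k}" N] by (auto simp: r_def)
  \<comment> \<open>The differences along the subsequence have norm below \<open>(1/4)^k\<close>, so after the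
    multiplication by \<open>2^k\<close> their \<open>p\<close>-th powers are still summable, and the differences are
    pointwise eventually bounded by \<open>(1/2)^k\<close>.\<close>
  define d where "d k x = 2^k * norm (f (r (Suc k)) x - f (r k) x)" for k x
  have dm [measurable]: "d k \<in> borel_measurable M" for k
    unfolding d_def using LpD(1)[OF f] by measurable
  have d_int: "integrable M (\<lambda>x. d k x powr p)" "(\<integral>x. d k x powr p \<partial>M) \<le> (2 powr - p)^k" for k
  proof -
    have eq: "d k x powr p = (2^k) powr p * norm (f (r (Suc k)) x - f (r k) x) powr p" for x
      by (simp add: d_def powr_mult)
    show "integrable M (\<lambda>x. d k x powr p)"
      unfolding eq using LpD(2)[OF Lp_diff[OF f f p]] by auto
    have "pint M p (\<lambda>x. f (r (Suc k)) x - f (r k) x) \<le> ((1/4)^k) powr p"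
      using N[of k "r (Suc k)" "r k"] r p by (intro pint_le_pnorm_powr) (auto intro: less_imp_le)
    then have "(\<integral>x. d k x powr p \<partial>M) \<le> (2^k) powr p * ((1/4)^k) powr p"
      unfolding eq using LpD(2)[OF Lp_diff[OF f f p]] by (simp add: pint_def)
    also have "\<dots> = ((2 * (1/4))^k) powr p"
      by (simp only: powr_mult[symmetric] power_mult_distrib[symmetric])
    also have "\<dots> = ((1/2) powr p)^k"
      by (simp add: powr_powr powr_realpow[symmetric] mult.commute)
    also have "\<dots> = (2 powr - p)^k" by (simp add: powr_minus_divide powr_divide)
    finally show "(\<integral>x. d k x powr p \<partial>M) \<le> (2 powr - p)^k" .
  qed
  have "(\<integral>\<^sup>+x. (\<Sum>k. ennreal (d k x powr p)) \<partial>M) = (\<Sum>k. \<integral>\<^sup>+x. ennreal (d k x powr p) \<partial>M)"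
    by (intro nn_integral_suminf) auto
  also have "\<dots> = (\<Sum>k. ennreal (\<integral>x. d k x powr p \<partial>M))"
    by (intro suminf_cong nn_integral_eq_integral d_int) auto
  also have "\<dots> \<le> (\<Sum>k. ennreal ((2 powr - p)^k))"
    by (intro suminf_le ennreal_leI d_int) auto
  also have "\<dots> < \<infinity>"
  proof -
    have "2 powr - p < 2 powr 0" using p by (intro powr_less_mono) auto
    then have "summable (\<lambda>k. (2 powr - p)^k)" by (intro summable_geometric) auto
    then show ?thesis by (subst suminf_ennreal2) auto
  qed
  finally have "(\<integral>\<^sup>+x. (\<Sum>k. ennreal (d k x powr p)) \<partial>M) \<noteq> \<infinity>" by simp
  then have "AE x in M. (\<Sum>k. ennreal (d k x powr p)) \<noteq> \<infinity>"
    by (intro nn_integral_PInf_AE) auto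
  then have conv: "AE x in M. convergent (\<lambda>k. f (r k) x)"
  proof eventually_elim
    case (elim x)
    have "summable (\<lambda>k. d k x powr p)"
      using elim by (intro summable_suminf_not_top) auto
    then have "(\<lambda>k. d k x powr p) \<longlonglongrightarrow> 0" by (rule summable_LIMSEQ_zero)
    then have "\<forall>\<^sub>F k in sequentially. d k x powr p < 1" by (rule order_tendstoD) simp
    then have "\<forall>\<^sub>F k in sequentially. norm (f (r (Suc k)) x - f (r k) x) \<le> (1/2)^k"
    proof eventually_elim
      case (elim k)
      have "d k x < 1"
      proof (rule ccontr)
        assume "\<not> d k x < 1"
        then have "1 powr p \<le> d k x powr p" using p by (intro powr_mono2) auto
        then show False using elim by simp
      qed
      then show ?case by (simp add: d_def field_simps)
    qed
    then have "summable (\<lambda>k. f (r (Suc k)) x - f (r k) x)"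
      by (rule summable_comparison_test_ev) (simp add: summable_geometric)
    then have "(\<lambda>n. \<Sum>k<n. f (r (Suc k)) x - f (r k) x) \<longlonglongrightarrow> (\<Sum>k. f (r (Suc k)) x - f (r k) x)"
      by (rule summable_LIMSEQ)
    then have "(\<lambda>n. f (r n) x - f (r 0) x) \<longlonglongrightarrow> (\<Sum>k. f (r (Suc k)) x - f (r k) x)"
      using sum_lessThan_telescope[of "\<lambda>k. f (r k) x"] by simp
    from tendsto_add[OF this tendsto_const[of "f (r 0) x"]] show ?case
      by (auto simp: convergent_def)
  qed
  define g where "g x = lim (\<lambda>k. f (r k) x)" for x
  have g: "g \<in> borel_measurable M"
    unfolding g_def using LpD(1)[OF f] by (intro borel_measurable_lim_metric) auto
  have lim: "AE x in M. (\<lambda>k. f (r k) x) \<longlonglongrightarrow> g x"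
    using conv by eventually_elim (simp add: g_def convergent_LIMSEQ_iff)
  have close: "(\<lambda>x. f n x - g x) \<in> Lp M p" "pnorm M p (\<lambda>x. f n x - g x) \<le> (1/4)^k" if "n \<ge> N k" for n k
  proof -
    have ev: "\<forall>\<^sub>F j in sequentially. pnorm M p (\<lambda>x. f n x - f (r j) x) \<le> (1/4)^k"
      using eventually_ge_at_top[of "N k"]
    proof eventually_elim
      case (elim j)
      then have "r j \<ge> N k" using r(3)[of j] by simp
      then show ?case using N[of k n "r j"] that by simp
    qed
    have lim': "AE x in M. (\<lambda>j. f n x - f (r j) x) \<longlonglongrightarrow> f n x - g x"
      using lim by eventually_elim (intro tendsto_intros)
    show "(\<lambda>x. f n x - g x) \<in> Lp M p" "pnorm M p (\<lambda>x. f n x - g x) \<le> (1/4)^k"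
      using Lp_Fatou[of "\<lambda>j x. f n x - f (r j) x" M p "\<lambda>x. f n x - g x", OF Lp_diff[OF f f p] _ lim' ev p] g LpD(1)[OF f]
      by auto
  qed
  show ?thesis
  proof
    show "g \<in> Lp M p"
      using Lp_diff[OF f[of "N 0"] close(1)[of 0 "N 0"] p] by simp
    show "(\<lambda>k. pnorm M p (\<lambda>x. f k x - g x)) \<longlonglongrightarrow> 0"
    proof (rule LIMSEQ_I)
      fix e :: real assume "0 < e"
      then obtain k where k: "(1/4)^k < e" using real_arch_pow_inv[of e "1/4"] by auto
      show "\<exists>no. \<forall>n\<ge>no. norm (pnorm M p (\<lambda>x. f n x - g x) - 0) < e"
        using close(2)[of k] k by (intro exI[of _ "N k"]) (auto intro: order_le_less_trans)
    qed
  qed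
qed

text \<open>
  Uniform convexity at work: functions whose integrals approach \<open>c\<close> while those of the midpoints
  do not fall below it asymptotically form a Cauchy sequence. Strong convergence of gradients is
  always obtained in this way below, without weak topologies.
\<close>

lemma Lp_converges_if_midpoints_large:
  assumes f: "\<And>k::nat. f k \<in> Lp M p" and p: "1 < p"
    and lim: "(\<lambda>k. pint M p (f k)) \<longlonglongrightarrow> c"
    and mid: "\<And>e. 0 < e \<Longrightarrow> \<exists>N. \<forall>m\<ge>N. \<forall>n\<ge>N. c - e \<le> pint M p (\<lambda>x. (1/2) *\<^sub>R (f m x + f n x))"
  obtains g where "g \<in> Lp M p" "(\<lambda>k. pnorm M p (\<lambda>x. f k x - g x)) \<longlonglongrightarrow> 0" "pint M p g = c"
proof -
  have p1: "1 \<le> p" using p by simp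
  have c: "0 \<le> c" using lim by (rule LIMSEQ_le_const) auto
  have "\<exists>N. \<forall>m\<ge>N. \<forall>n\<ge>N. pnorm M p (\<lambda>x. f m x - f n x) < e" if e: "0 < e" for e
  proof -
    \<comment> \<open>The sum of the integrals stays below \<open>2 * (c + 1)\<close>, so this \<open>\<epsilon>\<close> contributes at most \<open>e powr p / 2\<close>.\<close>
    define \<epsilon> where "\<epsilon> = e powr p / (4 * (c + 1))"
    have \<epsilon>: "\<epsilon> > 0" using e c by (simp add: \<epsilon>_def)
    obtain C where C: "0 \<le> C" "\<And>x y :: 'b. norm (x - y) powr p \<le> \<epsilon> * (norm x powr p + norm y powr p)
      + C * ((norm x powr p + norm y powr p) / 2 - norm ((1/2) *\<^sub>R (x + y)) powr p)"
      using norm_powr_uniformly_convex[OF p \<epsilon>] by metis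
    \<comment> \<open>The defect is at most \<open>2 * \<delta>\<close>, so this \<open>\<delta>\<close> contributes at most \<open>e powr p / 4\<close>.\<close>
    define \<delta> where "\<delta> = min 1 (e powr p / (8 * (C + 1)))"
    have \<delta>: "\<delta> > 0" using e C by (simp add: \<delta>_def)
    obtain N1 where N1: "\<And>n. n \<ge> N1 \<Longrightarrow> \<bar>pint M p (f n) - c\<bar> < \<delta>"
      using LIMSEQ_D[OF lim \<delta>] by auto
    obtain N2 where N2: "\<And>m n. m \<ge> N2 \<Longrightarrow> n \<ge> N2 \<Longrightarrow> c - \<delta> \<le> pint M p (\<lambda>x. (1/2) *\<^sub>R (f m x + f n x))"
      using mid[OF \<delta>] by auto
    have "pnorm M p (\<lambda>x. f m x - f n x) < e" if mn: "m \<ge> max N1 N2" "n \<ge> max N1 N2" for m n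
    proof -
      have I: "integrable M (\<lambda>x. norm (f m x) powr p)" "integrable M (\<lambda>x. norm (f n x) powr p)"
        "integrable M (\<lambda>x. norm ((1/2) *\<^sub>R (f m x + f n x)) powr p)" "integrable M (\<lambda>x. norm (f m x - f n x) powr p)"
        using LpD(2)[OF Lp_scaleR[OF Lp_add[OF f f p1]]] LpD(2)[OF f] LpD(2)[OF Lp_diff[OF f f p1]] by blast+
      have "pint M p (\<lambda>x. f m x - f n x) \<le> (\<integral>x. \<epsilon> * (norm (f m x) powr p + norm (f n x) powr p)
          + C * ((norm (f m x) powr p + norm (f n x) powr p) / 2 - norm ((1/2) *\<^sub>R (f m x + f n x)) powr p) \<partial>M)"
        unfolding pint_def using I C(2)
        by (intro integral_mono Bochner_Integration.integrable_add Bochner_Integration.integrable_diff integrable_mult_right integrable_divide) auto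
      also have "\<dots> = (\<integral>x. \<epsilon> * (norm (f m x) powr p + norm (f n x) powr p) \<partial>M)
          + (\<integral>x. C * ((norm (f m x) powr p + norm (f n x) powr p) / 2 - norm ((1/2) *\<^sub>R (f m x + f n x)) powr p) \<partial>M)"
        using I by (intro Bochner_Integration.integral_add integrable_mult_right Bochner_Integration.integrable_add Bochner_Integration.integrable_diff integrable_divide) auto
      also have "(\<integral>x. \<epsilon> * (norm (f m x) powr p + norm (f n x) powr p) \<partial>M) = \<epsilon> * (pint M p (f m) + pint M p (f n))"
        using I unfolding pint_def by (simp only: integral_mult_right_zero Bochner_Integration.integral_add)
      also have "(\<integral>x. C * ((norm (f m x) powr p + norm (f n x) powr p) / 2 - norm ((1/2) *\<^sub>R (f m x + f n x)) powr p) \<partial>M)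
         = C * ((pint M p (f m) + pint M p (f n)) / 2 - pint M p (\<lambda>x. (1/2) *\<^sub>R (f m x + f n x)))"
        using I unfolding pint_def
        by (simp only: integral_mult_right_zero Bochner_Integration.integral_add Bochner_Integration.integral_diff
          integral_divide_zero Bochner_Integration.integrable_add integrable_divide)
      also have "\<epsilon> * (pint M p (f m) + pint M p (f n)) \<le> \<epsilon> * (2 * (c + 1))"
        using N1[of m] N1[of n] mn \<epsilon> by (intro mult_left_mono) (auto simp: \<delta>_def)
      also have "\<dots> = e powr p / 2" using c by (simp add: \<epsilon>_def field_simps)
      also have "C * ((pint M p (f m) + pint M p (f n)) / 2 - pint M p (\<lambda>x. (1/2) *\<^sub>R (f m x + f n x))) \<le> C * (2 * \<delta>)"
        using N1[of m] N1[of n] N2[of m n] mn C(1) by (intro mult_left_mono) (auto simp: abs_less_iff field_simps)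
      also have "\<dots> \<le> (C + 1) * (2 * (e powr p / (8 * (C + 1))))"
        using C(1) \<delta> by (intro mult_mono) (auto simp: \<delta>_def)
      also have "\<dots> = e powr p / 4" using C(1) by (simp add: field_simps add_pos_nonneg)
      finally have "pint M p (\<lambda>x. f m x - f n x) \<le> e powr p / 2 + e powr p / 4" by simp
      also have "\<dots> < e powr p" using powr_gt_zero[of e p] e by linarith
      finally have "pint M p (\<lambda>x. f m x - f n x) < e powr p" .
      then have "pint M p (\<lambda>x. f m x - f n x) powr (1/p) < (e powr p) powr (1/p)"
        using p by (intro powr_less_mono2) auto
      then show ?thesis using e p by (simp add: pnorm_def powr_powr)
    qed
    then show ?thesis by blast
  qed
  from Lp_complete[OF f p1 this] obtain g where g: "g \<in> Lp M p" "(\<lambda>k. pnorm M p (\<lambda>x. f k x - g x)) \<longlonglongrightarrow> 0"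
    by metis
  moreover have "pint M p g = c"
    using tendsto_pint[OF f g(1) p1 g(2)] lim LIMSEQ_unique by blast
  ultimately show ?thesis using that by blast
qed

lemma Lp_integral_bound:
  fixes f :: "'a \<Rightarrow> 'b::euclidean_space"
  assumes "finite_measure M" and f: "f \<in> Lp M p" and p: "1 < p"
  shows "integrable M f" and "(\<integral>x. norm (f x) \<partial>M) \<le> measure M (space M) powr ((p - 1) / p) * pnorm M p f"
proof -
  interpret finite_measure M by fact
  have one: "(\<lambda>x. 1::real) \<in> Lp M p" by (auto simp: Lp_def)
  have "integrable M (\<lambda>x. norm (f x))" using Hoelder(1)[OF one f p] by simp
  then show "integrable M f" using LpD(1)[OF f] by (simp add: integrable_norm_iff)
  show "(\<integral>x. norm (f x) \<partial>M) \<le> measure M (space M) powr ((p - 1) / p) * pnorm M p f"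
    using Hoelder(2)[OF one f p] p by (simp add: pnorm_def[of M p "\<lambda>x. 1::real"] pint_def powr_powr mult.commute)
qed


section \<open>Translations\<close>

lemma Lp_translate:
  fixes f :: "'a::euclidean_space \<Rightarrow> 'b::euclidean_space"
  assumes "f \<in> Lp lborel p"
  shows "(\<lambda>x. f (x + z)) \<in> Lp lborel p" "pint lborel p (\<lambda>x. f (x + z)) = pint lborel p f"
    "pnorm lborel p (\<lambda>x. f (x + z)) = pnorm lborel p f"
proof -
  have m [measurable]: "f \<in> borel_measurable borel" using LpD(1)[OF assms] by simp
  have *: "integrable (distr lborel borel ((+) z)) (\<lambda>x. norm (f x) powr p)"
    "(\<integral>x. norm (f x) powr p \<partial>distr lborel borel ((+) z)) = (\<integral>x. norm (f x) powr p \<partial>lborel)"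
    using LpD(2)[OF assms] by (simp_all add: lborel_distr_plus)
  show "(\<lambda>x. f (x + z)) \<in> Lp lborel p"
    using *(1) by (intro LpI) (simp_all add: integrable_distr_eq add.commute)
  show "pint lborel p (\<lambda>x. f (x + z)) = pint lborel p f"
    using *(2) by (simp add: pint_def integral_distr add.commute)
  then show "pnorm lborel p (\<lambda>x. f (x + z)) = pnorm lborel p f" by (simp add: pnorm_def)
qed

lemma pnorm_tendsto_dominated:
  assumes f: "\<And>k. f k \<in> borel_measurable M" and w: "integrable M w"
    and lim: "AE x in M. (\<lambda>k. f k x) \<longlonglongrightarrow> 0"
    and bound: "\<And>k. AE x in M. norm (f k x) powr p \<le> w x" and p: "1 \<le> p"
  shows "(\<lambda>k. pnorm M p (f k)) \<longlonglongrightarrow> 0"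
proof -
  have "(\<lambda>k. \<integral>x. norm (f k x) powr p \<partial>M) \<longlonglongrightarrow> (\<integral>x. 0 \<partial>M)"
  proof (rule integral_dominated_convergence[OF _ _ w])
    show "AE x in M. (\<lambda>k. norm (f k x) powr p) \<longlonglongrightarrow> 0"
      using lim
    proof eventually_elim
      case (elim x)
      have "(\<lambda>k. norm (f k x) powr p) \<longlonglongrightarrow> 0 powr p"
        using elim p by (intro tendsto_powr' tendsto_norm_zero tendsto_const) auto
      then show ?case by simp
    qed
  qed (use f bound in auto)
  then have "(\<lambda>k. pint M p (f k)) \<longlonglongrightarrow> 0" by (simp add: pint_def)
  then show ?thesis using p tendsto_pnorm_0_iff[of p M f sequentially] by auto
qed

text \<open>
  After a truncation the function is bounded with bounded support. It is an almost everywhere limit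
  of continuous functions, whose values and supports can be cut off to the same bounds, so that
  dominated convergence applies.
\<close>

lemma Lp_approx_continuous:
  fixes f :: "'a::euclidean_space \<Rightarrow> 'b::euclidean_space"
  assumes f: "f \<in> Lp lborel p" and p: "1 \<le> p" and e: "0 < e"
  obtains g R where "continuous_on UNIV g" "\<And>x. R < norm x \<Longrightarrow> g x = 0" "g \<in> Lp lborel p"
    "pnorm lborel p (\<lambda>x. f x - g x) < e"
proof -
  have fm [measurable]: "f \<in> borel_measurable borel" using LpD(1)[OF f] by simp
  define trunc where "trunc k x = (if norm x \<le> real k \<and> norm (f x) \<le> real k then f x else 0)" for k x
  have tm [measurable]: "trunc k \<in> borel_measurable borel" for k unfolding trunc_def by measurable
  have "(\<lambda>k. pnorm lborel p (\<lambda>x. f x - trunc k x)) \<longlonglongrightarrow> 0"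
  proof (rule pnorm_tendsto_dominated[OF _ LpD(2)[OF f]])
    show "AE x in lborel. (\<lambda>k. f x - trunc k x) \<longlonglongrightarrow> 0"
    proof (rule AE_I2)
      fix x
      have "\<forall>\<^sub>F k in sequentially. f x - trunc k x = 0"
        using eventually_ge_at_top[of "nat \<lceil>norm x\<rceil>"] eventually_ge_at_top[of "nat \<lceil>norm (f x)\<rceil>"]
        by eventually_elim (auto simp: trunc_def)
      then show "(\<lambda>k. f x - trunc k x) \<longlonglongrightarrow> 0" by (rule tendsto_eventually)
    qed
  qed (use p in \<open>auto simp: trunc_def\<close>)
  from LIMSEQ_D[OF this, of "e/2"] e obtain k0 where k0: "\<And>k. k \<ge> k0 \<Longrightarrow> pnorm lborel p (\<lambda>x. f x - trunc k x) < e/2"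
    by auto
  define K where "K = real (Suc k0)"
  have K: "K > 0" by (simp add: K_def)
  define F where "F = trunc (Suc k0)"
  have F1: "pnorm lborel p (\<lambda>x. f x - F x) < e/2" using k0[of "Suc k0"] by (simp add: F_def)
  have F2: "norm (F x) \<le> K" "norm x > K \<Longrightarrow> F x = 0" for x
    by (auto simp: F_def trunc_def K_def)
  have Fm [measurable]: "F \<in> borel_measurable borel" by (simp add: F_def)
  have "F \<in> borel_measurable lebesgue" by (simp add: measurable_completion)
  then have "F measurable_on UNIV" by (rule lebesgue_measurable_imp_measurable_on) simp
  then obtain N h where N: "negligible N" "\<And>n. continuous_on UNIV (h n)" "\<And>x. x \<notin> N \<Longrightarrow> (\<lambda>n. h n x) \<longlonglongrightarrow> F x"
    unfolding measurable_on_def by auto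
  define clamp where "clamp y = (K / max K (norm y)) *\<^sub>R y" for y :: 'b
  define cut where "cut x = max 0 (min 1 (K + 1 - norm x))" for x :: 'a
  define G where "G n x = cut x *\<^sub>R clamp (h n x)" for n x
  have clamp: "norm (clamp y) \<le> K" "continuous_on UNIV clamp" "norm y \<le> K \<Longrightarrow> clamp y = y" for y
  proof -
    show "norm (clamp y) \<le> K" using K by (auto simp: clamp_def field_simps max_def)
    show "continuous_on UNIV clamp" unfolding clamp_def using K by (intro continuous_intros) (auto simp: max_def)
    show "norm y \<le> K \<Longrightarrow> clamp y = y" using K by (simp add: clamp_def max_absorb1)
  qed
  have cut: "0 \<le> cut x" "cut x \<le> 1" "norm x \<le> K \<Longrightarrow> cut x = 1" "K + 1 < norm x \<Longrightarrow> cut x = 0" "continuous_on UNIV cut" for x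
    unfolding cut_def by (auto intro!: continuous_intros)
  have Gc: "continuous_on UNIV (G n)" for n
    unfolding G_def using clamp(2) N(2) cut(5)
    by (intro continuous_intros continuous_on_compose2[OF clamp(2)]) auto
  have Gb: "norm (G n x) \<le> K" "norm x > K + 1 \<Longrightarrow> G n x = 0" for n x
    using mult_mono[OF cut(2) clamp(1)[of "h n x"], of x] cut(1)[of x] K cut(4)[of x] by (auto simp: G_def)
  have wint: "integrable lborel (\<lambda>x::'a. C * indicator (cball 0 (K+1)) x :: real)" for C
    using emeasure_lborel_cball_finite[of "0::'a" "K+1"] by (intro integrable_mult_right integrable_real_indicator) auto
  have GL: "G n \<in> Lp lborel p" for n
  proof (rule Lp_bound[OF _ wint[of "K powr p"]])
    show "AE x in lborel. norm (G n x) powr p \<le> K powr p * indicator (cball 0 (K+1)) x"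
      using Gb p K by (auto intro!: AE_I2 powr_mono2 simp: indicator_def)
  qed (use Gc in \<open>simp add: borel_measurable_continuous_onI\<close>)
  have FL: "F \<in> Lp lborel p"
  proof (rule Lp_bound[OF _ wint[of "K powr p"]])
    show "AE x in lborel. norm (F x) powr p \<le> K powr p * indicator (cball 0 (K+1)) x"
      using F2 p K by (auto intro!: AE_I2 powr_mono2 simp: indicator_def)
  qed simp
  have "(\<lambda>n. pnorm lborel p (\<lambda>x. F x - G n x)) \<longlonglongrightarrow> 0"
  proof (rule pnorm_tendsto_dominated[OF _ wint[of "(2 * K) powr p"]])
    have "AE x in lborel. x \<notin> N"
      using AE_not_in[of N lebesgue] N(1) unfolding negligible_iff_null_sets AE_completion_iff by blast
    then show "AE x in lborel. (\<lambda>n. F x - G n x) \<longlonglongrightarrow> 0"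
    proof eventually_elim
      case (elim x)
      have "(\<lambda>n. clamp (h n x)) \<longlonglongrightarrow> clamp (F x)"
        using clamp(2) N(3)[OF elim] by (intro isCont_tendsto_compose[of _ clamp]) (auto simp: continuous_on_eq_continuous_at)
      then have "(\<lambda>n. G n x) \<longlonglongrightarrow> cut x *\<^sub>R F x"
        unfolding G_def using clamp(3)[OF F2(1)] by (intro tendsto_intros) auto
      moreover have "cut x *\<^sub>R F x = F x" using F2(2)[of x] cut(3)[of x] by (cases "norm x \<le> K") auto
      ultimately show ?case using tendsto_diff[OF tendsto_const[of "F x"], of "\<lambda>n. G n x" "F x"] by simp
    qed
    have "norm (F x - G n x) \<le> 2 * K" for n x
      using norm_triangle_ineq4[of "F x" "G n x"] F2(1)[of x] Gb(1)[of n x] by linarith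
    then show "AE x in lborel. norm (F x - G n x) powr p \<le> (2 * K) powr p * indicator (cball 0 (K+1)) x" for n
      using F2 Gb p K by (auto intro!: AE_I2 powr_mono2 simp: indicator_def)
  qed (use p GL[THEN LpD(1)] in auto)
  from LIMSEQ_D[OF this, of "e/2"] e obtain n where n: "pnorm lborel p (\<lambda>x. F x - G n x) < e/2"
    by auto
  show ?thesis
  proof
    show "pnorm lborel p (\<lambda>x. f x - G n x) < e"
      using pnorm_triangle3[OF f FL GL[of n] p] F1 n by simp
  qed (use Gc Gb(2) GL in auto)
qed

lemma Lp_translation_continuous:
  fixes f :: "'a::euclidean_space \<Rightarrow> 'b::euclidean_space"
  assumes f: "f \<in> Lp lborel p" and p: "1 \<le> p"
  shows "((\<lambda>z. pnorm lborel p (\<lambda>x. f (x + z) - f x)) \<longlongrightarrow> 0) (at 0)"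
proof (rule LIM_I)
  fix e :: real assume e: "0 < e"
  from Lp_approx_continuous[OF f p, of "e/3"] e obtain g R where g: "continuous_on UNIV g" "\<And>x. R < norm x \<Longrightarrow> g x = 0" "g \<in> Lp lborel p"
    "pnorm lborel p (\<lambda>x. f x - g x) < e/3" by auto
  define m where "m = measure lborel (cball (0::'a) (\<bar>R\<bar> + 1))"
  have m: "m \<ge> 0" by (simp add: m_def)
  \<comment> \<open>A pointwise difference of \<open>\<eta>\<close> on a ball of measure \<open>m\<close> amounts to less than \<open>e / 4\<close> in norm.\<close>
  define \<eta> where "\<eta> = e / 4 / (m + 1) powr (1/p)"
  have \<eta>: "\<eta> > 0" using e m by (simp add: \<eta>_def)
  have "uniformly_continuous_on (cball 0 (\<bar>R\<bar> + 2)) g"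
    using g(1) continuous_on_subset by (intro compact_uniformly_continuous) auto
  then obtain d where d: "d > 0" "\<And>x y. x \<in> cball 0 (\<bar>R\<bar> + 2) \<Longrightarrow> y \<in> cball 0 (\<bar>R\<bar> + 2) \<Longrightarrow> dist x y < d \<Longrightarrow> dist (g x) (g y) < \<eta>"
    unfolding uniformly_continuous_on_def using \<eta> by (metis dist_commute)
  have "pnorm lborel p (\<lambda>x. f (x + z) - f x) < e" if z: "norm z < min d 1" for z
  proof -
    have fz: "(\<lambda>x. f (x + z)) \<in> Lp lborel p" "(\<lambda>x. g (x + z)) \<in> Lp lborel p"
      using Lp_translate(1) f g by blast+
    have bound: "norm (g (x + z) - g x) powr p \<le> \<eta> powr p * indicator (cball 0 (\<bar>R\<bar> + 1)) x" for x
    proof (cases "norm x \<le> \<bar>R\<bar> + 1")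
      case True
      have "norm (x + z) \<le> \<bar>R\<bar> + 2" using norm_triangle_ineq[of x z] z True by simp
      then have "dist (g (x + z)) (g x) < \<eta>" using True z d(2)[of "x + z" x] by (simp add: mem_cball_0 dist_norm[of "x + z" x])
      then show ?thesis using True p by (auto simp: dist_norm intro!: powr_mono2)
    next
      case False
      then have "norm (x + z) > R" using norm_triangle_ineq4[of "x + z" z] z by (auto simp: abs_if split: if_splits)
      then show ?thesis using False g(2) by auto
    qed
    have wint: "integrable lborel (\<lambda>x::'a. \<eta> powr p * indicator (cball 0 (\<bar>R\<bar> + 1)) x :: real)"
      using emeasure_lborel_cball_finite[of "0::'a" "\<bar>R\<bar> + 1"] by (intro integrable_mult_right integrable_real_indicator) auto
    have "pint lborel p (\<lambda>x. g (x + z) - g x) \<le> (\<integral>x. \<eta> powr p * indicator (cball (0::'a) (\<bar>R\<bar> + 1)) x \<partial>lborel)"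
      unfolding pint_def
    proof (rule integral_mono)
      show "integrable lborel (\<lambda>x. norm (g (x + z) - g x) powr p)"
        by (rule LpD(2)[OF Lp_diff[OF fz(2) g(3) p]])
    qed (rule wint, rule bound)
    also have "\<dots> = \<eta> powr p * m" by (simp add: m_def)
    also have "\<dots> \<le> \<eta> powr p * (m + 1)" by (intro mult_left_mono) auto
    also have "\<eta> powr p = (e/4) powr p / (m + 1)"
      using e m p unfolding \<eta>_def by (subst powr_divide) (auto simp: powr_powr)
    also have "\<dots> * (m + 1) = (e/4) powr p" using m by simp
    finally have "pnorm lborel p (\<lambda>x. g (x + z) - g x) \<le> e/4"
      using e p by (intro pnorm_le) auto
    moreover have "pnorm lborel p (\<lambda>x. f (x + z) - g (x + z)) = pnorm lborel p (\<lambda>x. f x - g x)"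
      using Lp_translate(3)[OF Lp_diff[OF f g(3) p], of z] by simp
    moreover have "pnorm lborel p (\<lambda>x. f (x + z) - f x)
       \<le> pnorm lborel p (\<lambda>x. f (x + z) - g (x + z)) + (pnorm lborel p (\<lambda>x. g (x + z) - g x) + pnorm lborel p (\<lambda>x. g x - f x))"
      using pnorm_triangle3[OF fz f p] pnorm_triangle3[OF fz(2) g(3) f p] by linarith
    ultimately show ?thesis using g(4) pnorm_commute_diff[of lborel p g f] e by linarith
  qed
  then show "\<exists>s>0. \<forall>z. z \<noteq> 0 \<and> norm (z - 0) < s \<longrightarrow> norm (pnorm lborel p (\<lambda>x. f (x + z) - f x) - 0) < e"
    using d(1) by (intro exI[of _ "min d 1"]) auto
qed


section \<open>Smooth functions\<close>

lemma Ck_fun_SucI: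
  assumes "\<And>x. (f has_derivative f' x) (at x)" "\<And>h. Ck_fun k (\<lambda>x. f' x h)"
  shows "Ck_fun (Suc k) f"
proof -
  have "frechet_derivative f (at x) = f' x" for x
    using frechet_derivative_at[OF assms(1)] by simp
  then show ?thesis using assms by (auto simp: differentiable_def)
qed

lemma Ck_fun_SucD: "Ck_fun (Suc k) f \<Longrightarrow> Ck_fun k f"
proof (induction k arbitrary: f)
  case 0
  then show ?case
    by (auto simp: continuous_on_eq_continuous_within intro: differentiable_imp_continuous_within)
qed simp

lemma Ck_fun_has_derivative: "Ck_fun (Suc k) f \<Longrightarrow> (f has_derivative frechet_derivative f (at x)) (at x)"
  by (simp add: frechet_derivative_works[symmetric])

lemma Ck_fun_const [simp]: "Ck_fun k (\<lambda>x. c)"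
  by (induction k arbitrary: c) (auto simp: frechet_derivative_const)

lemma Ck_fun_add: "Ck_fun k f \<Longrightarrow> Ck_fun k g \<Longrightarrow> Ck_fun k (\<lambda>x. f x + g x)"
proof (induction k arbitrary: f g)
  case 0 then show ?case by (auto intro: continuous_intros)
next
  case (Suc k)
  show ?case
  proof (rule Ck_fun_SucI)
    show "((\<lambda>x. f x + g x) has_derivative (\<lambda>h. frechet_derivative f (at x) h + frechet_derivative g (at x) h)) (at x)" for x
      using Suc.prems by (intro has_derivative_add Ck_fun_has_derivative)
    show "Ck_fun k (\<lambda>x. frechet_derivative f (at x) h + frechet_derivative g (at x) h)" for h
      using Suc by simp
  qed
qed

lemma Ck_fun_scaleR:
  fixes f :: "'a::real_normed_vector \<Rightarrow> real"
  shows "Ck_fun k f \<Longrightarrow> Ck_fun k g \<Longrightarrow> Ck_fun k (\<lambda>x. f x *\<^sub>R g x)"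
proof (induction k arbitrary: f g)
  case 0 then show ?case by (auto intro: continuous_intros)
next
  case (Suc k)
  show ?case
  proof (rule Ck_fun_SucI)
    show "((\<lambda>x. f x *\<^sub>R g x) has_derivative
       (\<lambda>h. f x *\<^sub>R frechet_derivative g (at x) h + frechet_derivative f (at x) h *\<^sub>R g x)) (at x)" for x
      using Suc.prems by (intro has_derivative_scaleR Ck_fun_has_derivative)
    show "Ck_fun k (\<lambda>x. f x *\<^sub>R frechet_derivative g (at x) h + frechet_derivative f (at x) h *\<^sub>R g x)" for h
      using Suc Ck_fun_SucD[OF Suc.prems(1)] Ck_fun_SucD[OF Suc.prems(2)]
      by (intro Ck_fun_add Suc.IH) auto
  qed
qed

lemma Ck_fun_compose_affine:
  assumes "bounded_linear L"
  shows "Ck_fun k f \<Longrightarrow> Ck_fun k (\<lambda>x. f (L x + c))"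
proof (induction k arbitrary: f)
  case 0
  have "continuous_on UNIV (\<lambda>x. L x + c)"
    using assms by (intro continuous_intros linear_continuous_on)
  then show ?case using 0 by (auto intro: continuous_on_compose2)
next
  case (Suc k)
  show ?case
  proof (rule Ck_fun_SucI)
    have "((\<lambda>x. L x + c) has_derivative L) (at x)" for x
      using bounded_linear_imp_has_derivative[OF assms] by (auto intro!: derivative_eq_intros)
    from has_derivative_compose[OF this Ck_fun_has_derivative[OF Suc.prems]]
    show "((\<lambda>x. f (L x + c)) has_derivative (\<lambda>h. frechet_derivative f (at (L x + c)) (L h))) (at x)" for x .
    show "Ck_fun k (\<lambda>x. frechet_derivative f (at (L x + c)) (L h))" for h
      using Suc.IH[of "\<lambda>x. frechet_derivative f (at x) (L h)"] Suc.prems by simp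
  qed
qed

lemma smooth_fun_const [simp]: "smooth_fun (\<lambda>x. c)"
  by (simp add: smooth_fun_def)

lemma smooth_fun_add: "smooth_fun f \<Longrightarrow> smooth_fun g \<Longrightarrow> smooth_fun (\<lambda>x. f x + g x)"
  by (simp add: smooth_fun_def Ck_fun_add)

lemma smooth_fun_scaleR: "smooth_fun f \<Longrightarrow> smooth_fun g \<Longrightarrow> smooth_fun (\<lambda>x. f x *\<^sub>R g x)"
  by (simp add: smooth_fun_def Ck_fun_scaleR)

lemma smooth_fun_mult: "smooth_fun f \<Longrightarrow> smooth_fun g \<Longrightarrow> smooth_fun (\<lambda>x. f x * g x :: real)"
  using smooth_fun_scaleR[of f g] by simp

lemma smooth_fun_prod: "(\<And>i. i \<in> I \<Longrightarrow> smooth_fun (f i)) \<Longrightarrow> smooth_fun (\<lambda>x. \<Prod>i\<in>I. f i x :: real)"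
  by (induction I rule: infinite_finite_induct) (auto intro: smooth_fun_mult)

lemma smooth_fun_compose_affine: "bounded_linear L \<Longrightarrow> smooth_fun f \<Longrightarrow> smooth_fun (\<lambda>x. f (L x + c))"
  by (simp add: smooth_fun_def Ck_fun_compose_affine)

lemma smooth_fun_compose_linear: "bounded_linear L \<Longrightarrow> smooth_fun f \<Longrightarrow> smooth_fun (\<lambda>x. f (L x))"
  using smooth_fun_compose_affine[of L f 0] by simp

lemma smooth_fun_continuous: "smooth_fun f \<Longrightarrow> continuous_on UNIV f"
  unfolding smooth_fun_def by (metis Ck_fun.simps(1))

lemma smooth_fun_has_derivative: "smooth_fun f \<Longrightarrow> (f has_derivative frechet_derivative f (at x)) (at x)"
  unfolding smooth_fun_def by (metis Ck_fun_has_derivative)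

lemma smooth_fun_derivative: "smooth_fun f \<Longrightarrow> smooth_fun (\<lambda>x. frechet_derivative f (at x) h)"
  unfolding smooth_fun_def by (metis Ck_fun.simps(2))

text \<open>
  The functions \<open>(1 / x) ^ n * exp (- (1 / x))\<close>, extended by \<open>0\<close>: up to linear combinations the family
  is closed under differentiation, so that one induction makes all its members smooth.
\<close>

definition flat :: "nat \<Rightarrow> real \<Rightarrow> real" where
  "flat n x = (if x \<le> 0 then 0 else (1 / x) ^ n * exp (- (1 / x)))"

lemma flat_nonneg: "0 \<le> flat n x"
  by (simp add: flat_def)

lemma flat_tendsto_0: "(flat n \<longlongrightarrow> 0) (at 0)"
proof -
  have "((\<lambda>y::real. y ^ n / exp y) \<longlongrightarrow> 0) at_top" by (rule tendsto_power_div_exp_0)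
  then have "((\<lambda>x. inverse x ^ n / exp (inverse x)) \<longlongrightarrow> (0::real)) (at_right 0)"
    by (rule filterlim_compose[OF _ filterlim_inverse_at_top_right])
  then have "(flat n \<longlongrightarrow> 0) (at_right 0)"
    by (rule Lim_transform_eventually)
      (auto simp: eventually_at_filter flat_def exp_minus field_simps)
  moreover have "(flat n \<longlongrightarrow> 0) (at_left 0)"
    by (rule tendsto_eventually) (auto simp: eventually_at_filter flat_def)
  ultimately show ?thesis by (simp add: filterlim_at_split)
qed

lemma flat_has_derivative: "(flat n has_real_derivative (flat (n + 2) x - real n * flat (n + 1) x)) (at x)"
proof -
  consider "x < 0" | "x = 0" | "0 < x" by linarith
  then show ?thesis
  proof cases
    case 1
    have "((\<lambda>x. 0::real) has_real_derivative 0) (at x)" by simp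
    moreover have "\<forall>\<^sub>F y in nhds x. (0::real) = flat n y"
      using eventually_nhds_in_open[of "{..<0}" x] 1 by (auto elim!: eventually_mono simp: flat_def)
    ultimately show ?thesis using 1 by (simp add: flat_def DERIV_cong_ev)
  next
    case 2
    have "((\<lambda>h. flat (Suc n) h) \<longlongrightarrow> 0) (at 0)" by (rule flat_tendsto_0)
    then have "((\<lambda>h. (flat n (0 + h) - flat n 0) / h) \<longlongrightarrow> 0) (at 0)"
      by (rule Lim_transform_eventually) (auto simp: eventually_at_filter flat_def)
    then show ?thesis using 2 by (simp add: DERIV_def flat_def)
  next
    case 3
    define y where "y = 1 / x"
    have d: "((\<lambda>x. 1 / x) has_real_derivative (- (y * y))) (at x)"
      using 3 by (auto intro!: derivative_eq_intros simp: y_def power2_eq_square)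
    have "((\<lambda>x. (1 / x) ^ n * exp (- (1 / x))) has_real_derivative
      (real n * (- (y * y)) * y ^ (n - 1)) * exp (- y) + y ^ n * (exp (- y) * (y * y))) (at x)"
      using DERIV_mult[OF DERIV_power[OF d, of n] DERIV_fun_exp[OF DERIV_minus[OF d]]]
      by (simp add: y_def mult.assoc mult.commute mult.left_commute)
    moreover have "(real n * (- (y * y)) * y ^ (n - 1)) * exp (- y) + y ^ n * (exp (- y) * (y * y))
      = flat (n + 2) x - real n * flat (n + 1) x"
    proof -
      have 1: "real n * (- (y * y)) * y ^ (n - 1) = - (real n * (y ^ n * y))"
        by (cases n) simp_all
      have 2: "flat (n + 2) x = y ^ n * y * y * exp (- y)" "flat (n + 1) x = y ^ n * y * exp (- y)"
        using 3 by (simp_all add: flat_def y_def)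
      show ?thesis unfolding 1 2 by algebra
    qed
    ultimately have *: "((\<lambda>x. (1 / x) ^ n * exp (- (1 / x))) has_real_derivative (flat (n + 2) x - real n * flat (n + 1) x)) (at x)"
      by simp
    have "\<forall>\<^sub>F y in nhds x. (1 / y) ^ n * exp (- (1 / y)) = flat n y"
      using eventually_nhds_in_open[of "{0<..}" x] 3 by (auto elim!: eventually_mono simp: flat_def)
    then show ?thesis using * DERIV_cong_ev[OF refl _ refl] by fast
  qed
qed

lemma smooth_flat: "smooth_fun (flat n)"
proof -
  have "Ck_fun k (flat n)" for k
  proof (induction k arbitrary: n)
    case 0
    show ?case
      using DERIV_isCont[OF flat_has_derivative] by (auto simp: continuous_on_eq_continuous_at)
  next
    case (Suc k)
    show ?case
    proof (rule Ck_fun_SucI)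
      show "(flat n has_derivative (\<lambda>h. (flat (n + 2) x - real n * flat (n + 1) x) * h)) (at x)" for x
        using flat_has_derivative[of n x] by (simp add: has_field_derivative_def)
      have "Ck_fun k (\<lambda>x. h *\<^sub>R flat (n + 2) x + (- real n * h) *\<^sub>R flat (n + 1) x)" for h
        by (intro Ck_fun_add Ck_fun_scaleR Ck_fun_const Suc)
      then show "Ck_fun k (\<lambda>x. (flat (n + 2) x - real n * flat (n + 1) x) * h)" for h
        by (simp add: algebra_simps)
    qed
  qed
  then show ?thesis by (simp add: smooth_fun_def)
qed

lemma flat0_le_1: "flat 0 x \<le> 1"
  by (simp add: flat_def)

lemma flat0_tendsto: "(\<lambda>k. flat 0 (real k * y)) \<longlonglongrightarrow> (if 0 < y then 1 else 0)"
proof (cases "0 < y")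
  case True
  have "(\<lambda>k. exp (- ((1 / y) * (1 / real k)))) \<longlonglongrightarrow> exp (- ((1 / y) * 0))"
    by (intro tendsto_intros lim_1_over_n)
  then have "(\<lambda>k. exp (- ((1 / y) * (1 / real k)))) \<longlonglongrightarrow> 1" by simp
  then have "(\<lambda>k. flat 0 (real k * y)) \<longlonglongrightarrow> 1"
  proof (rule Lim_transform_eventually)
    show "\<forall>\<^sub>F k in sequentially. exp (- ((1 / y) * (1 / real k))) = flat 0 (real k * y)"
      using eventually_gt_at_top[of 0]
      by eventually_elim (use True in \<open>auto simp: flat_def mult_le_0_iff mult.commute\<close>)
  qed
  then show ?thesis using True by simp
next
  case False
  then have "flat 0 (real k * y) = 0" for k by (simp add: flat_def mult_nonneg_nonpos)
  then show ?thesis using False by simp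
qed


section \<open>Test functions\<close>

lemma test_fun_smooth: "test_fun U \<phi> \<Longrightarrow> smooth_fun \<phi>"
  by (simp add: test_fun_def)

lemma test_funI:
  assumes "smooth_fun \<phi>" "compact K" "K \<subseteq> U" "\<And>x. x \<notin> K \<Longrightarrow> \<phi> x = 0"
  shows "test_fun U \<phi>"
proof -
  have "closure {x. \<phi> x \<noteq> 0} \<subseteq> K"
    using assms by (intro closure_minimal) (auto simp: compact_imp_closed)
  then show ?thesis
    using assms compact_Int_closed[OF assms(2) closed_closure, of "{x. \<phi> x \<noteq> 0}"]
    by (auto simp: test_fun_def Int_absorb1)
qed

lemma test_funE:
  assumes "test_fun U \<phi>"
  obtains K where "compact K" "K \<subseteq> U" "\<And>x. x \<notin> K \<Longrightarrow> \<phi> x = 0"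
    "\<And>x h. x \<notin> K \<Longrightarrow> frechet_derivative \<phi> (at x) h = 0"
proof (rule that[of "closure {x. \<phi> x \<noteq> 0}"])
  show "compact (closure {x. \<phi> x \<noteq> 0})" "closure {x. \<phi> x \<noteq> 0} \<subseteq> U" using assms by (auto simp: test_fun_def)
  show "\<phi> x = 0" if "x \<notin> closure {x. \<phi> x \<noteq> 0}" for x using that closure_subset[of "{x. \<phi> x \<noteq> 0}"] by auto
  show "frechet_derivative \<phi> (at x) h = 0" if "x \<notin> closure {x. \<phi> x \<noteq> 0}" for x h
  proof -
    have "((\<lambda>x. 0) has_derivative (\<lambda>h. 0)) (at x)" by simp
    then have "(\<phi> has_derivative (\<lambda>h. 0)) (at x)"
    proof (rule has_derivative_transform_within_open)
      show "open (- closure {x. \<phi> x \<noteq> 0})" by (rule open_Compl[OF closed_closure])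
    qed (use that closure_subset[of "{x. \<phi> x \<noteq> 0}"] in auto)
    then show ?thesis using frechet_derivative_at by metis
  qed
qed

lemma test_fun_add:
  assumes "test_fun U \<phi>" "test_fun U \<psi>"
  shows "test_fun U (\<lambda>x. \<phi> x + \<psi> x)"
proof -
  obtain K L where "compact K" "K \<subseteq> U" "\<And>x. x \<notin> K \<Longrightarrow> \<phi> x = 0" "compact L" "L \<subseteq> U" "\<And>x. x \<notin> L \<Longrightarrow> \<psi> x = 0"
    using assms by (metis test_funE)
  then show ?thesis
    using assms by (intro test_funI[of _ "K \<union> L"] smooth_fun_add) (auto simp: test_fun_smooth)
qed

lemma test_fun_scaleR:
  assumes "smooth_fun f" "test_fun U \<phi>"
  shows "test_fun U (\<lambda>x. f x *\<^sub>R \<phi> x)"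
proof -
  obtain K where "compact K" "K \<subseteq> U" "\<And>x. x \<notin> K \<Longrightarrow> \<phi> x = 0" using assms by (metis test_funE)
  then show ?thesis
    using assms by (intro test_funI[of _ K] smooth_fun_scaleR) (auto simp: test_fun_smooth)
qed

lemma test_fun_scaleR':
  assumes "test_fun U f" "smooth_fun \<phi>"
  shows "test_fun U (\<lambda>x. f x *\<^sub>R \<phi> x)"
proof -
  obtain K where "compact K" "K \<subseteq> U" "\<And>x. x \<notin> K \<Longrightarrow> f x = 0" using assms by (metis test_funE)
  then show ?thesis
    using assms by (intro test_funI[of _ K] smooth_fun_scaleR) (auto simp: test_fun_smooth)
qed

lemma test_fun_continuous: "test_fun U \<phi> \<Longrightarrow> continuous_on UNIV \<phi>"
  by (intro smooth_fun_continuous test_fun_smooth)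

lemma test_fun_derivative:
  assumes "test_fun U \<phi>"
  shows "test_fun U (\<lambda>x. frechet_derivative \<phi> (at x) h)"
proof -
  obtain K where "compact K" "K \<subseteq> U" "\<And>x h. x \<notin> K \<Longrightarrow> frechet_derivative \<phi> (at x) h = 0" using assms by (metis test_funE)
  then show ?thesis
    using assms by (intro test_funI[of _ K] smooth_fun_derivative) (auto simp: test_fun_smooth)
qed

lemma test_fun_bounded:
  fixes \<phi> :: "'a::euclidean_space \<Rightarrow> 'b::real_normed_vector"
  assumes "test_fun U \<phi>"
  obtains B where "0 < B" "\<And>x. norm (\<phi> x) \<le> B"
proof -
  obtain K where K: "compact K" "\<And>x. x \<notin> K \<Longrightarrow> \<phi> x = 0" using assms by (metis test_funE)
  have "compact (\<phi> ` K)"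
    using K(1) test_fun_continuous[OF assms] continuous_on_subset by (intro compact_continuous_image) auto
  then obtain B where B: "\<And>x. x \<in> K \<Longrightarrow> norm (\<phi> x) \<le> B"
    using compact_imp_bounded bounded_iff by (metis image_eqI)
  have "norm (\<phi> x) \<le> max 1 B" for x
    using B[of x] K(2)[of x] by (cases "x \<in> K") auto
  then show ?thesis using that[of "max 1 B"] by auto
qed

text \<open>
  As \<open>flat 0 (k * y)\<close> tends to \<open>1\<close> for \<open>y > 0\<close> and is \<open>0\<close> otherwise, these products are test functions
  that tend to the indicator of the open box.
\<close>

definition box_bump :: "'a::euclidean_space \<Rightarrow> 'a \<Rightarrow> nat \<Rightarrow> 'a \<Rightarrow> real" where
  "box_bump a b k x = (\<Prod>i\<in>Basis. flat 0 (real k * (x \<bullet> i - a \<bullet> i)) * flat 0 (real k * (b \<bullet> i - x \<bullet> i)))"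

lemma box_bump_test_fun:
  assumes "cbox a b \<subseteq> U"
  shows "test_fun U (box_bump a b k)"
proof (rule test_funI[of _ "cbox a b"])
  have aff: "smooth_fun (\<lambda>x::'a. flat 0 (c * (x \<bullet> i) + d))" for c d i
    by (rule smooth_fun_compose_affine[OF _ smooth_flat]) (intro bounded_linear_const_mult bounded_linear_inner_left)
  have eq: "flat 0 (real k * (x \<bullet> i - a \<bullet> i)) * flat 0 (real k * (b \<bullet> i - x \<bullet> i))
      = flat 0 (real k * (x \<bullet> i) + - real k * (a \<bullet> i)) * flat 0 (- real k * (x \<bullet> i) + real k * (b \<bullet> i))" for x i
    by (simp add: algebra_simps)
  show "smooth_fun (box_bump a b k)"
    unfolding box_bump_def eq by (intro smooth_fun_prod smooth_fun_mult aff)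
  fix x assume "x \<notin> cbox a b"
  then obtain i where i: "i \<in> Basis" "x \<bullet> i < a \<bullet> i \<or> b \<bullet> i < x \<bullet> i" by (auto simp: mem_box not_le)
  then have "flat 0 (real k * (x \<bullet> i - a \<bullet> i)) = 0 \<or> flat 0 (real k * (b \<bullet> i - x \<bullet> i)) = 0"
    by (auto simp: flat_def mult_nonneg_nonpos)
  then show "box_bump a b k x = 0"
    unfolding box_bump_def using i(1) by (intro prod_zero) auto
qed (use assms in auto)

lemma box_bump_bounds: "0 \<le> box_bump a b k x" "box_bump a b k x \<le> 1"
  unfolding box_bump_def
  by (auto intro!: prod_nonneg prod_le_1 mult_nonneg_nonneg mult_le_one flat_nonneg flat0_le_1)

lemma box_bump_outside: "x \<notin> cbox a b \<Longrightarrow> box_bump a b k x = 0"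
proof -
  assume "x \<notin> cbox a b"
  then obtain i where i: "i \<in> Basis" "x \<bullet> i < a \<bullet> i \<or> b \<bullet> i < x \<bullet> i" by (auto simp: mem_box not_le)
  then have "flat 0 (real k * (x \<bullet> i - a \<bullet> i)) = 0 \<or> flat 0 (real k * (b \<bullet> i - x \<bullet> i)) = 0"
    by (auto simp: flat_def mult_nonneg_nonpos)
  then show "box_bump a b k x = 0"
    unfolding box_bump_def using i(1) by (intro prod_zero) auto
qed

lemma box_bump_tendsto: "(\<lambda>k. box_bump a b k x) \<longlonglongrightarrow> indicator (box a b) x"
proof -
  have "(\<lambda>k. box_bump a b k x) \<longlonglongrightarrow>
    (\<Prod>i\<in>Basis. (if 0 < x \<bullet> i - a \<bullet> i then 1 else 0) * (if 0 < b \<bullet> i - x \<bullet> i then 1 else 0))"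
    unfolding box_bump_def by (intro tendsto_prod tendsto_mult flat0_tendsto)
  also have "(\<Prod>i\<in>Basis. (if 0 < x \<bullet> i - a \<bullet> i then 1 else 0) * (if 0 < b \<bullet> i - x \<bullet> i then 1 else 0)) = (indicator (box a b) x :: real)"
  proof (cases "x \<in> box a b")
    case True then show ?thesis by (auto simp: mem_box intro!: prod.neutral)
  next
    case False
    then obtain i where "i \<in> Basis" "\<not> (a \<bullet> i < x \<bullet> i \<and> x \<bullet> i < b \<bullet> i)" by (auto simp: mem_box)
    then show ?thesis using False by (auto intro!: prod_zero bexI[of _ i])
  qed
  finally show ?thesis .
qed


section \<open>The fundamental lemma of the calculus of variations\<close>

lemma integrable_lebesgue_on_iff:
  fixes f :: "'a::euclidean_space \<Rightarrow> 'b::euclidean_space"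
  assumes "S \<in> sets lebesgue"
  shows "integrable (lebesgue_on S) f \<longleftrightarrow> integrable lebesgue (\<lambda>x. indicator S x *\<^sub>R f x)"
  using assms by (intro integrable_restrict_space) auto

lemma integral_lebesgue_on_eq:
  fixes f :: "'a::euclidean_space \<Rightarrow> 'b::euclidean_space"
  assumes "S \<in> sets lebesgue"
  shows "(LINT x|lebesgue_on S. f x) = (LINT x|lebesgue. indicator S x *\<^sub>R f x)"
  using assms by (intro integral_restrict_space) auto

lemma AE_lebesgue_on_iff:
  assumes "S \<in> sets lebesgue"
  shows "(AE x in lebesgue_on S. P x) \<longleftrightarrow> (AE x in lborel. x \<in> S \<longrightarrow> P x)"
  using assms by (subst AE_restrict_space_iff) (auto simp: AE_completion_iff)

lemma loc_integrableD:
  assumes "loc_integrable U u" "compact K" "K \<subseteq> U"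
  shows "integrable lebesgue (\<lambda>x. indicator K x *\<^sub>R u x)"
  using assms by (simp add: loc_integrable_def set_integrable_def)

lemma loc_integrable_add: "loc_integrable U u \<Longrightarrow> loc_integrable U w \<Longrightarrow> loc_integrable U (\<lambda>x. u x + w x)"
  unfolding loc_integrable_def by (auto intro: set_integral_add)

lemma loc_integrable_scaleR: "loc_integrable U u \<Longrightarrow> loc_integrable U (\<lambda>x. c *\<^sub>R u x)"
  unfolding loc_integrable_def by (simp add: set_integrable_scaleR_right)

lemma loc_integrable_mult:
  fixes u :: "'a::euclidean_space \<Rightarrow> 'b::euclidean_space" and g :: "'a \<Rightarrow> real"
  assumes u: "loc_integrable U u" and U: "U \<in> sets lebesgue" and g: "test_fun U g"
  shows "integrable (lebesgue_on U) (\<lambda>x. g x *\<^sub>R u x)"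
proof -
  obtain K where K: "compact K" "K \<subseteq> U" "\<And>x. x \<notin> K \<Longrightarrow> g x = 0" using g by (metis test_funE)
  obtain B where B: "0 < B" "\<And>x. norm (g x) \<le> B" using test_fun_bounded[OF g] by metis
  note int = loc_integrableD[OF u K(1,2)]
  have gm: "g \<in> borel_measurable lebesgue"
    using test_fun_continuous[OF g] by (simp add: borel_measurable_continuous_onI measurable_completion)
  have eq: "indicator U x *\<^sub>R g x *\<^sub>R u x = g x *\<^sub>R indicator K x *\<^sub>R u x" for x
    using K by (auto simp: indicator_def)
  have "integrable lebesgue (\<lambda>x. g x *\<^sub>R indicator K x *\<^sub>R u x)"
  proof (rule Bochner_Integration.integrable_bound)
    show "integrable lebesgue (\<lambda>x. B *\<^sub>R indicator K x *\<^sub>R u x)" by (rule integrable_scaleR_right[OF int])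
    show "(\<lambda>x. g x *\<^sub>R indicator K x *\<^sub>R u x) \<in> borel_measurable lebesgue"
      by (rule borel_measurable_scaleR[OF gm borel_measurable_integrable[OF int]])
    show "AE x in lebesgue. norm (g x *\<^sub>R indicator K x *\<^sub>R u x) \<le> norm (B *\<^sub>R indicator K x *\<^sub>R u x)"
      using B by (auto simp: indicator_def intro!: AE_I2 mult_right_mono)
  qed
  then show ?thesis using U by (simp only: integrable_lebesgue_on_iff eq)
qed

lemma sigma_finite_lebesgue: "sigma_finite_measure (lebesgue :: 'a::euclidean_space measure)"
proof
  obtain A :: "'a set set" where "countable A" "A \<subseteq> sets lborel" "\<Union>A = space lborel" "\<forall>a\<in>A. emeasure lborel a \<noteq> \<infinity>"
    using lborel.sigma_finite_countable by auto
  then show "\<exists>A::'a set set. countable A \<and> A \<subseteq> sets lebesgue \<and> \<Union> A = space lebesgue \<and> (\<forall>a\<in>A. emeasure lebesgue a \<noteq> \<infinity>)"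
    by (intro exI[of _ A]) auto
qed

text \<open>
  The boxes are stable under intersection and generate the Borel sets, hence all integrals of the
  restriction of \<open>f\<close> to \<open>cbox c d\<close> over measurable sets vanish.
\<close>

lemma integral_zero_on_boxes_imp_AE_zero:
  fixes f :: "'a::euclidean_space \<Rightarrow> 'b::euclidean_space"
  assumes int: "integrable lebesgue (\<lambda>x. indicator (cbox c d) x *\<^sub>R f x)"
    and zero: "\<And>a b. cbox a b \<subseteq> cbox c d \<Longrightarrow> (LINT x|lebesgue. indicator (box a b) x *\<^sub>R f x) = 0"
  shows "AE x in lborel. x \<in> cbox c d \<longrightarrow> f x = 0"
proof -
  define F where "F x = indicator (cbox c d) x *\<^sub>R f x" for x
  have F: "integrable lebesgue F" using int by (simp add: F_def[abs_def])
  have FA: "set_integrable lebesgue A F" if "A \<in> sets lebesgue" for A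
    using F that unfolding set_integrable_def by (intro integrable_mult_indicator)
  have ae_box: "AE x in lebesgue. (x \<in> cbox c d) = (x \<in> box c d)"
  proof -
    have "AE x in lebesgue. x \<notin> cbox c d - box c d"
      using negligible_frontier_interval[of c d] by (intro AE_not_in) (simp add: negligible_iff_null_sets)
    then show ?thesis using box_subset_cbox[of c d] by (auto elim!: eventually_mono)
  qed
  have basic: "(LINT x:box a b|lebesgue. F x) = 0" for a b
  proof -
    define a' b' where "a' = (\<Sum>i\<in>Basis. max (a\<bullet>i) (c\<bullet>i) *\<^sub>R i)" and "b' = (\<Sum>i\<in>Basis. min (b\<bullet>i) (d\<bullet>i) *\<^sub>R i)"
    have eq: "box a b \<inter> box c d = box a' b'" by (simp add: box_Int_box a'_def b'_def)
    have "cbox a' b' \<subseteq> cbox c d" by (auto simp: a'_def b'_def mem_box)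
    then have "0 = (LINT x|lebesgue. indicator (box a' b') x *\<^sub>R f x)" using zero by simp
    also have "\<dots> = (LINT x:box a b|lebesgue. F x)"
      unfolding set_lebesgue_integral_def
    proof (rule integral_cong_AE)
      show "(\<lambda>x. indicator (box a b) x *\<^sub>R F x) \<in> borel_measurable lebesgue"
        using FA[of "box a b"] unfolding set_integrable_def by auto
      have "(\<lambda>x. indicator (box a' b') x *\<^sub>R F x) \<in> borel_measurable lebesgue"
        using FA[of "box a' b'"] unfolding set_integrable_def by auto
      moreover have "(\<lambda>x. indicator (box a' b') x *\<^sub>R F x) = (\<lambda>x. indicator (box a' b') x *\<^sub>R f x)"
        using \<open>cbox a' b' \<subseteq> cbox c d\<close> box_subset_cbox[of a' b'] by (auto simp: fun_eq_iff F_def indicator_def)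
      ultimately show "(\<lambda>x. indicator (box a' b') x *\<^sub>R f x) \<in> borel_measurable lebesgue" by simp
      show "AE x in lebesgue. indicator (box a' b') x *\<^sub>R f x = indicator (box a b) x *\<^sub>R F x"
        using ae_box by eventually_elim (auto simp: F_def indicator_def eq[symmetric])
    qed
    finally show ?thesis by simp
  qed
  have total: "(LINT x|lebesgue. F x) = 0"
  proof -
    have "(LINT x|lebesgue. F x) = (LINT x:box c d|lebesgue. F x)"
      unfolding set_lebesgue_integral_def
    proof (rule integral_cong_AE)
      show "AE x in lebesgue. F x = indicator (box c d) x *\<^sub>R F x"
        using ae_box by eventually_elim (auto simp: F_def indicator_def)
      show "(\<lambda>x. indicator (box c d) x *\<^sub>R F x) \<in> borel_measurable lebesgue"
        using FA[of "box c d"] unfolding set_integrable_def by auto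
    qed (use F in auto)
    then show ?thesis using basic by simp
  qed
  have borel: "(LINT x:A|lebesgue. F x) = 0" if "A \<in> sets borel" for A
  proof -
    have "Int_stable (range (\<lambda>(a, b). box a b :: 'a set))"
      by (auto simp: Int_stable_def box_Int_box)
    moreover have "range (\<lambda>(a, b). box a b :: 'a set) \<subseteq> Pow UNIV" by auto
    moreover have "A \<in> sigma_sets UNIV (range (\<lambda>(a, b). box a b :: 'a set))"
      using that by (simp add: borel_eq_box)
    ultimately show ?thesis
    proof (induction rule: sigma_sets_induct_disjoint)
      case (basic A) then show ?case using \<open>\<And>a b. (LINT x:box a b|lebesgue. F x) = 0\<close> by auto
    next
      case empty then show ?case by (simp add: set_lebesgue_integral_def)
    next
      case (compl A)
      then have A: "A \<in> sets lebesgue" by (simp add: borel_eq_box)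
      have "(LINT x|lebesgue. F x) = (LINT x:(UNIV - A)|lebesgue. F x) + (LINT x:A|lebesgue. F x)"
      proof -
        have "F x = indicator (UNIV - A) x *\<^sub>R F x + indicator A x *\<^sub>R F x" for x
          by (auto simp: indicator_def)
        then show ?thesis
          unfolding set_lebesgue_integral_def
          using FA[OF A] FA[OF sets.compl_sets[OF A]] unfolding set_integrable_def space_completion space_lborel
          by (subst Bochner_Integration.integral_add[symmetric]) auto
      qed
      then show ?case using compl total by simp
    next
      case (union A)
      then have A: "A i \<in> sets lebesgue" for i
      proof -
        have "A i \<in> sets borel" using union(2) by (auto simp: borel_eq_box)
        then show ?thesis by simp
      qed
      have "(LINT x:(\<Union>i. A i)|lebesgue. F x) = (\<Sum>i. LINT x:(A i)|lebesgue. F x)"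
        using union(1) A by (intro lebesgue_integral_countable_add FA) (auto simp: disjoint_family_on_def)
      then show ?case using union by simp
    qed
  qed
  have "(LINT x:A|lebesgue. F x) = 0" if A: "A \<in> sets lebesgue" for A
  proof -
    obtain S N N' where *: "A = S \<union> N" "N \<subseteq> N'" "N' \<in> null_sets lborel" "S \<in> sets lborel"
      using A by (rule sets_completionE)
    have "AE x in lebesgue. x \<notin> N'" using *(3) by (intro AE_completion AE_not_in)
    then have "AE x in lebesgue. indicator A x *\<^sub>R F x = indicator S x *\<^sub>R F x"
      by eventually_elim (use * in \<open>auto simp: indicator_def\<close>)
    then have "(LINT x:A|lebesgue. F x) = (LINT x:S|lebesgue. F x)"
      unfolding set_lebesgue_integral_def using FA[OF A] FA[of S] * unfolding set_integrable_def
      by (intro integral_cong_AE) auto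
    then show ?thesis using borel *(4) by simp
  qed
  then have "AE x in lebesgue. F x = 0"
    by (intro sigma_finite_measure.density_zero[OF sigma_finite_lebesgue F])
  then show ?thesis
    unfolding AE_completion_iff by eventually_elim (auto simp: F_def)
qed

text \<open>
  The test functions \<open>box_bump\<close> approximate indicators of boxes, so the integrals of \<open>f\<close> over all
  boxes inside \<open>U\<close> vanish, and \<open>U\<close> is a countable union of boxes.
\<close>

lemma fundamental_lemma:
  fixes f :: "'a::euclidean_space \<Rightarrow> 'b::euclidean_space"
  assumes U: "open U" and f: "loc_integrable U f"
    and zero: "\<And>\<phi>::'a \<Rightarrow> real. test_fun U \<phi> \<Longrightarrow> (LINT x|lebesgue_on U. \<phi> x *\<^sub>R f x) = 0"
  shows "AE x in lborel. x \<in> U \<longrightarrow> f x = 0"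
proof -
  have Ul: "U \<in> sets lebesgue" using U by simp
  have box: "(LINT x|lebesgue. indicator (box a b) x *\<^sub>R f x) = 0" if ab: "cbox a b \<subseteq> U" for a b
  proof -
    note int = loc_integrableD[OF f compact_cbox ab]
    have meas: "(\<lambda>x. box_bump a b k x *\<^sub>R indicator (cbox a b) x *\<^sub>R f x) \<in> borel_measurable lebesgue" for k
      using test_fun_continuous[OF box_bump_test_fun[OF ab, of k]]
      by (intro borel_measurable_scaleR[OF _ borel_measurable_integrable[OF int]])
        (auto simp: borel_measurable_continuous_onI measurable_completion)
    have eq: "box_bump a b k x *\<^sub>R indicator (cbox a b) x *\<^sub>R f x = indicator U x *\<^sub>R box_bump a b k x *\<^sub>R f x" for k x
      using ab box_bump_outside[of x a b k] by (auto simp: indicator_def)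
    have "(\<lambda>k. LINT x|lebesgue. box_bump a b k x *\<^sub>R indicator (cbox a b) x *\<^sub>R f x) \<longlonglongrightarrow>
       (LINT x|lebesgue. indicator (box a b) x *\<^sub>R indicator (cbox a b) x *\<^sub>R f x)"
    proof (rule integral_dominated_convergence[where w = "\<lambda>x. norm (indicator (cbox a b) x *\<^sub>R f x)"])
      show "AE x in lebesgue. norm (box_bump a b k x *\<^sub>R indicator (cbox a b) x *\<^sub>R f x) \<le> norm (indicator (cbox a b) x *\<^sub>R f x)" for k
        using box_bump_bounds[of a b k]
        by (intro AE_I2) (simp only: norm_scaleR[of "box_bump a b k _"] mult_left_le_one_le abs_of_nonneg norm_ge_zero)
      show "AE x in lebesgue. (\<lambda>k. box_bump a b k x *\<^sub>R indicator (cbox a b) x *\<^sub>R f x) \<longlonglongrightarrow> indicator (box a b) x *\<^sub>R indicator (cbox a b) x *\<^sub>R f x"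
        by (intro AE_I2 tendsto_intros box_bump_tendsto)
      show "(\<lambda>x. indicator (box a b) x *\<^sub>R indicator (cbox a b) x *\<^sub>R f x) \<in> borel_measurable lebesgue"
        by (intro borel_measurable_scaleR[OF _ borel_measurable_integrable[OF int]] borel_measurable_indicator) simp
    qed (rule meas, rule integrable_norm[OF int])
    moreover have "(LINT x|lebesgue. box_bump a b k x *\<^sub>R indicator (cbox a b) x *\<^sub>R f x) = 0" for k
      using zero[OF box_bump_test_fun[OF ab, of k]] Ul by (simp only: eq integral_lebesgue_on_eq)
    moreover have "indicator (box a b) x *\<^sub>R indicator (cbox a b) x *\<^sub>R f x = indicator (box a b) x *\<^sub>R f x" for x
      using box_subset_cbox[of a b] by (auto simp: indicator_def)
    ultimately show ?thesis by (simp only: LIMSEQ_const_iff)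
  qed
  have cb: "AE x in lborel. x \<in> cbox c d \<longrightarrow> f x = 0" if "cbox c d \<subseteq> U" for c d
    using that by (intro integral_zero_on_boxes_imp_AE_zero loc_integrableD[OF f] box) auto
  obtain D where D: "countable D" "D \<subseteq> Pow U" "\<And>X. X \<in> D \<Longrightarrow> \<exists>a b. X = cbox a b" "\<Union>D = U"
    using open_countable_Union_open_cbox[OF U] by metis
  have "AE x in lborel. \<forall>X\<in>D. x \<in> X \<longrightarrow> f x = 0"
    using D cb by (subst AE_ball_countable) (auto, metis Pow_iff subsetD)
  then show ?thesis by eventually_elim (use D(4) in blast)
qed


section \<open>Weak derivatives\<close>

lemma has_weak_derivD:
  assumes "has_weak_deriv U e u w"
  shows "loc_integrable U u" "loc_integrable U w"
    and "\<And>\<phi>::'a::euclidean_space \<Rightarrow> real. test_fun U \<phi> \<Longrightarrow> (LINT x|lebesgue_on U. frechet_derivative \<phi> (at x) e *\<^sub>R u x) =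
        - (LINT x|lebesgue_on U. \<phi> x *\<^sub>R w x)"
  using assms by (auto simp: has_weak_deriv_def)

lemma has_weak_deriv_unique:
  fixes u :: "'a::euclidean_space \<Rightarrow> 'b::euclidean_space"
  assumes U: "open U" and "has_weak_deriv U e u w" "has_weak_deriv U e u w'"
  shows "AE x in lborel. x \<in> U \<longrightarrow> w x = w' x"
proof -
  have Ul: "U \<in> sets lebesgue" using U by simp
  note 1 = has_weak_derivD[OF assms(2)] and 2 = has_weak_derivD[OF assms(3)]
  have "loc_integrable U (\<lambda>x. w x + (-1) *\<^sub>R w' x)"
    using 1 2 by (intro loc_integrable_add loc_integrable_scaleR)
  moreover have "(LINT x|lebesgue_on U. \<phi> x *\<^sub>R (w x + (-1) *\<^sub>R w' x)) = 0" if "test_fun U \<phi>" for \<phi> :: "'a \<Rightarrow> real"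
    using 1(3)[OF that] 2(3)[OF that] loc_integrable_mult[OF 1(2) Ul that] loc_integrable_mult[OF 2(2) Ul that]
    by (simp add: algebra_simps)
  ultimately have "AE x in lborel. x \<in> U \<longrightarrow> w x + (-1) *\<^sub>R w' x = 0"
    by (rule fundamental_lemma[OF U])
  then show ?thesis by eventually_elim auto
qed

lemma has_weak_deriv_add:
  fixes u u' :: "'a::euclidean_space \<Rightarrow> 'b::euclidean_space"
  assumes U: "open U" and "has_weak_deriv U e u w" "has_weak_deriv U e u' w'"
  shows "has_weak_deriv U e (\<lambda>x. u x + u' x) (\<lambda>x. w x + w' x)"
proof -
  have Ul: "U \<in> sets lebesgue" using U by simp
  note 1 = has_weak_derivD[OF assms(2)] and 2 = has_weak_derivD[OF assms(3)]
  show ?thesis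
    unfolding has_weak_deriv_def
  proof (intro conjI allI impI)
    fix \<phi> :: "'a \<Rightarrow> real" assume \<phi>: "test_fun U \<phi>"
    note d = test_fun_derivative[OF \<phi>, of e]
    show "(LINT x|lebesgue_on U. frechet_derivative \<phi> (at x) e *\<^sub>R (u x + u' x)) = - (LINT x|lebesgue_on U. \<phi> x *\<^sub>R (w x + w' x))"
      using 1(3)[OF \<phi>] 2(3)[OF \<phi>] loc_integrable_mult[OF 1(2) Ul \<phi>] loc_integrable_mult[OF 2(2) Ul \<phi>]
        loc_integrable_mult[OF 1(1) Ul d] loc_integrable_mult[OF 2(1) Ul d]
      by (simp add: scaleR_add_right)
  qed (use 1 2 in \<open>auto intro: loc_integrable_add\<close>)
qed

lemma has_weak_deriv_scaleR:
  assumes "has_weak_deriv U e u w"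
  shows "has_weak_deriv U e (\<lambda>x. c *\<^sub>R u x) (\<lambda>x. c *\<^sub>R w x)"
proof -
  note 1 = has_weak_derivD[OF assms]
  have eq: "a *\<^sub>R c *\<^sub>R y = c *\<^sub>R a *\<^sub>R y" for a and y :: 'b by simp
  show ?thesis
    unfolding has_weak_deriv_def eq integral_scaleR_right
    using 1 by (auto intro: loc_integrable_scaleR)
qed

definition diff_quot :: "('a::euclidean_space \<Rightarrow> 'b::euclidean_space) \<Rightarrow> 'a \<Rightarrow> nat \<Rightarrow> 'a \<Rightarrow> 'b" where
  "diff_quot \<psi> e k x = real (Suc k) *\<^sub>R (\<psi> (x + (1 / real (Suc k)) *\<^sub>R e) - \<psi> x)"

text \<open>
  The uniform bound and the common bounded support are what dominated convergence needs for passing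
  from difference quotients to the derivative under an integral.
\<close>

lemma difference_quotient_limits:
  fixes \<psi> :: "'a::euclidean_space \<Rightarrow> 'b::euclidean_space" and e :: 'a
  assumes "test_fun U \<psi>"
  obtains B R where "\<And>k x. norm (diff_quot \<psi> e k x) \<le> B" "\<And>k x. R < norm x \<Longrightarrow> diff_quot \<psi> e k x = 0"
    "0 < B" "0 < R"
    "\<And>x. (\<lambda>k. diff_quot \<psi> e k x) \<longlonglongrightarrow> frechet_derivative \<psi> (at x) e" "\<And>k. diff_quot \<psi> e k \<in> borel_measurable borel"
    "\<And>x. norm (frechet_derivative \<psi> (at x) e) \<le> B" "\<And>x. R < norm x \<Longrightarrow> frechet_derivative \<psi> (at x) e = 0"
    "\<And>x. norm (\<psi> x) \<le> B" "\<And>x. R < norm x \<Longrightarrow> \<psi> x = 0"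
proof -
  obtain K where K: "compact K" "\<And>x. x \<notin> K \<Longrightarrow> \<psi> x = 0" "\<And>x h. x \<notin> K \<Longrightarrow> frechet_derivative \<psi> (at x) h = 0"
    using assms by (metis test_funE)
  obtain R where R: "0 < R" "\<And>x. x \<in> K \<Longrightarrow> norm x \<le> R"
    using compact_imp_bounded[OF K(1)] by (auto simp: bounded_pos)
  obtain B1 where B1: "0 < B1" "\<And>x. norm (frechet_derivative \<psi> (at x) e) \<le> B1"
    using test_fun_bounded[OF test_fun_derivative[OF assms(1), of e]] by metis
  obtain B2 where B2: "0 < B2" "\<And>x. norm (\<psi> x) \<le> B2"
    using test_fun_bounded[OF assms(1)] by metis
  define B where "B = max B1 B2"
  have B: "0 < B" "norm (frechet_derivative \<psi> (at x) e) \<le> B" "norm (\<psi> x) \<le> B" for x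
    using B1(1) B2(2)[of x] B1(2)[of x] by (auto simp: B_def le_max_iff_disj)
  have der: "(\<psi> has_derivative frechet_derivative \<psi> (at x)) (at x)" for x
    using assms by (intro smooth_fun_has_derivative test_fun_smooth)
  have line: "((\<lambda>t. \<psi> (x + t *\<^sub>R e)) has_vector_derivative frechet_derivative \<psi> (at (x + t *\<^sub>R e)) e) (at t)" for x t
  proof -
    have "((\<lambda>t. x + t *\<^sub>R e) has_derivative (\<lambda>h. h *\<^sub>R e)) (at t)" by (auto intro!: derivative_eq_intros)
    from has_derivative_compose[OF this der] have "((\<lambda>t. \<psi> (x + t *\<^sub>R e)) has_derivative (\<lambda>h. frechet_derivative \<psi> (at (x + t *\<^sub>R e)) (h *\<^sub>R e))) (at t)" .
    then show ?thesis
      using linear_scale[OF has_derivative_linear[OF der]] by (simp add: has_vector_derivative_def)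
  qed
  have cont: "continuous_on UNIV \<psi>" using test_fun_continuous[OF assms(1)] .
  have q_bound: "norm (diff_quot \<psi> e k x) \<le> B" for k x
  proof -
    have "norm (\<psi> (x + (1 / real (Suc k)) *\<^sub>R e) - \<psi> (x + 0 *\<^sub>R e)) \<le> B * norm (1 / real (Suc k) - 0)"
    proof (rule differentiable_bound[where S = UNIV and f = "\<lambda>t. \<psi> (x + t *\<^sub>R e)"])
      show "((\<lambda>t. \<psi> (x + t *\<^sub>R e)) has_derivative (\<lambda>h. h *\<^sub>R frechet_derivative \<psi> (at (x + t *\<^sub>R e)) e)) (at t within UNIV)" for t
        using line by (simp add: has_vector_derivative_def)
      show "onorm (\<lambda>h. h *\<^sub>R frechet_derivative \<psi> (at (x + t *\<^sub>R e)) e) \<le> B" for t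
        using B mult_right_mono[OF B(2) abs_ge_zero] by (intro onorm_le) (simp add: mult.commute)
    qed auto
    then have "real (Suc k) * norm (\<psi> (x + (1 / real (Suc k)) *\<^sub>R e) - \<psi> x) \<le> B"
      by (simp add: field_simps del: of_nat_Suc)
    then show ?thesis by (simp only: diff_quot_def norm_scaleR abs_of_nat)
  qed
  have q_supp: "diff_quot \<psi> e k x = 0" if "norm x > R + norm e" for k x
  proof -
    have "norm ((1 / real (Suc k)) *\<^sub>R e) \<le> norm e" by (simp add: field_simps mult_left_mono)
    then have "norm (x + (1 / real (Suc k)) *\<^sub>R e) > R"
      using that norm_diff_ineq[of x "(1 / real (Suc k)) *\<^sub>R e"] by linarith
    moreover have "norm x > R" using that norm_ge_zero[of e] by linarith
    ultimately have "\<psi> x = 0" "\<psi> (x + (1 / real (Suc k)) *\<^sub>R e) = 0"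
      using K(2) R(2) by (meson not_le)+
    then show ?thesis by (simp add: diff_quot_def)
  qed
  have q_lim: "(\<lambda>k. diff_quot \<psi> e k x) \<longlonglongrightarrow> frechet_derivative \<psi> (at x) e" for x
  proof -
      have "((\<lambda>h. (1/h) *\<^sub>R (\<psi> (x + h *\<^sub>R e) - \<psi> x)) \<longlongrightarrow> frechet_derivative \<psi> (at x) e) (at 0)"
      proof (rule LIM_zero_cancel, rule tendsto_norm_zero_cancel)
        have "((\<lambda>h. norm (\<psi> (x + (0 + h) *\<^sub>R e) - \<psi> (x + 0 *\<^sub>R e) - h *\<^sub>R frechet_derivative \<psi> (at x) e) / norm h) \<longlongrightarrow> 0) (at 0)"
          using line[of x 0] unfolding has_vector_derivative_def has_derivative_at by simp
        then show "((\<lambda>h. norm ((1/h) *\<^sub>R (\<psi> (x + h *\<^sub>R e) - \<psi> x) - frechet_derivative \<psi> (at x) e)) \<longlongrightarrow> 0) (at 0)"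
        proof (rule Lim_transform_eventually)
          have "norm (a - h *\<^sub>R b) / norm h = norm ((1/h) *\<^sub>R a - b)" if "h \<noteq> 0" for h and a b :: 'b
          proof -
            have "(1/h) *\<^sub>R a - b = (1/h) *\<^sub>R (a - h *\<^sub>R b)" using that by (simp add: scaleR_diff_right)
            then show ?thesis by simp
          qed
          then show "\<forall>\<^sub>F h in at 0. norm (\<psi> (x + (0 + h) *\<^sub>R e) - \<psi> (x + 0 *\<^sub>R e) - h *\<^sub>R frechet_derivative \<psi> (at x) e) / norm h
             = norm ((1/h) *\<^sub>R (\<psi> (x + h *\<^sub>R e) - \<psi> x) - frechet_derivative \<psi> (at x) e)"
            by (simp add: eventually_at_filter)
        qed
      qed
      moreover have "filterlim (\<lambda>k. 1 / real (Suc k)) (at 0) sequentially"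
        using LIMSEQ_Suc[OF lim_1_over_n] by (simp add: filterlim_at)
      ultimately show "(\<lambda>k. diff_quot \<psi> e k x) \<longlonglongrightarrow> frechet_derivative \<psi> (at x) e"
        unfolding diff_quot_def by (auto dest: filterlim_compose)
  qed
  have q_meas: "diff_quot \<psi> e k \<in> borel_measurable borel" for k
    unfolding diff_quot_def using cont by (auto intro!: borel_measurable_continuous_onI continuous_intros continuous_on_compose2[OF cont])
  show ?thesis
  proof (rule that[of B "R + norm e"])
    fix x :: 'a assume "R + norm e < norm x"
    then have "x \<notin> K" using R(2)[of x] norm_ge_zero[of e] by linarith
    then show "frechet_derivative \<psi> (at x) e = 0" "\<psi> x = 0" using K by auto
  qed (use B R(1) q_bound q_supp q_lim q_meas in \<open>auto simp: add_pos_nonneg\<close>)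
qed

text \<open>
  The Lebesgue measure is invariant under translations, so already the difference quotients have
  integral zero.
\<close>

lemma integral_derivative_eq_0:
  fixes \<psi> :: "'a::euclidean_space \<Rightarrow> 'b::euclidean_space"
  assumes "test_fun U \<psi>"
  shows "(LINT x|lborel. frechet_derivative \<psi> (at x) e) = 0"
proof -
  obtain B R where B: "\<And>k x. norm (diff_quot \<psi> e k x) \<le> B" "\<And>k x. R < norm x \<Longrightarrow> diff_quot \<psi> e k x = 0"
    "0 < B" "0 < R"
    "\<And>x. (\<lambda>k. diff_quot \<psi> e k x) \<longlonglongrightarrow> frechet_derivative \<psi> (at x) e" "\<And>k. diff_quot \<psi> e k \<in> borel_measurable borel"
    "\<And>x. norm (frechet_derivative \<psi> (at x) e) \<le> B" "\<And>x. R < norm x \<Longrightarrow> frechet_derivative \<psi> (at x) e = 0"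
    "\<And>x. norm (\<psi> x) \<le> B" "\<And>x. R < norm x \<Longrightarrow> \<psi> x = 0"
    by (rule difference_quotient_limits[OF assms, of e]) (rule that)
  have cont: "continuous_on UNIV \<psi>" using test_fun_continuous[OF assms] .
  have w: "integrable lborel (\<lambda>x. B * indicator (cball (0::'a) R) x)"
    using emeasure_lborel_cball_finite[of "0::'a" R] by (intro integrable_mult_right integrable_real_indicator) auto
  have "(\<lambda>k. LINT x|lborel. diff_quot \<psi> e k x) \<longlonglongrightarrow> (LINT x|lborel. frechet_derivative \<psi> (at x) e)"
  proof (rule integral_dominated_convergence[OF _ _ w])
    show "AE x in lborel. norm (diff_quot \<psi> e k x) \<le> B * indicator (cball 0 R) x" for k
      using B by (auto intro!: AE_I2 simp: indicator_def)
    show "(\<lambda>x. frechet_derivative \<psi> (at x) e) \<in> borel_measurable lborel"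
      using test_fun_continuous[OF test_fun_derivative[OF assms]] by (simp add: borel_measurable_continuous_onI)
  qed (use B in auto)
  moreover have "(LINT x|lborel. diff_quot \<psi> e k x) = 0" for k
  proof -
    have m: "\<psi> \<in> borel_measurable borel" using cont by (simp add: borel_measurable_continuous_onI)
    have i: "integrable lborel \<psi>"
    proof (rule Bochner_Integration.integrable_bound[OF w])
      show "AE x in lborel. norm (\<psi> x) \<le> norm (B * indicator (cball 0 R) x)"
        using B by (intro AE_I2) (auto simp: indicator_def)
    qed (use m in simp)
    have "integrable (distr lborel borel ((+) z)) \<psi>" "integral\<^sup>L (distr lborel borel ((+) z)) \<psi> = integral\<^sup>L lborel \<psi>" for z
      using i by (simp_all add: lborel_distr_plus)
    then have "integrable lborel (\<lambda>x. \<psi> (z + x))" "(LINT x|lborel. \<psi> (z + x)) = (LINT x|lborel. \<psi> x)" for z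
      using m by (simp_all add: integrable_distr_eq integral_distr)
    then have "integrable lborel (\<lambda>x. \<psi> (x + z))" "(LINT x|lborel. \<psi> (x + z)) = (LINT x|lborel. \<psi> x)" for z
      by (simp_all only: add.commute[of _ z])
    then show ?thesis using i by (simp add: diff_quot_def)
  qed
  ultimately show ?thesis by (simp add: LIMSEQ_const_iff)
qed

text \<open>
  Integration by parts is \<open>integral_derivative_eq_0\<close> for the product of \<open>u\<close> with the test function.
\<close>

lemma smooth_fun_has_weak_deriv:
  fixes u :: "'a::euclidean_space \<Rightarrow> 'b::euclidean_space"
  assumes U: "open U" and u: "smooth_fun u"
  shows "has_weak_deriv U e u (\<lambda>x. frechet_derivative u (at x) e)"
proof -
  have loc: "loc_integrable U f" if "continuous_on UNIV f" for f :: "'a \<Rightarrow> 'b"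
    unfolding loc_integrable_def set_integrable_def
  proof (intro allI impI)
    fix K assume "compact K \<and> K \<subseteq> U"
    then have "integrable lborel (\<lambda>x. indicator K x *\<^sub>R f x)"
      using continuous_on_subset[OF that] by (intro borel_integrable_compact) auto
    then show "integrable lebesgue (\<lambda>x. indicator K x *\<^sub>R f x)"
      by (subst integrable_completion) auto
  qed
  show ?thesis
    unfolding has_weak_deriv_def
  proof (intro conjI allI impI)
    show l1: "loc_integrable U u" using u by (intro loc smooth_fun_continuous)
    show l2: "loc_integrable U (\<lambda>x. frechet_derivative u (at x) e)"
      using u by (intro loc smooth_fun_continuous smooth_fun_derivative)
    fix \<phi> :: "'a \<Rightarrow> real" assume \<phi>: "test_fun U \<phi>"
    obtain K where K: "compact K" "K \<subseteq> U" "\<And>x. x \<notin> K \<Longrightarrow> \<phi> x = 0" "\<And>x h. x \<notin> K \<Longrightarrow> frechet_derivative \<phi> (at x) h = 0"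
      using \<phi> by (metis test_funE)
    have prod: "frechet_derivative (\<lambda>x. \<phi> x *\<^sub>R u x) (at x) e = \<phi> x *\<^sub>R frechet_derivative u (at x) e + frechet_derivative \<phi> (at x) e *\<^sub>R u x" for x
      using frechet_derivative_at[OF has_derivative_scaleR[OF smooth_fun_has_derivative[OF test_fun_smooth[OF \<phi>], of x] smooth_fun_has_derivative[OF u, of x]]]
      by (rule fun_cong[OF sym, of _ _ e])
    have Ul: "U \<in> sets lebesgue" using U by simp
    have "0 = (LINT x|lborel. frechet_derivative (\<lambda>x. \<phi> x *\<^sub>R u x) (at x) e)"
      using integral_derivative_eq_0[OF test_fun_scaleR'[OF \<phi> u]] by simp
    also have "\<dots> = (LINT x|lebesgue. frechet_derivative (\<lambda>x. \<phi> x *\<^sub>R u x) (at x) e)"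
      using test_fun_continuous[OF test_fun_derivative[OF test_fun_scaleR'[OF \<phi> u]]]
      by (intro integral_completion[symmetric]) (simp add: borel_measurable_continuous_onI)
    also have "\<dots> = (LINT x|lebesgue_on U. \<phi> x *\<^sub>R frechet_derivative u (at x) e + frechet_derivative \<phi> (at x) e *\<^sub>R u x)"
      using K unfolding prod integral_lebesgue_on_eq[OF Ul]
      by (intro Bochner_Integration.integral_cong) (auto simp: indicator_def K(3,4)[OF contra_subsetD[OF K(2)]])
    also have "\<dots> = (LINT x|lebesgue_on U. \<phi> x *\<^sub>R frechet_derivative u (at x) e) + (LINT x|lebesgue_on U. frechet_derivative \<phi> (at x) e *\<^sub>R u x)"
      by (intro Bochner_Integration.integral_add loc_integrable_mult[OF l2 Ul \<phi>] loc_integrable_mult[OF l1 Ul test_fun_derivative[OF \<phi>]])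
    finally show "(LINT x|lebesgue_on U. frechet_derivative \<phi> (at x) e *\<^sub>R u x) = - (LINT x|lebesgue_on U. \<phi> x *\<^sub>R frechet_derivative u (at x) e)"
      by (simp add: add_eq_0_iff)
  qed
qed

lemma has_weak_deriv_zero:
  fixes u :: "'a::euclidean_space \<Rightarrow> 'b::euclidean_space"
  assumes U: "open U" and "has_weak_deriv U e u w" and zero: "AE x in lborel. x \<in> U \<longrightarrow> u x = 0"
  shows "AE x in lborel. x \<in> U \<longrightarrow> w x = 0"
proof (rule fundamental_lemma[OF U])
  have Ul: "U \<in> sets lebesgue" using U by simp
  note 1 = has_weak_derivD[OF assms(2)]
  show "loc_integrable U w" by (rule 1)
  fix \<phi> :: "'a \<Rightarrow> real" assume \<phi>: "test_fun U \<phi>"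
  have "AE x in lebesgue_on U. frechet_derivative \<phi> (at x) e *\<^sub>R u x = 0"
    unfolding AE_lebesgue_on_iff[OF Ul] using zero by eventually_elim auto
  then have "(LINT x|lebesgue_on U. frechet_derivative \<phi> (at x) e *\<^sub>R u x) = 0"
    by (rule integral_eq_zero_AE)
  then show "(LINT x|lebesgue_on U. \<phi> x *\<^sub>R w x) = 0" using 1(3)[OF \<phi>] by simp
qed


section \<open>Weak gradients\<close>

lemma has_weak_grad_unique:
  assumes "open \<Omega>" "has_weak_grad \<Omega> u V" "has_weak_grad \<Omega> u W"
  shows "AE x in lebesgue_on \<Omega>. V x = W x"
proof -
  have "AE x in lborel. x \<in> \<Omega> \<longrightarrow> column j (V x) = column j (W x)" for j
    using assms unfolding has_weak_grad_def by (intro has_weak_deriv_unique[OF assms(1)]) auto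
  then have "AE x in lborel. \<forall>j\<in>UNIV. x \<in> \<Omega> \<longrightarrow> column j (V x) = column j (W x)"
    by (intro AE_finite_allI) auto
  then have "AE x in lborel. x \<in> \<Omega> \<longrightarrow> V x = W x"
    by eventually_elim (auto simp: column_def vec_eq_iff)
  then show ?thesis using assms(1) by (subst AE_lebesgue_on_iff) auto
qed

lemma has_weak_grad_add:
  fixes u :: "real ^ 'n::finite \<Rightarrow> real ^ 'm::finite"
  assumes "open \<Omega>" "has_weak_grad \<Omega> u V" "has_weak_grad \<Omega> w W"
  shows "has_weak_grad \<Omega> (\<lambda>x. u x + w x) (\<lambda>x. V x + W x)"
proof -
  have "column j (A + B) = column j A + column j B" for j and A B :: "real^'n^'m"
    by (simp add: column_def vec_eq_iff)
  then show ?thesis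
    unfolding has_weak_grad_def using assms(2,3)[unfolded has_weak_grad_def]
    by (simp only: has_weak_deriv_add[OF assms(1)] simp_thms)
qed

lemma has_weak_grad_scaleR:
  fixes u :: "real ^ 'n::finite \<Rightarrow> real ^ 'm::finite"
  assumes "has_weak_grad \<Omega> u V"
  shows "has_weak_grad \<Omega> (\<lambda>x. c *\<^sub>R u x) (\<lambda>x. c *\<^sub>R V x)"
proof -
  have "column j (c *\<^sub>R A) = c *\<^sub>R column j A" for j and A :: "real^'n^'m"
    by (simp add: column_def vec_eq_iff)
  then show ?thesis using assms has_weak_deriv_scaleR[of \<Omega> _ u _ c] by (simp add: has_weak_grad_def)
qed

lemma has_weak_grad_wgrad: "has_weak_grad \<Omega> u V \<Longrightarrow> has_weak_grad \<Omega> u (wgrad \<Omega> u)"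
  unfolding wgrad_def by (rule someI[where P = "has_weak_grad \<Omega> u"])

lemma wgrad_AE_eq:
  assumes "open \<Omega>" "has_weak_grad \<Omega> u V"
  shows "AE x in lebesgue_on \<Omega>. wgrad \<Omega> u x = V x"
  using has_weak_grad_unique[OF assms(1) has_weak_grad_wgrad[OF assms(2)] assms(2)] .

definition grad_matrix :: "(real ^ 'n::finite \<Rightarrow> real ^ 'm::finite) \<Rightarrow> real ^ 'n \<Rightarrow> real ^ 'n ^ 'm" where
  "grad_matrix u x = (\<chi> i j. frechet_derivative u (at x) (axis j 1) $ i)"

lemma has_weak_grad_grad_matrix:
  assumes "open \<Omega>" "smooth_fun u"
  shows "has_weak_grad \<Omega> u (grad_matrix u)"
proof -
  have "column j (grad_matrix u x) = frechet_derivative u (at x) (axis j 1)" for j x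
    by (simp add: column_def grad_matrix_def vec_eq_iff)
  then show ?thesis using assms by (simp add: has_weak_grad_def smooth_fun_has_weak_deriv)
qed

lemma grad_matrix_mult: "smooth_fun u \<Longrightarrow> frechet_derivative u (at x) z = grad_matrix u x *v z"
proof -
  assume "smooth_fun u"
  then have "linear (frechet_derivative u (at x))"
    by (rule has_derivative_linear[OF smooth_fun_has_derivative])
  from matrix_works[OF this[unfolded linear_matrix_vector_mul_eq[symmetric], simplified], of z]
  show ?thesis by (simp add: grad_matrix_def matrix_def)
qed

lemma norm_matrix_vector_mult_le:
  fixes A :: "real ^ 'n::finite ^ 'm::finite"
  shows "norm (A *v z) \<le> norm A * norm z"
proof -
  have "norm (A *v z) = L2_set (\<lambda>i. norm (A $ i \<bullet> z)) UNIV"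
    by (simp add: norm_vec_def matrix_vector_mul_component)
  also have "\<dots> \<le> L2_set (\<lambda>i. norm (A $ i) * norm z) UNIV"
    by (intro L2_set_mono) (auto simp: Cauchy_Schwarz_ineq2)
  also have "\<dots> = norm A * norm z"
    by (simp add: L2_set_left_distrib norm_vec_def)
  finally show ?thesis .
qed

lemma continuous_grad_matrix:
  assumes "smooth_fun u" shows "continuous_on UNIV (grad_matrix u)"
  unfolding grad_matrix_def
  by (intro continuous_on_vec_lambda continuous_on_component smooth_fun_continuous smooth_fun_derivative assms)


section \<open>Sobolev functions with zero boundary values\<close>

lemma measurable_lebesgue_on_cong_AE:
  fixes f :: "'a::euclidean_space \<Rightarrow> 'b::euclidean_space"
  assumes S: "S \<in> sets lebesgue" and f: "f \<in> borel_measurable (lebesgue_on S)"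
    and ae: "AE x in lebesgue_on S. f x = g x"
  shows "g \<in> borel_measurable (lebesgue_on S)"
proof -
  have "(\<lambda>x. if x \<in> S then f x else 0) \<in> borel_measurable lebesgue"
    using f S by (rule borel_measurable_if_I)
  moreover have "AE x in lebesgue. (if x \<in> S then f x else 0) = (if x \<in> S then g x else 0)"
    using ae unfolding AE_lebesgue_on_iff[OF S] AE_completion_iff by eventually_elim auto
  ultimately have "(\<lambda>x. if x \<in> S then g x else 0) \<in> borel_measurable lebesgue"
    by (rule borel_measurable_AE)
  then show ?thesis by (rule borel_measurable_if_D)
qed

lemma Lp_lebesgue_on_iff_lborel:
  fixes f :: "'a::euclidean_space \<Rightarrow> 'b::euclidean_space"
  assumes S: "S \<in> sets lebesgue" and f: "f \<in> borel_measurable borel" and zero: "\<And>x. x \<notin> S \<Longrightarrow> f x = 0"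
  shows "f \<in> Lp (lebesgue_on S) p \<longleftrightarrow> f \<in> Lp lborel p" "pint (lebesgue_on S) p f = pint lborel p f"
    "pnorm (lebesgue_on S) p f = pnorm lborel p f"
proof -
  have eq: "indicator S x *\<^sub>R (norm (f x) powr p) = norm (f x) powr p" for x
    using zero[of x] by (auto simp: indicator_def)
  have m: "f \<in> borel_measurable (lebesgue_on S)"
    using f by (intro measurable_restrict_space1) (simp add: measurable_completion)
  have m2: "(\<lambda>x. norm (f x) powr p) \<in> borel_measurable lborel" using f by simp
  show "f \<in> Lp (lebesgue_on S) p \<longleftrightarrow> f \<in> Lp lborel p"
    using f m integrable_completion[OF m2] by (simp add: Lp_def integrable_lebesgue_on_iff[OF S] eq del: real_scaleR_def)
  show "pint (lebesgue_on S) p f = pint lborel p f"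
    using integral_completion[OF m2] by (simp add: pint_def integral_lebesgue_on_eq[OF S] eq del: real_scaleR_def)
  then show "pnorm (lebesgue_on S) p f = pnorm lborel p f" by (simp add: pnorm_def)
qed

lemma continuous_compact_support_Lp:
  fixes \<phi> :: "'a::euclidean_space \<Rightarrow> 'b::euclidean_space"
  assumes c: "continuous_on UNIV \<phi>" and K: "compact K" "\<And>x. x \<notin> K \<Longrightarrow> \<phi> x = 0" and p: "0 < p"
  shows "\<phi> \<in> Lp lborel p"
proof (rule LpI)
  show "\<phi> \<in> borel_measurable lborel" using c by (simp add: borel_measurable_continuous_onI)
  have "integrable lborel (\<lambda>x. indicator K x *\<^sub>R (norm (\<phi> x) powr p))"
    using p by (intro borel_integrable_compact[OF K(1)] continuous_on_powr' continuous_on_norm continuous_on_subset[OF c] continuous_on_const) auto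
  also have "(\<lambda>x. indicator K x *\<^sub>R (norm (\<phi> x) powr p)) = (\<lambda>x. norm (\<phi> x) powr p)"
    using K(2) by (auto simp: fun_eq_iff indicator_def)
  finally show "integrable lborel (\<lambda>x. norm (\<phi> x) powr p)" .
qed

locale bounded_open_set =
  fixes \<Omega> :: "(real ^ 'n::finite) set" and p :: real
  assumes open_set: "open \<Omega>" and bounded_set: "bounded \<Omega>" and p_gt_1: "1 < p"
begin

abbreviation "M \<equiv> lebesgue_on \<Omega>"

lemma p_facts [simp]: "1 \<le> p" "0 < p" "p \<noteq> 0" "0 \<le> p"
  using p_gt_1 by auto

lemma set_lebesgue [simp]: "\<Omega> \<in> sets lebesgue"
  using open_set by simp

lemma finite_measure_set: "finite_measure M"
  by (intro finite_measure_lebesgue_on bounded_set_imp_lmeasurable bounded_set) simp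

lemma Lp_loc_integrable:
  fixes u :: "real ^ 'n \<Rightarrow> 'b::euclidean_space"
  assumes "u \<in> Lp M p"
  shows "loc_integrable \<Omega> u"
  unfolding loc_integrable_def
proof (intro allI impI)
  fix K assume K: "compact K \<and> K \<subseteq> \<Omega>"
  have "set_integrable lebesgue \<Omega> u"
    using Lp_integral_bound(1)[OF finite_measure_set assms p_gt_1]
    by (simp add: integrable_lebesgue_on_iff set_integrable_def)
  then show "u absolutely_integrable_on K"
    by (rule set_integrable_subset) (use K in \<open>auto simp: lmeasurable_compact fmeasurableD\<close>)
qed

lemma Lp_limit_of_integrals:
  fixes u :: "nat \<Rightarrow> real ^ 'n \<Rightarrow> 'b::euclidean_space" and g :: "real ^ 'n \<Rightarrow> real"
  assumes u: "\<And>k. u k \<in> Lp M p" "w \<in> Lp M p" and lim: "(\<lambda>k. pnorm M p (\<lambda>x. u k x - w x)) \<longlonglongrightarrow> 0"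
    and g: "test_fun \<Omega> g"
  shows "(\<lambda>k. LINT x|M. g x *\<^sub>R u k x) \<longlonglongrightarrow> (LINT x|M. g x *\<^sub>R w x)"
proof -
  obtain B where B: "0 < B" "\<And>x. norm (g x) \<le> B" using test_fun_bounded[OF g] by metis
  have int: "integrable M (\<lambda>x. g x *\<^sub>R h x)" if "h \<in> Lp M p" for h :: "real ^ 'n \<Rightarrow> 'b"
    by (rule loc_integrable_mult[OF Lp_loc_integrable[OF that] _ g]) simp
  define c where "c = measure M (space M) powr ((p - 1) / p)"
  have "norm ((LINT x|M. g x *\<^sub>R u k x) - (LINT x|M. g x *\<^sub>R w x)) \<le> (B * c) * pnorm M p (\<lambda>x. u k x - w x)" for k
  proof -
    have d: "(\<lambda>x. u k x - w x) \<in> Lp M p" using u by (intro Lp_diff) auto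
    have "(LINT x|M. g x *\<^sub>R u k x) - (LINT x|M. g x *\<^sub>R w x) = (LINT x|M. g x *\<^sub>R (u k x - w x))"
      using int[OF u(1)] int[OF u(2)] by (simp add: scaleR_diff_right)
    then have "norm ((LINT x|M. g x *\<^sub>R u k x) - (LINT x|M. g x *\<^sub>R w x)) \<le> (LINT x|M. norm (g x *\<^sub>R (u k x - w x)))"
      by (simp only: integral_norm_bound)
    also have "\<dots> \<le> (LINT x|M. B * norm (u k x - w x))"
    proof (rule integral_mono)
      show "integrable M (\<lambda>x. norm (g x *\<^sub>R (u k x - w x)))" by (rule integrable_norm[OF int[OF d]])
      show "integrable M (\<lambda>x. B * norm (u k x - w x))"
        by (intro integrable_mult_right integrable_norm Lp_integral_bound(1)[OF finite_measure_set d p_gt_1])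
      show "norm (g x *\<^sub>R (u k x - w x)) \<le> B * norm (u k x - w x)" for x
        using mult_right_mono[OF B(2)[of x] norm_ge_zero] by simp
    qed
    also have "\<dots> \<le> B * (c * pnorm M p (\<lambda>x. u k x - w x))"
      using Lp_integral_bound(2)[OF finite_measure_set d p_gt_1] B(1) by (simp add: c_def)
    finally show ?thesis by simp
  qed
  then have "(\<lambda>k. (LINT x|M. g x *\<^sub>R u k x) - (LINT x|M. g x *\<^sub>R w x)) \<longlonglongrightarrow> 0"
  proof (rule Lim_null_comparison[OF always_eventually[OF allI]])
    show "(\<lambda>k. (B * c) * pnorm M p (\<lambda>x. u k x - w x)) \<longlonglongrightarrow> 0"
      using tendsto_mult_left[OF lim, of "B * c"] by simp
  qed
  then show ?thesis by (simp add: LIM_zero_iff)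
qed

lemma wgrad_Lp_AE_eq:
  fixes u :: "real ^ 'n \<Rightarrow> real ^ 'm::finite"
  assumes "has_weak_grad \<Omega> u V" "V \<in> Lp M p"
  shows "wgrad \<Omega> u \<in> Lp M p" "AE x in M. wgrad \<Omega> u x = V x"
proof -
  show ae: "AE x in M. wgrad \<Omega> u x = V x" using wgrad_AE_eq[OF open_set assms(1)] .
  have ae': "AE x in M. V x = wgrad \<Omega> u x" using ae by eventually_elim simp
  show "wgrad \<Omega> u \<in> Lp M p"
    using measurable_lebesgue_on_cong_AE[OF _ LpD(1)[OF assms(2)] ae'] by (intro Lp_cong_AE[OF assms(2) _ ae']) auto
qed

lemma W1p_iff: "u \<in> W1p \<Omega> p \<longleftrightarrow> u \<in> Lp M p \<and> has_weak_grad \<Omega> u (wgrad \<Omega> u) \<and> wgrad \<Omega> u \<in> Lp M p"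
  unfolding W1p_def Lp_space_eq using wgrad_Lp_AE_eq has_weak_grad_wgrad by blast

lemma W1pD:
  assumes "u \<in> W1p \<Omega> p"
  shows "u \<in> Lp M p" "has_weak_grad \<Omega> u (wgrad \<Omega> u)" "wgrad \<Omega> u \<in> Lp M p"
  using assms by (auto simp: W1p_iff)

lemma W1pI: "u \<in> Lp M p \<Longrightarrow> has_weak_grad \<Omega> u V \<Longrightarrow> V \<in> Lp M p \<Longrightarrow> u \<in> W1p \<Omega> p"
  by (auto simp: W1p_def Lp_space_eq)

lemma W01pD: "u \<in> W01p \<Omega> p \<Longrightarrow> u \<in> W1p \<Omega> p"
  by (simp add: W01p_def)

lemmas W01p_simps = W1pD[OF W01pD]

lemma W1p_add:
  assumes "u \<in> W1p \<Omega> p" "w \<in> W1p \<Omega> p"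
  shows "(\<lambda>x. u x + w x) \<in> W1p \<Omega> p" "AE x in M. wgrad \<Omega> (\<lambda>x. u x + w x) x = wgrad \<Omega> u x + wgrad \<Omega> w x"
proof -
  note 1 = W1pD[OF assms(1)] and 2 = W1pD[OF assms(2)]
  note 3 = has_weak_grad_add[OF open_set 1(2) 2(2)] Lp_add[OF 1(3) 2(3) p_facts(1)]
  show "(\<lambda>x. u x + w x) \<in> W1p \<Omega> p" by (rule W1pI[OF Lp_add[OF 1(1) 2(1) p_facts(1)] 3])
  show "AE x in M. wgrad \<Omega> (\<lambda>x. u x + w x) x = wgrad \<Omega> u x + wgrad \<Omega> w x"
    by (rule wgrad_Lp_AE_eq(2)[OF 3])
qed

lemma W1p_scaleR:
  assumes "u \<in> W1p \<Omega> p"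
  shows "(\<lambda>x. c *\<^sub>R u x) \<in> W1p \<Omega> p" "AE x in M. wgrad \<Omega> (\<lambda>x. c *\<^sub>R u x) x = c *\<^sub>R wgrad \<Omega> u x"
proof -
  note 1 = W1pD[OF assms(1)]
  note 3 = has_weak_grad_scaleR[OF 1(2), of c] Lp_scaleR[OF 1(3), of c]
  show "(\<lambda>x. c *\<^sub>R u x) \<in> W1p \<Omega> p" by (rule W1pI[OF Lp_scaleR[OF 1(1)] 3])
  show "AE x in M. wgrad \<Omega> (\<lambda>x. c *\<^sub>R u x) x = c *\<^sub>R wgrad \<Omega> u x"
    by (rule wgrad_Lp_AE_eq(2)[OF 3])
qed

lemma W1p_diff:
  assumes "u \<in> W1p \<Omega> p" "w \<in> W1p \<Omega> p"
  shows "(\<lambda>x. u x - w x) \<in> W1p \<Omega> p" "AE x in M. wgrad \<Omega> (\<lambda>x. u x - w x) x = wgrad \<Omega> u x - wgrad \<Omega> w x"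
proof -
  have eq: "(\<lambda>x. u x - w x) = (\<lambda>x. u x + (-1) *\<^sub>R w x)" by auto
  note 1 = W1p_scaleR[OF assms(2), of "-1"]
  show "(\<lambda>x. u x - w x) \<in> W1p \<Omega> p" unfolding eq by (rule W1p_add[OF assms(1) 1(1)])
  show "AE x in M. wgrad \<Omega> (\<lambda>x. u x - w x) x = wgrad \<Omega> u x - wgrad \<Omega> w x"
    unfolding eq using W1p_add(2)[OF assms(1) 1(1)] 1(2) by eventually_elim simp
qed

lemma pint_wgrad_diff:
  assumes "u \<in> W1p \<Omega> p" "w \<in> W1p \<Omega> p"
  shows "pint M p (wgrad \<Omega> (\<lambda>x. u x - w x)) = pint M p (\<lambda>x. wgrad \<Omega> u x - wgrad \<Omega> w x)"
  by (rule pint_cong_AE[OF LpD(1)[OF W1pD(3)[OF W1p_diff(1)[OF assms]]]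
      borel_measurable_diff[OF LpD(1)[OF W1pD(3)[OF assms(1)]] LpD(1)[OF W1pD(3)[OF assms(2)]]] W1p_diff(2)[OF assms]])

lemma energy_eq: "energy \<Omega> p u = pint M p (wgrad \<Omega> u)"
  by (simp add: energy_def pint_def)

lemma energy_nonneg [simp]: "0 \<le> energy \<Omega> p u"
  by (simp add: energy_eq)

lemma energy_scaleR:
  assumes "u \<in> W1p \<Omega> p"
  shows "energy \<Omega> p (\<lambda>x. c *\<^sub>R u x) = \<bar>c\<bar> powr p * energy \<Omega> p u"
proof -
  have "energy \<Omega> p (\<lambda>x. c *\<^sub>R u x) = pint M p (\<lambda>x. c *\<^sub>R wgrad \<Omega> u x)"
    unfolding energy_eq using W1p_scaleR[OF assms, of c] W1pD[OF assms] W1pD[OF W1p_scaleR(1)[OF assms]]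
    by (intro pint_cong_AE) auto
  then show ?thesis by (simp add: pint_scaleR energy_eq)
qed

lemma W1p_norm_tendsto_0_iff:
  "((\<lambda>k. W1p_norm \<Omega> p (f k)) \<longlongrightarrow> 0) F \<longleftrightarrow>
    ((\<lambda>k. pnorm M p (f k)) \<longlongrightarrow> 0) F \<and> ((\<lambda>k. pnorm M p (wgrad \<Omega> (f k))) \<longlongrightarrow> 0) F"
proof -
  define S where "S k = pint M p (f k) + pint M p (wgrad \<Omega> (f k))" for k
  have S0: "0 \<le> S k" for k by (simp add: S_def)
  have W: "W1p_norm \<Omega> p (f k) = S k powr (1/p)" for k by (simp add: W1p_norm_def S_def pint_def)
  have "((\<lambda>k. W1p_norm \<Omega> p (f k)) \<longlongrightarrow> 0) F \<longleftrightarrow> (S \<longlongrightarrow> 0) F"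
  proof
    assume "((\<lambda>k. W1p_norm \<Omega> p (f k)) \<longlongrightarrow> 0) F"
    then have "((\<lambda>k. W1p_norm \<Omega> p (f k) powr p) \<longlongrightarrow> 0 powr p) F"
      by (intro tendsto_powr') (auto simp: W)
    then show "(S \<longlongrightarrow> 0) F" using S0 by (simp add: W powr_powr)
  next
    assume "(S \<longlongrightarrow> 0) F"
    then have "((\<lambda>k. S k powr (1/p)) \<longlongrightarrow> 0 powr (1/p)) F"
      by (intro tendsto_powr') (auto simp: S0)
    then show "((\<lambda>k. W1p_norm \<Omega> p (f k)) \<longlongrightarrow> 0) F" by (simp add: W)
  qed
  also have "\<dots> \<longleftrightarrow> ((\<lambda>k. pint M p (f k)) \<longlongrightarrow> 0) F \<and> ((\<lambda>k. pint M p (wgrad \<Omega> (f k))) \<longlongrightarrow> 0) F"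
  proof
    assume S: "(S \<longlongrightarrow> 0) F"
    show "((\<lambda>k. pint M p (f k)) \<longlongrightarrow> 0) F \<and> ((\<lambda>k. pint M p (wgrad \<Omega> (f k))) \<longlongrightarrow> 0) F"
      using Lim_null_comparison[OF always_eventually S, of "\<lambda>k. pint M p (f k)"]
        Lim_null_comparison[OF always_eventually S, of "\<lambda>k. pint M p (wgrad \<Omega> (f k))"] by (simp add: S_def)
  next
    assume "((\<lambda>k. pint M p (f k)) \<longlongrightarrow> 0) F \<and> ((\<lambda>k. pint M p (wgrad \<Omega> (f k))) \<longlongrightarrow> 0) F"
    then show "(S \<longlongrightarrow> 0) F" unfolding S_def using tendsto_add[of "\<lambda>k. pint M p (f k)" 0 F] by auto
  qed
  finally show ?thesis by (simp add: tendsto_pnorm_0_iff)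
qed

lemma test_fun_props:
  fixes \<phi> :: "real ^ 'n \<Rightarrow> real ^ 'm::finite"
  assumes "test_fun \<Omega> \<phi>"
  shows "\<phi> \<in> Lp lborel p" "grad_matrix \<phi> \<in> Lp lborel p" "\<phi> \<in> Lp M p" "grad_matrix \<phi> \<in> Lp M p" "has_weak_grad \<Omega> \<phi> (grad_matrix \<phi>)"
    "pnorm M p \<phi> = pnorm lborel p \<phi>" "pnorm M p (grad_matrix \<phi>) = pnorm lborel p (grad_matrix \<phi>)"
    "\<phi> \<in> W1p \<Omega> p" "AE x in M. wgrad \<Omega> \<phi> x = grad_matrix \<phi> x" "\<phi> \<in> W01p \<Omega> p"
proof -
  obtain K where K: "compact K" "K \<subseteq> \<Omega>" "\<And>x. x \<notin> K \<Longrightarrow> \<phi> x = 0" "\<And>x h. x \<notin> K \<Longrightarrow> frechet_derivative \<phi> (at x) h = 0"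
    using assms by (metis test_funE)
  have K5: "grad_matrix \<phi> x = 0" if "x \<notin> K" for x using K(4)[OF that] by (simp add: grad_matrix_def vec_eq_iff)
  have c: "continuous_on UNIV \<phi>" "continuous_on UNIV (grad_matrix \<phi>)"
    using assms by (auto intro: test_fun_continuous continuous_grad_matrix test_fun_smooth)
  have b: "\<phi> \<in> borel_measurable borel" "grad_matrix \<phi> \<in> borel_measurable borel"
    using c by (auto intro: borel_measurable_continuous_onI)
  show L: "\<phi> \<in> Lp lborel p" "grad_matrix \<phi> \<in> Lp lborel p"
    using continuous_compact_support_Lp[OF c(1) K(1,3)] continuous_compact_support_Lp[OF c(2) K(1) K5] by auto
  have z: "x \<notin> \<Omega> \<Longrightarrow> \<phi> x = 0" "x \<notin> \<Omega> \<Longrightarrow> grad_matrix \<phi> x = 0" for x using K(2,3) K5 by auto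
  show L2: "\<phi> \<in> Lp M p" "grad_matrix \<phi> \<in> Lp M p"
    using L Lp_lebesgue_on_iff_lborel(1)[OF set_lebesgue b(1) z(1), of p] Lp_lebesgue_on_iff_lborel(1)[OF set_lebesgue b(2) z(2), of p] by auto
  show "pnorm M p \<phi> = pnorm lborel p \<phi>" "pnorm M p (grad_matrix \<phi>) = pnorm lborel p (grad_matrix \<phi>)"
    using Lp_lebesgue_on_iff_lborel(3)[OF set_lebesgue b(1) z(1), of p] Lp_lebesgue_on_iff_lborel(3)[OF set_lebesgue b(2) z(2), of p] by auto
  show g: "has_weak_grad \<Omega> \<phi> (grad_matrix \<phi>)" using assms by (intro has_weak_grad_grad_matrix open_set test_fun_smooth)
  show W: "\<phi> \<in> W1p \<Omega> p" using L2 g by (intro W1pI)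
  show "AE x in M. wgrad \<Omega> \<phi> x = grad_matrix \<phi> x" by (rule wgrad_Lp_AE_eq(2)[OF g L2(2)])
  have z0: "W1p_norm \<Omega> p (\<lambda>x. \<phi> x - \<phi> x) = 0"
  proof -
    have "pint M p (wgrad \<Omega> (\<lambda>x. \<phi> x - \<phi> x)) = pint M p (\<lambda>x. wgrad \<Omega> \<phi> x - wgrad \<Omega> \<phi> x)"
      by (rule pint_wgrad_diff[OF W W])
    then show ?thesis by (simp add: W1p_norm_def pint_def)
  qed
  show "\<phi> \<in> W01p \<Omega> p"
    unfolding W01p_def using W assms z0 by (auto intro!: exI[of _ "\<lambda>_. \<phi>"])
qed

text \<open>
  For test functions the unspecified representative \<open>wgrad\<close> can be replaced by the classical gradient,
  which is defined everywhere and is continuous.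
\<close>

lemma W01p_iff_approx:
  fixes u :: "real ^ 'n \<Rightarrow> real ^ 'm::finite"
  shows "u \<in> W01p \<Omega> p \<longleftrightarrow> u \<in> W1p \<Omega> p \<and> (\<exists>\<phi>. (\<forall>k::nat. test_fun \<Omega> (\<phi> k)) \<and>
    (\<lambda>k. pnorm M p (\<lambda>x. \<phi> k x - u x)) \<longlonglongrightarrow> 0 \<and> (\<lambda>k. pnorm M p (\<lambda>x. grad_matrix (\<phi> k) x - wgrad \<Omega> u x)) \<longlonglongrightarrow> 0)"
proof (cases "u \<in> W1p \<Omega> p")
  case u: True
  have "(\<lambda>k. W1p_norm \<Omega> p (\<lambda>x. u x - \<phi> k x)) \<longlonglongrightarrow> 0 \<longleftrightarrow>
      (\<lambda>k. pnorm M p (\<lambda>x. \<phi> k x - u x)) \<longlonglongrightarrow> 0 \<and> (\<lambda>k. pnorm M p (\<lambda>x. grad_matrix (\<phi> k) x - wgrad \<Omega> u x)) \<longlonglongrightarrow> 0"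
    if \<phi>: "\<And>k::nat. test_fun \<Omega> (\<phi> k)" for \<phi>
  proof -
    have "pnorm M p (wgrad \<Omega> (\<lambda>x. u x - \<phi> k x)) = pnorm M p (\<lambda>x. grad_matrix (\<phi> k) x - wgrad \<Omega> u x)" for k
    proof -
      note t = test_fun_props[OF \<phi>[of k]]
      have "pint M p (wgrad \<Omega> (\<lambda>x. u x - \<phi> k x)) = pint M p (\<lambda>x. wgrad \<Omega> u x - grad_matrix (\<phi> k) x)"
      proof (rule pint_cong_AE)
        show "AE x in M. wgrad \<Omega> (\<lambda>x. u x - \<phi> k x) x = wgrad \<Omega> u x - grad_matrix (\<phi> k) x"
          using W1p_diff(2)[OF u t(8)] t(9) by eventually_elim simp
      qed (rule LpD(1)[OF W1pD(3)[OF W1p_diff(1)[OF u t(8)]]],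
        rule borel_measurable_diff[OF LpD(1)[OF W1pD(3)[OF u]] LpD(1)[OF t(4)]])
      then show ?thesis by (simp add: pnorm_def pint_commute_diff[of M p "wgrad \<Omega> u"])
    qed
    moreover have "pnorm M p (\<lambda>x. u x - \<phi> k x) = pnorm M p (\<lambda>x. \<phi> k x - u x)" for k by (rule pnorm_commute_diff)
    ultimately show ?thesis by (simp add: W1p_norm_tendsto_0_iff)
  qed
  then show ?thesis using u unfolding W01p_def by blast
qed (simp add: W01p_def)

lemma W01p_approxE:
  fixes u :: "real ^ 'n \<Rightarrow> real ^ 'm::finite"
  assumes "u \<in> W01p \<Omega> p" "0 < e"
  obtains \<phi> where "test_fun \<Omega> \<phi>" "pnorm M p (\<lambda>x. \<phi> x - u x) < e" "pnorm M p (\<lambda>x. grad_matrix \<phi> x - wgrad \<Omega> u x) < e"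
proof -
  obtain \<phi> where \<phi>: "\<And>k::nat. test_fun \<Omega> (\<phi> k)"
    "(\<lambda>k. pnorm M p (\<lambda>x. \<phi> k x - u x)) \<longlonglongrightarrow> 0" "(\<lambda>k. pnorm M p (\<lambda>x. grad_matrix (\<phi> k) x - wgrad \<Omega> u x)) \<longlonglongrightarrow> 0"
    using assms(1) unfolding W01p_iff_approx by (elim conjE exE) (rule that, simp_all)
  have "\<forall>\<^sub>F k in sequentially. pnorm M p (\<lambda>x. \<phi> k x - u x) < e \<and> pnorm M p (\<lambda>x. grad_matrix (\<phi> k) x - wgrad \<Omega> u x) < e"
    using order_tendstoD(2)[OF \<phi>(2) assms(2)] order_tendstoD(2)[OF \<phi>(3) assms(2)] by eventually_elim simp
  then obtain k where "pnorm M p (\<lambda>x. \<phi> k x - u x) < e \<and> pnorm M p (\<lambda>x. grad_matrix (\<phi> k) x - wgrad \<Omega> u x) < e"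
    by (auto dest: eventually_happens)
  then show ?thesis using that[OF \<phi>(1)[of k]] by simp
qed

text \<open>
  The defining identity of the weak gradient passes to limits in \<open>L\<^sup>p\<close> because a test function and
  its derivatives are bounded and \<open>\<Omega>\<close> has finite measure.
\<close>

lemma W01p_closed:
  fixes u :: "nat \<Rightarrow> real ^ 'n \<Rightarrow> real ^ 'm::finite"
  assumes u: "\<And>k. u k \<in> W01p \<Omega> p" and w: "w \<in> Lp M p" "V \<in> Lp M p"
    and lim: "(\<lambda>k. pnorm M p (\<lambda>x. u k x - w x)) \<longlonglongrightarrow> 0" "(\<lambda>k. pnorm M p (\<lambda>x. wgrad \<Omega> (u k) x - V x)) \<longlonglongrightarrow> 0"
  shows "w \<in> W01p \<Omega> p" "AE x in M. wgrad \<Omega> w x = V x" "(\<lambda>k. W1p_norm \<Omega> p (\<lambda>x. u k x - w x)) \<longlonglongrightarrow> 0"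
proof -
  have col: "norm (column j A) \<le> norm A" for j and A :: "real^'n^'m"
  proof -
    have "column j A = A *v axis j 1" by (simp add: matrix_vector_mult_basis)
    then show ?thesis using norm_matrix_vector_mult_le[of A "axis j 1"] by simp
  qed
  have colm: "(\<lambda>x. column j (W x)) \<in> Lp M p" if "W \<in> Lp M p" for j and W :: "real^'n \<Rightarrow> real^'n^'m"
  proof (rule Lp_bound[OF _ LpD(2)[OF that]])
    have "continuous_on UNIV (\<lambda>A::real^'n^'m. column j A)"
      unfolding column_def by (intro continuous_intros)
    then show "(\<lambda>x. column j (W x)) \<in> borel_measurable M"
      using LpD(1)[OF that] borel_measurable_continuous_onI measurable_compose by blast
    show "AE x in M. norm (column j (W x)) powr p \<le> norm (W x) powr p"
      using col by (intro AE_I2 powr_mono2) auto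
  qed
  note uD = W01p_simps[OF u]
  have "has_weak_grad \<Omega> w V"
    unfolding has_weak_grad_def has_weak_deriv_def
  proof (intro allI conjI impI)
    show "loc_integrable \<Omega> w" using w by (intro Lp_loc_integrable)
    show "loc_integrable \<Omega> (\<lambda>x. column j (V x))" for j using w by (intro Lp_loc_integrable colm)
    fix j and \<phi> :: "real ^ 'n \<Rightarrow> real" assume \<phi>: "test_fun \<Omega> \<phi>"
    have 1: "(\<lambda>k. LINT x|M. frechet_derivative \<phi> (at x) (axis j 1) *\<^sub>R u k x) \<longlonglongrightarrow> (LINT x|M. frechet_derivative \<phi> (at x) (axis j 1) *\<^sub>R w x)"
      by (rule Lp_limit_of_integrals[OF uD(1) w(1) lim(1) test_fun_derivative[OF \<phi>]])
    have 2: "(\<lambda>k. LINT x|M. \<phi> x *\<^sub>R column j (wgrad \<Omega> (u k) x)) \<longlonglongrightarrow> (LINT x|M. \<phi> x *\<^sub>R column j (V x))"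
    proof (rule Lp_limit_of_integrals[OF colm[OF uD(3)] colm[OF w(2)] _ \<phi>])
      have "pnorm M p (\<lambda>x. column j (wgrad \<Omega> (u k) x) - column j (V x)) \<le> pnorm M p (\<lambda>x. wgrad \<Omega> (u k) x - V x)" for k
      proof -
        have L: "(\<lambda>x. wgrad \<Omega> (u k) x - V x) \<in> Lp M p" "(\<lambda>x. column j (wgrad \<Omega> (u k) x) - column j (V x)) \<in> Lp M p"
          using uD(3) w(2) colm by (auto intro: Lp_diff)
        have e: "column j A - column j B = column j (A - B)" for A B :: "real^'n^'m" by (simp add: column_def vec_eq_iff)
        have "pint M p (\<lambda>x. column j (wgrad \<Omega> (u k) x) - column j (V x)) \<le> pint M p (\<lambda>x. wgrad \<Omega> (u k) x - V x)"
          unfolding pint_def using LpD(2)[OF L(1)] LpD(2)[OF L(2)] col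
          by (intro integral_mono) (auto simp: e intro: powr_mono2)
        then show ?thesis unfolding pnorm_def by (intro powr_mono2) auto
      qed
      then show "(\<lambda>k. pnorm M p (\<lambda>x. column j (wgrad \<Omega> (u k) x) - column j (V x))) \<longlonglongrightarrow> 0"
        using lim(2) by (intro Lim_null_comparison[OF always_eventually lim(2)]) auto
    qed
    have "(LINT x|M. frechet_derivative \<phi> (at x) (axis j 1) *\<^sub>R u k x) = - (LINT x|M. \<phi> x *\<^sub>R column j (wgrad \<Omega> (u k) x))" for k
      using uD(2)[of k] has_weak_derivD(3)[OF _ \<phi>] unfolding has_weak_grad_def by blast
    then have "(\<lambda>k. - (LINT x|M. \<phi> x *\<^sub>R column j (wgrad \<Omega> (u k) x))) \<longlonglongrightarrow> (LINT x|M. frechet_derivative \<phi> (at x) (axis j 1) *\<^sub>R w x)"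
      using 1 by simp
    from LIMSEQ_unique[OF this tendsto_minus[OF 2]]
    show "(LINT x|M. frechet_derivative \<phi> (at x) (axis j 1) *\<^sub>R w x) = - (LINT x|M. \<phi> x *\<^sub>R column j (V x))" .
  qed
  note V = this
  have W: "w \<in> W1p \<Omega> p" using w V by (intro W1pI)
  show ae: "AE x in M. wgrad \<Omega> w x = V x" by (rule wgrad_Lp_AE_eq(2)[OF V w(2)])
  have lim2: "(\<lambda>k. pnorm M p (\<lambda>x. wgrad \<Omega> (u k) x - wgrad \<Omega> w x)) \<longlonglongrightarrow> 0"
  proof -
    have "pnorm M p (\<lambda>x. wgrad \<Omega> (u k) x - wgrad \<Omega> w x) = pnorm M p (\<lambda>x. wgrad \<Omega> (u k) x - V x)" for k
    proof -
      have "pint M p (\<lambda>x. wgrad \<Omega> (u k) x - wgrad \<Omega> w x) = pint M p (\<lambda>x. wgrad \<Omega> (u k) x - V x)"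
      proof (rule pint_cong_AE)
        show "AE x in M. wgrad \<Omega> (u k) x - wgrad \<Omega> w x = wgrad \<Omega> (u k) x - V x"
          using ae by eventually_elim simp
      qed (intro borel_measurable_diff LpD(1)[OF uD(3)] LpD(1)[OF W1pD(3)[OF W]] LpD(1)[OF w(2)])+
      then show ?thesis by (simp add: pnorm_def)
    qed
    then show ?thesis using lim(2) by simp
  qed
  have "pnorm M p (wgrad \<Omega> (\<lambda>x. u k x - w x)) = pnorm M p (\<lambda>x. wgrad \<Omega> (u k) x - wgrad \<Omega> w x)" for k
    unfolding pnorm_def using pint_wgrad_diff[OF W01pD[OF u] W] by simp
  then show "(\<lambda>k. W1p_norm \<Omega> p (\<lambda>x. u k x - w x)) \<longlonglongrightarrow> 0"
    using lim(1) lim2 by (simp add: W1p_norm_tendsto_0_iff)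
  have "\<forall>k. \<exists>\<phi>. test_fun \<Omega> \<phi> \<and> pnorm M p (\<lambda>x. \<phi> x - u k x) < 1 / real (Suc k) \<and> pnorm M p (\<lambda>x. grad_matrix \<phi> x - wgrad \<Omega> (u k) x) < 1 / real (Suc k)"
  proof
    fix k
    show "\<exists>\<phi>. test_fun \<Omega> \<phi> \<and> pnorm M p (\<lambda>x. \<phi> x - u k x) < 1 / real (Suc k) \<and> pnorm M p (\<lambda>x. grad_matrix \<phi> x - wgrad \<Omega> (u k) x) < 1 / real (Suc k)"
      by (rule W01p_approxE[OF u[of k], of "1 / real (Suc k)"]) auto
  qed
  from choice[OF this] obtain \<phi> where "\<forall>k. test_fun \<Omega> (\<phi> k) \<and> pnorm M p (\<lambda>x. \<phi> k x - u k x) < 1 / real (Suc k) \<and>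
    pnorm M p (\<lambda>x. grad_matrix (\<phi> k) x - wgrad \<Omega> (u k) x) < 1 / real (Suc k)" ..
  then have \<phi>: "test_fun \<Omega> (\<phi> k)" "pnorm M p (\<lambda>x. \<phi> k x - u k x) < 1 / real (Suc k)"
     "pnorm M p (\<lambda>x. grad_matrix (\<phi> k) x - wgrad \<Omega> (u k) x) < 1 / real (Suc k)" for k
    by (simp_all del: of_nat_Suc)
  have n0: "(\<lambda>k. 1 / real (Suc k)) \<longlonglongrightarrow> 0" using LIMSEQ_Suc[OF lim_1_over_n] by simp
  have "(\<lambda>k. pnorm M p (\<lambda>x. \<phi> k x - w x)) \<longlonglongrightarrow> 0"
  proof (rule Lim_null_comparison[OF always_eventually])
    show "\<forall>k. norm (pnorm M p (\<lambda>x. \<phi> k x - w x)) \<le> 1 / real (Suc k) + pnorm M p (\<lambda>x. u k x - w x)"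
    proof
      fix k
      show "norm (pnorm M p (\<lambda>x. \<phi> k x - w x)) \<le> 1 / real (Suc k) + pnorm M p (\<lambda>x. u k x - w x)"
        using pnorm_triangle3[OF test_fun_props(3)[OF \<phi>(1)[of k]] uD(1)[of k] w(1)] \<phi>(2)[of k] by simp
    qed
    show "(\<lambda>k. 1 / real (Suc k) + pnorm M p (\<lambda>x. u k x - w x)) \<longlonglongrightarrow> 0"
      using tendsto_add[OF n0 lim(1)] by simp
  qed
  moreover have "(\<lambda>k. pnorm M p (\<lambda>x. grad_matrix (\<phi> k) x - wgrad \<Omega> w x)) \<longlonglongrightarrow> 0"
  proof (rule Lim_null_comparison[OF always_eventually])
    show "\<forall>k. norm (pnorm M p (\<lambda>x. grad_matrix (\<phi> k) x - wgrad \<Omega> w x)) \<le> 1 / real (Suc k) + pnorm M p (\<lambda>x. wgrad \<Omega> (u k) x - wgrad \<Omega> w x)"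
    proof
      fix k
      show "norm (pnorm M p (\<lambda>x. grad_matrix (\<phi> k) x - wgrad \<Omega> w x)) \<le> 1 / real (Suc k) + pnorm M p (\<lambda>x. wgrad \<Omega> (u k) x - wgrad \<Omega> w x)"
        using pnorm_triangle3[OF test_fun_props(4)[OF \<phi>(1)[of k]] uD(3)[of k] W1pD(3)[OF W]] \<phi>(3)[of k] by simp
    qed
    show "(\<lambda>k. 1 / real (Suc k) + pnorm M p (\<lambda>x. wgrad \<Omega> (u k) x - wgrad \<Omega> w x)) \<longlonglongrightarrow> 0"
      using tendsto_add[OF n0 lim2] by simp
  qed
  ultimately show "w \<in> W01p \<Omega> p" using W \<phi>(1) by (subst W01p_iff_approx) blast
qed

lemma W01p_lincomb:
  fixes u w :: "real ^ 'n \<Rightarrow> real ^ 'm::finite"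
  assumes u: "u \<in> W01p \<Omega> p" and w: "w \<in> W01p \<Omega> p"
  shows "(\<lambda>x. a *\<^sub>R u x + b *\<^sub>R w x) \<in> W01p \<Omega> p"
    "AE x in M. wgrad \<Omega> (\<lambda>x. a *\<^sub>R u x + b *\<^sub>R w x) x = a *\<^sub>R wgrad \<Omega> u x + b *\<^sub>R wgrad \<Omega> w x"
proof -
  obtain \<phi> where \<phi>: "\<And>k::nat. test_fun \<Omega> (\<phi> k)"
    "(\<lambda>k. pnorm M p (\<lambda>x. \<phi> k x - u x)) \<longlonglongrightarrow> 0" "(\<lambda>k. pnorm M p (\<lambda>x. grad_matrix (\<phi> k) x - wgrad \<Omega> u x)) \<longlonglongrightarrow> 0"
    using u unfolding W01p_iff_approx by (elim conjE exE) (rule that, simp_all)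
  obtain \<psi> where \<psi>: "\<And>k::nat. test_fun \<Omega> (\<psi> k)"
    "(\<lambda>k. pnorm M p (\<lambda>x. \<psi> k x - w x)) \<longlonglongrightarrow> 0" "(\<lambda>k. pnorm M p (\<lambda>x. grad_matrix (\<psi> k) x - wgrad \<Omega> w x)) \<longlonglongrightarrow> 0"
    using w unfolding W01p_iff_approx by (elim conjE exE) (rule that, simp_all)
  note uD = W01p_simps[OF u] and wD = W01p_simps[OF w] and fD = test_fun_props[OF \<phi>(1)] and gD = test_fun_props[OF \<psi>(1)]
  define z where "z x = a *\<^sub>R u x + b *\<^sub>R w x" for x
  define zk where "zk k x = a *\<^sub>R \<phi> k x + b *\<^sub>R \<psi> k x" for k x
  have zk: "test_fun \<Omega> (zk k)" for k
    unfolding zk_def using \<phi>(1) \<psi>(1) by (intro test_fun_add test_fun_scaleR) auto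
  have comb: "(\<lambda>k. pnorm M p (\<lambda>x. (a *\<^sub>R f k x + b *\<^sub>R g k x) - (a *\<^sub>R f' x + b *\<^sub>R g' x))) \<longlonglongrightarrow> 0"
    if "\<And>k. f k \<in> Lp M p" "\<And>k. g k \<in> Lp M p" "f' \<in> Lp M p" "g' \<in> Lp M p"
      "(\<lambda>k. pnorm M p (\<lambda>x. f k x - f' x)) \<longlonglongrightarrow> 0" "(\<lambda>k. pnorm M p (\<lambda>x. g k x - g' x)) \<longlonglongrightarrow> 0"
    for f g :: "nat \<Rightarrow> real^'n \<Rightarrow> 'b::euclidean_space" and f' g'
  proof (rule Lim_null_comparison[OF always_eventually])
    show "\<forall>k. norm (pnorm M p (\<lambda>x. (a *\<^sub>R f k x + b *\<^sub>R g k x) - (a *\<^sub>R f' x + b *\<^sub>R g' x)))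
      \<le> \<bar>a\<bar> * pnorm M p (\<lambda>x. f k x - f' x) + \<bar>b\<bar> * pnorm M p (\<lambda>x. g k x - g' x)"
    proof
      fix k
      have e: "(a *\<^sub>R f k x + b *\<^sub>R g k x) - (a *\<^sub>R f' x + b *\<^sub>R g' x) = a *\<^sub>R (f k x - f' x) + b *\<^sub>R (g k x - g' x)" for x
        by (simp add: algebra_simps)
      have "pnorm M p (\<lambda>x. a *\<^sub>R (f k x - f' x) + b *\<^sub>R (g k x - g' x)) \<le> pnorm M p (\<lambda>x. a *\<^sub>R (f k x - f' x)) + pnorm M p (\<lambda>x. b *\<^sub>R (g k x - g' x))"
        using that(1-4) by (intro pnorm_add Lp_scaleR Lp_diff) auto
      then show "norm (pnorm M p (\<lambda>x. (a *\<^sub>R f k x + b *\<^sub>R g k x) - (a *\<^sub>R f' x + b *\<^sub>R g' x)))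
      \<le> \<bar>a\<bar> * pnorm M p (\<lambda>x. f k x - f' x) + \<bar>b\<bar> * pnorm M p (\<lambda>x. g k x - g' x)"
        by (simp add: e pnorm_scaleR)
    qed
    show "(\<lambda>k. \<bar>a\<bar> * pnorm M p (\<lambda>x. f k x - f' x) + \<bar>b\<bar> * pnorm M p (\<lambda>x. g k x - g' x)) \<longlonglongrightarrow> 0"
      using tendsto_add[OF tendsto_mult_left[OF that(5), of "\<bar>a\<bar>"] tendsto_mult_left[OF that(6), of "\<bar>b\<bar>"]] by simp
  qed
  have zL: "z \<in> Lp M p" "(\<lambda>x. a *\<^sub>R wgrad \<Omega> u x + b *\<^sub>R wgrad \<Omega> w x) \<in> Lp M p"
    unfolding z_def using uD wD by (auto intro!: Lp_add)
  have 1: "(\<lambda>k. pnorm M p (\<lambda>x. zk k x - z x)) \<longlonglongrightarrow> 0"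
    unfolding zk_def z_def using fD(3) gD(3) uD(1) wD(1) \<phi>(2) \<psi>(2) by (intro comb)
  have 2: "(\<lambda>k. pnorm M p (\<lambda>x. wgrad \<Omega> (zk k) x - (a *\<^sub>R wgrad \<Omega> u x + b *\<^sub>R wgrad \<Omega> w x))) \<longlonglongrightarrow> 0"
  proof -
    have j: "grad_matrix (zk k) x = a *\<^sub>R grad_matrix (\<phi> k) x + b *\<^sub>R grad_matrix (\<psi> k) x" for k x
    proof -
      have "(zk k has_derivative (\<lambda>h. a *\<^sub>R frechet_derivative (\<phi> k) (at x) h + b *\<^sub>R frechet_derivative (\<psi> k) (at x) h)) (at x)"
        unfolding zk_def[abs_def] by (intro has_derivative_add has_derivative_scaleR_right smooth_fun_has_derivative test_fun_smooth[OF \<phi>(1)] test_fun_smooth[OF \<psi>(1)])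
      from frechet_derivative_at[OF this, symmetric] show ?thesis by (simp add: grad_matrix_def vec_eq_iff)
    qed
    have "pnorm M p (\<lambda>x. wgrad \<Omega> (zk k) x - (a *\<^sub>R wgrad \<Omega> u x + b *\<^sub>R wgrad \<Omega> w x))
      = pnorm M p (\<lambda>x. (a *\<^sub>R grad_matrix (\<phi> k) x + b *\<^sub>R grad_matrix (\<psi> k) x) - (a *\<^sub>R wgrad \<Omega> u x + b *\<^sub>R wgrad \<Omega> w x))" for k
    proof -
      note t = test_fun_props[OF zk[of k]]
      have "pint M p (\<lambda>x. wgrad \<Omega> (zk k) x - (a *\<^sub>R wgrad \<Omega> u x + b *\<^sub>R wgrad \<Omega> w x))
        = pint M p (\<lambda>x. grad_matrix (zk k) x - (a *\<^sub>R wgrad \<Omega> u x + b *\<^sub>R wgrad \<Omega> w x))"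
      proof (rule pint_cong_AE)
        show "AE x in M. wgrad \<Omega> (zk k) x - (a *\<^sub>R wgrad \<Omega> u x + b *\<^sub>R wgrad \<Omega> w x) = grad_matrix (zk k) x - (a *\<^sub>R wgrad \<Omega> u x + b *\<^sub>R wgrad \<Omega> w x)"
          using t(9) by eventually_elim simp
      qed (use LpD(1)[OF W1pD(3)[OF t(8)]] LpD(1)[OF t(4)] LpD(1)[OF zL(2)] in auto)
      then show ?thesis by (simp add: pnorm_def j)
    qed
    moreover have "(\<lambda>k. pnorm M p (\<lambda>x. (a *\<^sub>R grad_matrix (\<phi> k) x + b *\<^sub>R grad_matrix (\<psi> k) x) - (a *\<^sub>R wgrad \<Omega> u x + b *\<^sub>R wgrad \<Omega> w x))) \<longlonglongrightarrow> 0"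
      using fD(4) gD(4) uD(3) wD(3) \<phi>(3) \<psi>(3) by (intro comb)
    ultimately show ?thesis by simp
  qed
  from W01p_closed[OF test_fun_props(10)[OF zk] zL 1 2]
  show "(\<lambda>x. a *\<^sub>R u x + b *\<^sub>R w x) \<in> W01p \<Omega> p"
    "AE x in M. wgrad \<Omega> (\<lambda>x. a *\<^sub>R u x + b *\<^sub>R w x) x = a *\<^sub>R wgrad \<Omega> u x + b *\<^sub>R wgrad \<Omega> w x"
    unfolding z_def by auto
qed

end


section \<open>Poincare's inequality, Rellich compactness and convexity of the energy\<close>

text \<open>Jensen's inequality for the power \<open>p\<close>, with values in a Euclidean space.\<close>

lemma average_powr_le:
  fixes f :: "'a \<Rightarrow> 'b::euclidean_space"
  assumes N: "finite_measure N" "0 < measure N (space N)" and f: "f \<in> Lp N p" and p: "1 < p"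
  shows "norm ((1 / measure N (space N)) *\<^sub>R (\<integral>x. f x \<partial>N)) powr p \<le> (1 / measure N (space N)) * pint N p f"
proof -
  define m where "m = measure N (space N)"
  have m: "m > 0" using N by (simp add: m_def)
  have "norm (\<integral>x. f x \<partial>N) \<le> m powr ((p - 1) / p) * pnorm N p f"
    using order_trans[OF integral_norm_bound Lp_integral_bound(2)[OF N(1) f p]] by (simp add: m_def)
  then have "norm (\<integral>x. f x \<partial>N) powr p \<le> (m powr ((p - 1) / p) * pnorm N p f) powr p"
    using p by (intro powr_mono2) auto
  also have "\<dots> = m powr (p - 1) * pint N p f"
    using p by (simp add: powr_mult powr_powr pnorm_powr)
  finally have "norm (\<integral>x. f x \<partial>N) powr p / m powr p \<le> m powr (p - 1) * pint N p f / m powr p"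
    by (intro divide_right_mono) auto
  also have "\<dots> = (1 / m) * pint N p f"
    using m by (simp add: powr_diff field_simps)
  finally show ?thesis using m by (simp add: m_def[symmetric] powr_divide)
qed

context bounded_open_set
begin

text \<open>
  The translation by \<open>z\<close> is composed of \<open>k\<close> translations by \<open>z / k\<close>. By the triangle inequality its
  effect is at most \<open>k\<close> times the effect of one of them, and this is a difference quotient, which
  tends to the derivative in direction \<open>z\<close>.
\<close>

lemma translation_estimate:
  fixes \<phi> :: "real ^ 'n \<Rightarrow> real ^ 'm::finite"
  assumes \<phi>: "test_fun \<Omega> \<phi>"
  shows "pnorm lborel p (\<lambda>x. \<phi> (x + z) - \<phi> x) \<le> norm z * pnorm lborel p (grad_matrix \<phi>)"
proof -
  note t = test_fun_props[OF \<phi>]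
  have L: "(\<lambda>x. \<phi> (x + y) - \<phi> x) \<in> Lp lborel p" for y
    using t(1) Lp_translate(1) by (intro Lp_diff) auto
  obtain B R where B: "\<And>k x. norm (diff_quot \<phi> z k x) \<le> B" "\<And>k x. R < norm x \<Longrightarrow> diff_quot \<phi> z k x = 0"
    "0 < B" "0 < R"
    "\<And>x. (\<lambda>k. diff_quot \<phi> z k x) \<longlonglongrightarrow> frechet_derivative \<phi> (at x) z" "\<And>k. diff_quot \<phi> z k \<in> borel_measurable borel"
    "\<And>x. norm (frechet_derivative \<phi> (at x) z) \<le> B" "\<And>x. R < norm x \<Longrightarrow> frechet_derivative \<phi> (at x) z = 0"
    "\<And>x. norm (\<phi> x) \<le> B" "\<And>x. R < norm x \<Longrightarrow> \<phi> x = 0"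
    by (rule difference_quotient_limits[OF \<phi>, of z]) (rule that)
  define D where "D x = frechet_derivative \<phi> (at x) z" for x
  have DL: "D \<in> Lp lborel p" "pnorm lborel p D \<le> norm z * pnorm lborel p (grad_matrix \<phi>)"
  proof -
    have Dm: "D \<in> borel_measurable lborel"
      unfolding D_def using test_fun_continuous[OF test_fun_derivative[OF \<phi>]] by (simp add: borel_measurable_continuous_onI)
    have pt: "norm (D x) powr p \<le> norm z powr p * norm (grad_matrix \<phi> x) powr p" for x
    proof -
      have "norm (D x) \<le> norm z * norm (grad_matrix \<phi> x)"
        using norm_matrix_vector_mult_le[of "grad_matrix \<phi> x" z] grad_matrix_mult[OF test_fun_smooth[OF \<phi>], of x z] by (simp add: D_def mult.commute)
      then have "norm (D x) powr p \<le> (norm z * norm (grad_matrix \<phi> x)) powr p" by (intro powr_mono2) auto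
      then show ?thesis by (simp add: powr_mult)
    qed
    have i: "integrable lborel (\<lambda>x. norm z powr p * norm (grad_matrix \<phi> x) powr p)" using LpD(2)[OF t(2)] by simp
    show DL: "D \<in> Lp lborel p" using pt by (intro Lp_bound[OF Dm i]) auto
    have "pint lborel p D \<le> norm z powr p * pint lborel p (grad_matrix \<phi>)"
      unfolding pint_def using integral_mono[OF LpD(2)[OF DL] i pt] by simp
    also have "\<dots> = (norm z * pnorm lborel p (grad_matrix \<phi>)) powr p"
      by (simp add: powr_mult pnorm_powr)
    finally show "pnorm lborel p D \<le> norm z * pnorm lborel p (grad_matrix \<phi>)" by (intro pnorm_le) auto
  qed
  have step: "pnorm lborel p (\<lambda>x. \<phi> (x + (real i * h) *\<^sub>R z) - \<phi> x) \<le> real i * pnorm lborel p (\<lambda>x. \<phi> (x + h *\<^sub>R z) - \<phi> x)" for h i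
  proof (induction i)
    case 0 then show ?case by (simp add: pnorm_def pint_def)
  next
    case (Suc i)
    define y where "y = (real i * h) *\<^sub>R z"
    have e: "\<phi> (x + (real (Suc i) * h) *\<^sub>R z) - \<phi> x = (\<phi> ((x + y) + h *\<^sub>R z) - \<phi> (x + y)) + (\<phi> (x + y) - \<phi> x)" for x
      by (simp add: y_def algebra_simps)
    have "pnorm lborel p (\<lambda>x. \<phi> (x + (real (Suc i) * h) *\<^sub>R z) - \<phi> x)
       \<le> pnorm lborel p (\<lambda>x. \<phi> ((x + y) + h *\<^sub>R z) - \<phi> (x + y)) + pnorm lborel p (\<lambda>x. \<phi> (x + y) - \<phi> x)"
      unfolding e using Lp_translate(1)[OF L[of "h *\<^sub>R z"], of y] L[of y] by (intro pnorm_add) auto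
    also have "pnorm lborel p (\<lambda>x. \<phi> ((x + y) + h *\<^sub>R z) - \<phi> (x + y)) = pnorm lborel p (\<lambda>x. \<phi> (x + h *\<^sub>R z) - \<phi> x)"
      using Lp_translate(3)[OF L[of "h *\<^sub>R z"], of y] by simp
    finally show ?case using Suc by (simp add: y_def algebra_simps)
  qed
  have le: "pnorm lborel p (\<lambda>x. \<phi> (x + z) - \<phi> x) \<le> pnorm lborel p (diff_quot \<phi> z k)" for k
  proof -
    have "pnorm lborel p (diff_quot \<phi> z k) = real (Suc k) * pnorm lborel p (\<lambda>x. \<phi> (x + (1 / real (Suc k)) *\<^sub>R z) - \<phi> x)"
      unfolding diff_quot_def[abs_def] using pnorm_scaleR[of p lborel "real (Suc k)"] by (simp del: of_nat_Suc)
    then show ?thesis using step[of "Suc k" "1 / real (Suc k)"] by (simp del: of_nat_Suc)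
  qed
  have w: "integrable lborel (\<lambda>x. (2 * B) powr p * indicator (cball (0::real^'n) R) x)"
    using emeasure_lborel_cball_finite[of "0::real^'n" R] by (intro integrable_mult_right integrable_real_indicator) auto
  have qL: "diff_quot \<phi> z k \<in> Lp lborel p" for k
    using Lp_scaleR[OF L] unfolding diff_quot_def[abs_def] by blast
  have "(\<lambda>k. pnorm lborel p (\<lambda>x. diff_quot \<phi> z k x - D x)) \<longlonglongrightarrow> 0"
  proof (rule pnorm_tendsto_dominated[OF _ w])
    show "AE x in lborel. (\<lambda>k. diff_quot \<phi> z k x - D x) \<longlonglongrightarrow> 0"
      using B(5) by (intro AE_I2 LIM_zero) (simp add: D_def)
    have "norm (diff_quot \<phi> z k x - D x) \<le> 2 * B" for k x
      using norm_triangle_ineq4[of "diff_quot \<phi> z k x" "D x"] B(1)[of k x] B(7)[of x] by (simp add: D_def)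
    then show "AE x in lborel. norm (diff_quot \<phi> z k x - D x) powr p \<le> (2 * B) powr p * indicator (cball 0 R) x" for k
      using B(2,8) by (intro AE_I2) (auto simp: indicator_def D_def intro!: powr_mono2)
  qed (use LpD(1)[OF qL] LpD(1)[OF DL(1)] in auto)
  from tendsto_pnorm[OF qL DL(1) _ this]
  have "(\<lambda>k. pnorm lborel p (diff_quot \<phi> z k)) \<longlonglongrightarrow> pnorm lborel p D" by simp
  from LIMSEQ_le_const[OF this, of "pnorm lborel p (\<lambda>x. \<phi> (x + z) - \<phi> x)"] le DL(2)
  show ?thesis by fastforce
qed

text \<open>
  A translation that moves the domain off itself turns \<open>translation_estimate\<close> into Poincare's
  inequality.
\<close>

lemma poincare_test_fun:
  obtains C where "0 < C" "\<And>\<phi> :: real ^ 'n \<Rightarrow> real ^ 'm::finite. test_fun \<Omega> \<phi> \<Longrightarrow> pnorm M p \<phi> \<le> C * pnorm M p (grad_matrix \<phi>)"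
proof -
  obtain R where R: "0 < R" "\<And>x. x \<in> \<Omega> \<Longrightarrow> norm x \<le> R" using bounded_set by (auto simp: bounded_pos)
  obtain e :: "real^'n" where e: "e \<in> Basis" using nonempty_Basis by blast
  \<comment> \<open>Two points of \<open>\<Omega>\<close> have distance at most \<open>2 * R\<close>, less than the length of \<open>z\<close>.\<close>
  define z where "z = (2 * R + 1) *\<^sub>R e"
  have nz: "norm z = 2 * R + 1" using R e by (simp add: z_def)
  show ?thesis
  proof
    show "0 < 2 * R + 1" using R by simp
    fix \<phi> :: "real ^ 'n \<Rightarrow> real ^ 'm" assume \<phi>: "test_fun \<Omega> \<phi>"
    note t = test_fun_props[OF \<phi>]
    obtain K where K: "K \<subseteq> \<Omega>" "\<And>x. x \<notin> K \<Longrightarrow> \<phi> x = 0" using \<phi> by (metis test_funE)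
    have L: "(\<lambda>x. \<phi> (x + z) - \<phi> x) \<in> Lp lborel p"
      using t(1) Lp_translate(1) by (intro Lp_diff) auto
    have pt: "norm (\<phi> x) powr p \<le> norm (\<phi> (x + z) - \<phi> x) powr p" for x
    proof (cases "x \<in> \<Omega>")
      case True
      then have "norm (x + z) > R" using norm_diff_ineq[of z x] nz R(2)[OF True] by (simp add: add.commute)
      then have "\<phi> (x + z) = 0" using R(2) K by (meson not_le subsetD)
      then show ?thesis by simp
    next
      case False
      then have "\<phi> x = 0" using K by blast
      then show ?thesis by simp
    qed
    have "pint lborel p \<phi> \<le> pint lborel p (\<lambda>x. \<phi> (x + z) - \<phi> x)"
      unfolding pint_def by (intro integral_mono LpD(2)[OF L] LpD(2)[OF t(1)] pt)
    then have "pnorm lborel p \<phi> \<le> pnorm lborel p (\<lambda>x. \<phi> (x + z) - \<phi> x)"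
      unfolding pnorm_def by (intro powr_mono2) auto
    also have "\<dots> \<le> (2 * R + 1) * pnorm lborel p (grad_matrix \<phi>)"
      using translation_estimate[OF \<phi>, of z] by (simp add: nz)
    finally show "pnorm M p \<phi> \<le> (2 * R + 1) * pnorm M p (grad_matrix \<phi>)" by (simp add: t(6,7))
  qed
qed

lemma poincare:
  obtains C where "0 < C" "\<And>u :: real ^ 'n \<Rightarrow> real ^ 'm::finite. u \<in> W01p \<Omega> p \<Longrightarrow> pnorm M p u \<le> C * pnorm M p (wgrad \<Omega> u)"
proof -
  obtain C where C: "0 < C" "\<And>\<phi> :: real ^ 'n \<Rightarrow> real ^ 'm::finite. test_fun \<Omega> \<phi> \<Longrightarrow> pnorm M p \<phi> \<le> C * pnorm M p (grad_matrix \<phi>)"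
    using poincare_test_fun by blast
  show ?thesis
  proof (rule that[OF C(1)])
    fix u :: "real ^ 'n \<Rightarrow> real ^ 'm" assume u: "u \<in> W01p \<Omega> p"
    obtain \<phi> where \<phi>: "\<And>k::nat. test_fun \<Omega> (\<phi> k)"
      "(\<lambda>k. pnorm M p (\<lambda>x. \<phi> k x - u x)) \<longlonglongrightarrow> 0" "(\<lambda>k. pnorm M p (\<lambda>x. grad_matrix (\<phi> k) x - wgrad \<Omega> u x)) \<longlonglongrightarrow> 0"
      using u unfolding W01p_iff_approx by (elim conjE exE) (rule that, simp_all)
    note uD = W01p_simps[OF u] and t = test_fun_props[OF \<phi>(1)]
    have "(\<lambda>k. pnorm M p (\<phi> k)) \<longlonglongrightarrow> pnorm M p u" by (rule tendsto_pnorm[OF t(3) uD(1) _ \<phi>(2)]) simp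
    moreover have "(\<lambda>k. C * pnorm M p (grad_matrix (\<phi> k))) \<longlonglongrightarrow> C * pnorm M p (wgrad \<Omega> u)"
      by (intro tendsto_mult_left tendsto_pnorm[OF t(4) uD(3) _ \<phi>(3)]) simp
    ultimately show "pnorm M p u \<le> C * pnorm M p (wgrad \<Omega> u)"
      by (rule LIMSEQ_le) (use C(2)[OF \<phi>(1)] in auto)
  qed
qed

end

definition ball_measure :: "real \<Rightarrow> 'a::euclidean_space measure" where
  "ball_measure e = restrict_space lborel (cball 0 e)"

text \<open>
  The average of \<open>f\<close> over the ball of radius \<open>e\<close> around \<open>x\<close>, written as an integral over translates of
  \<open>f\<close>, so that it moves \<open>f\<close> no farther than these translations do.
\<close>

definition ball_average :: "real \<Rightarrow> ('a::euclidean_space \<Rightarrow> 'b::euclidean_space) \<Rightarrow> 'a \<Rightarrow> 'b" where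
  "ball_average e f x = (1 / measure lborel (cball (0::'a) e)) *\<^sub>R (\<integral>z. f (x + z) \<partial>ball_measure e)"

lemma ball_measure_props:
  assumes "0 < e"
  shows "finite_measure (ball_measure e :: 'a::euclidean_space measure)"
    "measure (ball_measure e) (space (ball_measure e :: 'a measure)) = measure lborel (cball (0::'a) e)"
    "0 < measure lborel (cball (0::'a) e)"
proof -
  have sp: "space (ball_measure e :: 'a measure) = cball 0 e" by (simp add: ball_measure_def space_restrict_space)
  have em: "emeasure (ball_measure e) (cball (0::'a) e) = emeasure lborel (cball (0::'a) e)"
    by (simp add: ball_measure_def emeasure_restrict_space)
  show "finite_measure (ball_measure e :: 'a measure)"
    using emeasure_lborel_cball_finite[of "0::'a" e] by (intro finite_measureI) (simp add: sp em)
  show "measure (ball_measure e) (space (ball_measure e :: 'a measure)) = measure lborel (cball (0::'a) e)"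
    by (simp add: sp measure_def em)
  show "0 < measure lborel (cball (0::'a) e)"
    using content_cball_pos[OF assms, of "0::'a"] by simp
qed

lemma Lp_ball_measure:
  fixes f :: "'a::euclidean_space \<Rightarrow> 'b::euclidean_space"
  assumes "f \<in> Lp lborel p"
  shows "f \<in> Lp (ball_measure e) p" "pint (ball_measure e) p f \<le> pint lborel p f"
    "pint (ball_measure e) p f = (\<integral>x. indicator (cball 0 e) x * norm (f x) powr p \<partial>lborel)"
proof -
  have i: "integrable lborel (\<lambda>x. indicator (cball 0 e) x * norm (f x) powr p)"
    using integrable_mult_indicator[OF _ LpD(2)[OF assms], of "cball 0 e"] by simp
  show "f \<in> Lp (ball_measure e) p"
    using LpD[OF assms] i by (intro LpI) (auto simp: ball_measure_def integrable_restrict_space intro: measurable_restrict_space1)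
  show eq: "pint (ball_measure e) p f = (\<integral>x. indicator (cball 0 e) x * norm (f x) powr p \<partial>lborel)"
    unfolding pint_def ball_measure_def by (subst integral_restrict_space) auto
  show "pint (ball_measure e) p f \<le> pint lborel p f"
    by (subst eq, subst pint_def, rule integral_mono[OF i LpD(2)[OF assms]]) (auto simp: indicator_def)
qed

lemma ball_average_bound:
  fixes f :: "'a::euclidean_space \<Rightarrow> 'b::euclidean_space"
  assumes f: "f \<in> Lp lborel p" and p: "1 < p" and e: "0 < e"
  shows "norm (ball_average e f x) \<le> (1 / measure lborel (cball (0::'a) e)) powr (1/p) * pnorm lborel p f"
proof -
  define V where "V = measure lborel (cball (0::'a) e)"
  note b = ball_measure_props[OF e, where 'a='a]
  have g: "(\<lambda>z. f (z + x)) \<in> Lp lborel p" by (rule Lp_translate(1)[OF f])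
  have "norm (ball_average e f x) powr p \<le> (1 / V) * pint (ball_measure e) p (\<lambda>z. f (z + x))"
    using average_powr_le[OF b(1) _ Lp_ball_measure(1)[OF g] p] b(2,3)
    by (simp add: ball_average_def V_def add.commute)
  also have "\<dots> \<le> (1 / V) * pint lborel p f"
    using Lp_ball_measure(2)[OF g, of e] Lp_translate(2)[OF f, of x] b(3) by (intro mult_left_mono) (auto simp: V_def)
  finally have "(norm (ball_average e f x) powr p) powr (1/p) \<le> ((1 / V) * pint lborel p f) powr (1/p)"
    using p by (intro powr_mono2) auto
  also have "\<dots> = (1 / V) powr (1/p) * pnorm lborel p f"
    by (simp only: powr_mult pnorm_def)
  finally show ?thesis using p by (simp add: powr_powr V_def)
qed

lemma ball_average_translate:
  fixes f :: "'a::euclidean_space \<Rightarrow> 'b::euclidean_space"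
  assumes f: "f \<in> Lp lborel p" and p: "1 < p" and e: "0 < e"
  shows "ball_average e f (x + h) - ball_average e f x = ball_average e (\<lambda>y. f (y + h) - f y) x"
proof -
  have i: "integrable (ball_measure e) (\<lambda>z. f (z + y))" for y
    by (rule Lp_integral_bound(1)[OF ball_measure_props(1)[OF e] Lp_ball_measure(1)[OF Lp_translate(1)[OF f]] p])
  have "(\<integral>z. f (z + (x + h)) - f (z + x) \<partial>ball_measure e) = (\<integral>z. f (z + (x + h)) \<partial>ball_measure e) - (\<integral>z. f (z + x) \<partial>ball_measure e)"
    by (rule Bochner_Integration.integral_diff[OF i i])
  moreover have "ball_average e f (x + h) = (1 / measure lborel (cball (0::'a) e)) *\<^sub>R (\<integral>z. f (z + (x + h)) \<partial>ball_measure e)"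
    "ball_average e f x = (1 / measure lborel (cball (0::'a) e)) *\<^sub>R (\<integral>z. f (z + x) \<partial>ball_measure e)"
    "ball_average e (\<lambda>y. f (y + h) - f y) x = (1 / measure lborel (cball (0::'a) e)) *\<^sub>R (\<integral>z. f (z + (x + h)) - f (z + x) \<partial>ball_measure e)"
    by (simp_all add: ball_average_def ac_simps)
  ultimately show ?thesis by (simp add: scaleR_diff_right)
qed

text \<open>
  By Jensen's inequality and Fubini's theorem, an average of translates of \<open>f\<close> is as close to \<open>f\<close> as
  each translate is. The average is taken over an abstract finite measure so that the lemma serves
  both balls in space and intervals of time.
\<close>

lemma average_close:
  fixes f :: "'a::euclidean_space \<Rightarrow> 'b::euclidean_space" and N :: "'c measure"
  defines "V \<equiv> measure N (space N)"
  assumes f: "f \<in> Lp lborel p" and p: "1 < p" and N: "finite_measure N" "0 < V"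
    and l [measurable]: "l \<in> N \<rightarrow>\<^sub>M borel"
    and d: "\<And>z. z \<in> space N \<Longrightarrow> pnorm lborel p (\<lambda>x. f (x + l z) - f x) \<le> \<delta>" and \<delta>: "0 \<le> \<delta>"
  shows "(\<lambda>x. (1 / V) *\<^sub>R (\<integral>z. f (x + l z) \<partial>N) - f x) \<in> Lp lborel p"
    "pnorm lborel p (\<lambda>x. (1 / V) *\<^sub>R (\<integral>z. f (x + l z) \<partial>N) - f x) \<le> \<delta>"
proof -
  interpret N: finite_measure N by (rule N)
  interpret P: pair_sigma_finite lborel N ..
  have p1: "1 \<le> p" using p by simp
  have fm [measurable]: "f \<in> borel_measurable borel" using LpD(1)[OF f] by simp
  define A where "A x = (1 / V) *\<^sub>R (\<integral>z. f (x + l z) \<partial>N)" for x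
  have Am [measurable]: "A \<in> borel_measurable borel"
    unfolding A_def by measurable
  have pt: "ennreal (norm (A x - f x) powr p) \<le> ennreal (1 / V) * (\<integral>\<^sup>+z. ennreal (norm (f (x + l z) - f x) powr p) \<partial>N)" for x
  proof (cases "(\<integral>\<^sup>+z. ennreal (norm (f (x + l z) - f x) powr p) \<partial>N) = \<infinity>")
    case True
    then show ?thesis using N(2) by (simp add: ennreal_mult_top)
  next
    case False
    then have int: "integrable N (\<lambda>z. norm (f (x + l z) - f x) powr p)"
      by (intro integrableI_nonneg) (auto simp: less_top)
    have L: "(\<lambda>z. f (x + l z) - f x) \<in> Lp N p" by (intro LpI int) measurable
    have i1: "integrable N (\<lambda>z. f (x + l z) - f x)" by (rule Lp_integral_bound(1)[OF N(1) L p])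
    have i2: "integrable N (\<lambda>z. f (x + l z))"
      using Bochner_Integration.integrable_add[OF i1 N.integrable_const[of "f x"]] by simp
    have "(\<integral>z. f (x + l z) - f x \<partial>N) = (\<integral>z. f (x + l z) \<partial>N) - V *\<^sub>R f x"
      using i2 by (simp add: V_def)
    then have e1: "A x - f x = (1 / V) *\<^sub>R (\<integral>z. f (x + l z) - f x \<partial>N)"
      using N(2) by (simp add: A_def scaleR_diff_right)
    have "norm (A x - f x) powr p \<le> (1 / V) * (\<integral>z. norm (f (x + l z) - f x) powr p \<partial>N)"
      using average_powr_le[OF N(1) _ L p] N(2) unfolding e1 V_def pint_def by simp
    moreover have "(\<integral>\<^sup>+z. ennreal (norm (f (x + l z) - f x) powr p) \<partial>N) = ennreal (\<integral>z. norm (f (x + l z) - f x) powr p \<partial>N)"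
      by (rule nn_integral_eq_integral[OF int]) auto
    ultimately show ?thesis
      using N(2) by (simp add: ennreal_mult[symmetric] Bochner_Integration.integral_nonneg ennreal_leI del: times_divide_eq_left)
  qed
  have jm [measurable]: "(\<lambda>(x, z). ennreal (norm (f (x + l z) - f x) powr p)) \<in> borel_measurable (lborel \<Otimes>\<^sub>M N)"
    by measurable
  have "(\<integral>\<^sup>+x. ennreal (norm (A x - f x) powr p) \<partial>lborel)
    \<le> (\<integral>\<^sup>+x. ennreal (1 / V) * (\<integral>\<^sup>+z. ennreal (norm (f (x + l z) - f x) powr p) \<partial>N) \<partial>lborel)"
    by (intro nn_integral_mono pt)
  also have "\<dots> = ennreal (1 / V) * (\<integral>\<^sup>+x. \<integral>\<^sup>+z. ennreal (norm (f (x + l z) - f x) powr p) \<partial>N \<partial>lborel)"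
    by (intro nn_integral_cmult) measurable
  also have "(\<integral>\<^sup>+x. \<integral>\<^sup>+z. ennreal (norm (f (x + l z) - f x) powr p) \<partial>N \<partial>lborel)
     = (\<integral>\<^sup>+z. \<integral>\<^sup>+x. ennreal (norm (f (x + l z) - f x) powr p) \<partial>lborel \<partial>N)"
    by (rule P.Fubini'[symmetric, OF jm])
  also have "\<dots> \<le> (\<integral>\<^sup>+z. ennreal (\<delta> powr p) \<partial>N)"
  proof (rule nn_integral_mono)
    fix z assume z: "z \<in> space N"
    have L: "(\<lambda>x. f (x + l z) - f x) \<in> Lp lborel p" by (intro Lp_diff Lp_translate(1) f p1)
    have "(\<integral>\<^sup>+x. ennreal (norm (f (x + l z) - f x) powr p) \<partial>lborel) = ennreal (pint lborel p (\<lambda>x. f (x + l z) - f x))"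
      unfolding pint_def by (rule nn_integral_eq_integral[OF LpD(2)[OF L]]) auto
    also have "\<dots> \<le> ennreal (\<delta> powr p)"
      using d[OF z] p by (intro ennreal_leI pint_le_pnorm_powr) auto
    finally show "(\<integral>\<^sup>+x. ennreal (norm (f (x + l z) - f x) powr p) \<partial>lborel) \<le> ennreal (\<delta> powr p)" .
  qed
  also have "\<dots> = ennreal (\<delta> powr p) * ennreal V"
    by (simp add: N.emeasure_eq_measure V_def)
  also have "ennreal (1 / V) * (ennreal (\<delta> powr p) * ennreal V) = ennreal (\<delta> powr p)"
    using N(2) by (simp add: ennreal_mult[symmetric])
  finally have nn: "(\<integral>\<^sup>+x. ennreal (norm (A x - f x) powr p) \<partial>lborel) \<le> ennreal (\<delta> powr p)"
    using N(2) by (simp add: mult_left_mono)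
  then have int: "integrable lborel (\<lambda>x. norm (A x - f x) powr p)"
    by (intro integrableI_nonneg) (auto simp: order_le_less_trans)
  then have "(\<lambda>x. A x - f x) \<in> Lp lborel p" by (intro LpI) measurable
  then show "(\<lambda>x. (1 / V) *\<^sub>R (\<integral>z. f (x + l z) \<partial>N) - f x) \<in> Lp lborel p" by (simp add: A_def)
  have "pint lborel p (\<lambda>x. A x - f x) \<le> \<delta> powr p"
    using nn unfolding pint_def by (subst (asm) nn_integral_eq_integral[OF int]) auto
  then have "pnorm lborel p (\<lambda>x. A x - f x) \<le> \<delta>" using p \<delta> by (intro pnorm_le) auto
  then show "pnorm lborel p (\<lambda>x. (1 / V) *\<^sub>R (\<integral>z. f (x + l z) \<partial>N) - f x) \<le> \<delta>" by (simp add: A_def)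
qed

context bounded_open_set
begin

text \<open>
  For a fixed radius the ball averages are bounded and equi-Lipschitz, so that a subsequence
  converges pointwise, and in \<open>L\<^sup>p\<close> by dominated convergence. The averages of radius \<open>e\<close> differ from
  the functions by at most \<open>e * C\<close>, uniformly along the sequence, by \<open>translation_estimate\<close>; with one
  subsequence for all radii \<open>1 / (j + 1)\<close> the functions themselves become a Cauchy sequence.
\<close>

lemma rellich_test_fun:
  fixes \<phi> :: "nat \<Rightarrow> real ^ 'n \<Rightarrow> real ^ 'm::finite"
  assumes \<phi>: "\<And>k. test_fun \<Omega> (\<phi> k)" and C: "\<And>k. pnorm M p (grad_matrix (\<phi> k)) \<le> C"
  obtains r where "strict_mono (r :: nat \<Rightarrow> nat)"
    "\<And>e. 0 < e \<Longrightarrow> \<exists>N. \<forall>i\<ge>N. \<forall>j\<ge>N. pnorm M p (\<lambda>x. \<phi> (r i) x - \<phi> (r j) x) < e"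
proof -
  note t = test_fun_props[OF \<phi>]
  have C0: "0 \<le> C" using order_trans[OF pnorm_nonneg C] .
  obtain C1 where C1: "0 < C1" "\<And>\<phi> :: real ^ 'n \<Rightarrow> real ^ 'm::finite. test_fun \<Omega> \<phi> \<Longrightarrow> pnorm M p \<phi> \<le> C1 * pnorm M p (grad_matrix \<phi>)"
    using poincare_test_fun by blast
  define K where "K = C1 * C"
  have nK: "pnorm lborel p (\<phi> k) \<le> K" for k
    using C1(2)[OF \<phi>[of k]] mult_left_mono[OF C[of k] less_imp_le[OF C1(1)]] by (simp add: t K_def)
  have nT: "pnorm lborel p (\<lambda>x. \<phi> k (x + z) - \<phi> k x) \<le> norm z * C" for k z
    using translation_estimate[OF \<phi>[of k], of z] mult_left_mono[OF C[of k], of "norm z"] by (simp add: t)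
  obtain R where R: "0 < R" "\<And>x. x \<in> \<Omega> \<Longrightarrow> norm x \<le> R" using bounded_set by (auto simp: bounded_pos)
  have supp: "\<phi> k x = 0" if "R < norm x" for k x
  proof -
    have "x \<notin> \<Omega>" using R(2)[of x] that by auto
    then show ?thesis using \<phi>[of k] by (metis test_funE subsetD)
  qed
  define e where "e j = 1 / real (Suc j)" for j
  have e: "0 < e j" "e j \<le> 1" for j by (auto simp: e_def)
  define c where "c j = (1 / measure lborel (cball (0::real^'n) (e j))) powr (1/p)" for j
  have c: "0 < c j" for j using ball_measure_props(3)[OF e(1)[of j], where 'a="real^'n"] by (simp add: c_def)
  define A where "A j k = ball_average (e j) (\<phi> k)" for j k
  have Ab: "norm (A j k x) \<le> c j * K" for j k x
    using order_trans[OF ball_average_bound[OF t(1) p_gt_1 e(1)] mult_left_mono[OF nK]] c[of j]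
    by (fastforce simp: A_def c_def)
  have AL: "norm (A j k (x + h) - A j k x) \<le> c j * (norm h * C)" for j k x h
  proof -
    have "(\<lambda>y. \<phi> k (y + h) - \<phi> k y) \<in> Lp lborel p" by (intro Lp_diff Lp_translate(1) t) simp
    from ball_average_bound[OF this p_gt_1 e(1), of j x]
    have "norm (A j k (x + h) - A j k x) \<le> c j * pnorm lborel p (\<lambda>y. \<phi> k (y + h) - \<phi> k y)"
      by (simp add: A_def c_def ball_average_translate[OF t(1) p_gt_1 e(1)])
    also have "\<dots> \<le> c j * (norm h * C)" using nT c[of j] by (intro mult_left_mono) auto
    finally show ?thesis .
  qed
  have AL': "norm (A j k y - A j k x) \<le> c j * C * norm (y - x)" for j k x y
    using AL[of j k x "y - x"] by (simp add: mult_ac)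
  have Ac: "continuous_on UNIV (A j k)" for j k
  proof (rule continuous_onI)
    fix x :: "real^'n" and \<epsilon> :: real assume "0 < \<epsilon>"
    define d where "d = \<epsilon> / (c j * C + 1)"
    have pos: "c j * C + 1 > 0" using c[of j] C0 by (simp add: add_nonneg_pos)
    show "\<exists>d>0. \<forall>y\<in>UNIV. dist y x < d \<longrightarrow> dist (A j k y) (A j k x) \<le> \<epsilon>"
    proof (intro exI[of _ d] conjI ballI impI)
      show "d > 0" using \<open>0 < \<epsilon>\<close> pos by (simp add: d_def)
      fix y assume "dist y x < d"
      then have "c j * C * norm (y - x) \<le> (c j * C + 1) * d"
        using c[of j] C0 pos by (intro mult_mono) (auto simp: dist_norm)
      also have "\<dots> = \<epsilon>" using pos by (simp add: d_def)
      finally show "dist (A j k y) (A j k x) \<le> \<epsilon>" using AL'[of j k y x] by (simp add: dist_norm)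
    qed
  qed
  then have Am: "A j k \<in> borel_measurable borel" for j k by (rule borel_measurable_continuous_onI)
  have close: "(\<lambda>x. A j k x - \<phi> k x) \<in> Lp lborel p" "pnorm lborel p (\<lambda>x. A j k x - \<phi> k x) \<le> e j * C" for j k
  proof -
    have "pnorm lborel p (\<lambda>x. \<phi> k (x + z) - \<phi> k x) \<le> e j * C" if "norm z \<le> e j" for z
      using order_trans[OF nT mult_right_mono[OF that C0]] .
    moreover have "z \<in> space (ball_measure (e j)) \<Longrightarrow> norm z \<le> e j" for z :: "real^'n"
      by (simp add: ball_measure_def space_restrict_space)
    ultimately have "pnorm lborel p (\<lambda>x. \<phi> k (x + z) - \<phi> k x) \<le> e j * C" if "z \<in> space (ball_measure (e j))" for z
      using that by blast
    moreover have "(\<lambda>z. z) \<in> (ball_measure (e j) :: (real^'n) measure) \<rightarrow>\<^sub>M borel"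
      unfolding ball_measure_def by (intro measurable_restrict_space1) simp
    ultimately have "(\<lambda>x. ball_average (e j) (\<phi> k) x - \<phi> k x) \<in> Lp lborel p"
      "pnorm lborel p (\<lambda>x. ball_average (e j) (\<phi> k) x - \<phi> k x) \<le> e j * C"
      using average_close[of "\<phi> k" p "ball_measure (e j)" "\<lambda>z. z" "e j * C"] t(1) p_gt_1
        ball_measure_props[OF e(1)[of j], where 'a="real^'n"] less_imp_le[OF e(1)[of j]] C0
      by (simp_all add: ball_average_def)
    then show "(\<lambda>x. A j k x - \<phi> k x) \<in> Lp lborel p" "pnorm lborel p (\<lambda>x. A j k x - \<phi> k x) \<le> e j * C"
      unfolding A_def by auto
  qed
  have Asupp: "A j k x = 0" if "R + 1 < norm x" for j k x
  proof -
    have "(\<integral>z. \<phi> k (x + z) \<partial>ball_measure (e j)) = (\<integral>z. 0 \<partial>(ball_measure (e j) :: (real^'n) measure))"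
    proof (rule Bochner_Integration.integral_cong[OF refl])
      fix z :: "real^'n" assume "z \<in> space (ball_measure (e j))"
      then have "norm z \<le> 1" using e(2)[of j] by (simp add: ball_measure_def space_restrict_space)
      then have "R < norm (x + z)" using norm_diff_ineq[of x z] that by linarith
      then show "\<phi> k (x + z) = 0" by (rule supp)
    qed
    then show ?thesis by (simp add: A_def ball_average_def)
  qed
  obtain D :: "(real^'n) set" where D: "countable D" "\<And>X. open X \<Longrightarrow> X \<noteq> {} \<Longrightarrow> \<exists>d\<in>D. d \<in> X"
    using countable_dense_setE by blast
  \<comment> \<open>The diagonal argument takes one bound for all pairs of a radius and a point, hence the
    factor \<open>1 / c j\<close>.\<close>
  obtain r where r: "strict_mono (r :: nat \<Rightarrow> nat)"
    "\<And>y. y \<in> UNIV \<times> D \<Longrightarrow> \<exists>l. (\<lambda>n. (1 / c (fst y)) *\<^sub>R A (fst y) (r n) (snd y)) \<longlonglongrightarrow> l"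
  proof (rule function_convergent_subsequence[of "UNIV \<times> D" "\<lambda>n y. (1 / c (fst y)) *\<^sub>R A (fst y) n (snd y)" K])
    show "countable ((UNIV :: nat set) \<times> D)" using D by auto
    show "norm ((1 / c (fst y)) *\<^sub>R A (fst y) n (snd y)) \<le> K" for n y
      using Ab[of "fst y" n "snd y"] c[of "fst y"] by (simp add: field_simps)
  qed (use that in auto)
  have conv_D: "\<exists>l. (\<lambda>n. A j (r n) d) \<longlonglongrightarrow> l" if d: "d \<in> D" for j d
  proof -
    obtain l where "(\<lambda>n. (1 / c j) *\<^sub>R A j (r n) d) \<longlonglongrightarrow> l" using r(2)[of "(j, d)"] d by auto
    from tendsto_scaleR[OF tendsto_const[of "c j"] this] have "(\<lambda>n. A j (r n) d) \<longlonglongrightarrow> c j *\<^sub>R l"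
      using c[of j] by simp
    then show ?thesis by blast
  qed
  have conv: "convergent (\<lambda>n. A j (r n) x)" for j x
  proof -
    have "Cauchy (\<lambda>n. A j (r n) x)"
    proof (rule metric_CauchyI)
      fix \<epsilon> :: real assume \<epsilon>: "0 < \<epsilon>"
      define \<delta> where "\<delta> = \<epsilon> / (4 * (c j * C + 1))"
      have pos: "c j * C + 1 > 0" using c[of j] C0 by (simp add: add_nonneg_pos)
      have \<delta>: "\<delta> > 0" using \<epsilon> pos by (simp add: \<delta>_def)
      obtain d where d: "d \<in> D" "dist x d < \<delta>"
        using D(2)[of "ball x \<delta>"] \<delta> by auto
      have near: "norm (A j k x - A j k d) \<le> \<epsilon> / 4" for k
      proof -
        have "norm (A j k x - A j k d) \<le> c j * C * norm (x - d)" by (rule AL')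
        also have "\<dots> \<le> (c j * C + 1) * \<delta>"
          using c[of j] C0 pos d(2) by (intro mult_mono) (auto simp: dist_norm)
        also have "\<dots> = \<epsilon> / 4"
        proof -
          have "\<delta> = (\<epsilon> / 4) / (c j * C + 1)" by (simp add: \<delta>_def)
          moreover have "q * (y / q) = y" if "0 < q" for q y :: real using that by simp
          ultimately show ?thesis using pos by (simp only:)
        qed
        finally show ?thesis .
      qed
      obtain l where "(\<lambda>n. A j (r n) d) \<longlonglongrightarrow> l" using conv_D[OF d(1)] by blast
      then have "Cauchy (\<lambda>n. A j (r n) d)" by (rule LIMSEQ_imp_Cauchy)
      then obtain N where N: "\<And>m n. m \<ge> N \<Longrightarrow> n \<ge> N \<Longrightarrow> dist (A j (r m) d) (A j (r n) d) < \<epsilon> / 4"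
        using \<epsilon> unfolding Cauchy_def by (meson divide_pos_pos zero_less_numeral)
      have "dist (A j (r m) x) (A j (r n) x) < \<epsilon>" if "m \<ge> N" "n \<ge> N" for m n
      proof -
        have "norm (A j (r m) x - A j (r n) x) \<le> norm (A j (r m) x - A j (r m) d) + norm (A j (r m) d - A j (r n) d) + norm (A j (r n) x - A j (r n) d)"
          by norm
        then show ?thesis using near[of "r m"] near[of "r n"] N[OF that] \<epsilon> by (simp add: dist_norm)
      qed
      then show "\<exists>N. \<forall>m\<ge>N. \<forall>n\<ge>N. dist (A j (r m) x) (A j (r n) x) < \<epsilon>" by blast
    qed
    then show ?thesis by (simp add: Cauchy_convergent_iff)
  qed
  define g where "g j x = lim (\<lambda>n. A j (r n) x)" for j x
  have lim: "(\<lambda>n. A j (r n) x) \<longlonglongrightarrow> g j x" for j x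
    using conv by (simp add: g_def convergent_LIMSEQ_iff)
  have gm: "g j \<in> borel_measurable lborel" for j
    using Am unfolding g_def by (intro borel_measurable_lim_metric) auto
  have gb: "norm (g j x) \<le> c j * K" for j x
    using Ab by (intro LIMSEQ_le_const2[OF tendsto_norm[OF lim]]) auto
  have gsupp: "g j x = 0" if "R + 1 < norm x" for j x
    using lim[of j x] Asupp[OF that] by (simp add: LIMSEQ_const_iff)
  have w: "integrable lborel (\<lambda>x. (2 * (c j * K)) powr p * indicator (cball (0::real^'n) (R + 1)) x)" for j
    using emeasure_lborel_cball_finite[of "0::real^'n" "R + 1"] by (intro integrable_mult_right integrable_real_indicator) auto
  have dom: "norm (A j k x - g j x) powr p \<le> (2 * (c j * K)) powr p * indicator (cball 0 (R + 1)) x" for j k x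
  proof (cases "R + 1 < norm x")
    case False
    have "norm (A j k x - g j x) \<le> 2 * (c j * K)"
      using norm_triangle_ineq4[of "A j k x" "g j x"] Ab[of j k x] gb[of j x] by linarith
    then show ?thesis using False by (auto intro: powr_mono2)
  qed (use Asupp gsupp in simp)
  have AgL: "(\<lambda>x. A j k x - g j x) \<in> Lp lborel p" for j k
    by (rule Lp_bound[OF borel_measurable_diff w[of j]]) (use Am gm dom in auto)
  have Ag: "(\<lambda>n. pnorm lborel p (\<lambda>x. A j (r n) x - g j x)) \<longlonglongrightarrow> 0" for j
    by (rule pnorm_tendsto_dominated[OF _ w[of j] AE_I2 AE_I2[OF dom]]) (use LpD(1)[OF AgL] lim in \<open>auto intro: LIM_zero\<close>)
  show ?thesis
  proof (rule that[OF r(1)])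
    fix \<epsilon> :: real assume \<epsilon>: "0 < \<epsilon>"
    have "(\<lambda>j. e j * C) \<longlonglongrightarrow> 0 * C"
      unfolding e_def using LIMSEQ_Suc[OF lim_1_over_n] by (intro tendsto_intros) auto
    then obtain j where j: "e j * C < \<epsilon> / 4"
    proof -
      have "\<forall>\<^sub>F j in sequentially. e j * C < \<epsilon> / 4"
        by (rule order_tendstoD(2)[OF \<open>(\<lambda>j. e j * C) \<longlonglongrightarrow> 0 * C\<close>]) (use \<epsilon> in simp)
      then show ?thesis using that by (auto dest: eventually_happens)
    qed
    obtain N where N: "\<And>n. n \<ge> N \<Longrightarrow> pnorm lborel p (\<lambda>x. A j (r n) x - g j x) < \<epsilon> / 4"
      using LIMSEQ_D[OF Ag[of j], of "\<epsilon> / 4"] \<epsilon> by auto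
    have near: "pnorm lborel p (\<lambda>x. \<phi> (r n) x - g j x) < \<epsilon> / 2" and nL: "(\<lambda>x. \<phi> (r n) x - g j x) \<in> Lp lborel p" if "n \<ge> N" for n
    proof -
      have eq: "\<phi> (r n) x - g j x = (\<phi> (r n) x - A j (r n) x) + (A j (r n) x - g j x)" for x by simp
      have L: "(\<lambda>x. \<phi> (r n) x - A j (r n) x) \<in> Lp lborel p" using Lp_uminus[OF close(1)[of j "r n"]] by simp
      have "pnorm lborel p (\<lambda>x. \<phi> (r n) x - g j x) \<le> pnorm lborel p (\<lambda>x. \<phi> (r n) x - A j (r n) x) + pnorm lborel p (\<lambda>x. A j (r n) x - g j x)"
        unfolding eq by (rule pnorm_add[OF L AgL]) simp
      then show "pnorm lborel p (\<lambda>x. \<phi> (r n) x - g j x) < \<epsilon> / 2"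
        using close(2)[of j "r n"] N[OF that] j pnorm_commute_diff[of lborel p "\<phi> (r n)" "A j (r n)"] by linarith
      show "(\<lambda>x. \<phi> (r n) x - g j x) \<in> Lp lborel p" unfolding eq by (rule Lp_add[OF L AgL]) simp
    qed
    have "pnorm M p (\<lambda>x. \<phi> (r i) x - \<phi> (r l) x) < \<epsilon>" if "i \<ge> N" "l \<ge> N" for i l
    proof -
      have eq: "\<phi> (r i) x - \<phi> (r l) x = (\<phi> (r i) x - g j x) - (\<phi> (r l) x - g j x)" for x by simp
      have "pnorm lborel p (\<lambda>x. \<phi> (r i) x - \<phi> (r l) x) \<le> pnorm lborel p (\<lambda>x. \<phi> (r i) x - g j x) + pnorm lborel p (\<lambda>x. - (\<phi> (r l) x - g j x))"
        unfolding eq using pnorm_add[OF nL[OF that(1)] Lp_uminus[OF nL[OF that(2)]]] by simp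
      also have "pnorm lborel p (\<lambda>x. - (\<phi> (r l) x - g j x)) = pnorm lborel p (\<lambda>x. \<phi> (r l) x - g j x)"
        by (simp add: pnorm_def pint_def norm_minus_commute)
      finally have "pnorm lborel p (\<lambda>x. \<phi> (r i) x - \<phi> (r l) x) < \<epsilon>" using near[OF that(1)] near[OF that(2)] by simp
      moreover have "pnorm M p (\<lambda>x. \<phi> (r i) x - \<phi> (r l) x) = pnorm lborel p (\<lambda>x. \<phi> (r i) x - \<phi> (r l) x)"
      proof (rule Lp_lebesgue_on_iff_lborel(3))
        show "(\<lambda>x. \<phi> (r i) x - \<phi> (r l) x) \<in> borel_measurable borel"
          using LpD(1)[OF t(1)] by (intro borel_measurable_diff) auto
        show "\<phi> (r i) x - \<phi> (r l) x = 0" if "x \<notin> \<Omega>" for x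
          using that \<phi>[of "r i"] \<phi>[of "r l"] by (metis test_funE subsetD diff_self)
      qed simp
      ultimately show ?thesis by simp
    qed
    then show "\<exists>N. \<forall>i\<ge>N. \<forall>j\<ge>N. pnorm M p (\<lambda>x. \<phi> (r i) x - \<phi> (r j) x) < \<epsilon>" by blast
  qed
qed

lemma rellich:
  fixes u :: "nat \<Rightarrow> real ^ 'n \<Rightarrow> real ^ 'm::finite"
  assumes u: "\<And>k. u k \<in> W01p \<Omega> p" and C: "\<And>k. pnorm M p (wgrad \<Omega> (u k)) \<le> C"
  obtains r w where "strict_mono (r :: nat \<Rightarrow> nat)" "w \<in> Lp M p" "(\<lambda>k. pnorm M p (\<lambda>x. u (r k) x - w x)) \<longlonglongrightarrow> 0"
proof -
  note uD = W01p_simps[OF u]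
  have "\<forall>k. \<exists>\<phi>. test_fun \<Omega> \<phi> \<and> pnorm M p (\<lambda>x. \<phi> x - u k x) < 1 / real (Suc k) \<and> pnorm M p (\<lambda>x. grad_matrix \<phi> x - wgrad \<Omega> (u k) x) < 1 / real (Suc k)"
  proof
    fix k
    show "\<exists>\<phi>. test_fun \<Omega> \<phi> \<and> pnorm M p (\<lambda>x. \<phi> x - u k x) < 1 / real (Suc k) \<and> pnorm M p (\<lambda>x. grad_matrix \<phi> x - wgrad \<Omega> (u k) x) < 1 / real (Suc k)"
      by (rule W01p_approxE[OF u[of k], of "1 / real (Suc k)"]) auto
  qed
  from choice[OF this] obtain \<phi> where "\<forall>k. test_fun \<Omega> (\<phi> k) \<and> pnorm M p (\<lambda>x. \<phi> k x - u k x) < 1 / real (Suc k) \<and>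
    pnorm M p (\<lambda>x. grad_matrix (\<phi> k) x - wgrad \<Omega> (u k) x) < 1 / real (Suc k)" ..
  then have \<phi>: "test_fun \<Omega> (\<phi> k)" "pnorm M p (\<lambda>x. \<phi> k x - u k x) < 1 / real (Suc k)"
     "pnorm M p (\<lambda>x. grad_matrix (\<phi> k) x - wgrad \<Omega> (u k) x) < 1 / real (Suc k)" for k
    by (simp_all del: of_nat_Suc)
  note t = test_fun_props[OF \<phi>(1)]
  have "pnorm M p (grad_matrix (\<phi> k)) \<le> C + 1" for k
  proof -
    have "1 / real (Suc k) \<le> 1" by simp
    moreover have "\<bar>pnorm M p (grad_matrix (\<phi> k)) - pnorm M p (wgrad \<Omega> (u k))\<bar> \<le> pnorm M p (\<lambda>x. grad_matrix (\<phi> k) x - wgrad \<Omega> (u k) x)"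
      by (rule pnorm_triangle_diff[OF t(4) uD(3)]) simp
    ultimately show ?thesis using \<phi>(3)[of k] C[of k] by linarith
  qed
  note bound = this
  obtain r where r: "strict_mono (r :: nat \<Rightarrow> nat)"
    "\<And>e. 0 < e \<Longrightarrow> \<exists>N. \<forall>i\<ge>N. \<forall>j\<ge>N. pnorm M p (\<lambda>x. \<phi> (r i) x - \<phi> (r j) x) < e"
  proof (rule rellich_test_fun[where \<phi> = \<phi>, OF \<phi>(1) bound])
    fix r :: "nat \<Rightarrow> nat"
    assume "strict_mono r" "\<And>e. 0 < e \<Longrightarrow> \<exists>N. \<forall>i\<ge>N. \<forall>j\<ge>N. pnorm M p (\<lambda>x. \<phi> (r i) x - \<phi> (r j) x) < e"
    then show thesis by (rule that)
  qed
  obtain w where w: "w \<in> Lp M p" "(\<lambda>k. pnorm M p (\<lambda>x. \<phi> (r k) x - w x)) \<longlonglongrightarrow> 0"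
    by (rule Lp_complete[of "\<lambda>k. \<phi> (r k)", OF t(3) p_facts(1) r(2)])
  have "(\<lambda>k. pnorm M p (\<lambda>x. u (r k) x - w x)) \<longlonglongrightarrow> 0"
  proof (rule Lim_null_comparison[OF always_eventually[OF allI]])
    fix k
    have "1 / real (Suc (r k)) \<le> 1 / real (Suc k)"
      using seq_suble[OF r(1), of k] by (intro divide_left_mono) auto
    then show "norm (pnorm M p (\<lambda>x. u (r k) x - w x)) \<le> 1 / real (Suc k) + pnorm M p (\<lambda>x. \<phi> (r k) x - w x)"
      using pnorm_triangle3[OF uD(1)[of "r k"] t(3)[of "r k"] w(1)] \<phi>(2)[of "r k"] pnorm_commute_diff[of M p "u (r k)" "\<phi> (r k)"] by simp
  next
    show "(\<lambda>k. 1 / real (Suc k) + pnorm M p (\<lambda>x. \<phi> (r k) x - w x)) \<longlonglongrightarrow> 0"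
      using tendsto_add[OF LIMSEQ_Suc[OF lim_1_over_n] w(2)] by simp
  qed
  then show ?thesis by (rule that[OF r(1) w(1)])
qed

text \<open>
  \<open>Lp_converges_if_midpoints_large\<close> for the gradients, together with the closedness of the space. The
  \<open>L\<^sup>p\<close> limit \<open>w\<close> of the functions, supplied by compactness or by construction, identifies the limit of
  the gradients as a weak gradient.
\<close>

lemma W01p_converges_if_midpoints_large:
  fixes u :: "nat \<Rightarrow> real ^ 'n \<Rightarrow> real ^ 'm::finite"
  assumes u: "\<And>k. u k \<in> W01p \<Omega> p" and w: "w \<in> Lp M p" "(\<lambda>k. pnorm M p (\<lambda>x. u k x - w x)) \<longlonglongrightarrow> 0"
    and lim: "(\<lambda>k. energy \<Omega> p (u k)) \<longlonglongrightarrow> c"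
    and mid: "\<And>e. 0 < e \<Longrightarrow> \<exists>N. \<forall>i\<ge>N. \<forall>j\<ge>N. c - e \<le> energy \<Omega> p (\<lambda>x. (1/2) *\<^sub>R u i x + (1/2) *\<^sub>R u j x)"
  shows "w \<in> W01p \<Omega> p" "energy \<Omega> p w = c" "(\<lambda>k. W1p_norm \<Omega> p (\<lambda>x. u k x - w x)) \<longlonglongrightarrow> 0"
proof -
  note uD = W01p_simps[OF u]
  have eq: "energy \<Omega> p (\<lambda>x. (1/2) *\<^sub>R u i x + (1/2) *\<^sub>R u j x) = pint M p (\<lambda>x. (1/2) *\<^sub>R (wgrad \<Omega> (u i) x + wgrad \<Omega> (u j) x))" for i j
    unfolding energy_eq
  proof (rule pint_cong_AE)
    note l = W01p_lincomb[OF u[of i] u[of j], of "1/2" "1/2"]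
    show "AE x in M. wgrad \<Omega> (\<lambda>x. (1/2) *\<^sub>R u i x + (1/2) *\<^sub>R u j x) x = (1/2) *\<^sub>R (wgrad \<Omega> (u i) x + wgrad \<Omega> (u j) x)"
      using l(2) by eventually_elim (simp add: scaleR_add_right)
    show "wgrad \<Omega> (\<lambda>x. (1/2) *\<^sub>R u i x + (1/2) *\<^sub>R u j x) \<in> borel_measurable M"
      by (rule LpD(1)[OF W01p_simps(3)[OF l(1)]])
    show "(\<lambda>x. (1/2) *\<^sub>R (wgrad \<Omega> (u i) x + wgrad \<Omega> (u j) x)) \<in> borel_measurable M"
      using LpD(1)[OF Lp_scaleR[OF Lp_add[OF uD(3)[of i] uD(3)[of j] p_facts(1)], of "1/2"]] .
  qed
  obtain V where V: "V \<in> Lp M p" "(\<lambda>k. pnorm M p (\<lambda>x. wgrad \<Omega> (u k) x - V x)) \<longlonglongrightarrow> 0" "pint M p V = c"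
    by (rule Lp_converges_if_midpoints_large[OF uD(3) p_gt_1 lim[unfolded energy_eq] mid[unfolded eq]])
  note cl = W01p_closed[OF u w(1) V(1) w(2) V(2)]
  show "w \<in> W01p \<Omega> p" "(\<lambda>k. W1p_norm \<Omega> p (\<lambda>x. u k x - w x)) \<longlonglongrightarrow> 0" by (rule cl)+
  show "energy \<Omega> p w = c"
    unfolding energy_eq using V(3) pint_cong_AE[OF LpD(1)[OF W01p_simps(3)[OF cl(1)]] LpD(1)[OF V(1)] cl(2)] by simp
qed

text \<open>
  Minimizing the energy over the convex sets \<open>H n\<close> of all Sobolev functions close to \<open>u\<close>
  does the work of weak compactness and Mazur's lemma: the infima \<open>c n\<close> increase to a limit, and the
  midpoint of two late almost minimizers lies in \<open>H n\<close> again, so that its energy is not much smaller.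
\<close>

lemma energy_lower_semicontinuous:
  fixes u :: "real ^ 'n \<Rightarrow> real ^ 'm::finite"
  assumes u: "u \<in> Lp M p"
    and near: "\<And>\<delta>. 0 < \<delta> \<Longrightarrow> \<exists>w\<in>W01p \<Omega> p. pnorm M p (\<lambda>x. w x - u x) \<le> \<delta> \<and> energy \<Omega> p w \<le> C"
  shows "u \<in> W01p \<Omega> p" "energy \<Omega> p u \<le> C"
proof -
  define H where "H n = {w \<in> W01p \<Omega> p. pnorm M p (\<lambda>x. w x - u x) \<le> 1 / real (Suc n)}" for n
  define c where "c n = Inf (energy \<Omega> p ` H n)" for n
  have bdd: "bdd_below (energy \<Omega> p ` A)" for A :: "(real ^ 'n \<Rightarrow> real ^ 'm) set" by (rule bdd_belowI[of _ 0]) auto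
  have ne: "\<exists>w\<in>H n. energy \<Omega> p w \<le> C" for n using near[of "1 / real (Suc n)"] by (auto simp: H_def)
  have H_dec: "H n \<subseteq> H m" if "m \<le> n" for m n
  proof -
    have "1 / real (Suc n) \<le> 1 / real (Suc m)" using that by (intro divide_left_mono) auto
    then show ?thesis by (auto simp: H_def)
  qed
  have c_le: "c n \<le> energy \<Omega> p w" if "w \<in> H n" for n w
    unfolding c_def using that bdd by (intro cInf_lower) auto
  have c_inc: "incseq c"
    unfolding incseq_def c_def using H_dec ne bdd by (intro allI impI cInf_superset_mono image_mono) blast+
  have cC: "c n \<le> C" for n using ne[of n] c_le by force
  obtain L where L: "c \<longlonglongrightarrow> L" "\<And>n. c n \<le> L"
    using incseq_convergent[OF c_inc] cC by blast
  have LC: "L \<le> C" by (rule LIMSEQ_le_const2[OF L(1)]) (use cC in auto)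
  have "\<forall>n. \<exists>w. w \<in> H n \<and> energy \<Omega> p w < c n + 1 / real (Suc n)"
  proof
    fix n
    have "Inf (energy \<Omega> p ` H n) < c n + 1 / real (Suc n)" by (simp add: c_def)
    from cInf_lessD[OF _ this] show "\<exists>w. w \<in> H n \<and> energy \<Omega> p w < c n + 1 / real (Suc n)"
      using ne[of n] by blast
  qed
  from choice[OF this] obtain w where "\<forall>n. w n \<in> H n \<and> energy \<Omega> p (w n) < c n + 1 / real (Suc n)" ..
  then have wn: "w n \<in> H n" "energy \<Omega> p (w n) < c n + 1 / real (Suc n)" for n by blast+
  have wW: "w n \<in> W01p \<Omega> p" "pnorm M p (\<lambda>x. w n x - u x) \<le> 1 / real (Suc n)" for n using wn(1)[of n] unfolding H_def by blast+
  have n0: "(\<lambda>k. 1 / real (Suc k)) \<longlonglongrightarrow> 0" using LIMSEQ_Suc[OF lim_1_over_n] by simp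
  have lim: "(\<lambda>n. energy \<Omega> p (w n)) \<longlonglongrightarrow> L"
  proof (rule tendsto_sandwich[OF _ _ L(1)])
    show "(\<lambda>n. c n + 1 / real (Suc n)) \<longlonglongrightarrow> L" using tendsto_add[OF L(1) n0] by simp
  qed (use wn c_le in \<open>auto intro!: always_eventually less_imp_le\<close>)
  have wu: "(\<lambda>n. pnorm M p (\<lambda>x. w n x - u x)) \<longlonglongrightarrow> 0"
    by (rule Lim_null_comparison[OF always_eventually n0]) (use wW(2) in auto)
  have mid: "\<exists>N. \<forall>i\<ge>N. \<forall>j\<ge>N. L - e \<le> energy \<Omega> p (\<lambda>x. (1/2) *\<^sub>R w i x + (1/2) *\<^sub>R w j x)" if e: "0 < e" for e
  proof -
    obtain N where N: "L - e < c N"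
    proof -
      have "\<forall>\<^sub>F n in sequentially. L - e < c n" by (rule order_tendstoD(1)[OF L(1)]) (use e in simp)
      then show ?thesis using that by (auto dest: eventually_happens)
    qed
    have "L - e \<le> energy \<Omega> p (\<lambda>x. (1/2) *\<^sub>R w i x + (1/2) *\<^sub>R w j x)" if ij: "i \<ge> N" "j \<ge> N" for i j
    proof -
      have "w i \<in> H N" "w j \<in> H N" using H_dec[OF ij(1)] H_dec[OF ij(2)] wn(1) by blast+
      then have h: "w i \<in> W01p \<Omega> p" "pnorm M p (\<lambda>x. w i x - u x) \<le> 1 / real (Suc N)" "w j \<in> W01p \<Omega> p" "pnorm M p (\<lambda>x. w j x - u x) \<le> 1 / real (Suc N)"
        by (auto simp: H_def)
      have eq: "((1/2) *\<^sub>R w i x + (1/2) *\<^sub>R w j x) - u x = (1/2) *\<^sub>R (w i x - u x) + (1/2) *\<^sub>R (w j x - u x)" for x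
      proof -
        have "u x = (1/2) *\<^sub>R u x + (1/2) *\<^sub>R u x" by (simp flip: scaleR_add_left)
        then show ?thesis by (simp add: algebra_simps)
      qed
      have "pnorm M p (\<lambda>x. ((1/2) *\<^sub>R w i x + (1/2) *\<^sub>R w j x) - u x) \<le> pnorm M p (\<lambda>x. (1/2) *\<^sub>R (w i x - u x)) + pnorm M p (\<lambda>x. (1/2) *\<^sub>R (w j x - u x))"
        unfolding eq by (intro pnorm_add Lp_scaleR Lp_diff W01p_simps(1) h u) simp_all
      also have "\<dots> \<le> 1 / real (Suc N)" using h(2,4) by (simp add: pnorm_scaleR)
      finally have "(\<lambda>x. (1/2) *\<^sub>R w i x + (1/2) *\<^sub>R w j x) \<in> H N"
        using W01p_lincomb(1)[OF h(1,3)] by (simp add: H_def)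
      then show ?thesis using c_le N by fastforce
    qed
    then show ?thesis by blast
  qed
  from W01p_converges_if_midpoints_large(1,2)[OF wW(1) u wu lim mid] LC
  show "u \<in> W01p \<Omega> p" "energy \<Omega> p u \<le> C" by auto
qed

end


section \<open>Borel representatives and slices in time\<close>

lemma lebesgue_measurable_ex_borel:
  fixes f :: "'a::euclidean_space \<Rightarrow> 'b::euclidean_space"
  assumes f: "f \<in> borel_measurable lebesgue"
  obtains g where "g \<in> borel_measurable borel" "AE x in lborel. f x = g x"
proof -
  have "\<forall>i\<in>Basis. \<exists>g. g \<in> borel_measurable lborel \<and> (AE x in lborel. f x \<bullet> i = g x)"
  proof
    fix i :: 'b assume "i \<in> Basis"
    have "(\<lambda>x. f x \<bullet> i) \<in> borel_measurable lebesgue" using f by measurable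
    from completion_ex_borel_measurable_real[OF this] show "\<exists>g. g \<in> borel_measurable lborel \<and> (AE x in lborel. f x \<bullet> i = g x)"
      by blast
  qed
  from bchoice[OF this] obtain g where g: "\<forall>i\<in>Basis. g i \<in> borel_measurable lborel \<and> (AE x in lborel. f x \<bullet> i = g i x)" ..
  have "AE x in lborel. \<forall>i\<in>Basis. f x \<bullet> i = g i x"
    using g by (intro AE_finite_allI) auto
  then have "AE x in lborel. f x = (\<Sum>i\<in>Basis. g i x *\<^sub>R i)"
    by eventually_elim (metis (no_types, lifting) euclidean_representation sum.cong)
  moreover have "(\<lambda>x. \<Sum>i\<in>Basis. g i x *\<^sub>R i) \<in> borel_measurable borel"
    using g by (intro borel_measurable_sum borel_measurable_scaleR) auto
  ultimately show ?thesis using that by blast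
qed

text \<open>
  Local integrability gives measurability only with respect to the completed measure, while product
  measures, slices and Fubini's theorem call for Borel functions on the product space.
\<close>

lemma loc_integrable_ex_borel:
  fixes u :: "'a::euclidean_space \<Rightarrow> 'b::euclidean_space"
  assumes U: "open U" and u: "loc_integrable U u"
  obtains g where "g \<in> borel_measurable borel" "\<And>x. x \<notin> U \<Longrightarrow> g x = 0" "AE x in lborel. x \<in> U \<longrightarrow> u x = g x"
proof -
  obtain D where D: "countable D" "D \<subseteq> Pow U" "\<And>X. X \<in> D \<Longrightarrow> \<exists>a b. X = cbox a b" "\<Union>D = U"
    using open_countable_Union_open_cbox[OF U] by metis
  define X where "X n = (if D = {} then {} else from_nat_into D n)" for n
  have X: "compact (X n)" "X n \<subseteq> U" for n
  proof -
    have "compact Y" if "Y \<in> D" for Y using D(3)[OF that] by auto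
    then show "compact (X n)" "X n \<subseteq> U"
      using D(2) from_nat_into[of D n] by (auto simp: X_def)
  qed
  have XU: "(\<Union>n. X n) = U"
    using D by (cases "D = {}") (auto simp: X_def range_from_nat_into UN_from_nat_into[symmetric])
  define K where "K n = (\<Union>i\<le>n. X i)" for n
  have K: "compact (K n)" "K n \<subseteq> U" for n using X by (auto simp: K_def)
  have lim: "(\<lambda>n. indicator (K n) x *\<^sub>R u x) \<longlonglongrightarrow> indicator U x *\<^sub>R u x" for x
  proof (cases "x \<in> U")
    case True
    then obtain m where m: "x \<in> X m" using XU by blast
    have "\<forall>\<^sub>F n in sequentially. indicator (K n) x *\<^sub>R u x = indicator U x *\<^sub>R u x"
      using eventually_ge_at_top[of m] by eventually_elim (use True m in \<open>auto simp: K_def indicator_def\<close>)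
    then show ?thesis by (rule tendsto_eventually)
  next
    case False
    then have "x \<notin> K n" for n using K(2) by blast
    then show ?thesis using False by simp
  qed
  have "(\<lambda>x. indicator U x *\<^sub>R u x) \<in> borel_measurable lebesgue"
    by (rule borel_measurable_LIMSEQ_metric[OF borel_measurable_integrable[OF loc_integrableD[OF u K]] lim])
  then obtain g where g: "g \<in> borel_measurable borel" "AE x in lborel. indicator U x *\<^sub>R u x = g x"
    by (rule lebesgue_measurable_ex_borel)
  show ?thesis
  proof (rule that[of "\<lambda>x. indicator U x *\<^sub>R g x"])
    show "(\<lambda>x. indicator U x *\<^sub>R g x) \<in> borel_measurable borel"
      using U g(1) by (intro borel_measurable_scaleR borel_measurable_indicator) auto
    show "AE x in lborel. x \<in> U \<longrightarrow> u x = indicator U x *\<^sub>R g x"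
      using g(2) by eventually_elim (auto simp: indicator_def)
  qed simp
qed

lemma AE_time_slices:
  fixes P :: "'a::euclidean_space \<times> real \<Rightarrow> bool"
  assumes "AE z in lborel. P z"
  shows "AE t in lborel. AE x in lborel. P (x, t)"
proof -
  obtain N where N0: "{z \<in> space lborel. \<not> P z} \<subseteq> N" "emeasure lborel N = 0" "N \<in> sets lborel"
    by (rule AE_E[OF assms])
  then have N: "N \<in> null_sets lborel" "{z. \<not> P z} \<subseteq> N" by (simp_all add: null_setsI)
  have "AE z in lborel. z \<notin> N" using N(1) by (rule AE_not_in)
  then have "AE z in (lborel :: 'a measure) \<Otimes>\<^sub>M (lborel :: real measure). z \<notin> N" unfolding lborel_prod .
  then have 1: "AE x in lborel. AE t in lborel. (x, t) \<notin> N" by (rule lborel_pair.AE_pair)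
  have "{z \<in> space ((lborel :: 'a measure) \<Otimes>\<^sub>M (lborel :: real measure)). (fst z, snd z) \<notin> N} \<in> sets ((lborel :: 'a measure) \<Otimes>\<^sub>M (lborel :: real measure))"
  proof -
    have "- N \<in> sets lborel" using N(1) by auto
    moreover have "{z \<in> space ((lborel :: 'a measure) \<Otimes>\<^sub>M (lborel :: real measure)). (fst z, snd z) \<notin> N} = - N" by (auto simp: space_pair_measure)
    ultimately show ?thesis unfolding lborel_prod by simp
  qed
  from iffD1[OF lborel_pair.AE_commute[OF this] 1]
  show ?thesis by (elim eventually_mono) (use N(2) in blast)
qed

lemma Fubini_time:
  fixes G :: "'a::euclidean_space \<times> real \<Rightarrow> 'b::euclidean_space"
  assumes "integrable lborel G"
  shows "AE t in lborel. integrable lborel (\<lambda>x. G (x, t))"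
    "integrable lborel (\<lambda>t. LINT x|lborel. G (x, t))"
    "(LINT t|lborel. LINT x|lborel. G (x, t)) = (LINT z|lborel. G z)"
proof -
  have G: "integrable ((lborel :: 'a measure) \<Otimes>\<^sub>M (lborel :: real measure)) (\<lambda>(x, t). G (x, t))"
    using assms by (simp add: lborel_prod)
  show "AE t in lborel. integrable lborel (\<lambda>x. G (x, t))" by (rule lborel_pair.AE_integrable_snd[OF G])
  show "integrable lborel (\<lambda>t. LINT x|lborel. G (x, t))" by (rule lborel_pair.integrable_snd[OF G])
  show "(LINT t|lborel. LINT x|lborel. G (x, t)) = (LINT z|lborel. G z)"
    using lborel_pair.integral_snd[OF G] by (simp add: lborel_prod)
qed


section \<open>The fundamental theorem of calculus for weak derivatives in time\<close>

definition bump :: "real \<Rightarrow> real" where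
  "bump x = flat 0 x * flat 0 (1 - x)"

definition bump_mass :: real where
  "bump_mass = (LINT x|lborel. bump x)"

text \<open>
  A primitive of \<open>bump\<close>, rising from \<open>0\<close> to \<open>bump_mass\<close> between \<open>0\<close> and \<open>1\<close>.
\<close>

definition step :: "real \<Rightarrow> real" where
  "step x = (LINT y|lborel. indicator {..x} y * bump y)"

lemma bump_props: "0 \<le> bump x" "bump x \<le> 1" "x \<le> 0 \<Longrightarrow> bump x = 0" "1 \<le> x \<Longrightarrow> bump x = 0" "smooth_fun bump"
proof -
  show "0 \<le> bump x" "bump x \<le> 1" by (auto simp: bump_def flat_nonneg flat0_le_1 intro: mult_le_one)
  show "x \<le> 0 \<Longrightarrow> bump x = 0" "1 \<le> x \<Longrightarrow> bump x = 0" by (auto simp: bump_def flat_def)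
  have "smooth_fun (\<lambda>x::real. flat 0 (- x + 1))"
    by (rule smooth_fun_compose_affine[OF bounded_linear_minus[OF bounded_linear_ident] smooth_flat])
  then show "smooth_fun bump" unfolding bump_def[abs_def] by (intro smooth_fun_mult smooth_flat) simp
qed

lemma bump_continuous: "continuous_on S bump"
  using smooth_fun_continuous[OF bump_props(5)] continuous_on_subset by blast

lemma bump_measurable [measurable]: "bump \<in> borel_measurable borel"
  using bump_continuous by (rule borel_measurable_continuous_onI)

lemma bump_integrable: "integrable lborel bump"
proof (rule Bochner_Integration.integrable_bound)
  show "integrable lborel (indicator {0..1} :: real \<Rightarrow> real)" by (simp add: integrable_indicator_iff)
  show "AE x in lborel. norm (bump x) \<le> norm (indicator {0..1} x :: real)"
    using bump_props(1-4) by (intro AE_I2) (auto simp: indicator_def)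
qed simp

lemma bump_mass_pos: "0 < bump_mass"
proof -
  have "exp (- 8) * indicator {1/4..3/4} x \<le> bump x" for x
  proof (cases "x \<in> {1/4..3/4}")
    case True
    have f: "exp (- 4) \<le> flat 0 y" if "1/4 \<le> y" for y
      using that by (auto simp: flat_def field_simps)
    have "exp (- 4) * exp (- 4) \<le> flat 0 x * flat 0 (1 - x)"
      using f[of x] f[of "1 - x"] True by (intro mult_mono) (auto simp: flat_nonneg)
    then show ?thesis using True by (simp add: bump_def mult_exp_exp)
  qed (use bump_props(1) in simp)
  then have "(LINT x|lborel. exp (- 8) * indicator {1/4..3/4::real} x) \<le> (bump_mass :: real)"
    unfolding bump_mass_def
    by (intro integral_mono integrable_mult_right bump_integrable integrable_real_indicator emeasure_bounded_finite) auto
  moreover have "(LINT x|lborel. exp (- 8) * indicator {1/4..3/4::real} x) > (0::real)" by simp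
  ultimately show ?thesis by linarith
qed

lemma step_props:
  "0 \<le> step x" "step x \<le> bump_mass" "x \<le> 0 \<Longrightarrow> step x = 0" "1 \<le> x \<Longrightarrow> step x = bump_mass"
  "(step has_real_derivative bump x) (at x)"
proof -
  have i: "integrable lborel (\<lambda>y. indicator {..x} y * bump y)" for x
    using integrable_mult_indicator[OF _ bump_integrable, of "{..x}"] by simp
  show "0 \<le> step x" unfolding step_def by (intro Bochner_Integration.integral_nonneg) (simp add: bump_props)
  show "step x \<le> bump_mass"
    unfolding step_def bump_mass_def using bump_props(1) by (intro integral_mono i bump_integrable) (auto simp: indicator_def)
  show z: "step x = 0" if "x \<le> 0" for x
  proof -
    have "indicator {..x} y * bump y = 0" for y using that bump_props(3)[of y] by (auto simp: indicator_def)
    then show ?thesis by (simp only: step_def Bochner_Integration.integral_zero)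
  qed
  show "step x = bump_mass" if "1 \<le> x"
  proof -
    have "indicator {..x} y * bump y = bump y" for y using that bump_props(4)[of y] by (auto simp: indicator_def)
    then show ?thesis by (simp only: step_def bump_mass_def)
  qed
  have eq: "step y = integral {-1..y} bump" for y
  proof -
    have "step y = (LINT r:{-1..y}|lborel. bump r)"
      unfolding step_def set_lebesgue_integral_def
      by (intro Bochner_Integration.integral_cong refl) (use bump_props(3) in \<open>auto simp: indicator_def\<close>)
    also have "\<dots> = integral {-1..y} bump"
      using borel_integrable_atLeastAtMost'[OF bump_continuous] by (rule set_borel_integral_eq_integral)
    finally show ?thesis .
  qed
  show "(step has_real_derivative bump x) (at x)"
  proof (cases "x < 0")
    case True
    have "((\<lambda>x. 0::real) has_real_derivative 0) (at x)" by simp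
    moreover have "\<forall>\<^sub>F y in nhds x. 0 = step y"
      using eventually_nhds_in_open[of "{..<0}" x] True by (auto elim!: eventually_mono simp: z)
    ultimately show ?thesis
      using DERIV_cong_ev[OF refl, of "\<lambda>_. 0" step x 0 "bump x"] True bump_props(3)[of x] by simp
  next
    case False
    have "((\<lambda>y. integral {-1..y} bump) has_real_derivative bump x) (at x within {-1..x+1})"
      using False by (intro integral_has_real_derivative bump_continuous) auto
    moreover have "at x within {-1..x+1} = at x" using False by (intro at_within_Icc_at) auto
    moreover have "step = (\<lambda>y. integral {-1..y} bump)" using eq by blast
    ultimately show ?thesis by simp
  qed
qed

lemma step_smooth: "smooth_fun step"
  unfolding smooth_fun_def
proof
  fix k show "Ck_fun k step"
  proof (cases k)
    case 0
    then show ?thesis using DERIV_isCont[OF step_props(5)] by (auto simp: continuous_on_eq_continuous_at)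
  next
    case (Suc j)
    have "Ck_fun (Suc j) step"
    proof (rule Ck_fun_SucI)
      show "(step has_derivative (\<lambda>h. bump x * h)) (at x)" for x
        using step_props(5)[of x] by (simp add: has_field_derivative_def)
      have "Ck_fun j (\<lambda>x. bump x *\<^sub>R h)" for h :: real
        using bump_props(5) by (intro Ck_fun_scaleR) (auto simp: smooth_fun_def)
      then show "Ck_fun j (\<lambda>x. bump x * h)" for h by simp
    qed
    then show ?thesis using Suc by simp
  qed
qed

text \<open>
  The identity is tested with the difference of two steps that rise within time \<open>2 / (n + 1)\<close> after
  \<open>s\<close> and after \<open>t\<close>. The derivative of the test function concentrates at \<open>s\<close> and \<open>t\<close>, where \<open>f\<close> is
  continuous, and the test function tends to the indicator of the interval between them.
\<close>

lemma weak_derivative_in_time: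
  fixes f k :: "real \<Rightarrow> 'b::euclidean_space"
  assumes f: "continuous_on {0..} f" and k: "\<And>T. integrable lborel (\<lambda>r. indicator {0<..<T} r *\<^sub>R k r)"
    and weak: "\<And>\<theta> :: real \<Rightarrow> real. test_fun {0<..} \<theta> \<Longrightarrow>
      (LINT r|lborel. frechet_derivative \<theta> (at r) 1 *\<^sub>R f r) = - (LINT r|lborel. \<theta> r *\<^sub>R k r)"
    and st: "0 \<le> s" "s < t"
  shows "f t - f s = (LINT r|lborel. indicator {s<..<t} r *\<^sub>R k r)"
proof -
  \<comment> \<open>A continuous extension to negative times.\<close>
  define g where "g r = f (max 0 r)" for r
  have g: "continuous_on UNIV g" unfolding g_def by (intro continuous_on_compose2[OF f] continuous_intros) auto
  have gm [measurable]: "g \<in> borel_measurable borel" using g by (rule borel_measurable_continuous_onI)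
  have gf: "g r = f r" if "0 \<le> r" for r using that by (simp add: g_def)
  \<comment> \<open>The shift by \<open>1\<close> keeps the support of the step away from \<open>a\<close>, so that it lies in \<open>{0<..}\<close>
    even for \<open>a = 0\<close>.\<close>
  define sh where "sh a n r = step (real (Suc n) * (r - a) - 1)" for a n r
  define \<beta> where "\<beta> a n r = real (Suc n) * bump (real (Suc n) * (r - a) - 1)" for a n r
  have sh_smooth: "smooth_fun (sh a n)" for a n
  proof -
    have "smooth_fun (\<lambda>r. step (real (Suc n) * r + (- real (Suc n) * a - 1)))"
      by (rule smooth_fun_compose_affine[OF bounded_linear_const_mult[OF bounded_linear_ident] step_smooth])
    then show ?thesis by (simp add: sh_def[abs_def] algebra_simps)
  qed
  have sh_der: "(sh a n has_real_derivative \<beta> a n r) (at r)" for a n r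
  proof -
    have "((\<lambda>r. real (Suc n) * (r - a) - 1) has_real_derivative real (Suc n)) (at r)" by (auto intro!: derivative_eq_intros)
    from DERIV_chain2[OF step_props(5) this] show ?thesis by (simp add: sh_def[abs_def] \<beta>_def mult.commute)
  qed
  define \<theta> where "\<theta> n r = sh s n r - sh t n r" for n r
  have \<theta>_out: "\<theta> n r = 0" if "r \<notin> {s + 1 / real (Suc n) .. t + 2}" for n r
  proof -
    consider "r < s + 1 / real (Suc n)" | "t + 2 < r" using \<open>r \<notin> _\<close> by fastforce
    then show ?thesis
    proof cases
      case 1
      then have "real (Suc n) * (r - s) \<le> 1" by (simp add: field_simps del: of_nat_Suc)
      moreover have "real (Suc n) * (r - t) \<le> real (Suc n) * (r - s)" using st by (intro mult_left_mono) auto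
      ultimately have "real (Suc n) * (r - s) - 1 \<le> 0" "real (Suc n) * (r - t) - 1 \<le> 0" by linarith+
      then show ?thesis by (simp only: \<theta>_def sh_def step_props(3))
    next
      case 2
      have "1 * 2 \<le> real (Suc n) * (r - t)" using 2 by (intro mult_mono) auto
      moreover have "1 * 2 \<le> real (Suc n) * (r - s)" using 2 st by (intro mult_mono) auto
      ultimately have "1 \<le> real (Suc n) * (r - s) - 1" "1 \<le> real (Suc n) * (r - t) - 1" by linarith+
      then show ?thesis by (simp only: \<theta>_def sh_def step_props(4))
    qed
  qed
  have \<theta>_test: "test_fun {0<..} (\<theta> n)" for n
  proof (rule test_funI[of _ "{s + 1 / real (Suc n) .. t + 2}"])
    have "smooth_fun (\<lambda>r. sh s n r + (-1) *\<^sub>R sh t n r)"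
      by (intro smooth_fun_add smooth_fun_scaleR smooth_fun_const sh_smooth)
    then show "smooth_fun (\<theta> n)" by (simp add: \<theta>_def[abs_def])
    show "{s + 1 / real (Suc n)..t + 2} \<subseteq> {0<..}"
    proof
      fix r assume "r \<in> {s + 1 / real (Suc n)..t + 2}"
      moreover have "0 < 1 / real (Suc n)" by simp
      ultimately show "r \<in> {0<..}" using st unfolding atLeastAtMost_iff greaterThan_iff by linarith
    qed
  qed (use \<theta>_out in auto)
  have \<theta>_der: "frechet_derivative (\<theta> n) (at r) 1 = \<beta> s n r - \<beta> t n r" for n r
  proof -
    have "(\<theta> n has_real_derivative \<beta> s n r - \<beta> t n r) (at r)"
      unfolding \<theta>_def[abs_def] by (intro DERIV_diff sh_der)
    from frechet_derivative_at[OF this[unfolded has_field_derivative_def], symmetric] show ?thesis by simp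
  qed
  obtain Bd where Bd: "\<And>r. r \<in> {0..t + 2} \<Longrightarrow> norm (g r) \<le> Bd"
  proof -
    have "compact (g ` {0..t + 2})" using g continuous_on_subset by (intro compact_continuous_image) auto
    then obtain B where "\<And>y. y \<in> g ` {0..t + 2} \<Longrightarrow> norm y \<le> B" using compact_imp_bounded bounded_iff by metis
    then show ?thesis using that by blast
  qed
  have sub: "integrable lborel (\<lambda>r. \<beta> a n r *\<^sub>R g r)"
    "(LINT r|lborel. \<beta> a n r *\<^sub>R g r) = (LINT y|lborel. bump y *\<^sub>R g (a + (y + 1) / real (Suc n)))"
    and subint: "integrable lborel (\<lambda>y. bump y *\<^sub>R g (a + (y + 1) / real (Suc n)))"
    and subb: "norm (bump y *\<^sub>R g (a + (y + 1) / real (Suc n))) \<le> Bd * indicator {0..1} y"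
    if a: "0 \<le> a" "a \<le> t" for a n y
  proof -
    define j where "j = real (Suc n)"
    have j: "j \<ge> 1" by (simp add: j_def)
    have b: "norm (bump y *\<^sub>R g (a + (y + 1) / j)) \<le> Bd * indicator {0..1} y" for y
    proof (cases "y \<in> {0..1}")
      case True
      have "0 \<le> (y + 1) / j" "(y + 1) / j \<le> 2"
        using True j by (auto simp: divide_le_eq)
      then have "norm (g (a + (y + 1) / j)) \<le> Bd" using a by (intro Bd) auto
      then show ?thesis using True bump_props(1,2)[of y] mult_mono[of "bump y" 1 "norm (g (a + (y + 1) / j))" Bd] by simp
    next
      case False
      then have "bump y = 0" using bump_props(3,4)[of y] by auto
      then show ?thesis using False by simp
    qed
    then show "norm (bump y *\<^sub>R g (a + (y + 1) / real (Suc n))) \<le> Bd * indicator {0..1} y" by (simp add: j_def)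
    have i: "integrable lborel (\<lambda>y. bump y *\<^sub>R g (a + (y + 1) / j))"
    proof (rule Bochner_Integration.integrable_bound)
      show "integrable lborel (\<lambda>y. Bd * indicator {0..1::real} y)" by (simp add: integrable_indicator_iff)
      show "AE y in lborel. norm (bump y *\<^sub>R g (a + (y + 1) / j)) \<le> norm (Bd * indicator {0..1} y)"
        by (intro AE_I2) (simp only: real_norm_def, rule order_trans[OF b abs_ge_self])
    qed simp
    then show "integrable lborel (\<lambda>y. bump y *\<^sub>R g (a + (y + 1) / real (Suc n)))" by (simp add: j_def)
    have e: "\<beta> a n (a + 1 / j + (1 / j) * y) *\<^sub>R g (a + 1 / j + (1 / j) * y) = j *\<^sub>R (bump y *\<^sub>R g (a + (y + 1) / j))" for y
    proof -
      have 1: "a + 1 / j + (1 / j) * y = a + (y + 1) / j" by (simp add: add_divide_distrib)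
      have 2: "j * ((a + (y + 1) / j) - a) - 1 = y" using j by simp
      show ?thesis unfolding \<beta>_def j_def[symmetric] 1 2 by simp
    qed
    have "integrable lborel (\<lambda>y. \<beta> a n (a + 1 / j + (1 / j) * y) *\<^sub>R g (a + 1 / j + (1 / j) * y))"
      unfolding e by (rule integrable_scaleR_right[OF i])
    then show "integrable lborel (\<lambda>r. \<beta> a n r *\<^sub>R g r)"
      by (subst (asm) lborel_integrable_real_affine_iff[of "1/j" "\<lambda>r. \<beta> a n r *\<^sub>R g r"]) (use j in auto)
    have "(LINT r|lborel. \<beta> a n r *\<^sub>R g r) = \<bar>1 / j\<bar> *\<^sub>R (LINT y|lborel. \<beta> a n (a + 1 / j + (1 / j) * y) *\<^sub>R g (a + 1 / j + (1 / j) * y))"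
      by (rule lborel_integral_real_affine) (use j in auto)
    also have "\<dots> = (LINT y|lborel. bump y *\<^sub>R g (a + (y + 1) / j))"
      unfolding e integral_scaleR_right using j by simp
    finally show "(LINT r|lborel. \<beta> a n r *\<^sub>R g r) = (LINT y|lborel. bump y *\<^sub>R g (a + (y + 1) / real (Suc n)))" by (simp add: j_def)
  qed
  have lim_g: "(\<lambda>n. LINT r|lborel. \<beta> a n r *\<^sub>R g r) \<longlonglongrightarrow> bump_mass *\<^sub>R g a" if a: "0 \<le> a" "a \<le> t" for a
  proof -
    have "(\<lambda>n. LINT y|lborel. bump y *\<^sub>R g (a + (y + 1) / real (Suc n))) \<longlonglongrightarrow> (LINT y|lborel. bump y *\<^sub>R g a)"
    proof (rule integral_dominated_convergence[where w = "\<lambda>y. Bd * indicator {0..1} y"])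
      show "integrable lborel (\<lambda>y. Bd * indicator {0..1::real} y)" by (simp add: integrable_indicator_iff)
      show "AE y in lborel. norm (bump y *\<^sub>R g (a + (y + 1) / real (Suc n))) \<le> Bd * indicator {0..1} y" for n
        using subb[OF a] by (intro AE_I2)
      show "AE y in lborel. (\<lambda>n. bump y *\<^sub>R g (a + (y + 1) / real (Suc n))) \<longlonglongrightarrow> bump y *\<^sub>R g a"
      proof (rule AE_I2)
        fix y
        have "(\<lambda>n. a + (y + 1) * (1 / real (Suc n))) \<longlonglongrightarrow> a + (y + 1) * 0"
          by (intro tendsto_intros LIMSEQ_Suc[OF lim_1_over_n])
        then have "(\<lambda>n. a + (y + 1) / real (Suc n)) \<longlonglongrightarrow> a" by simp
        then have "(\<lambda>n. g (a + (y + 1) / real (Suc n))) \<longlonglongrightarrow> g a"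
          using g by (intro isCont_tendsto_compose[of _ g]) (auto simp: continuous_on_eq_continuous_at)
        then show "(\<lambda>n. bump y *\<^sub>R g (a + (y + 1) / real (Suc n))) \<longlonglongrightarrow> bump y *\<^sub>R g a" by (intro tendsto_intros)
      qed
    qed simp_all
    then show ?thesis by (simp add: sub(2)[OF a] bump_mass_def bump_integrable)
  qed
  have L: "(LINT r|lborel. frechet_derivative (\<theta> n) (at r) 1 *\<^sub>R f r) = (LINT r|lborel. \<beta> s n r *\<^sub>R g r) - (LINT r|lborel. \<beta> t n r *\<^sub>R g r)" for n
  proof -
    have "frechet_derivative (\<theta> n) (at r) 1 *\<^sub>R f r = \<beta> s n r *\<^sub>R g r - \<beta> t n r *\<^sub>R g r" for r
    proof (cases "0 \<le> r")
      case True
      then show ?thesis by (simp add: \<theta>_der gf scaleR_diff_left)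
    next
      case False
      have "\<beta> a n r = 0" if "0 \<le> a" for a
      proof -
        have "real (Suc n) * (r - a) \<le> 0" using False that by (intro mult_nonneg_nonpos) auto
        then show ?thesis by (simp add: \<beta>_def bump_props(3) del: of_nat_Suc)
      qed
      then show ?thesis using st by (simp add: \<theta>_der)
    qed
    then show ?thesis using sub(1)[of s n] sub(1)[of t n] st by simp
  qed
  have lim_L: "(\<lambda>n. LINT r|lborel. frechet_derivative (\<theta> n) (at r) 1 *\<^sub>R f r) \<longlonglongrightarrow> bump_mass *\<^sub>R g s - bump_mass *\<^sub>R g t"
    unfolding L using st by (intro tendsto_diff lim_g) auto
  have "(\<lambda>n. LINT r|lborel. \<theta> n r *\<^sub>R k r) \<longlonglongrightarrow> (LINT r|lborel. bump_mass *\<^sub>R (indicator {s<..t} r *\<^sub>R k r))"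
  proof (rule integral_dominated_convergence[where w = "\<lambda>r. bump_mass * norm (indicator {0<..<t+3} r *\<^sub>R k r)"])
    have km: "(\<lambda>r. indicator {0<..<t+3} r *\<^sub>R k r) \<in> borel_measurable lborel" using k by auto
    have e: "\<theta> n r *\<^sub>R k r = \<theta> n r *\<^sub>R (indicator {0<..<t+3} r *\<^sub>R k r)" for n r
    proof (cases "r \<in> {0<..<t+3}")
      case False
      have "r \<notin> {s + 1 / real (Suc n)..t + 2}"
      proof
        assume "r \<in> {s + 1 / real (Suc n)..t + 2}"
        moreover have "0 < 1 / real (Suc n)" by simp
        ultimately show False using False st unfolding atLeastAtMost_iff greaterThanLessThan_iff by linarith
      qed
      then show ?thesis using \<theta>_out[of r n] by simp
    qed simp
    show "(\<lambda>r. \<theta> n r *\<^sub>R k r) \<in> borel_measurable lborel" for n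
      using borel_measurable_continuous_onI[OF test_fun_continuous[OF \<theta>_test, of n]]
      by (subst e) (intro borel_measurable_scaleR[OF _ km], simp)
    have e2: "indicator {s<..t} r *\<^sub>R k r = indicator {s<..t} r *\<^sub>R (indicator {0<..<t+3} r *\<^sub>R k r)" for r
      using st by (auto simp: indicator_def)
    show "(\<lambda>r. bump_mass *\<^sub>R (indicator {s<..t} r *\<^sub>R k r)) \<in> borel_measurable lborel"
      by (subst e2) (intro borel_measurable_scaleR[OF _ borel_measurable_scaleR[OF _ km]], simp_all)
    show "integrable lborel (\<lambda>r. bump_mass * norm (indicator {0<..<t+3} r *\<^sub>R k r))"
      using k by (intro integrable_mult_right integrable_norm)
    show "AE r in lborel. norm (\<theta> n r *\<^sub>R k r) \<le> bump_mass * norm (indicator {0<..<t+3} r *\<^sub>R k r)" for n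
    proof (rule AE_I2)
      fix r
      have "\<bar>\<theta> n r\<bar> \<le> bump_mass"
        using step_props(1,2)[of "real (Suc n) * (r - s) - 1"] step_props(1,2)[of "real (Suc n) * (r - t) - 1"]
        unfolding \<theta>_def sh_def by linarith
      then show "norm (\<theta> n r *\<^sub>R k r) \<le> bump_mass * norm (indicator {0<..<t+3} r *\<^sub>R k r)"
        by (subst e) (simp add: mult_right_mono del: scaleR_scaleR)
    qed
    show "AE r in lborel. (\<lambda>n. \<theta> n r *\<^sub>R k r) \<longlonglongrightarrow> bump_mass *\<^sub>R (indicator {s<..t} r *\<^sub>R k r)"
    proof (rule AE_I2)
      fix r
      have sh_lim: "(\<lambda>n. sh a n r) \<longlonglongrightarrow> (if a < r then bump_mass else 0)" for a
      proof (cases "a < r")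
        case True
        obtain N where N: "real N \<ge> 2 / (r - a)" using real_arch_simple by blast
        have "sh a n r = bump_mass" if "n \<ge> N" for n
        proof -
          have "2 \<le> real N * (r - a)" using N True by (simp only: pos_divide_le_eq diff_gt_0_iff_gt)
          also have "\<dots> \<le> real (Suc n) * (r - a)" using that True by (intro mult_right_mono) auto
          finally show ?thesis by (simp add: sh_def step_props(4) del: of_nat_Suc)
        qed
        then have "\<forall>\<^sub>F n in sequentially. sh a n r = bump_mass" by (auto simp: eventually_sequentially)
        then show ?thesis using True by (simp add: tendsto_eventually)
      next
        case False
        have "sh a n r = 0" for n
        proof -
          have "real (Suc n) * (r - a) \<le> 0" using False by (intro mult_nonneg_nonpos) auto
          then show ?thesis by (simp add: sh_def step_props(3) del: of_nat_Suc)
        qed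
        then show ?thesis using False by simp
      qed
      have "(\<lambda>n. \<theta> n r) \<longlonglongrightarrow> (if s < r then bump_mass else 0) - (if t < r then bump_mass else 0)"
        unfolding \<theta>_def by (intro tendsto_diff sh_lim)
      then have "(\<lambda>n. \<theta> n r *\<^sub>R k r) \<longlonglongrightarrow> ((if s < r then bump_mass else 0) - (if t < r then bump_mass else 0)) *\<^sub>R k r"
        by (intro tendsto_intros)
      also have "((if s < r then bump_mass else 0) - (if t < r then bump_mass else 0)) *\<^sub>R k r = bump_mass *\<^sub>R (indicator {s<..t} r *\<^sub>R k r)"
        using st by (auto simp: indicator_def)
      finally show "(\<lambda>n. \<theta> n r *\<^sub>R k r) \<longlonglongrightarrow> bump_mass *\<^sub>R (indicator {s<..t} r *\<^sub>R k r)" .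
    qed
  qed
  from tendsto_minus[OF this] have "(\<lambda>n. LINT r|lborel. frechet_derivative (\<theta> n) (at r) 1 *\<^sub>R f r) \<longlonglongrightarrow> - (bump_mass *\<^sub>R (LINT r|lborel. indicator {s<..t} r *\<^sub>R k r))"
    by (simp only: weak[OF \<theta>_test] integral_scaleR_right)
  from LIMSEQ_unique[OF lim_L this]
  have "bump_mass *\<^sub>R (g t - g s) = bump_mass *\<^sub>R (LINT r|lborel. indicator {s<..t} r *\<^sub>R k r)"
    by (simp add: scaleR_diff_right algebra_simps)
  then have "f t - f s = (LINT r|lborel. indicator {s<..t} r *\<^sub>R k r)"
    using bump_mass_pos st by (simp add: gf)
  also have "\<dots> = (LINT r|lborel. indicator {s<..<t} r *\<^sub>R k r)"
  proof (rule integral_cong_AE)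
    have m: "(\<lambda>r. indicator A r *\<^sub>R (indicator {0<..<t+3} r *\<^sub>R k r)) \<in> borel_measurable lborel" if "A \<in> sets borel" for A
      using that by (intro borel_measurable_scaleR[OF _ borel_measurable_integrable[OF k]]) simp
    have e: "indicator A r *\<^sub>R (indicator {0<..<t+3} r *\<^sub>R k r) = indicator A r *\<^sub>R k r" if "A \<subseteq> {s<..t}" for A r
      using that st by (auto simp: indicator_def)
    have m': "(\<lambda>r. indicator A r *\<^sub>R k r) \<in> borel_measurable lborel" if A: "A \<in> sets borel" "A \<subseteq> {s<..t}" for A
      using m[OF A(1)] by (simp only: e[OF A(2)])
    show "(\<lambda>r. indicator {s<..t} r *\<^sub>R k r) \<in> borel_measurable lborel" "(\<lambda>r. indicator {s<..<t} r *\<^sub>R k r) \<in> borel_measurable lborel"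
      by (intro m'; auto)+
    show "AE r in lborel. indicator {s<..t} r *\<^sub>R k r = indicator {s<..<t} r *\<^sub>R k r"
      using AE_lborel_singleton[of t] by eventually_elim (auto simp: indicator_def)
  qed
  finally show ?thesis .
qed


section \<open>Increments of a trajectory as time integrals\<close>

lemma Fubini_space:
  fixes G :: "'a::euclidean_space \<times> real \<Rightarrow> 'b::euclidean_space"
  assumes "integrable lborel G"
  shows "AE x in lborel. integrable lborel (\<lambda>t. G (x, t))"
    "integrable lborel (\<lambda>x. LINT t|lborel. G (x, t))"
    "(LINT x|lborel. LINT t|lborel. G (x, t)) = (LINT z|lborel. G z)"
proof -
  have G: "integrable ((lborel :: 'a measure) \<Otimes>\<^sub>M (lborel :: real measure)) (\<lambda>(x, t). G (x, t))"
    using assms by (simp add: lborel_prod)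
  show "AE x in lborel. integrable lborel (\<lambda>t. G (x, t))" by (rule lborel_pair.AE_integrable_fst[OF G])
  show "integrable lborel (\<lambda>x. LINT t|lborel. G (x, t))" by (rule lborel_pair.integrable_fst[OF G])
  show "(LINT x|lborel. LINT t|lborel. G (x, t)) = (LINT z|lborel. G z)"
    using lborel_pair.integral_fst[OF G] by (simp add: lborel_prod)
qed

text \<open>
  For passing from the Lebesgue integrals over \<open>U\<close> of the problem to integrals of Borel functions
  on the whole space.
\<close>

lemma integral_representative:
  fixes u :: "'a::euclidean_space \<Rightarrow> 'b::euclidean_space"
  assumes U: "open U" and w: "w \<in> borel_measurable borel" "\<And>x. x \<notin> U \<Longrightarrow> w x = 0"
    and ae: "AE x in lborel. x \<in> U \<longrightarrow> u x = w x"
  shows "(LINT x|lebesgue_on U. u x) = (LINT x|lborel. w x)"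
    "integrable (lebesgue_on U) u \<longleftrightarrow> integrable lborel w"
proof -
  have Ul: "U \<in> sets lebesgue" using U by simp
  have wl: "w \<in> borel_measurable lebesgue" using w(1) by (simp add: measurable_completion)
  have ae': "AE x in lebesgue. w x = indicator U x *\<^sub>R u x"
    unfolding AE_completion_iff using ae by eventually_elim (use w(2) in \<open>auto simp: indicator_def\<close>)
  have um: "(\<lambda>x. indicator U x *\<^sub>R u x) \<in> borel_measurable lebesgue" by (rule borel_measurable_AE[OF wl ae'])
  have "(LINT x|lebesgue. indicator U x *\<^sub>R u x) = (LINT x|lebesgue. w x)"
    by (rule integral_cong_AE[OF um wl]) (use ae' in eventually_elim, simp)
  then show "(LINT x|lebesgue_on U. u x) = (LINT x|lborel. w x)"
    using w(1) by (simp add: integral_lebesgue_on_eq[OF Ul] integral_completion)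
  have "integrable lebesgue (\<lambda>x. indicator U x *\<^sub>R u x) \<longleftrightarrow> integrable lebesgue w"
    by (rule integrable_cong_AE[OF um wl]) (use ae' in eventually_elim, simp)
  then show "integrable (lebesgue_on U) u \<longleftrightarrow> integrable lborel w"
    using w(1) by (simp add: integrable_lebesgue_on_iff[OF Ul] integrable_completion)
qed

locale trajectory = bounded_open_set \<Omega> p
  for \<Omega> :: "(real ^ 'n::finite) set" and p :: real +
  fixes v vt :: "real \<Rightarrow> real ^ 'n \<Rightarrow> real ^ 'm::finite"
  assumes continuous_time: "continuous_Lp \<Omega> p v"
    and weak_dt: "has_weak_deriv (\<Omega> \<times> {0<..}) (0, 1) (\<lambda>(x, t). v t x) (\<lambda>(x, t). vt t x)"
    and vt_Lp: "\<And>T. 0 < T \<Longrightarrow> (\<lambda>(x, t). vt t x) \<in> Lp_space (\<Omega> \<times> {0<..<T}) p"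
begin

text \<open>
  A Borel representative of the velocity \<open>vt\<close> on space-time, equal to zero outside of \<open>\<Omega>\<close> and for
  \<open>t \<le> 0\<close>.
\<close>

definition F :: "(real ^ 'n) \<times> real \<Rightarrow> real ^ 'm" where
  "F = (SOME g. g \<in> borel_measurable borel \<and> (\<forall>z. z \<notin> \<Omega> \<times> {0<..} \<longrightarrow> g z = 0) \<and>
     (AE z in lborel. z \<in> \<Omega> \<times> {0<..} \<longrightarrow> (\<lambda>(x, t). vt t x) z = g z))"

lemma cylinder_open: "open (\<Omega> \<times> {0::real<..})" "open (\<Omega> \<times> {0::real<..<T})"
  using open_set by (auto intro: open_Times)

lemma F_props: "F \<in> borel_measurable borel" "z \<notin> \<Omega> \<times> {0<..} \<Longrightarrow> F z = 0"
    "AE z in lborel. z \<in> \<Omega> \<times> {0<..} \<longrightarrow> (\<lambda>(x, t). vt t x) z = F z"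
proof -
  obtain g where g: "g \<in> borel_measurable borel" "\<And>z. z \<notin> \<Omega> \<times> {0<..} \<Longrightarrow> g z = 0"
     "AE z in lborel. z \<in> \<Omega> \<times> {0<..} \<longrightarrow> (\<lambda>(x, t). vt t x) z = g z"
    by (rule loc_integrable_ex_borel[OF cylinder_open(1) has_weak_derivD(2)[OF weak_dt]]) (rule that)
  have "F \<in> borel_measurable borel \<and> (\<forall>z. z \<notin> \<Omega> \<times> {0<..} \<longrightarrow> F z = 0) \<and>
     (AE z in lborel. z \<in> \<Omega> \<times> {0<..} \<longrightarrow> (\<lambda>(x, t). vt t x) z = F z)"
    unfolding F_def by (rule someI[of _ g]) (use g in auto)
  then show "F \<in> borel_measurable borel" "z \<notin> \<Omega> \<times> {0<..} \<Longrightarrow> F z = 0"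
    "AE z in lborel. z \<in> \<Omega> \<times> {0<..} \<longrightarrow> (\<lambda>(x, t). vt t x) z = F z" by blast+
qed

lemma F_measurable [measurable]: "F \<in> borel_measurable (borel \<Otimes>\<^sub>M borel)"
  using F_props(1) by (simp add: borel_prod)

lemma F_slice_measurable [measurable]: "(\<lambda>x. F (x, t)) \<in> borel_measurable borel" "(\<lambda>t. F (x, t)) \<in> borel_measurable borel"
  by measurable

lemma F_outside: "x \<notin> \<Omega> \<Longrightarrow> F (x, t) = 0" "t \<le> 0 \<Longrightarrow> F (x, t) = 0"
  by (auto intro: F_props(2))

lemma v_Lp: "0 \<le> t \<Longrightarrow> v t \<in> Lp M p"
  using continuous_time by (simp add: continuous_Lp_def Lp_space_eq)

lemma v_continuous: "0 \<le> t \<Longrightarrow> ((\<lambda>s. pnorm M p (\<lambda>x. v s x - v t x)) \<longlongrightarrow> 0) (at t within {0..})"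
  using continuous_time by (simp add: continuous_Lp_def Lp_norm_eq)

lemma F_slice_eq: "AE t in lborel. 0 < t \<longrightarrow> (AE x in M. vt t x = F (x, t))"
  using AE_time_slices[OF F_props(3)]
proof eventually_elim
  case (elim t)
  show ?case
  proof
    assume "0 < t"
    then show "AE x in M. vt t x = F (x, t)"
      unfolding AE_lebesgue_on_iff[OF set_lebesgue] using elim by (auto elim!: eventually_mono)
  qed
qed

text \<open>
  The velocity between the times \<open>s\<close> and \<open>t\<close>. In contrast to \<open>F\<close> it is integrable over all of
  space-time, which makes translations in time available.
\<close>

definition slab_velocity :: "real \<Rightarrow> real \<Rightarrow> (real ^ 'n) \<times> real \<Rightarrow> real ^ 'm" where
  "slab_velocity s t z = indicator {s<..<t} (snd z) *\<^sub>R F z"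

definition D :: "real \<Rightarrow> real" where
  "D t = pint lborel p (\<lambda>x. F (x, t))"

lemma D_nonneg [simp]: "0 \<le> D t"
  by (simp add: D_def)

lemma slab_measurable: "slab_velocity s t \<in> borel_measurable borel"
proof -
  have "slab_velocity s t \<in> borel_measurable (borel \<Otimes>\<^sub>M borel)" unfolding slab_velocity_def by measurable
  then show ?thesis by (simp add: borel_prod)
qed

lemma slab_Lp: "slab_velocity s t \<in> Lp lborel p"
proof -
  define T where "T = max 1 t"
  have T: "T > 0" by (simp add: T_def)
  have S: "open (\<Omega> \<times> {0::real<..<T})" by (rule cylinder_open)
  have vT: "integrable (lebesgue_on (\<Omega> \<times> {0<..<T})) (\<lambda>z. norm ((\<lambda>(x, t). vt t x) z) powr p)"
    using LpD(2)[OF vt_Lp[OF T, unfolded Lp_space_eq]] .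
  have i0: "integrable lborel (\<lambda>z. norm (slab_velocity 0 T z) powr p)"
  proof (rule iffD1[OF integral_representative(2)[OF S] vT])
    show "(\<lambda>z. norm (slab_velocity 0 T z) powr p) \<in> borel_measurable borel" using slab_measurable[of 0 T] by measurable
    show "norm (slab_velocity 0 T z) powr p = 0" if "z \<notin> \<Omega> \<times> {0<..<T}" for z
      using that F_outside by (cases z) (auto simp: slab_velocity_def indicator_def)
    show "AE z in lborel. z \<in> \<Omega> \<times> {0<..<T} \<longrightarrow> norm ((\<lambda>(x, t). vt t x) z) powr p = norm (slab_velocity 0 T z) powr p"
      using F_props(3) by eventually_elim (auto simp: slab_velocity_def)
  qed
  show ?thesis
  proof (rule Lp_bound[OF _ i0])
    show "AE z in lborel. norm (slab_velocity s t z) powr p \<le> norm (slab_velocity 0 T z) powr p"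
    proof (rule AE_I2, rule powr_mono2)
      fix z
      show "norm (slab_velocity s t z) \<le> norm (slab_velocity 0 T z)"
        using F_outside(2)[of "snd z" "fst z"] by (cases "snd z \<le> 0") (auto simp: slab_velocity_def indicator_def T_def)
    qed auto
  qed (use slab_measurable in simp)
qed

lemma slab_integrable: "integrable lborel (slab_velocity s t)"
proof -
  obtain R where R: "\<And>x. x \<in> \<Omega> \<Longrightarrow> norm x \<le> R" using bounded_set by (auto simp: bounded_iff)
  define S where "S = cball (0::real^'n) R \<times> {s..t}"
  have S: "S \<in> sets borel" unfolding S_def by (intro borel_closed closed_Times) auto
  have "bounded S" unfolding S_def by (intro bounded_Times) auto
  then have "integrable lborel (indicator S :: _ \<Rightarrow> real)"
    using S by (intro integrable_real_indicator emeasure_bounded_finite) auto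
  then have 1: "integrable lborel (\<lambda>z. norm (slab_velocity s t z) powr p + indicator S z)"
    using LpD(2)[OF slab_Lp] by (intro Bochner_Integration.integrable_add)
  \<comment> \<open>Wherever the norm exceeds \<open>1\<close> it is bounded by its \<open>p\<close>-th power; elsewhere the bounded support helps.\<close>
  have "norm (slab_velocity s t z) \<le> norm (slab_velocity s t z) powr p + indicator S z" for z
  proof (cases "z \<in> S")
    case True
    show ?thesis
    proof (cases "norm (slab_velocity s t z) \<le> 1")
      case False
      then have "norm (slab_velocity s t z) powr 1 \<le> norm (slab_velocity s t z) powr p" by (intro powr_mono) auto
      then show ?thesis using False True by simp
    next
      case le: True
      show ?thesis using True le by (simp add: add_increasing)
    qed
  next
    case False
    have "slab_velocity s t z = 0"
    proof (cases "fst z \<in> \<Omega>")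
      case True
      then have "snd z \<notin> {s..t}" using False R[OF True] by (cases z) (auto simp: S_def)
      then show ?thesis by (auto simp: slab_velocity_def indicator_def)
    next
      case False
      then show ?thesis using F_outside(1)[of "fst z" "snd z"] by (simp add: slab_velocity_def)
    qed
    then show ?thesis by simp
  qed
  then have "AE z in lborel. norm (slab_velocity s t z) \<le> norm (norm (slab_velocity s t z) powr p + indicator S z)"
    by (intro AE_I2) (simp only: real_norm_def, rule order_trans[OF _ abs_ge_self])
  then show ?thesis by (intro Bochner_Integration.integrable_bound[OF 1]) (use slab_measurable in simp)
qed

lemma D_slices:
  "AE \<tau> in lborel. (\<lambda>x. F (x, \<tau>)) \<in> Lp lborel p"
  "integrable lborel (\<lambda>\<tau>. indicator {s<..<t} \<tau> * D \<tau>)"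
  "(LINT \<tau>|lborel. indicator {s<..<t} \<tau> * D \<tau>) = pint lborel p (slab_velocity s t)"
proof -
  have e: "norm (slab_velocity s t (x, \<tau>)) powr p = indicator {s<..<t} \<tau> * norm (F (x, \<tau>)) powr p" for s t x \<tau>
    by (auto simp: slab_velocity_def indicator_def)
  note Fu = Fubini_time[OF LpD(2)[OF slab_Lp]]
  have "AE \<tau> in lborel. \<forall>n::nat. integrable lborel (\<lambda>x. norm (slab_velocity 0 (real n) (x, \<tau>)) powr p)"
    unfolding AE_all_countable using Fu(1) by blast
  then show "AE \<tau> in lborel. (\<lambda>x. F (x, \<tau>)) \<in> Lp lborel p"
  proof eventually_elim
    case (elim \<tau>)
    show ?case
    proof (cases "0 < \<tau>")
      case True
      obtain n where n: "\<tau> < real n" using reals_Archimedean2 by blast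
      have "integrable lborel (\<lambda>x. norm (F (x, \<tau>)) powr p)" using elim[rule_format, of n] n True by (simp add: e)
      then show ?thesis by (intro LpI) auto
    next
      case False
      then show ?thesis using F_outside(2)[of \<tau>] by simp
    qed
  qed
  show "integrable lborel (\<lambda>\<tau>. indicator {s<..<t} \<tau> * D \<tau>)"
    using Fu(2)[of s t] by (simp add: e D_def pint_def)
  show "(LINT \<tau>|lborel. indicator {s<..<t} \<tau> * D \<tau>) = pint lborel p (slab_velocity s t)"
    using Fu(3)[of s t] by (simp add: e D_def pint_def)
qed

definition increment :: "real \<Rightarrow> real \<Rightarrow> real ^ 'n \<Rightarrow> real ^ 'm" where
  "increment s t x = (LINT \<tau>|lborel. indicator {s<..<t} \<tau> *\<^sub>R F (x, \<tau>))"

lemma increment_integrable: "integrable lborel (increment s t)"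
  using Fubini_space(2)[OF slab_integrable[of s t]] by (simp add: slab_velocity_def increment_def[abs_def])

lemma increment_outside: "x \<notin> \<Omega> \<Longrightarrow> increment s t x = 0"
  by (simp add: increment_def F_outside)

lemma test_fun_product:
  fixes \<eta> :: "real ^ 'n \<Rightarrow> real" and \<theta> :: "real \<Rightarrow> real"
  assumes \<eta>: "test_fun \<Omega> \<eta>" and \<theta>: "test_fun {0<..} \<theta>"
  shows "test_fun (\<Omega> \<times> {0<..}) (\<lambda>z. \<eta> (fst z) * \<theta> (snd z))"
    "frechet_derivative (\<lambda>z. \<eta> (fst z) * \<theta> (snd z)) (at (x, t)) (0, 1) = \<eta> x * frechet_derivative \<theta> (at t) 1"
proof -
  obtain K where K: "compact K" "K \<subseteq> \<Omega>" "\<And>x. x \<notin> K \<Longrightarrow> \<eta> x = 0" using \<eta> by (metis test_funE)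
  obtain L where L: "compact L" "L \<subseteq> {0<..}" "\<And>x. x \<notin> L \<Longrightarrow> \<theta> x = 0" using \<theta> by (metis test_funE)
  show "test_fun (\<Omega> \<times> {0<..}) (\<lambda>z. \<eta> (fst z) * \<theta> (snd z))"
  proof (rule test_funI[of _ "K \<times> L"])
    show "smooth_fun (\<lambda>z::(real^'n) \<times> real. \<eta> (fst z) * \<theta> (snd z))"
      by (intro smooth_fun_mult smooth_fun_compose_linear[OF bounded_linear_fst] smooth_fun_compose_linear[OF bounded_linear_snd]
          test_fun_smooth[OF \<eta>] test_fun_smooth[OF \<theta>])
    show "\<eta> (fst z) * \<theta> (snd z) = 0" if "z \<notin> K \<times> L" for z
      using that K(3)[of "fst z"] L(3)[of "snd z"] by (cases z) auto
  qed (use K(1,2) L(1,2) in \<open>auto intro: compact_Times\<close>)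
  note d1 = smooth_fun_has_derivative[OF test_fun_smooth[OF \<eta>], of x] and d2 = smooth_fun_has_derivative[OF test_fun_smooth[OF \<theta>], of t]
  have "((\<lambda>z. \<eta> (fst z)) has_derivative (\<lambda>h. frechet_derivative \<eta> (at x) (fst h))) (at (x, t))"
    by (rule has_derivative_compose[of fst fst "(x, t)"]) (use d1 in \<open>auto intro: derivative_eq_intros\<close>)
  moreover have "((\<lambda>z. \<theta> (snd z)) has_derivative (\<lambda>h. frechet_derivative \<theta> (at t) (snd h))) (at (x, t))"
    by (rule has_derivative_compose[of snd snd "(x, t)"]) (use d2 in \<open>auto intro: derivative_eq_intros\<close>)
  ultimately have "((\<lambda>z. \<eta> (fst z) * \<theta> (snd z)) has_derivative
     (\<lambda>h. \<eta> x * frechet_derivative \<theta> (at t) (snd h) + frechet_derivative \<eta> (at x) (fst h) * \<theta> t)) (at (x, t))"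
    using has_derivative_mult by fastforce
  from frechet_derivative_at[OF this, symmetric]
  show "frechet_derivative (\<lambda>z. \<eta> (fst z) * \<theta> (snd z)) (at (x, t)) (0, 1) = \<eta> x * frechet_derivative \<theta> (at t) 1"
    using linear_0[OF has_derivative_linear[OF d1]] by simp
qed

text \<open>
  Weak differentiation in space-time, applied to products of test functions in space and in time,
  says that the scalar product of \<open>v t\<close> with a fixed test function has a weak derivative in time.
\<close>

lemma tested_increment:
  fixes \<eta> :: "real ^ 'n \<Rightarrow> real"
  assumes \<eta>: "test_fun \<Omega> \<eta>" and st: "0 \<le> s" "s < t"
  shows "(LINT x|M. \<eta> x *\<^sub>R v t x) - (LINT x|M. \<eta> x *\<^sub>R v s x) = (LINT x|lborel. \<eta> x *\<^sub>R increment s t x)"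
proof -
  define U where "U = \<Omega> \<times> {0::real<..}"
  have U: "open U" "U \<in> sets lebesgue" using cylinder_open(1) by (auto simp: U_def)
  have \<eta>m [measurable]: "\<eta> \<in> borel_measurable borel" using test_fun_continuous[OF \<eta>] by (rule borel_measurable_continuous_onI)
  obtain B where B: "0 < B" "\<And>x. norm (\<eta> x) \<le> B" using test_fun_bounded[OF \<eta>] by metis
  obtain V where V: "V \<in> borel_measurable borel" "\<And>z. z \<notin> U \<Longrightarrow> V z = 0"
     "AE z in lborel. z \<in> U \<longrightarrow> (\<lambda>(x, t). v t x) z = V z"
    by (rule loc_integrable_ex_borel[OF cylinder_open(1) has_weak_derivD(1)[OF weak_dt], folded U_def]) (rule that)
  have Vm [measurable]: "V \<in> borel_measurable (borel \<Otimes>\<^sub>M borel)" using V(1) by (simp add: borel_prod)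
  define f where "f t = (LINT x|M. \<eta> x *\<^sub>R v t x)" for t
  define k where "k \<tau> = (LINT x|lborel. \<eta> x *\<^sub>R F (x, \<tau>))" for \<tau>
  have f: "continuous_on {0..} f"
    unfolding continuous_on_def
  proof
    fix a :: real assume a: "a \<in> {0..}"
    have seq: "(\<lambda>n. f (X n)) \<longlonglongrightarrow> f a" if X: "\<And>n. X n \<in> {0..}" "(\<lambda>n. X n) \<longlonglongrightarrow> a" for X
    proof -
      have "(\<lambda>n. pnorm M p (\<lambda>x. v (X n) x - v a x)) \<longlonglongrightarrow> 0"
      proof -
        have c: "continuous_on {0..} (\<lambda>r. r)" by simp
        have g: "((\<lambda>s. pnorm M p (\<lambda>x. v s x - v a x)) \<longlongrightarrow> (\<lambda>s. pnorm M p (\<lambda>x. v s x - v a x)) a) (at a within {0..})"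
          using v_continuous[of a] a by (simp add: pnorm_def pint_def)
        then have "continuous (at a within {0..}) (\<lambda>s. pnorm M p (\<lambda>x. v s x - v a x))" by (simp add: continuous_within)
        from continuous_within_tendsto_compose'[OF this X(1) X(2)]
        show ?thesis by (simp add: pnorm_def pint_def)
      qed
      then show ?thesis unfolding f_def using X(1) a by (intro Lp_limit_of_integrals[OF v_Lp v_Lp _ \<eta>]) auto
    qed
    then have "continuous (at a within {0..}) f"
      using a by (intro continuous_within_sequentiallyI) auto
    then show "(f \<longlongrightarrow> f a) (at a within {0..})" by (simp add: continuous_within)
  qed
  have prod_slab: "integrable lborel (\<lambda>z. \<eta> (fst z) *\<^sub>R slab_velocity s t z)" for s t
  proof (rule Bochner_Integration.integrable_bound)
    show "integrable lborel (\<lambda>z. B * norm (slab_velocity s t z))" using slab_integrable by simp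
    have "(\<lambda>z. \<eta> (fst z) *\<^sub>R slab_velocity s t z) \<in> borel_measurable (borel \<Otimes>\<^sub>M borel)" unfolding slab_velocity_def by measurable
    then show "(\<lambda>z. \<eta> (fst z) *\<^sub>R slab_velocity s t z) \<in> borel_measurable lborel" by (simp add: borel_prod)
    show "AE z in lborel. norm (\<eta> (fst z) *\<^sub>R slab_velocity s t z) \<le> norm (B * norm (slab_velocity s t z))"
      using B by (intro AE_I2) (auto intro: mult_right_mono)
  qed
  have inner: "(LINT x|lborel. \<eta> x *\<^sub>R slab_velocity s t (x, \<tau>)) = indicator {s<..<t} \<tau> *\<^sub>R k \<tau>" for s t \<tau>
    by (auto simp: slab_velocity_def k_def indicator_def)
  have k: "integrable lborel (\<lambda>\<tau>. indicator {0<..<T} \<tau> *\<^sub>R k \<tau>)" for T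
    using Fubini_time(2)[OF prod_slab[of 0 T]] by (simp add: inner)
  have weak: "(LINT r|lborel. frechet_derivative \<theta> (at r) 1 *\<^sub>R f r) = - (LINT r|lborel. \<theta> r *\<^sub>R k r)"
    if \<theta>: "test_fun {0<..} \<theta>" for \<theta> :: "real \<Rightarrow> real"
  proof -
    define \<phi> where "\<phi> z = \<eta> (fst z) * \<theta> (snd z)" for z :: "(real^'n) \<times> real"
    define \<theta>' where "\<theta>' r = frechet_derivative \<theta> (at r) 1" for r
    have \<phi>: "test_fun U \<phi>" unfolding U_def \<phi>_def by (rule test_fun_product[OF \<eta> \<theta>])
    have d\<phi>: "frechet_derivative \<phi> (at z) (0, 1) = \<eta> (fst z) * \<theta>' (snd z)" for z
      using test_fun_product(2)[OF \<eta> \<theta>, of "fst z" "snd z"] by (simp add: \<phi>_def[abs_def] \<theta>'_def)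
    note d\<phi>t = test_fun_derivative[OF \<phi>, of "(0, 1)"]
    have cont: "continuous_on UNIV \<phi>" "continuous_on UNIV (\<lambda>z. frechet_derivative \<phi> (at z) (0, 1))"
      using \<phi> d\<phi>t by (auto intro: test_fun_continuous)
    have \<theta>m [measurable]: "\<theta> \<in> borel_measurable borel" "\<theta>' \<in> borel_measurable borel"
      using test_fun_continuous[OF \<theta>] test_fun_continuous[OF test_fun_derivative[OF \<theta>, of 1]]
      by (auto simp: \<theta>'_def[abs_def] intro: borel_measurable_continuous_onI)
    have \<theta>'0: "\<theta>' r = 0" if "r \<le> 0" for r
      using \<theta> that unfolding \<theta>'_def by (metis test_funE subsetD greaterThan_iff not_le)
    have weq: "(LINT z|lebesgue_on U. frechet_derivative \<phi> (at z) (0, 1) *\<^sub>R (\<lambda>(x, t). v t x) z) = - (LINT z|lebesgue_on U. \<phi> z *\<^sub>R (\<lambda>(x, t). vt t x) z)"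
      using has_weak_derivD(3)[OF weak_dt, folded U_def, OF \<phi>] .
    have r1: "(LINT z|lebesgue_on U. \<phi> z *\<^sub>R (\<lambda>(x, t). vt t x) z) = (LINT z|lborel. \<phi> z *\<^sub>R F z)"
      "integrable lborel (\<lambda>z. \<phi> z *\<^sub>R F z)"
    proof -
      have a: "(\<lambda>z. \<phi> z *\<^sub>R F z) \<in> borel_measurable borel"
        by (rule borel_measurable_scaleR[OF borel_measurable_continuous_onI[OF cont(1)] F_props(1)])
      have b: "\<phi> z *\<^sub>R F z = 0" if "z \<notin> U" for z using F_props(2) that by (simp add: U_def)
      have c: "AE z in lborel. z \<in> U \<longrightarrow> \<phi> z *\<^sub>R (\<lambda>(x, t). vt t x) z = \<phi> z *\<^sub>R F z"
        using F_props(3) unfolding U_def by eventually_elim auto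
      note ir = integral_representative[OF U(1) a b c]
      show "(LINT z|lebesgue_on U. \<phi> z *\<^sub>R (\<lambda>(x, t). vt t x) z) = (LINT z|lborel. \<phi> z *\<^sub>R F z)" by (rule ir(1))
      show "integrable lborel (\<lambda>z. \<phi> z *\<^sub>R F z)"
        using ir(2) loc_integrable_mult[OF has_weak_derivD(2)[OF weak_dt, folded U_def] U(2) \<phi>] by blast
    qed
    have r2: "(LINT z|lebesgue_on U. frechet_derivative \<phi> (at z) (0, 1) *\<^sub>R (\<lambda>(x, t). v t x) z) = (LINT z|lborel. frechet_derivative \<phi> (at z) (0, 1) *\<^sub>R V z)"
      "integrable lborel (\<lambda>z. frechet_derivative \<phi> (at z) (0, 1) *\<^sub>R V z)"
    proof -
      have a: "(\<lambda>z. frechet_derivative \<phi> (at z) (0, 1) *\<^sub>R V z) \<in> borel_measurable borel"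
        by (rule borel_measurable_scaleR[OF borel_measurable_continuous_onI[OF cont(2)] V(1)])
      have b: "frechet_derivative \<phi> (at z) (0, 1) *\<^sub>R V z = 0" if "z \<notin> U" for z using V(2) that by simp
      have c: "AE z in lborel. z \<in> U \<longrightarrow> frechet_derivative \<phi> (at z) (0, 1) *\<^sub>R (\<lambda>(x, t). v t x) z = frechet_derivative \<phi> (at z) (0, 1) *\<^sub>R V z"
        using V(3) by eventually_elim auto
      note ir = integral_representative[OF U(1) a b c]
      show "(LINT z|lebesgue_on U. frechet_derivative \<phi> (at z) (0, 1) *\<^sub>R (\<lambda>(x, t). v t x) z) = (LINT z|lborel. frechet_derivative \<phi> (at z) (0, 1) *\<^sub>R V z)"
        by (rule ir(1))
      show "integrable lborel (\<lambda>z. frechet_derivative \<phi> (at z) (0, 1) *\<^sub>R V z)"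
        using ir(2) loc_integrable_mult[OF has_weak_derivD(1)[OF weak_dt, folded U_def] U(2) d\<phi>t] by blast
    qed
    have "(LINT z|lborel. \<phi> z *\<^sub>R F z) = (LINT r|lborel. LINT x|lborel. \<phi> (x, r) *\<^sub>R F (x, r))"
      by (rule Fubini_time(3)[OF r1(2), symmetric])
    also have "\<dots> = (LINT r|lborel. \<theta> r *\<^sub>R k r)"
    proof (rule Bochner_Integration.integral_cong[OF refl])
      fix r
      have "(LINT x|lborel. \<phi> (x, r) *\<^sub>R F (x, r)) = (LINT x|lborel. \<theta> r *\<^sub>R (\<eta> x *\<^sub>R F (x, r)))"
        by (simp add: \<phi>_def mult.commute)
      then show "(LINT x|lborel. \<phi> (x, r) *\<^sub>R F (x, r)) = \<theta> r *\<^sub>R k r" by (simp only: k_def integral_scaleR_right)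
    qed
    finally have R: "(LINT z|lborel. \<phi> z *\<^sub>R F z) = (LINT r|lborel. \<theta> r *\<^sub>R k r)" .
    have e: "(LINT x|lborel. frechet_derivative \<phi> (at (x, r)) (0, 1) *\<^sub>R V (x, r)) = \<theta>' r *\<^sub>R (LINT x|lborel. \<eta> x *\<^sub>R V (x, r))" for r
    proof -
      have "(LINT x|lborel. frechet_derivative \<phi> (at (x, r)) (0, 1) *\<^sub>R V (x, r)) = (LINT x|lborel. \<theta>' r *\<^sub>R (\<eta> x *\<^sub>R V (x, r)))"
        by (simp add: d\<phi> mult.commute)
      then show ?thesis by (simp only: integral_scaleR_right)
    qed
    have "(LINT z|lborel. frechet_derivative \<phi> (at z) (0, 1) *\<^sub>R V z) = (LINT r|lborel. \<theta>' r *\<^sub>R (LINT x|lborel. \<eta> x *\<^sub>R V (x, r)))"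
      using Fubini_time(3)[OF r2(2)] by (simp only: e)
    also have "\<dots> = (LINT r|lborel. \<theta>' r *\<^sub>R f r)"
    proof (rule integral_cong_AE)
      show "(\<lambda>r. \<theta>' r *\<^sub>R (LINT x|lborel. \<eta> x *\<^sub>R V (x, r))) \<in> borel_measurable lborel"
        using borel_measurable_integrable[OF Fubini_time(2)[OF r2(2)]] by (simp only: e)
      have "continuous_on UNIV (\<lambda>r. f (max 0 r))"
        by (intro continuous_on_compose2[OF f] continuous_intros) auto
      then have "(\<lambda>r. \<theta>' r *\<^sub>R f (max 0 r)) \<in> borel_measurable borel"
        by (intro borel_measurable_scaleR \<theta>m borel_measurable_continuous_onI)
      also have "(\<lambda>r. \<theta>' r *\<^sub>R f (max 0 r)) = (\<lambda>r. \<theta>' r *\<^sub>R f r)"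
      proof
        fix r show "\<theta>' r *\<^sub>R f (max 0 r) = \<theta>' r *\<^sub>R f r"
          using \<theta>'0[of r] by (cases "r \<le> 0") auto
      qed
      finally show "(\<lambda>r. \<theta>' r *\<^sub>R f r) \<in> borel_measurable lborel" by simp
      show "AE r in lborel. \<theta>' r *\<^sub>R (LINT x|lborel. \<eta> x *\<^sub>R V (x, r)) = \<theta>' r *\<^sub>R f r"
        using AE_time_slices[OF V(3)]
      proof eventually_elim
        case (elim r)
        show ?case
        proof (cases "r \<le> 0")
          case True then show ?thesis by (simp add: \<theta>'0)
        next
          case False
          have "(LINT x|M. \<eta> x *\<^sub>R v r x) = (LINT x|lborel. \<eta> x *\<^sub>R V (x, r))"
          proof (rule integral_representative(1)[OF open_set])
            show "(\<lambda>x. \<eta> x *\<^sub>R V (x, r)) \<in> borel_measurable borel" by measurable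
            show "\<eta> x *\<^sub>R V (x, r) = 0" if "x \<notin> \<Omega>" for x using V(2)[of "(x, r)"] that by (simp add: U_def)
            show "AE x in lborel. x \<in> \<Omega> \<longrightarrow> \<eta> x *\<^sub>R v r x = \<eta> x *\<^sub>R V (x, r)"
              using elim False by (auto simp: U_def elim!: eventually_mono)
          qed
          then show ?thesis by (simp add: f_def)
        qed
      qed
    qed
    finally show ?thesis using weq r1(1) r2(1) R by (simp add: \<theta>'_def)
  qed
  have "f t - f s = (LINT r|lborel. indicator {s<..<t} r *\<^sub>R k r)"
    by (rule weak_derivative_in_time[OF f k weak st])
  also have "\<dots> = (LINT z|lborel. \<eta> (fst z) *\<^sub>R slab_velocity s t z)"
    using Fubini_time(3)[OF prod_slab[of s t]] by (simp add: inner)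
  also have "\<dots> = (LINT x|lborel. \<eta> x *\<^sub>R increment s t x)"
  proof -
    have "(LINT \<tau>|lborel. \<eta> x *\<^sub>R slab_velocity s t (x, \<tau>)) = \<eta> x *\<^sub>R increment s t x" for x
      unfolding increment_def slab_velocity_def snd_conv by (rule integral_scaleR_right)
    then show ?thesis using Fubini_space(3)[OF prod_slab[of s t]] by (simp only: fst_conv)
  qed
  finally show ?thesis by (simp add: f_def)
qed

text \<open>
  The fundamental theorem of calculus for the trajectory, at almost every point of space for any two
  given times.
\<close>

lemma v_increment:
  assumes st: "0 \<le> s" "s < t"
  shows "AE x in lborel. x \<in> \<Omega> \<longrightarrow> v t x - v s x = increment s t x"
proof -
  have Wm: "increment s t \<in> borel_measurable borel" using borel_measurable_integrable[OF increment_integrable[of s t]] by simp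
  have Wi: "integrable lebesgue (increment s t)"
    using increment_integrable Wm by (subst integrable_completion) auto
  have Wl: "loc_integrable \<Omega> (increment s t)"
    unfolding loc_integrable_def set_integrable_def
    using Wi by (auto intro!: integrable_mult_indicator simp: lmeasurable_compact fmeasurableD)
  have vl: "loc_integrable \<Omega> (v r)" if "0 \<le> r" for r by (rule Lp_loc_integrable[OF v_Lp[OF that]])
  have l: "loc_integrable \<Omega> (\<lambda>x. (v t x + (-1) *\<^sub>R v s x) + (-1) *\<^sub>R increment s t x)"
    using st by (intro loc_integrable_add loc_integrable_scaleR vl Wl) auto
  have "AE x in lborel. x \<in> \<Omega> \<longrightarrow> (v t x + (-1) *\<^sub>R v s x) + (-1) *\<^sub>R increment s t x = 0"
  proof (rule fundamental_lemma[OF open_set l])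
    fix \<eta> :: "real ^ 'n \<Rightarrow> real" assume \<eta>: "test_fun \<Omega> \<eta>"
    note i = loc_integrable_mult[OF vl set_lebesgue \<eta>] loc_integrable_mult[OF Wl set_lebesgue \<eta>]
    have "(LINT x|M. \<eta> x *\<^sub>R increment s t x) = (LINT x|lborel. \<eta> x *\<^sub>R increment s t x)"
    proof (rule integral_representative(1)[OF open_set])
      show "(\<lambda>x. \<eta> x *\<^sub>R increment s t x) \<in> borel_measurable borel"
        by (rule borel_measurable_scaleR[OF borel_measurable_continuous_onI[OF test_fun_continuous[OF \<eta>]] Wm])
    qed (auto simp: increment_outside)
    then have "(LINT x|M. \<eta> x *\<^sub>R v t x) - (LINT x|M. \<eta> x *\<^sub>R v s x) - (LINT x|M. \<eta> x *\<^sub>R increment s t x) = 0"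
      using tested_increment[OF \<eta> st] by simp
    also have "(LINT x|M. \<eta> x *\<^sub>R v t x) - (LINT x|M. \<eta> x *\<^sub>R v s x) - (LINT x|M. \<eta> x *\<^sub>R increment s t x)
      = (LINT x|M. \<eta> x *\<^sub>R v t x - \<eta> x *\<^sub>R v s x - \<eta> x *\<^sub>R increment s t x)"
      using i(1)[of t] i(1)[of s] i(2) st by simp
    also have "(\<lambda>x. \<eta> x *\<^sub>R v t x - \<eta> x *\<^sub>R v s x - \<eta> x *\<^sub>R increment s t x) = (\<lambda>x. \<eta> x *\<^sub>R ((v t x + (-1) *\<^sub>R v s x) + (-1) *\<^sub>R increment s t x))"
      by (auto simp: algebra_simps)
    finally show "(LINT x|M. \<eta> x *\<^sub>R ((v t x + (-1) *\<^sub>R v s x) + (-1) *\<^sub>R increment s t x)) = 0" .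
  qed
  then show ?thesis by eventually_elim auto
qed

text \<open>
  Jensen's inequality in time, applied to \<open>v_increment\<close> at almost every point of space.
\<close>

lemma pint_increment:
  assumes st: "0 \<le> s" "s < t"
  shows "pint M p (\<lambda>x. v t x - v s x) \<le> (t - s) powr (p - 1) * (LINT \<tau>|lborel. indicator {s<..<t} \<tau> * D \<tau>)"
proof -
  define N where "N = restrict_space lborel {s<..<t}"
  have spN: "space N = {s<..<t}" by (simp add: N_def space_restrict_space)
  have emN: "emeasure N (space N) = ennreal (t - s)"
    using st by (simp add: spN N_def emeasure_restrict_space)
  then have mN: "measure N (space N) = t - s" using st by (simp add: measure_def)
  have fN: "finite_measure N" by (rule finite_measureI) (simp add: emN)
  have Wm: "increment s t \<in> borel_measurable borel" using borel_measurable_integrable[OF increment_integrable[of s t]] by simp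
  note Fu = Fubini_space[OF LpD(2)[OF slab_Lp[of s t]]]
  have ae: "AE x in lborel. norm (increment s t x) powr p \<le> (t - s) powr (p - 1) * (LINT \<tau>|lborel. norm (slab_velocity s t (x, \<tau>)) powr p)"
    using Fu(1)
  proof eventually_elim
    case (elim x)
    have e: "norm (slab_velocity s t (x, \<tau>)) powr p = indicator {s<..<t} \<tau> *\<^sub>R (norm (F (x, \<tau>)) powr p)" for \<tau>
      by (auto simp: slab_velocity_def indicator_def)
    have L: "(\<lambda>\<tau>. F (x, \<tau>)) \<in> Lp N p"
    proof (rule LpI)
      show "(\<lambda>\<tau>. F (x, \<tau>)) \<in> borel_measurable N" unfolding N_def by (intro measurable_restrict_space1) simp
      show "integrable N (\<lambda>\<tau>. norm (F (x, \<tau>)) powr p)"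
        using elim unfolding N_def e by (subst integrable_restrict_space) auto
    qed
    have "(LINT \<tau>|N. F (x, \<tau>)) = increment s t x"
      unfolding N_def increment_def by (subst integral_restrict_space) auto
    moreover have "pint N p (\<lambda>\<tau>. F (x, \<tau>)) = (LINT \<tau>|lborel. norm (slab_velocity s t (x, \<tau>)) powr p)"
      unfolding pint_def N_def e by (subst integral_restrict_space) auto
    ultimately have "norm ((1 / (t - s)) *\<^sub>R increment s t x) powr p \<le> (1 / (t - s)) * (LINT \<tau>|lborel. norm (slab_velocity s t (x, \<tau>)) powr p)"
      using average_powr_le[OF fN _ L p_gt_1] st by (simp add: mN)
    then have "(t - s) powr p * norm ((1 / (t - s)) *\<^sub>R increment s t x) powr p \<le> (t - s) powr p * ((1 / (t - s)) * (LINT \<tau>|lborel. norm (slab_velocity s t (x, \<tau>)) powr p))"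
      by (intro mult_left_mono) auto
    moreover have "(t - s) powr p * norm ((1 / (t - s)) *\<^sub>R increment s t x) powr p = norm (increment s t x) powr p"
      using st by (simp add: powr_mult[symmetric])
    moreover have "(t - s) powr p * (1 / (t - s)) = (t - s) powr (p - 1)"
      using st by (simp add: powr_diff)
    ultimately show ?case by (simp only: mult.assoc[symmetric])
  qed
  have WL: "increment s t \<in> Lp lborel p"
    using ae Fu(2) Wm by (intro Lp_bound[OF _ integrable_mult_right[OF Fu(2)]]) auto
  have "pint M p (\<lambda>x. v t x - v s x) = pint lborel p (increment s t)"
    unfolding pint_def
  proof (rule integral_representative(1)[OF open_set])
    show "AE x in lborel. x \<in> \<Omega> \<longrightarrow> norm (v t x - v s x) powr p = norm (increment s t x) powr p"
      using v_increment[OF st] by eventually_elim auto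
  qed (use Wm in \<open>auto simp: increment_outside\<close>)
  also have "\<dots> \<le> (LINT x|lborel. (t - s) powr (p - 1) * (LINT \<tau>|lborel. norm (slab_velocity s t (x, \<tau>)) powr p))"
    unfolding pint_def by (rule integral_mono_AE[OF LpD(2)[OF WL] integrable_mult_right[OF Fu(2)] ae])
  also have "\<dots> = (t - s) powr (p - 1) * pint lborel p (slab_velocity s t)"
    using Fu(3) by (simp add: pint_def)
  finally show ?thesis by (simp add: D_slices(3))
qed

end


section \<open>The duality pairing\<close>

text \<open>
  The duality field \<open>norm a powr (p - 2) *\<^sub>R a\<close> of \<open>a\<close>, integrated against \<open>b\<close>. Up to the factor \<open>p\<close>
  this is the derivative of \<open>pint\<close> at \<open>a\<close> in direction \<open>b\<close>.
\<close>

definition dual_pairing :: "'a measure \<Rightarrow> real \<Rightarrow> ('a \<Rightarrow> 'b::euclidean_space) \<Rightarrow> ('a \<Rightarrow> 'b) \<Rightarrow> real" where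
  "dual_pairing M p a b = (LINT x|M. (norm (a x) powr (p - 2) *\<^sub>R a x) \<bullet> b x)"

lemma dual_field_bound:
  fixes a b :: "'b::euclidean_space"
  shows "\<bar>(norm a powr (p - 2) *\<^sub>R a) \<bullet> b\<bar> \<le> norm a powr (p - 1) * norm b"
proof (cases "a = 0")
  case False
  have "norm (norm a powr (p - 2) *\<^sub>R a) = norm a powr (p - 2) * norm a powr 1" using False by simp
  also have "\<dots> = norm a powr (p - 1)" by (simp only: powr_add[symmetric]) simp
  finally show ?thesis using Cauchy_Schwarz_ineq2[of "norm a powr (p - 2) *\<^sub>R a" b] by simp
qed simp

lemma dual_pairing_integrable:
  fixes a b :: "'a \<Rightarrow> 'b::euclidean_space"
  assumes p: "1 < p" and a: "a \<in> Lp M p" and b: "b \<in> Lp M p"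
  shows "integrable M (\<lambda>x. (norm (a x) powr (p - 2) *\<^sub>R a x) \<bullet> b x)"
proof (rule Bochner_Integration.integrable_bound[OF Hoelder(1)[OF a b p]])
  show "(\<lambda>x. (norm (a x) powr (p - 2) *\<^sub>R a x) \<bullet> b x) \<in> borel_measurable M"
    using LpD(1)[OF a] LpD(1)[OF b] by measurable
  show "AE x in M. norm ((norm (a x) powr (p - 2) *\<^sub>R a x) \<bullet> b x) \<le> norm (norm (a x) powr (p - 1) * norm (b x))"
    using dual_field_bound[of "a _" p] by (intro AE_I2) (simp del: inner_scaleR_left)
qed

lemma dual_pairing_bound:
  fixes a b :: "'a \<Rightarrow> 'b::euclidean_space"
  assumes p: "1 < p" and a: "a \<in> Lp M p" and b: "b \<in> Lp M p"
  shows "\<bar>dual_pairing M p a b\<bar> \<le> pnorm M p a powr (p - 1) * pnorm M p b"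
proof -
  have "norm (dual_pairing M p a b) \<le> (LINT x|M. norm ((norm (a x) powr (p - 2) *\<^sub>R a x) \<bullet> b x))"
    unfolding dual_pairing_def by (rule integral_norm_bound)
  also have "\<dots> \<le> (LINT x|M. norm (a x) powr (p - 1) * norm (b x))"
  proof (rule integral_mono[OF integrable_norm[OF dual_pairing_integrable[OF p a b]] Hoelder(1)[OF a b p]])
    show "norm ((norm (a x) powr (p - 2) *\<^sub>R a x) \<bullet> b x) \<le> norm (a x) powr (p - 1) * norm (b x)" for x
      using dual_field_bound[of "a x" p "b x"] by (simp del: inner_scaleR_left)
  qed
  also have "\<dots> \<le> pnorm M p a powr (p - 1) * pnorm M p b" by (rule Hoelder(2)[OF a b p])
  finally show ?thesis by simp
qed

lemma dual_pairing_diff: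
  fixes a b c :: "'a \<Rightarrow> 'b::euclidean_space"
  assumes p: "1 < p" and "a \<in> Lp M p" "b \<in> Lp M p" "c \<in> Lp M p"
  shows "dual_pairing M p a (\<lambda>x. b x - c x) = dual_pairing M p a b - dual_pairing M p a c"
  unfolding dual_pairing_def inner_diff_right
  by (rule Bochner_Integration.integral_diff[OF dual_pairing_integrable[OF assms(1,2,3)] dual_pairing_integrable[OF assms(1,2,4)]])

lemma dual_pairing_self:
  fixes a :: "'a \<Rightarrow> 'b::euclidean_space"
  shows "dual_pairing M p a a = pint M p a"
proof -
  have "(norm y powr (p - 2) *\<^sub>R y) \<bullet> y = norm y powr p" for y :: 'b
  proof (cases "y = 0")
    case False
    have "(norm y powr (p - 2) *\<^sub>R y) \<bullet> y = norm y powr (p - 2) * norm y powr 2"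
      using False by (simp add: power2_norm_eq_inner[symmetric] powr_numeral)
    then show ?thesis by (simp only: powr_add[symmetric]) simp
  qed simp
  then show ?thesis by (simp only: dual_pairing_def pint_def)
qed

text \<open>
  The subgradient inequality for the convex functional \<open>pint\<close>, with the pairing of \<open>a\<close> with itself
  already evaluated; pointwise it is Young's inequality.
\<close>

lemma dual_pairing_convex:
  fixes a b :: "'a \<Rightarrow> 'b::euclidean_space"
  assumes p: "1 < p" and a: "a \<in> Lp M p" and b: "b \<in> Lp M p"
  shows "p * dual_pairing M p a b \<le> pint M p b + (p - 1) * pint M p a"
proof -
  have pt: "p * ((norm x powr (p - 2) *\<^sub>R x) \<bullet> y) \<le> norm y powr p + (p - 1) * norm x powr p" for x y :: 'b
  proof -
    have "1 / p + 1 / (p / (p - 1)) = 1" using p by (simp add: field_simps)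
    from Youngs_inequality[OF p _ this, of "norm y" "norm x powr (p - 1)"]
    have "norm y * norm x powr (p - 1) \<le> norm y powr p / p + norm x powr p / (p / (p - 1))"
      using p by (simp add: powr_powr)
    then have "p * (norm y * norm x powr (p - 1)) \<le> p * (norm y powr p / p + norm x powr p / (p / (p - 1)))"
      using p by (intro mult_left_mono) auto
    also have "\<dots> = norm y powr p + (p - 1) * norm x powr p"
      using p by (simp add: field_simps)
    finally have 1: "p * (norm x powr (p - 1) * norm y) \<le> norm y powr p + (p - 1) * norm x powr p" by (simp only: mult.commute)
    have "(norm x powr (p - 2) *\<^sub>R x) \<bullet> y \<le> norm x powr (p - 1) * norm y"
      using order_trans[OF abs_ge_self dual_field_bound[of x p y]] .
    then have "p * ((norm x powr (p - 2) *\<^sub>R x) \<bullet> y) \<le> p * (norm x powr (p - 1) * norm y)"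
      by (rule mult_left_mono) (use p in simp)
    then show ?thesis using 1 by (rule order_trans)
  qed
  have "p * dual_pairing M p a b = (LINT x|M. p * ((norm (a x) powr (p - 2) *\<^sub>R a x) \<bullet> b x))"
    unfolding dual_pairing_def by (rule integral_mult_right_zero[symmetric])
  also have "\<dots> \<le> (LINT x|M. norm (b x) powr p + (p - 1) * norm (a x) powr p)"
  proof (rule integral_mono[OF _ _ pt])
    show "integrable M (\<lambda>x. p * ((norm (a x) powr (p - 2) *\<^sub>R a x) \<bullet> b x))"
      by (rule integrable_mult_right[OF dual_pairing_integrable[OF p a b]])
    show "integrable M (\<lambda>x. norm (b x) powr p + (p - 1) * norm (a x) powr p)"
      using LpD(2)[OF a] LpD(2)[OF b] by simp
  qed
  also have "\<dots> = pint M p b + (p - 1) * pint M p a"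
    using LpD(2)[OF a] LpD(2)[OF b] by (simp add: pint_def)
  finally show ?thesis .
qed

lemma dual_pairing_tendsto:
  fixes a c :: "'a \<Rightarrow> 'b::euclidean_space"
  assumes p: "1 < p" and a: "a \<in> Lp M p" and b: "\<And>k. b k \<in> Lp M p" "c \<in> Lp M p" and lim: "(\<lambda>k. pnorm M p (\<lambda>x. b k x - c x)) \<longlonglongrightarrow> 0"
  shows "(\<lambda>k. dual_pairing M p a (b k)) \<longlonglongrightarrow> dual_pairing M p a c"
proof -
  have "(\<lambda>k. dual_pairing M p a (b k) - dual_pairing M p a c) \<longlonglongrightarrow> 0"
  proof (rule Lim_null_comparison[OF always_eventually[OF allI]])
    show "norm (dual_pairing M p a (b k) - dual_pairing M p a c) \<le> pnorm M p a powr (p - 1) * pnorm M p (\<lambda>x. b k x - c x)" for k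
      using dual_pairing_bound[OF p a Lp_diff[OF b(1)[of k] b(2)]] p by (simp add: dual_pairing_diff[OF p a b(1) b(2)])
    show "(\<lambda>k. pnorm M p a powr (p - 1) * pnorm M p (\<lambda>x. b k x - c x)) \<longlonglongrightarrow> 0"
      using tendsto_mult_left[OF lim, of "pnorm M p a powr (p - 1)"] by simp
  qed
  then show ?thesis by (simp add: LIM_zero_iff)
qed

lemma AE_lborel_ex_between:
  fixes a b :: real
  assumes "AE s in lborel. P s" "a < b"
  shows "\<exists>s. a < s \<and> s < b \<and> P s"
proof (rule ccontr)
  assume neg: "\<not> ?thesis"
  have "AE s in lborel. s \<notin> {a<..<b}" using assms(1) by eventually_elim (use neg in auto)
  then have "{a<..<b} \<in> null_sets lborel" by (subst AE_iff_null_sets) auto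
  then show False using assms(2) by (auto simp: null_sets_def)
qed

lemma AE_lborel_translate:
  fixes c :: real
  assumes "AE x in lborel. P x"
  shows "AE x in lborel. P (x - c)"
proof -
  obtain N where N: "{x \<in> space lborel. \<not> P x} \<subseteq> N" "emeasure lborel N = 0" "N \<in> sets lborel"
    by (rule AE_E[OF assms])
  have "emeasure (distr lborel borel ((+) (- c))) N = 0" using N by (simp add: lborel_distr_plus)
  then have "emeasure lborel ((+) (- c) -` N) = 0" using N(3) by (subst (asm) emeasure_distr) auto
  moreover have "(+) (- c) -` N \<in> sets lborel"
    using N(3) measurable_sets[of "(+) (- c)" borel borel N] by auto
  moreover have "{x \<in> space lborel. \<not> P (x - c)} \<subseteq> (+) (- c) -` N" using N(1) by auto
  ultimately show ?thesis by (intro AE_I[where N = "(+) (- c) -` N"]) auto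
qed


section \<open>The energy inequality\<close>

locale evolution = trajectory \<Omega> p v vt
  for \<Omega> :: "(real ^ 'n::finite) set" and p :: real and v vt :: "real \<Rightarrow> real ^ 'n \<Rightarrow> real ^ 'm::finite" +
  assumes bounded_W01p: "\<And>T. 0 < T \<Longrightarrow> v \<in> Linf_W01p \<Omega> p T"
    and equation: "\<And>T w. 0 < T \<Longrightarrow> w \<in> W01p \<Omega> p \<Longrightarrow> AE t in lebesgue_on {0..T}.
      (LINT x|M. (norm (vt t x) powr (p - 2) *\<^sub>R vt t x) \<bullet> w x) +
      (LINT x|M. (norm (wgrad \<Omega> (v t) x) powr (p - 2) *\<^sub>R wgrad \<Omega> (v t) x) \<bullet> wgrad \<Omega> w x) = 0"
begin

text \<open>
  The equation at a single time against a single test function, with the Borel representative of the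
  velocity.
\<close>

definition solves_at :: "real \<Rightarrow> (real ^ 'n \<Rightarrow> real ^ 'm) \<Rightarrow> bool" where
  "solves_at t w \<longleftrightarrow> dual_pairing M p (\<lambda>x. F (x, t)) w + dual_pairing M p (wgrad \<Omega> (v t)) (wgrad \<Omega> w) = 0"

lemma F_slice_Lp:
  assumes "(\<lambda>x. F (x, t)) \<in> Lp lborel p"
  shows "(\<lambda>x. F (x, t)) \<in> Lp M p" "pint M p (\<lambda>x. F (x, t)) = D t" "pnorm M p (\<lambda>x. F (x, t)) = D t powr (1/p)"
  using Lp_lebesgue_on_iff_lborel[OF set_lebesgue F_slice_measurable(1)[of t] F_outside(1), of p] assms
  by (auto simp: D_def pnorm_def)

lemma AE_on_interval: "(AE t in lebesgue_on {0..T::real}. P t) \<longleftrightarrow> (AE t in lborel. 0 \<le> t \<and> t \<le> T \<longrightarrow> P t)"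
  by (subst AE_lebesgue_on_iff) auto

lemma AE_solves_at:
  assumes T: "0 < T" and w: "w \<in> W01p \<Omega> p"
  shows "AE t in lborel. 0 < t \<and> t \<le> T \<longrightarrow> solves_at t w"
  using equation[OF T w, unfolded AE_on_interval] F_slice_eq
proof eventually_elim
  case (elim t)
  show ?case
  proof
    assume t: "0 < t \<and> t \<le> T"
    then have ae: "AE x in M. F (x, t) = vt t x" using elim(2) by (auto elim: eventually_mono)
    have Fm: "(\<lambda>x. F (x, t)) \<in> borel_measurable M"
      by (intro measurable_restrict_space1) (simp add: measurable_completion)
    have vm: "vt t \<in> borel_measurable M" by (rule measurable_lebesgue_on_cong_AE[OF set_lebesgue Fm ae])
    have wm: "w \<in> borel_measurable M" by (rule LpD(1)[OF W01p_simps(1)[OF w]])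
    have "(LINT x|M. (norm (vt t x) powr (p - 2) *\<^sub>R vt t x) \<bullet> w x) = dual_pairing M p (\<lambda>x. F (x, t)) w"
      unfolding dual_pairing_def
    proof (rule integral_cong_AE)
      show "AE x in M. (norm (vt t x) powr (p - 2) *\<^sub>R vt t x) \<bullet> w x = (norm (F (x, t)) powr (p - 2) *\<^sub>R F (x, t)) \<bullet> w x"
        using ae by eventually_elim simp
    qed (use Fm vm wm in measurable)
    then show "solves_at t w" using elim(1) t by (auto simp: solves_at_def dual_pairing_def)
  qed
qed

lemma solves_at_limit:
  assumes F: "(\<lambda>x. F (x, t)) \<in> Lp lborel p" and v: "v t \<in> W01p \<Omega> p" and s: "\<And>k. s k \<in> W01p \<Omega> p" "\<And>k. solves_at t (s k)"
    and w: "w \<in> W01p \<Omega> p" and lim: "(\<lambda>k. W1p_norm \<Omega> p (\<lambda>x. s k x - w x)) \<longlonglongrightarrow> 0"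
  shows "solves_at t w"
proof -
  note l = lim[unfolded W1p_norm_tendsto_0_iff]
  have l2: "(\<lambda>k. pnorm M p (\<lambda>x. wgrad \<Omega> (s k) x - wgrad \<Omega> w x)) \<longlonglongrightarrow> 0"
    using l pint_wgrad_diff[OF W01pD[OF s(1)] W01pD[OF w]] by (simp add: pnorm_def)
  have "(\<lambda>k. dual_pairing M p (\<lambda>x. F (x, t)) (s k) + dual_pairing M p (wgrad \<Omega> (v t)) (wgrad \<Omega> (s k))) \<longlonglongrightarrow>
    dual_pairing M p (\<lambda>x. F (x, t)) w + dual_pairing M p (wgrad \<Omega> (v t)) (wgrad \<Omega> w)"
    by (intro tendsto_add dual_pairing_tendsto[OF p_gt_1] F_slice_Lp(1)[OF F] W01p_simps s(1) w v l2 conjunct1[OF l])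
  then show ?thesis using s(2) by (simp add: solves_at_def LIMSEQ_const_iff)
qed

text \<open>
  The exceptional null set of the equation depends on the test function. A strongly measurable map
  is almost everywhere a limit of countably many values, so almost all values of the solution
  itself are admissible test functions at almost all times.
\<close>

lemma good_times_bounded:
  assumes T: "0 < T"
  shows "\<exists>G. (AE t in lborel. 0 < t \<and> t \<le> T \<longrightarrow> t \<in> G) \<and> (\<forall>t\<in>G. v t \<in> W01p \<Omega> p \<and> (\<lambda>x. F (x, t)) \<in> Lp lborel p) \<and>
    (\<forall>t\<in>G. \<forall>r\<in>G. solves_at t (v r))"
proof -
  have W: "AE t in lborel. 0 \<le> t \<and> t \<le> T \<longrightarrow> v t \<in> W01p \<Omega> p"
    using bounded_W01p[OF T] unfolding Linf_W01p_def AE_on_interval by blast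
  have "\<exists>s. (\<forall>k. simple_function (lebesgue_on {0..T}) (s k) \<and> (\<forall>t\<in>{0..T}. s k t \<in> W01p \<Omega> p)) \<and>
      (AE t in lborel. 0 \<le> t \<and> t \<le> T \<longrightarrow> (\<lambda>k. W1p_norm \<Omega> p (\<lambda>x. (s :: nat \<Rightarrow> real \<Rightarrow> real ^ 'n \<Rightarrow> real ^ 'm) k t x - v t x)) \<longlonglongrightarrow> 0)"
    using bounded_W01p[OF T] unfolding Linf_W01p_def AE_on_interval by blast
  then obtain s where s0: "\<forall>k. simple_function (lebesgue_on {0..T}) (s k) \<and> (\<forall>t\<in>{0..T}. s k t \<in> W01p \<Omega> p)"
    and s3: "AE t in lborel. 0 \<le> t \<and> t \<le> T \<longrightarrow> (\<lambda>k. W1p_norm \<Omega> p (\<lambda>x. (s :: nat \<Rightarrow> real \<Rightarrow> real ^ 'n \<Rightarrow> real ^ 'm) k t x - v t x)) \<longlonglongrightarrow> 0"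
    by blast
  have s: "simple_function (lebesgue_on {0..T}) (s k)" "t \<in> {0..T} \<Longrightarrow> s k t \<in> W01p \<Omega> p" for k t
    using s0 by blast+
  \<comment> \<open>A simple function has finitely many values, so that the equation holds for all of \<open>S\<close> outside one null set.\<close>
  define S where "S = (\<Union>k. s k ` {0..T})"
  have "finite (s k ` {0..T})" for k using simple_functionD(1)[OF s(1)[of k]] by simp
  then have cS: "countable S" unfolding S_def by (auto intro: countable_finite)
  have SW: "w \<in> S \<Longrightarrow> w \<in> W01p \<Omega> p" for w using s(2) by (auto simp: S_def)
  have aeS: "AE t in lborel. \<forall>w\<in>S. 0 < t \<and> t \<le> T \<longrightarrow> solves_at t w"
    by (rule AE_ball_countable'[OF AE_solves_at[OF T SW] cS])
  define G where "G = {t. 0 < t \<and> t \<le> T \<and> v t \<in> W01p \<Omega> p \<and> (\<lambda>x. F (x, t)) \<in> Lp lborel p \<and> (\<forall>w\<in>S. solves_at t w) \<and>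
     (\<lambda>k. W1p_norm \<Omega> p (\<lambda>x. s k t x - v t x)) \<longlonglongrightarrow> 0}"
  have "AE t in lborel. 0 < t \<and> t \<le> T \<longrightarrow> t \<in> G"
    using W s3 aeS D_slices(1) by eventually_elim (auto simp: G_def)
  moreover have "v t \<in> W01p \<Omega> p \<and> (\<lambda>x. F (x, t)) \<in> Lp lborel p" if "t \<in> G" for t
    using that by (simp add: G_def)
  moreover have "solves_at t (v r)" if "t \<in> G" "r \<in> G" for t r
  proof (rule solves_at_limit[of t "\<lambda>k. s k r"])
    show "s k r \<in> W01p \<Omega> p" "solves_at t (s k r)" for k
      using that s(2)[of r k] by (auto simp: G_def S_def)
  qed (use that in \<open>auto simp: G_def\<close>)
  ultimately show ?thesis by blast
qed

lemma good_times:
  shows "\<exists>G. (AE t in lborel. 0 < t \<longrightarrow> t \<in> G) \<and> (\<forall>t\<in>G. 0 < t \<and> (\<lambda>x. F (x, t)) \<in> Lp lborel p) \<and>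
    (\<forall>t\<in>G. \<forall>r\<in>G. solves_at t (v r))"
proof -
  have "\<forall>n. \<exists>G. (AE t in lborel. 0 < t \<and> t \<le> real (Suc n) \<longrightarrow> t \<in> G) \<and> (\<forall>t\<in>G. v t \<in> W01p \<Omega> p \<and> (\<lambda>x. F (x, t)) \<in> Lp lborel p) \<and>
    (\<forall>t\<in>G. \<forall>r\<in>G. solves_at t (v r))"
    by (intro allI good_times_bounded) simp
  from choice[OF this] obtain G where G: "\<forall>n. (AE t in lborel. 0 < t \<and> t \<le> real (Suc n) \<longrightarrow> t \<in> G n) \<and> (\<forall>t\<in>G n. v t \<in> W01p \<Omega> p \<and> (\<lambda>x. F (x, t)) \<in> Lp lborel p) \<and>
    (\<forall>t\<in>G n. \<forall>r\<in>G n. solves_at t (v r))" ..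
  \<comment> \<open>Membership in all relevant \<open>G n\<close> lets two times of \<open>H\<close> share one index, since \<open>G n\<close> relates
    only times of the same set.\<close>
  define H where "H = {t. 0 < t \<and> (\<forall>n. t \<le> real (Suc n) \<longrightarrow> t \<in> G n)}"
  have big: "\<exists>n. t \<le> real (Suc n) \<and> r \<le> real (Suc n)" for t r :: real
  proof -
    obtain n where "max t r \<le> real n" using real_arch_simple by blast
    then show ?thesis by (intro exI[of _ n]) auto
  qed
  have HG: "\<exists>n. t \<in> G n \<and> r \<in> G n" if "t \<in> H" "r \<in> H" for t r
    using that big[of t r] by (auto simp: H_def)
  have "\<forall>n. AE t in lborel. 0 < t \<and> t \<le> real (Suc n) \<longrightarrow> t \<in> G n" using G by blast
  then have "AE t in lborel. \<forall>n. 0 < t \<and> t \<le> real (Suc n) \<longrightarrow> t \<in> G n" by (simp only: AE_all_countable simp_thms)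
  then have "AE t in lborel. 0 < t \<longrightarrow> t \<in> H" by eventually_elim (auto simp: H_def)
  moreover have "0 < t \<and> (\<lambda>x. F (x, t)) \<in> Lp lborel p" if tH: "t \<in> H" for t
  proof -
    have "0 < t" using tH by (simp add: H_def)
    moreover obtain n where "t \<in> G n" using HG[OF tH tH] by blast
    ultimately show ?thesis using G by blast
  qed
  moreover have "solves_at t (v r)" if "t \<in> H" "r \<in> H" for t r
    using HG[OF that] G by blast
  ultimately show ?thesis by blast
qed

definition E :: "real \<Rightarrow> real" where
  "E t = energy \<Omega> p (v t)"

lemma v_near:
  assumes t: "0 \<le> t" and \<delta>: "0 < \<delta>"
  shows "\<exists>\<eta>>0. \<forall>s\<ge>0. \<bar>s - t\<bar> < \<eta> \<longrightarrow> pnorm M p (\<lambda>x. v s x - v t x) < \<delta>"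
proof -
  have "\<forall>\<^sub>F s in at t within {0..}. pnorm M p (\<lambda>x. v s x - v t x) < \<delta>"
    using order_tendstoD(2)[OF v_continuous[OF t] \<delta>] .
  then obtain \<eta> where \<eta>: "0 < \<eta>" "\<And>s. s \<in> {0..} \<Longrightarrow> s \<noteq> t \<Longrightarrow> dist s t < \<eta> \<Longrightarrow> pnorm M p (\<lambda>x. v s x - v t x) < \<delta>"
    unfolding eventually_at by blast
  show ?thesis
  proof (intro exI[of _ \<eta>] conjI allI impI)
    fix s :: real assume "0 \<le> s" "\<bar>s - t\<bar> < \<eta>"
    then show "pnorm M p (\<lambda>x. v s x - v t x) < \<delta>"
      using \<eta>(2)[of s] \<delta> by (cases "s = t") (auto simp: dist_real_def pnorm_def pint_def)
  qed (rule \<eta>(1))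
qed

text \<open>
  Since \<open>v\<close> is continuous with values in \<open>L\<^sup>p\<close>, lower semicontinuity of the energy extends bounds
  from times arbitrarily close to \<open>t\<close> to \<open>t\<close> itself. This removes exceptional times.
\<close>

lemma W01p_of_nearby:
  assumes t: "0 \<le> t" and near: "\<And>\<eta>. 0 < \<eta> \<Longrightarrow> \<exists>s. 0 \<le> s \<and> \<bar>s - t\<bar> < \<eta> \<and> v s \<in> W01p \<Omega> p \<and> energy \<Omega> p (v s) \<le> C"
  shows "v t \<in> W01p \<Omega> p" "energy \<Omega> p (v t) \<le> C"
proof -
  have *: "\<exists>w\<in>W01p \<Omega> p. pnorm M p (\<lambda>x. w x - v t x) \<le> \<delta> \<and> energy \<Omega> p w \<le> C" if \<delta>: "0 < \<delta>" for \<delta>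
  proof -
    obtain \<eta> where \<eta>: "0 < \<eta>" "\<forall>s\<ge>0. \<bar>s - t\<bar> < \<eta> \<longrightarrow> pnorm M p (\<lambda>x. v s x - v t x) < \<delta>"
      using v_near[OF t \<delta>] by blast
    obtain s where s: "0 \<le> s" "\<bar>s - t\<bar> < \<eta>" "v s \<in> W01p \<Omega> p" "energy \<Omega> p (v s) \<le> C" using near[OF \<eta>(1)] by blast
    then have "pnorm M p (\<lambda>x. v s x - v t x) < \<delta>" using \<eta>(2) by blast
    then show ?thesis using s by (intro bexI[of _ "v s"]) auto
  qed
  show "v t \<in> W01p \<Omega> p" by (rule energy_lower_semicontinuous(1)[OF v_Lp[OF t] *])
  show "energy \<Omega> p (v t) \<le> C" by (rule energy_lower_semicontinuous(2)[OF v_Lp[OF t] *])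
qed

lemma energy_locally_bounded:
  assumes T: "0 < T"
  shows "\<exists>C. \<forall>t. 0 \<le> t \<and> t < T \<longrightarrow> v t \<in> W01p \<Omega> p \<and> energy \<Omega> p (v t) \<le> C"
proof -
  have ae1: "AE t in lborel. 0 \<le> t \<and> t \<le> T \<longrightarrow> v t \<in> W01p \<Omega> p"
    using bounded_W01p[OF T] unfolding Linf_W01p_def AE_on_interval by blast
  obtain C where ae2: "AE t in lborel. 0 \<le> t \<and> t \<le> T \<longrightarrow> W1p_norm \<Omega> p (v t) \<le> C"
    using bounded_W01p[OF T] unfolding Linf_W01p_def AE_on_interval by blast
  have ae: "AE t in lborel. 0 \<le> t \<and> t \<le> T \<longrightarrow> v t \<in> W01p \<Omega> p \<and> energy \<Omega> p (v t) \<le> C powr p"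
    using ae1 ae2
  proof eventually_elim
    case (elim t)
    have "energy \<Omega> p (v t) \<le> C powr p" if "W1p_norm \<Omega> p (v t) \<le> C"
    proof -
      have "energy \<Omega> p (v t) \<le> pint M p (v t) + pint M p (wgrad \<Omega> (v t))" by (simp add: energy_eq)
      also have "\<dots> = W1p_norm \<Omega> p (v t) powr p" by (simp add: W1p_norm_def pint_def powr_powr)
      also have "\<dots> \<le> C powr p" using that by (intro powr_mono2) (auto simp: W1p_norm_def)
      finally show ?thesis .
    qed
    then show ?case using elim by auto
  qed
  have "v t \<in> W01p \<Omega> p \<and> energy \<Omega> p (v t) \<le> C powr p" if t: "0 \<le> t" "t < T" for t
  proof -
    have "\<exists>s. 0 \<le> s \<and> \<bar>s - t\<bar> < \<eta> \<and> v s \<in> W01p \<Omega> p \<and> energy \<Omega> p (v s) \<le> C powr p" if "0 < \<eta>" for \<eta>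
    proof -
      have "t < min T (t + \<eta>)" using t that by simp
      from AE_lborel_ex_between[OF ae this] obtain s where
        "t < s" "s < min T (t + \<eta>)" "0 \<le> s \<and> s \<le> T \<longrightarrow> v s \<in> W01p \<Omega> p \<and> energy \<Omega> p (v s) \<le> C powr p"
        by blast
      then show ?thesis using t by (intro exI[of _ s]) auto
    qed
    from W01p_of_nearby[OF t(1) this] show ?thesis by blast
  qed
  then show ?thesis by blast
qed

lemma v_W01p: "0 \<le> t \<Longrightarrow> v t \<in> W01p \<Omega> p"
  using energy_locally_bounded[of "t + 1"] by auto

lemma E_bounded: "\<exists>C. \<forall>t. 0 \<le> t \<and> t < T \<longrightarrow> E t \<le> C"
proof (cases "0 < T")
  case True
  from energy_locally_bounded[OF True] show ?thesis unfolding E_def by blast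
next
  case False
  then show ?thesis by auto
qed

lemma E_nonneg [simp]: "0 \<le> E t"
  by (simp add: E_def)

lemma E_le_limit:
  assumes t: "0 \<le> t" and near: "\<And>\<eta>. 0 < \<eta> \<Longrightarrow> \<exists>s. 0 \<le> s \<and> \<bar>s - t\<bar> < \<eta> \<and> E s \<le> C"
  shows "E t \<le> C"
  unfolding E_def
proof (rule W01p_of_nearby(2)[OF t])
  fix \<eta> :: real assume "0 < \<eta>"
  from near[OF this] show "\<exists>s. 0 \<le> s \<and> \<bar>s - t\<bar> < \<eta> \<and> v s \<in> W01p \<Omega> p \<and> energy \<Omega> p (v s) \<le> C"
    using v_W01p by (auto simp: E_def)
qed

text \<open>
  The sublevel sets are closed by lower semicontinuity. Composition with \<open>max 0\<close> avoids negative
  times, where \<open>v\<close> is arbitrary.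
\<close>

lemma E_measurable: "(\<lambda>t. E (max 0 t)) \<in> borel_measurable borel"
proof (rule borel_measurableI_le)
  fix c
  have "closed {t. E (max 0 t) \<le> c}"
    unfolding closed_sequential_limits
  proof (intro allI impI)
    fix X l assume X: "(\<forall>n. X n \<in> {t. E (max 0 t) \<le> c}) \<and> X \<longlonglongrightarrow> l"
    then have lim: "(\<lambda>n. max 0 (X n)) \<longlonglongrightarrow> max 0 l" by (intro tendsto_intros) auto
    have "E (max 0 l) \<le> c"
    proof (rule E_le_limit)
      fix \<eta> :: real assume "0 < \<eta>"
      from LIMSEQ_D[OF lim this] obtain n where "\<bar>max 0 (X n) - max 0 l\<bar> < \<eta>" by auto
      then show "\<exists>s. 0 \<le> s \<and> \<bar>s - max 0 l\<bar> < \<eta> \<and> E s \<le> c"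
        using X by (intro exI[of _ "max 0 (X n)"]) auto
    qed simp
    then show "l \<in> {t. E (max 0 t) \<le> c}" by simp
  qed
  then show "{x \<in> space borel. E (max 0 x) \<le> c} \<in> sets borel" by simp
qed

text \<open>
  In the subgradient inequality of the energy at \<open>v t\<close>, both pairings of gradients are replaced by
  pairings with the velocity, by the equation at the same time \<open>t\<close>.
\<close>

lemma energy_difference:
  assumes F: "(\<lambda>x. F (x, t)) \<in> Lp lborel p" and t: "0 \<le> t" and s: "solves_at t (v t)" "solves_at t w" and w: "w \<in> W01p \<Omega> p"
  shows "E t - energy \<Omega> p w \<le> - p * dual_pairing M p (\<lambda>x. F (x, t)) (\<lambda>x. v t x - w x)"
proof -
  note vW = W01p_simps[OF v_W01p[OF t]] and wW = W01p_simps[OF w] and FL = F_slice_Lp(1)[OF F]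
  have "p * dual_pairing M p (wgrad \<Omega> (v t)) (wgrad \<Omega> w) \<le> energy \<Omega> p w + (p - 1) * E t"
    using dual_pairing_convex[OF p_gt_1 vW(3) wW(3)] by (simp add: energy_eq E_def)
  moreover have "E t = - dual_pairing M p (\<lambda>x. F (x, t)) (v t)"
    using s(1) by (simp add: solves_at_def dual_pairing_self energy_eq E_def)
  moreover have "dual_pairing M p (wgrad \<Omega> (v t)) (wgrad \<Omega> w) = - dual_pairing M p (\<lambda>x. F (x, t)) w"
    using s(2) by (simp add: solves_at_def)
  ultimately have "E t - energy \<Omega> p w \<le> - p * (dual_pairing M p (\<lambda>x. F (x, t)) (v t) - dual_pairing M p (\<lambda>x. F (x, t)) w)"
    by (simp add: algebra_simps)
  then show ?thesis by (simp only: dual_pairing_diff[OF p_gt_1 FL vW(1) wW(1)])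
qed

text \<open>
  The equation tested with \<open>v t\<close> itself expresses the energy as a pairing of velocity and solution,
  to which Hoelder's inequality applies.
\<close>

lemma energy_rate: "AE t in lborel. 0 < t \<longrightarrow> E t \<le> D t powr ((p - 1) / p) * pnorm M p (v t)"
proof -
  obtain G where G: "AE t in lborel. 0 < t \<longrightarrow> t \<in> G" "\<forall>t\<in>G. 0 < t \<and> (\<lambda>x. F (x, t)) \<in> Lp lborel p"
    "\<forall>t\<in>G. \<forall>r\<in>G. solves_at t (v r)"
    using good_times by blast
  show ?thesis
    using G(1)
  proof eventually_elim
    case (elim t)
    show ?case
    proof
      assume t0: "0 < t"
      then have t: "t \<in> G" using elim by simp
      then have FL0: "(\<lambda>x. F (x, t)) \<in> Lp lborel p" using G(2) by blast
      note FL = F_slice_Lp[OF FL0]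
      have "solves_at t (v t)" using G(3) t by blast
      then have "E t = - dual_pairing M p (\<lambda>x. F (x, t)) (v t)"
        by (simp add: solves_at_def dual_pairing_self energy_eq E_def)
      also have "\<dots> \<le> pnorm M p (\<lambda>x. F (x, t)) powr (p - 1) * pnorm M p (v t)"
        using dual_pairing_bound[OF p_gt_1 FL(1) v_Lp[of t]] t0 by (simp add: abs_le_iff)
      also have "pnorm M p (\<lambda>x. F (x, t)) powr (p - 1) = D t powr ((p - 1) / p)"
        by (simp add: FL(3) powr_powr)
      finally show "E t \<le> D t powr ((p - 1) / p) * pnorm M p (v t)" .
    qed
  qed
qed

text \<open>
  Extending the trajectory constantly outside of \<open>[s, t]\<close> makes the differences \<open>a \<tau> - a (\<tau> - h)\<close> of
  its energy telescope exactly when they are integrated over \<open>(s, t + h)\<close>. For \<open>\<tau> < t\<close> the subgradient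
  inequality bounds them by the pairing of the velocity with its own averages over time \<open>h\<close>, which
  converge to the velocity. For \<open>\<tau> > t\<close> the earlier state is compared with the one at the good time
  \<open>t\<close>, and continuity of \<open>v\<close> at \<open>t\<close> makes the contribution small compared with \<open>h\<close>.
\<close>

lemma energy_inequality_good:
  assumes G: "AE t in lborel. 0 < t \<longrightarrow> t \<in> G" "\<forall>t\<in>G. 0 < t \<and> (\<lambda>x. F (x, t)) \<in> Lp lborel p" "\<forall>t\<in>G. \<forall>r\<in>G. solves_at t (v r)"
    and s: "0 \<le> s" "s < t" and t: "t \<in> G"
  shows "E t + p * pint lborel p (slab_velocity s t) \<le> E s"
proof -
  \<comment> \<open>The clamped time, and below the energy \<open>a\<close> of the constantly extended trajectory.\<close>
  define c where "c \<tau> = max s (min \<tau> t)" for \<tau>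
  define a where "a \<tau> = E (c \<tau>)" for \<tau>
  define P where "P = slab_velocity s t"
  define \<kappa> where "\<kappa> = pnorm M p (\<lambda>x. F (x, t)) powr (p - 1)"
  have PL: "P \<in> Lp lborel p" and Pm: "P \<in> borel_measurable borel" unfolding P_def by (rule slab_Lp, rule slab_measurable)
  have Pm2 [measurable]: "P \<in> borel_measurable (borel \<Otimes>\<^sub>M borel)" using Pm by (simp add: borel_prod)
  have P_out: "P (x, \<tau>) = 0" if "\<tau> \<notin> {s<..<t}" for x \<tau> using that by (simp add: P_def slab_velocity_def)
  have P_in: "P (x, \<tau>) = F (x, \<tau>)" if "s < \<tau>" "\<tau> < t" for x \<tau> using that by (simp add: P_def slab_velocity_def)
  have a_low: "a \<tau> = E s" if "\<tau> \<le> s" for \<tau> using that s by (simp add: a_def c_def)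
  have a_high: "a \<tau> = E t" if "t \<le> \<tau>" for \<tau> using that s by (simp add: a_def c_def)
  obtain C where C: "\<And>\<tau>. 0 \<le> \<tau> \<Longrightarrow> \<tau> < t + 1 \<Longrightarrow> E \<tau> \<le> C" using E_bounded[of "t + 1"] by blast
  have aC: "0 \<le> a \<tau>" "a \<tau> \<le> C" for \<tau> using C[of "c \<tau>"] s by (auto simp: a_def c_def)
  have am [measurable]: "a \<in> borel_measurable borel"
  proof -
    have "a = (\<lambda>\<tau>. E (max 0 (c \<tau>)))" using s by (auto simp: a_def c_def fun_eq_iff)
    moreover have "c \<in> borel_measurable borel" unfolding c_def by measurable
    ultimately show ?thesis using measurable_compose[OF _ E_measurable, of c borel] by simp
  qed
  have main: "E t - E s + p * pint lborel p P \<le> p * (pnorm lborel p P powr (p - 1) + \<kappa>) * \<epsilon>" if \<epsilon>: "0 < \<epsilon>" for \<epsilon>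
  proof -
    obtain d1 where d1: "0 < d1" "\<And>z. z \<noteq> 0 \<Longrightarrow> norm z < d1 \<Longrightarrow> pnorm lborel p (\<lambda>x. P (x + z) - P x) < \<epsilon>"
      using LIM_D[OF Lp_translation_continuous[OF PL p_facts(1)] \<epsilon>] by auto
    obtain d2 where d2: "0 < d2" "\<forall>r\<ge>0. \<bar>r - t\<bar> < d2 \<longrightarrow> pnorm M p (\<lambda>x. v r x - v t x) < \<epsilon>"
      using v_near[of t \<epsilon>] s \<epsilon> by auto
    define h where "h = min (min d1 d2) (t - s) / 2"
    have h: "0 < h" "h < d1" "h < d2" "h < t - s" using d1(1) d2(1) s by (auto simp: h_def)
    define N where "N = restrict_space lborel {0<..<h}"
    have spN: "space N = {0<..<h}" by (simp add: N_def space_restrict_space)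
    have emN: "emeasure N (space N) = ennreal h" using h by (simp add: spN N_def emeasure_restrict_space)
    then have mN: "measure N (space N) = h" using h by (simp add: measure_def)
    have fN: "finite_measure N" by (rule finite_measureI) (simp add: emN)
    \<comment> \<open>A translation in time only; \<open>H\<close> is the average of \<open>P\<close> over the preceding time \<open>h\<close>.\<close>
    define l :: "real \<Rightarrow> (real ^ 'n) \<times> real" where "l \<sigma> = (0, - \<sigma>)" for \<sigma>
    have lm: "l \<in> N \<rightarrow>\<^sub>M borel"
    proof -
      have "l \<in> borel_measurable borel" unfolding l_def by (intro borel_measurable_continuous_onI continuous_intros)
      then show ?thesis unfolding N_def by (intro measurable_restrict_space1) simp
    qed
    define H where "H z = (1 / h) *\<^sub>R (\<integral>\<sigma>. P (z + l \<sigma>) \<partial>N)" for z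
    have ld: "pnorm lborel p (\<lambda>x. P (x + l \<sigma>) - P x) \<le> \<epsilon>" if "\<sigma> \<in> space N" for \<sigma>
      using that h(2) by (intro less_imp_le d1(2)) (auto simp: l_def spN zero_prod_def)
    have HP: "(\<lambda>z. H z - P z) \<in> Lp lborel p" "pnorm lborel p (\<lambda>z. H z - P z) \<le> \<epsilon>"
      using average_close[OF PL p_gt_1 fN _ lm ld] h \<epsilon> by (simp_all add: mN H_def)
    have HL: "H \<in> Lp lborel p" using Lp_add[OF HP(1) PL p_facts(1)] by simp
    have Hm [measurable]: "H \<in> borel_measurable (borel \<Otimes>\<^sub>M borel)" using LpD(1)[OF HL] by (simp add: borel_prod)
    define Q where "Q z = (norm (P z) powr (p - 2) *\<^sub>R P z) \<bullet> H z" for z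
    have Qi: "integrable lborel Q" unfolding Q_def by (rule dual_pairing_integrable[OF p_gt_1 PL HL])
    define q where "q \<tau> = (LINT x|lborel. Q (x, \<tau>))" for \<tau>
    have qi: "integrable lborel q" and qQ: "(LINT \<tau>|lborel. q \<tau>) = dual_pairing lborel p P H"
      using Fubini_time(2,3)[OF Qi] by (simp_all add: q_def[abs_def] dual_pairing_def Q_def)
    have q_out: "q \<tau> = 0" if "\<tau> \<notin> {s<..<t}" for \<tau> using P_out[OF that] by (simp add: q_def Q_def)
    have q_low: "pint lborel p P - pnorm lborel p P powr (p - 1) * \<epsilon> \<le> (LINT \<tau>|lborel. q \<tau>)"
    proof -
      have "\<bar>dual_pairing lborel p P (\<lambda>z. H z - P z)\<bar> \<le> pnorm lborel p P powr (p - 1) * pnorm lborel p (\<lambda>z. H z - P z)"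
        by (rule dual_pairing_bound[OF p_gt_1 PL HP(1)])
      also have "\<dots> \<le> pnorm lborel p P powr (p - 1) * \<epsilon>" using HP(2) by (intro mult_left_mono) auto
      finally show ?thesis using dual_pairing_diff[OF p_gt_1 PL HL PL] by (simp add: qQ dual_pairing_self abs_le_iff)
    qed
    have H_incr: "h *\<^sub>R H (x, \<tau>) = increment (max s (\<tau> - h)) \<tau> x" if \<tau>: "s < \<tau>" "\<tau> < t" for x \<tau>
    proof -
      have "h *\<^sub>R H (x, \<tau>) = (\<integral>\<sigma>. P (x, \<tau> - \<sigma>) \<partial>N)" using h by (simp add: H_def l_def)
      also have "\<dots> = (LINT \<sigma>|lborel. indicator {0<..<h} \<sigma> *\<^sub>R P (x, \<tau> - \<sigma>))"
        unfolding N_def by (rule integral_restrict_space) simp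
      also have "\<dots> = (LINT \<rho>|lborel. indicator {\<tau> - h<..<\<tau>} \<rho> *\<^sub>R P (x, \<rho>))"
        by (subst lborel_integral_real_affine[where c = "-1" and t = \<tau> and f = "\<lambda>\<rho>. indicator {\<tau> - h<..<\<tau>} \<rho> *\<^sub>R P (x, \<rho>)"])
          (auto intro!: Bochner_Integration.integral_cong simp: indicator_def)
      also have "\<dots> = increment (max s (\<tau> - h)) \<tau> x"
        unfolding increment_def P_def slab_velocity_def using \<tau>
        by (intro Bochner_Integration.integral_cong) (auto simp: indicator_def)
      finally show ?thesis .
    qed
    have K: "AE \<tau> in lborel. s < \<tau> \<and> \<tau> < t + h \<longrightarrow> a \<tau> - a (\<tau> - h) \<le> - p * h * q \<tau> + indicator {t<..<t+h} \<tau> * (p * \<kappa> * \<epsilon>)"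
    proof -
      \<comment> \<open>For \<open>\<tau> - h \<le> s\<close> the earlier state is \<open>v s\<close>, whose time \<open>s\<close> need not be good; therefore the
        equation is also tested with this one function.\<close>
      have T1: "0 < t + 1" using s by simp
      show ?thesis
        using G(1) AE_lborel_translate[OF G(1), of h] AE_solves_at[OF T1 v_W01p[OF s(1)]] AE_lborel_singleton[of t]
      proof eventually_elim
        case (elim \<tau>)
        show ?case
        proof
          assume \<tau>: "s < \<tau> \<and> \<tau> < t + h"
          consider "\<tau> < t" | "t < \<tau>" using elim(4) by linarith
          then show "a \<tau> - a (\<tau> - h) \<le> - p * h * q \<tau> + indicator {t<..<t+h} \<tau> * (p * \<kappa> * \<epsilon>)"
          proof cases
            case 1
            define r where "r = max s (\<tau> - h)"
            have r: "0 \<le> r" "r < \<tau>" using s \<tau> h by (auto simp: r_def)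
            have \<tau>G: "\<tau> \<in> G" using elim(1) \<tau> s by simp
            have FL: "(\<lambda>x. F (x, \<tau>)) \<in> Lp lborel p" using G(2) \<tau>G by blast
            have s1: "solves_at \<tau> (v \<tau>)" using G(3) \<tau>G by blast
            have s2: "solves_at \<tau> (v r)"
            proof (cases "\<tau> - h \<le> s")
              case True then show ?thesis using elim(3) \<tau> s 1 by (simp add: r_def)
            next
              case False
              then have "\<tau> - h \<in> G" using elim(2) s by simp
              then show ?thesis using G(3) \<tau>G False by (simp add: r_def)
            qed
            have "dual_pairing M p (\<lambda>x. F (x, \<tau>)) (\<lambda>x. v \<tau> x - v r x) = (LINT x|lborel. h * Q (x, \<tau>))"
              unfolding dual_pairing_def
            proof (rule integral_representative(1)[OF open_set])
              show "(\<lambda>x. h * Q (x, \<tau>)) \<in> borel_measurable borel" unfolding Q_def by measurable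
              show "h * Q (x, \<tau>) = 0" if "x \<notin> \<Omega>" for x
                using F_outside(1)[OF that] by (simp add: Q_def P_def slab_velocity_def)
              show "AE x in lborel. x \<in> \<Omega> \<longrightarrow> (norm (F (x, \<tau>)) powr (p - 2) *\<^sub>R F (x, \<tau>)) \<bullet> (v \<tau> x - v r x) = h * Q (x, \<tau>)"
                using v_increment[OF r]
              proof eventually_elim
                case (elim x)
                have "h * Q (x, \<tau>) = (norm (F (x, \<tau>)) powr (p - 2) *\<^sub>R F (x, \<tau>)) \<bullet> (h *\<^sub>R H (x, \<tau>))"
                  using \<tau> 1 by (simp add: Q_def P_in)
                then show ?case using elim H_incr[of \<tau> x] \<tau> 1 by (simp add: r_def)
              qed
            qed
            also have "\<dots> = h * q \<tau>" by (simp add: q_def)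
            finally have dq: "dual_pairing M p (\<lambda>x. F (x, \<tau>)) (\<lambda>x. v \<tau> x - v r x) = h * q \<tau>" .
            have "E \<tau> - E r \<le> - p * (h * q \<tau>)"
              using energy_difference[OF FL _ s1 s2 v_W01p[OF r(1)]] \<tau> s by (simp add: dq E_def[of r])
            moreover have "a \<tau> = E \<tau>" "a (\<tau> - h) = E r" using \<tau> 1 h by (auto simp: a_def c_def r_def)
            ultimately show ?thesis using 1 by simp
          next
            case 2
            define r where "r = \<tau> - h"
            have r: "0 \<le> r" "s < r" "r < t" "\<bar>r - t\<bar> < d2" using s \<tau> h 2 by (auto simp: r_def)
            have rG: "r \<in> G" using elim(2) r s by (simp add: r_def)
            have FL: "(\<lambda>x. F (x, t)) \<in> Lp lborel p" using G(2) t by blast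
            have s1: "solves_at t (v t)" "solves_at t (v r)" using G(3) t rG by blast+
            have t0: "0 \<le> t" using s by simp
            have "E t - E r \<le> - p * dual_pairing M p (\<lambda>x. F (x, t)) (\<lambda>x. v t x - v r x)"
              using energy_difference[OF FL t0 s1 v_W01p[OF r(1)]] by (simp add: E_def[of r])
            also have "\<dots> = p * (- dual_pairing M p (\<lambda>x. F (x, t)) (\<lambda>x. v t x - v r x))" by simp
            also have "\<dots> \<le> p * (\<kappa> * \<epsilon>)"
            proof (rule mult_left_mono)
              have "- dual_pairing M p (\<lambda>x. F (x, t)) (\<lambda>x. v t x - v r x) \<le> \<kappa> * pnorm M p (\<lambda>x. v t x - v r x)"
                using dual_pairing_bound[OF p_gt_1 F_slice_Lp(1)[OF FL] Lp_diff[OF v_Lp[OF t0] v_Lp[OF r(1)] p_facts(1)]]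
                by (simp add: \<kappa>_def abs_le_iff)
              also have "\<dots> \<le> \<kappa> * \<epsilon>"
                using d2(2) r pnorm_commute_diff[of M p "v t" "v r"] by (intro mult_left_mono) (auto simp: \<kappa>_def less_imp_le)
              finally show "- dual_pairing M p (\<lambda>x. F (x, t)) (\<lambda>x. v t x - v r x) \<le> \<kappa> * \<epsilon>" .
            qed simp
            finally have "E t - E r \<le> p * \<kappa> * \<epsilon>" by simp
            moreover have "a \<tau> = E t" "a (\<tau> - h) = E r" using r 2 by (auto simp: a_def c_def r_def)
            moreover have "q \<tau> = 0" using 2 by (intro q_out) simp
            ultimately show ?thesis using \<tau> 2 by simp
          qed
        qed
      qed
    qed
    have ai: "integrable lborel (\<lambda>\<tau>. indicator A \<tau> * a (\<tau> + y))" if A: "A \<in> sets borel" "bounded A" for A y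
    proof (rule Bochner_Integration.integrable_bound)
      show "integrable lborel (\<lambda>\<tau>. C * indicator A \<tau>)"
        using A by (intro integrable_mult_right integrable_real_indicator emeasure_bounded_finite) auto
      show "AE \<tau> in lborel. norm (indicator A \<tau> * a (\<tau> + y)) \<le> norm (C * indicator A \<tau>)"
        using aC order_trans[OF aC] by (intro AE_I2) (auto simp: indicator_def abs_of_nonneg)
    qed (use A in measurable)
    have ai1: "integrable lborel (\<lambda>\<tau>. indicator {s<..<t+h} \<tau> * a \<tau>)" using ai[of "{s<..<t+h}" 0] by simp
    have ai2: "integrable lborel (\<lambda>\<tau>. indicator {s<..<t+h} \<tau> * a (\<tau> - h))" using ai[of "{s<..<t+h}" "- h"] by simp
    have ai3: "integrable lborel (\<lambda>\<tau>. indicator {s-h<..<t} \<tau> * a \<tau>)" using ai[of "{s-h<..<t}" 0] by simp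
    have shift: "(LINT \<tau>|lborel. indicator {s<..<t+h} \<tau> * a (\<tau> - h)) = (LINT \<tau>|lborel. indicator {s-h<..<t} \<tau> * a \<tau>)"
      by (subst lborel_integral_real_affine[where c = 1 and t = h and f = "\<lambda>\<tau>. indicator {s<..<t+h} \<tau> * a (\<tau> - h)"])
        (auto intro!: Bochner_Integration.integral_cong simp: indicator_def)
    have "(LINT \<tau>|lborel. indicator {s<..<t+h} \<tau> * a \<tau> - indicator {s<..<t+h} \<tau> * a (\<tau> - h))
       = (LINT \<tau>|lborel. indicator {s<..<t+h} \<tau> * a \<tau> - indicator {s-h<..<t} \<tau> * a \<tau>)"
      using ai1 ai2 ai3 shift by simp
    also have "\<dots> = (LINT \<tau>|lborel. E t * indicator {t..<t+h} \<tau> - E s * indicator {s-h<..s} \<tau>)"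
      using s h a_low a_high by (intro Bochner_Integration.integral_cong) (auto simp: indicator_def)
    also have "\<dots> = E t * h - E s * h"
      using h by (subst Bochner_Integration.integral_diff)
        (auto intro!: integrable_mult_right integrable_real_indicator emeasure_bounded_finite)
    finally have L: "(LINT \<tau>|lborel. indicator {s<..<t+h} \<tau> * a \<tau> - indicator {s<..<t+h} \<tau> * a (\<tau> - h)) = E t * h - E s * h" .
    have ri: "integrable lborel (\<lambda>\<tau>. indicator {t<..<t+h} \<tau> * (p * \<kappa> * \<epsilon>))"
      by (intro integrable_mult_left integrable_real_indicator emeasure_bounded_finite) auto
    have "E t * h - E s * h \<le> (LINT \<tau>|lborel. - p * h * q \<tau> + indicator {t<..<t+h} \<tau> * (p * \<kappa> * \<epsilon>))"
      unfolding L[symmetric]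
    proof (rule integral_mono_AE)
      show "integrable lborel (\<lambda>\<tau>. indicator {s<..<t+h} \<tau> * a \<tau> - indicator {s<..<t+h} \<tau> * a (\<tau> - h))"
        by (rule Bochner_Integration.integrable_diff[OF ai1 ai2])
      show "integrable lborel (\<lambda>\<tau>. - p * h * q \<tau> + indicator {t<..<t+h} \<tau> * (p * \<kappa> * \<epsilon>))"
        by (rule Bochner_Integration.integrable_add[OF integrable_mult_right[OF qi] ri])
      show "AE \<tau> in lborel. indicator {s<..<t+h} \<tau> * a \<tau> - indicator {s<..<t+h} \<tau> * a (\<tau> - h) \<le> - p * h * q \<tau> + indicator {t<..<t+h} \<tau> * (p * \<kappa> * \<epsilon>)"
        using K
      proof eventually_elim
        case (elim \<tau>)
        show ?case
        proof (cases "s < \<tau> \<and> \<tau> < t + h")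
          case True then show ?thesis using elim by (simp only: indicator_simps greaterThanLessThan_iff simp_thms mult_1) 
        next
          case False
          then have "q \<tau> = 0" using h s by (intro q_out) auto
          then show ?thesis using False s h by (auto simp: indicator_def)
        qed
      qed
    qed
    also have "\<dots> = - p * h * (LINT \<tau>|lborel. q \<tau>) + h * (p * \<kappa> * \<epsilon>)"
      using qi ri h by (subst Bochner_Integration.integral_add[OF integrable_mult_right[OF qi] ri]) simp
    also have "\<dots> \<le> - p * h * (pint lborel p P - pnorm lborel p P powr (p - 1) * \<epsilon>) + h * (p * \<kappa> * \<epsilon>)"
    proof (rule add_right_mono)
      have "- p * h \<le> 0" using h p_facts by (simp add: mult_nonneg_nonneg)
      then show "- p * h * (LINT \<tau>|lborel. q \<tau>) \<le> - p * h * (pint lborel p P - pnorm lborel p P powr (p - 1) * \<epsilon>)"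
        by (rule mult_left_mono_neg[OF q_low])
    qed
    also have "\<dots> = h * (- p * (pint lborel p P - pnorm lborel p P powr (p - 1) * \<epsilon>) + p * \<kappa> * \<epsilon>)"
      by (simp add: algebra_simps)
    finally have "h * (E t - E s) \<le> h * (- p * (pint lborel p P - pnorm lborel p P powr (p - 1) * \<epsilon>) + p * \<kappa> * \<epsilon>)"
      by (simp add: algebra_simps)
    then have "E t - E s \<le> - p * (pint lborel p P - pnorm lborel p P powr (p - 1) * \<epsilon>) + p * \<kappa> * \<epsilon>"
      by (rule mult_left_le_imp_le[OF _ h(1)])
    then show ?thesis by (simp add: algebra_simps)
  qed
  have "E t - E s + p * pint lborel p P \<le> 0"
  proof (rule tendsto_lowerbound[OF _ _ trivial_limit_at_right_real])
    show "((\<lambda>\<epsilon>. p * (pnorm lborel p P powr (p - 1) + \<kappa>) * \<epsilon>) \<longlongrightarrow> 0) (at_right 0)"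
      by (auto intro!: tendsto_eq_intros)
    show "\<forall>\<^sub>F \<epsilon> in at_right 0. E t - E s + p * pint lborel p P \<le> p * (pnorm lborel p P powr (p - 1) + \<kappa>) * \<epsilon>"
      unfolding eventually_at_right_field by (intro exI[of _ 1]) (auto intro: main)
  qed
  then show ?thesis by (simp add: P_def)
qed

text \<open>
  Good times \<open>r\<close> accumulate at \<open>t\<close> from the right, and the energy at \<open>t\<close> is at most the bound that the
  inequality gives at these times, by lower semicontinuity.
\<close>

lemma energy_inequality:
  assumes s: "0 \<le> s" "s < t"
  shows "E t + p * (LINT \<tau>|lborel. indicator {s<..<t} \<tau> * D \<tau>) \<le> E s"
proof -
  obtain G where G: "AE t in lborel. 0 < t \<longrightarrow> t \<in> G" "\<forall>t\<in>G. 0 < t \<and> (\<lambda>x. F (x, t)) \<in> Lp lborel p"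
    "\<forall>t\<in>G. \<forall>r\<in>G. solves_at t (v r)"
    using good_times by blast
  have "E t \<le> E s - p * (LINT \<tau>|lborel. indicator {s<..<t} \<tau> * D \<tau>)"
  proof (rule E_le_limit)
    show "0 \<le> t" using s by simp
    fix \<eta> :: real assume \<eta>: "0 < \<eta>"
    then have "t < t + \<eta>" by simp
    from AE_lborel_ex_between[OF G(1) this] obtain r where r: "t < r" "r < t + \<eta>" "0 < r \<longrightarrow> r \<in> G" by blast
    have "E r + p * (LINT \<tau>|lborel. indicator {s<..<r} \<tau> * D \<tau>) \<le> E s"
      using energy_inequality_good[OF G s(1), of r] r s by (simp add: D_slices(3))
    moreover have "(LINT \<tau>|lborel. indicator {s<..<t} \<tau> * D \<tau>) \<le> (LINT \<tau>|lborel. indicator {s<..<r} \<tau> * D \<tau>)"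
      using r by (intro integral_mono D_slices(2)) (auto simp: indicator_def)
    then have "p * (LINT \<tau>|lborel. indicator {s<..<t} \<tau> * D \<tau>) \<le> p * (LINT \<tau>|lborel. indicator {s<..<r} \<tau> * D \<tau>)"
      by (rule mult_left_mono) simp
    ultimately have "E r \<le> E s - p * (LINT \<tau>|lborel. indicator {s<..<t} \<tau> * D \<tau>)" by linarith
    then show "\<exists>r. 0 \<le> r \<and> \<bar>r - t\<bar> < \<eta> \<and> E r \<le> E s - p * (LINT \<tau>|lborel. indicator {s<..<t} \<tau> * D \<tau>)"
      using r s by (intro exI[of _ r]) auto
  qed
  then show ?thesis by simp
qed

end


section \<open>The first eigenvalue\<close>

context bounded_open_set
begin

lemma nonzero_on_iff: "u \<in> Lp M p \<Longrightarrow> nonzero_on \<Omega> u \<longleftrightarrow> 0 < pint M p u"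
  using pint_eq_0_iff[of u M p] pint_nonneg[of M p u] by (auto simp: nonzero_on_def simp del: pint_nonneg)

lemma rayleigh_eq: "rayleigh \<Omega> p u = energy \<Omega> p u / pint M p u"
  by (simp add: rayleigh_def pint_def)

lemma Lambda_le_energy:
  fixes u :: "real ^ 'n \<Rightarrow> real ^ 'm::finite"
  assumes u: "u \<in> W01p \<Omega> p"
  shows "Lambda TYPE('m) \<Omega> p * pint M p u \<le> energy \<Omega> p u"
proof (cases "nonzero_on \<Omega> u")
  case True
  then have pos: "0 < pint M p u" using nonzero_on_iff[OF W01p_simps(1)[OF u]] by simp
  have "Lambda TYPE('m) \<Omega> p \<le> rayleigh \<Omega> p u"
    unfolding Lambda_def
  proof (rule cInf_lower)
    show "rayleigh \<Omega> p u \<in> {rayleigh \<Omega> p u |u :: real ^ 'n \<Rightarrow> real ^ 'm. u \<in> W01p \<Omega> p \<and> nonzero_on \<Omega> u}"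
      using u True by blast
    show "bdd_below {rayleigh \<Omega> p u |u :: real ^ 'n \<Rightarrow> real ^ 'm. u \<in> W01p \<Omega> p \<and> nonzero_on \<Omega> u}"
      by (rule bdd_belowI[of _ 0]) (auto simp: rayleigh_eq)
  qed
  then show ?thesis using pos by (simp add: rayleigh_eq pos_le_divide_eq)
next
  case False
  then have "pint M p u = 0" using nonzero_on_iff[OF W01p_simps(1)[OF u]] pint_nonneg[of M p u] by linarith
  then show ?thesis by simp
qed

text \<open>
  Poincare's inequality bounds all competing quotients from below. A competitor is needed since the
  infimum of the empty set is an unspecified number.
\<close>

lemma Lambda_pos:
  fixes u :: "real ^ 'n \<Rightarrow> real ^ 'm::finite"
  assumes u: "u \<in> W01p \<Omega> p" "nonzero_on \<Omega> u"
  shows "0 < Lambda TYPE('m) \<Omega> p"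
proof -
  obtain C where C: "0 < C" "\<And>u :: real ^ 'n \<Rightarrow> real ^ 'm. u \<in> W01p \<Omega> p \<Longrightarrow> pnorm M p u \<le> C * pnorm M p (wgrad \<Omega> u)"
    by (rule poincare) (rule that)
  have "1 / C powr p \<le> Lambda TYPE('m) \<Omega> p"
    unfolding Lambda_def
  proof (rule cInf_greatest)
    show "{rayleigh \<Omega> p u |u :: real ^ 'n \<Rightarrow> real ^ 'm. u \<in> W01p \<Omega> p \<and> nonzero_on \<Omega> u} \<noteq> {}"
      using u by blast
  next
    fix x assume "x \<in> {rayleigh \<Omega> p u |u :: real ^ 'n \<Rightarrow> real ^ 'm. u \<in> W01p \<Omega> p \<and> nonzero_on \<Omega> u}"
    then obtain w :: "real ^ 'n \<Rightarrow> real ^ 'm" where w: "x = rayleigh \<Omega> p w" "w \<in> W01p \<Omega> p" "nonzero_on \<Omega> w" by blast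
    have pos: "0 < pint M p w" using nonzero_on_iff[OF W01p_simps(1)[OF w(2)]] w(3) by simp
    have "pint M p w \<le> (C * pnorm M p (wgrad \<Omega> w)) powr p"
      by (rule pint_le_pnorm_powr[OF p_facts(2) C(2)[OF w(2)]])
    also have "\<dots> = C powr p * energy \<Omega> p w"
      using C(1) by (simp add: powr_mult pnorm_powr energy_eq)
    finally show "1 / C powr p \<le> x"
      using pos C(1) by (simp add: w(1) rayleigh_eq field_simps)
  qed
  moreover have "0 < 1 / C powr p" using C(1) by simp
  ultimately show ?thesis by linarith
qed

lemma energy_eq_0_if_zero:
  fixes u :: "real ^ 'n \<Rightarrow> real ^ 'm::finite"
  assumes u: "u \<in> W01p \<Omega> p" and zero: "AE x in M. u x = 0"
  shows "energy \<Omega> p u = 0"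
proof -
  have z: "AE x in lborel. x \<in> \<Omega> \<longrightarrow> u x = 0"
    using zero by (simp add: AE_lebesgue_on_iff)
  have "AE x in lborel. \<forall>j. x \<in> \<Omega> \<longrightarrow> column j (wgrad \<Omega> u x) = 0"
    using has_weak_deriv_zero[OF open_set _ z] W01p_simps(2)[OF u]
    unfolding has_weak_grad_def by (subst AE_all_countable) blast
  then have "AE x in lborel. x \<in> \<Omega> \<longrightarrow> wgrad \<Omega> u x = 0"
  proof eventually_elim
    case (elim x)
    then show ?case by (auto simp: vec_eq_iff column_def)
  qed
  then have "AE x in M. wgrad \<Omega> u x = 0" by (simp add: AE_lebesgue_on_iff)
  then show ?thesis unfolding energy_eq using pint_eq_0_iff[OF W01p_simps(3)[OF u]] by simp
qed

end


section \<open>Exponential decay of the energy\<close>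

context evolution
begin

lemma E_antimono:
  assumes "0 \<le> s" "s \<le> t"
  shows "E t \<le> E s"
proof (cases "s = t")
  case False
  then have st: "s < t" using assms by simp
  have "0 \<le> (LINT \<tau>|lborel. indicator {s<..<t} \<tau> * D \<tau>)" by (intro integral_nonneg_AE AE_I2) simp
  then have "0 \<le> p * (LINT \<tau>|lborel. indicator {s<..<t} \<tau> * D \<tau>)" by (intro mult_nonneg_nonneg) simp_all
  then show ?thesis using energy_inequality[OF assms(1) st] by linarith
qed simp

text \<open>
  The \<open>p\<close>-th power of \<open>energy_rate\<close> is \<open>E\<^sup>p \<le> D\<^bsup>p-1\<^esup> pint (v t)\<close>; multiplied by \<open>c\<close>, its last factor
  is bounded by \<open>E\<close>, and one power of \<open>E\<close> cancels.
\<close>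

lemma D_lower_bound:
  assumes c: "0 \<le> c"
  shows "AE t in lborel. 0 < t \<longrightarrow> c * pint M p (v t) \<le> E t \<longrightarrow> c powr (1 / (p - 1)) * E t \<le> D t"
  using energy_rate
proof eventually_elim
  case (elim t)
  show ?case
  proof (intro impI)
    assume t: "0 < t" and ct: "c * pint M p (v t) \<le> E t"
    show "c powr (1 / (p - 1)) * E t \<le> D t"
    proof (cases "E t = 0")
      case False
      then have E: "0 < E t" using E_nonneg[of t] by linarith
      have p1: "0 < p - 1" using p_gt_1 by simp
      have rate: "E t \<le> D t powr ((p - 1) / p) * pnorm M p (v t)" using elim t by simp
      have "E t powr p \<le> (D t powr ((p - 1) / p) * pnorm M p (v t)) powr p"
        using rate by (intro powr_mono2) auto
      also have "\<dots> = D t powr (p - 1) * pint M p (v t)"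
        by (simp add: powr_mult powr_powr pnorm_powr)
      finally have "c * E t powr p \<le> c * (D t powr (p - 1) * pint M p (v t))"
        using c by (rule mult_left_mono)
      also have "\<dots> = D t powr (p - 1) * (c * pint M p (v t))" by simp
      also have "\<dots> \<le> D t powr (p - 1) * E t" using ct by (intro mult_left_mono) auto
      finally have "c * E t powr p \<le> D t powr (p - 1) * E t" .
      moreover have "E t powr p = E t powr (p - 1) * E t"
        using E powr_add[of "E t" "p - 1" 1] by simp
      ultimately have "c * E t powr (p - 1) * E t \<le> D t powr (p - 1) * E t" by (simp add: mult.assoc)
      then have "c * E t powr (p - 1) \<le> D t powr (p - 1)" using E by (rule mult_right_le_imp_le)
      then have "(c * E t powr (p - 1)) powr (1 / (p - 1)) \<le> (D t powr (p - 1)) powr (1 / (p - 1))"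
        using c p1 by (intro powr_mono2) auto
      then show ?thesis using c p1 E by (simp add: powr_mult powr_powr)
    qed simp
  qed
qed

lemma E_decay_step:
  assumes s: "0 \<le> s" "s \<le> t" and \<kappa>: "0 \<le> \<kappa>" and low: "AE \<tau> in lborel. s < \<tau> \<and> \<tau> < t \<longrightarrow> \<kappa> * E \<tau> \<le> D \<tau>"
  shows "E t * (1 + p * \<kappa> * (t - s)) \<le> E s"
proof (cases "s = t")
  case False
  then have st: "s < t" using s by simp
  have "\<kappa> * E t * (t - s) = (LINT \<tau>|lborel. indicator {s<..<t} \<tau> * (\<kappa> * E t))"
    using st by simp
  also have "\<dots> \<le> (LINT \<tau>|lborel. indicator {s<..<t} \<tau> * D \<tau>)"
  proof (rule integral_mono_AE)
    show "integrable lborel (\<lambda>\<tau>. indicator {s<..<t} \<tau> * (\<kappa> * E t))"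
      by (intro integrable_mult_left integrable_real_indicator emeasure_bounded_finite) auto
    show "AE \<tau> in lborel. indicator {s<..<t} \<tau> * (\<kappa> * E t) \<le> indicator {s<..<t} \<tau> * D \<tau>"
      using low
    proof eventually_elim
      case (elim \<tau>)
      show ?case
      proof (cases "s < \<tau> \<and> \<tau> < t")
        case True
        then have "\<kappa> * E t \<le> \<kappa> * E \<tau>" using s \<kappa> by (intro mult_left_mono E_antimono) auto
        then show ?thesis using True elim by simp
      qed (auto simp: indicator_def)
    qed
  qed (rule D_slices(2))
  finally have "p * (\<kappa> * E t * (t - s)) \<le> p * (LINT \<tau>|lborel. indicator {s<..<t} \<tau> * D \<tau>)"
    by (rule mult_left_mono) simp
  then have "E t + p * (\<kappa> * E t * (t - s)) \<le> E s" using energy_inequality[OF s(1) st] by linarith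
  then show ?thesis by (simp add: algebra_simps)
qed simp

text \<open>
  The energy is only known to be a monotone function of time, so instead of integrating a
  differential inequality, the one-step estimate is iterated over \<open>n\<close> equal time steps; the
  product of the factors tends to the exponential.
\<close>

lemma E_decay:
  assumes s: "0 \<le> s" "s \<le> t" and \<kappa>: "0 \<le> \<kappa>" and low: "AE \<tau> in lborel. s < \<tau> \<and> \<tau> < t \<longrightarrow> \<kappa> * E \<tau> \<le> D \<tau>"
  shows "E t * exp (p * \<kappa> * (t - s)) \<le> E s"
proof (rule tendsto_upperbound)
  show "(\<lambda>n. E t * (1 + p * \<kappa> * (t - s) / real n) ^ n) \<longlonglongrightarrow> E t * exp (p * \<kappa> * (t - s))"
    by (intro tendsto_mult tendsto_const tendsto_exp_limit_sequentially)
  show "\<forall>\<^sub>F n in sequentially. E t * (1 + p * \<kappa> * (t - s) / real n) ^ n \<le> E s"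
  proof (rule eventually_mono[OF eventually_gt_at_top[of 0]])
    fix n :: nat assume n: "0 < n"
    define h where "h = (t - s) / real n"
    have h: "0 \<le> h" "real n * h = t - s" using s n by (auto simp: h_def)
    have "k \<le> n \<Longrightarrow> E (s + real k * h) * (1 + p * \<kappa> * h) ^ k \<le> E s" for k
    proof (induction k)
      case (Suc k)
      have le: "real (Suc k) * h \<le> real n * h" using Suc.prems h by (intro mult_right_mono) auto
      have kh: "0 \<le> real k * h" using h by simp
      have "E (s + real (Suc k) * h) * (1 + p * \<kappa> * (s + real (Suc k) * h - (s + real k * h))) \<le> E (s + real k * h)"
      proof (rule E_decay_step)
        show "0 \<le> s + real k * h" "s + real k * h \<le> s + real (Suc k) * h" using s h kh by (auto simp: algebra_simps)
        show "AE \<tau> in lborel. s + real k * h < \<tau> \<and> \<tau> < s + real (Suc k) * h \<longrightarrow> \<kappa> * E \<tau> \<le> D \<tau>"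
          using low
        proof eventually_elim
          case (elim \<tau>)
          then show ?case using le kh h(2) by auto
        qed
      qed (rule \<kappa>)
      moreover have "s + real (Suc k) * h - (s + real k * h) = h" by (simp add: algebra_simps)
      ultimately have 1: "E (s + real (Suc k) * h) * (1 + p * \<kappa> * h) \<le> E (s + real k * h)" by simp
      have "0 \<le> 1 + p * \<kappa> * h" using \<kappa> h by (intro add_nonneg_nonneg mult_nonneg_nonneg) auto
      then have "E (s + real (Suc k) * h) * (1 + p * \<kappa> * h) * (1 + p * \<kappa> * h) ^ k \<le> E (s + real k * h) * (1 + p * \<kappa> * h) ^ k"
        using 1 by (intro mult_right_mono zero_le_power) auto
      also have "\<dots> \<le> E s" using Suc by simp
      finally show ?case by (simp only: power_Suc mult.assoc)
    qed simp
    from this[of n] show "E t * (1 + p * \<kappa> * (t - s) / real n) ^ n \<le> E s"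
      using h(2) by (simp add: h_def)
  qed
qed simp

lemma E_decay_if_quotient_ge:
  assumes s: "0 \<le> s" "s \<le> t" and c: "0 \<le> c" and low: "\<And>\<tau>. s < \<tau> \<Longrightarrow> \<tau> < t \<Longrightarrow> c * pint M p (v \<tau>) \<le> E \<tau>"
  shows "E t * exp (p * c powr (1 / (p - 1)) * (t - s)) \<le> E s"
proof (rule E_decay[OF s])
  show "AE \<tau> in lborel. s < \<tau> \<and> \<tau> < t \<longrightarrow> c powr (1 / (p - 1)) * E \<tau> \<le> D \<tau>"
    using D_lower_bound[OF c]
  proof eventually_elim
    case (elim \<tau>)
    then show ?case using s low[of \<tau>] by auto
  qed
qed simp

end


section \<open>Large times\<close>

text \<open>
  The parameters \<open>\<Lambda>\<close> and \<open>\<Upsilon>\<close> merely name the two constants; as the latter depend on a type, an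
  abbreviation inside the locale would lose track of it.
\<close>

locale nondegenerate_evolution = evolution \<Omega> p v vt
  for \<Omega> :: "(real ^ 'n::finite) set" and p :: real and v vt :: "real \<Rightarrow> real ^ 'n \<Rightarrow> real ^ 'm::finite" +
  fixes \<Lambda> \<Upsilon> :: real
  assumes eigenvalue_def: "\<Lambda> = Lambda TYPE('m) \<Omega> p" and decay_rate_def: "\<Upsilon> = Upsilon TYPE('m) \<Omega> p"
    and nondegenerate: "\<exists>c>0. \<forall>\<^sub>F t in at_top. c \<le> exp (p * \<Upsilon> * t) * energy \<Omega> p (v t)"
begin

lemma decay_rate_eq: "\<Upsilon> = \<Lambda> powr (1 / (p - 1))"
  by (simp add: decay_rate_def eigenvalue_def Upsilon_def)

definition G :: "real \<Rightarrow> real" where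
  "G t = exp (p * \<Upsilon> * t) * E t"

lemma E_pos:
  assumes t: "0 \<le> t"
  shows "0 < E t"
proof (rule ccontr)
  assume "\<not> 0 < E t"
  then have 0: "E t \<le> 0" by simp
  obtain c where c: "0 < c" "\<forall>\<^sub>F s in at_top. c \<le> exp (p * \<Upsilon> * s) * E s"
    using nondegenerate unfolding E_def by blast
  have "\<forall>\<^sub>F s in at_top. t \<le> s \<and> c \<le> exp (p * \<Upsilon> * s) * E s"
    by (rule eventually_conj[OF eventually_ge_at_top c(2)])
  then obtain s where s: "t \<le> s" "c \<le> exp (p * \<Upsilon> * s) * E s"
    using eventually_happens'[OF trivial_limit_at_top_linorder] by blast
  have "E s = 0" using E_antimono[OF t s(1)] 0 E_nonneg[of s] by linarith
  then show False using s(2) c(1) by simp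
qed

lemma v_nonzero:
  assumes t: "0 \<le> t"
  shows "nonzero_on \<Omega> (v t)"
  unfolding nonzero_on_def
proof
  assume "AE x in M. v t x = 0"
  then have "E t = 0" unfolding E_def by (rule energy_eq_0_if_zero[OF v_W01p[OF t]])
  then show False using E_pos[OF t] by simp
qed

lemma pint_v_pos: "0 \<le> t \<Longrightarrow> 0 < pint M p (v t)"
  using v_nonzero nonzero_on_iff[OF v_Lp] by blast

lemma Lambda_positive: "0 < \<Lambda>"
  unfolding eigenvalue_def by (rule Lambda_pos[OF v_W01p v_nonzero, of 0]) simp_all

lemma Lambda_le_E: "0 \<le> t \<Longrightarrow> \<Lambda> * pint M p (v t) \<le> E t"
  unfolding E_def eigenvalue_def by (rule Lambda_le_energy[OF v_W01p])

lemma G_antimono: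
  assumes s: "0 \<le> s" "s \<le> t"
  shows "G t \<le> G s"
proof -
  have "E t * exp (p * \<Upsilon> * (t - s)) \<le> E s"
    unfolding decay_rate_eq
    using s Lambda_positive by (intro E_decay_if_quotient_ge Lambda_le_E) auto
  then have "exp (p * \<Upsilon> * s) * (E t * exp (p * \<Upsilon> * (t - s))) \<le> exp (p * \<Upsilon> * s) * E s"
    by (intro mult_left_mono) auto
  moreover have "exp (p * \<Upsilon> * t) = exp (p * \<Upsilon> * s) * exp (p * \<Upsilon> * (t - s))"
    by (simp add: exp_add[symmetric] algebra_simps)
  ultimately show ?thesis by (simp add: G_def mult_ac)
qed

text \<open>
  A nonincreasing function tends to its infimum, and nondegeneracy keeps the infimum positive.
\<close>

lemma G_limit:
  obtains S where "0 < S" "(G \<longlongrightarrow> S) at_top" "\<And>t. 0 \<le> t \<Longrightarrow> S \<le> G t"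
proof -
  obtain c where c: "0 < c" "\<forall>\<^sub>F s in at_top. c \<le> G s"
    using nondegenerate unfolding E_def[symmetric] G_def[symmetric] by blast
  have cG: "c \<le> G t" if "0 \<le> t" for t
  proof -
    have "\<forall>\<^sub>F s in at_top. t \<le> s \<and> c \<le> G s"
      by (rule eventually_conj[OF eventually_ge_at_top c(2)])
    then obtain s where s: "t \<le> s" "c \<le> G s"
      using eventually_happens'[OF trivial_limit_at_top_linorder] by blast
    then show ?thesis using G_antimono[OF that s(1)] by linarith
  qed
  define S where "S = Inf (G ` {0..})"
  have bdd: "bdd_below (G ` {0..})" by (rule bdd_belowI[of _ c]) (auto intro: cG)
  have low: "S \<le> G t" if "0 \<le> t" for t
    unfolding S_def using that by (intro cInf_lower bdd) auto
  have "c \<le> S" unfolding S_def by (rule cInf_greatest) (auto intro: cG)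
  then have pos: "0 < S" using c(1) by linarith
  have "(G \<longlongrightarrow> S) at_top"
  proof (rule order_tendstoI)
    fix a assume a: "a < S"
    show "\<forall>\<^sub>F t in at_top. a < G t"
    proof (rule eventually_mono[OF eventually_ge_at_top[of 0]])
      fix t :: real assume "0 \<le> t"
      then show "a < G t" using low[of t] a by linarith
    qed
  next
    fix a assume a: "S < a"
    have "\<exists>y\<in>G ` {0..}. y < a" using a unfolding S_def by (intro cInf_lessD) auto
    then obtain t where t: "0 \<le> t" "G t < a" by auto
    show "\<forall>\<^sub>F s in at_top. G s < a"
    proof (rule eventually_mono[OF eventually_ge_at_top[of t]])
      fix s assume "t \<le> s"
      then show "G s < a" using G_antimono[OF t(1), of s] t(2) by linarith
    qed
  qed
  then show thesis using that[OF pos _ low] by blast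
qed

text \<open>
  A larger quotient during a whole time interval of length \<open>\<delta>\<close> would divide \<open>G\<close> by a fixed
  factor \<open>q > 1\<close>; once \<open>G\<close> is close to its positive limit, this is impossible.
\<close>

lemma quotient_small_somewhere:
  assumes \<epsilon>: "0 < \<epsilon>" and \<delta>: "0 < \<delta>"
  shows "\<forall>\<^sub>F s in at_top. \<exists>r. s < r \<and> r < s + \<delta> \<and> E r < (\<Lambda> + \<epsilon>) * pint M p (v r)"
proof -
  obtain S where S: "0 < S" "(G \<longlongrightarrow> S) at_top" "\<And>t. 0 \<le> t \<Longrightarrow> S \<le> G t" by (rule G_limit) (rule that)
  define \<kappa> where "\<kappa> = (\<Lambda> + \<epsilon>) powr (1 / (p - 1))"
  define q where "q = exp (p * (\<kappa> - \<Upsilon>) * \<delta>)"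
  have "\<Upsilon> < \<kappa>" unfolding \<kappa>_def decay_rate_eq using Lambda_positive \<epsilon> p_gt_1 by (intro powr_less_mono2) auto
  then have "0 < p * (\<kappa> - \<Upsilon>) * \<delta>" using \<delta> by (intro mult_pos_pos) auto
  then have "1 < q" by (simp add: q_def)
  then have "S < S * q" using S(1) by simp
  then have "\<forall>\<^sub>F s in at_top. G s < S * q" by (rule order_tendstoD(2)[OF S(2)])
  then show ?thesis using eventually_ge_at_top[of 0]
  proof eventually_elim
    case (elim s)
    show ?case
    proof (rule ccontr)
      assume not: "\<not> (\<exists>r>s. r < s + \<delta> \<and> E r < (\<Lambda> + \<epsilon>) * pint M p (v r))"
      have "E (s + \<delta>) * exp (p * \<kappa> * (s + \<delta> - s)) \<le> E s"
        unfolding \<kappa>_def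
      proof (rule E_decay_if_quotient_ge)
        show "(\<Lambda> + \<epsilon>) * pint M p (v \<tau>) \<le> E \<tau>" if "s < \<tau>" "\<tau> < s + \<delta>" for \<tau>
          proof (rule ccontr)
          assume "\<not> (\<Lambda> + \<epsilon>) * pint M p (v \<tau>) \<le> E \<tau>"
          then show False using not that by auto
        qed
      qed (use elim \<delta> \<epsilon> Lambda_positive in auto)
      then have Gs: "exp (p * \<Upsilon> * s) * (E (s + \<delta>) * exp (p * \<kappa> * \<delta>)) \<le> G s"
        unfolding G_def by (intro mult_left_mono) auto
      have split: "exp (p * \<Upsilon> * s) * exp (p * \<kappa> * \<delta>) = exp (p * \<Upsilon> * (s + \<delta>)) * q"
        by (simp add: q_def exp_add[symmetric] algebra_simps)
      have "exp (p * \<Upsilon> * s) * (E (s + \<delta>) * exp (p * \<kappa> * \<delta>)) = (exp (p * \<Upsilon> * s) * exp (p * \<kappa> * \<delta>)) * E (s + \<delta>)"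
        by simp
      also have "\<dots> = G (s + \<delta>) * q" unfolding split G_def by simp
      finally have "exp (p * \<Upsilon> * s) * (E (s + \<delta>) * exp (p * \<kappa> * \<delta>)) = G (s + \<delta>) * q" .
      with Gs have "G (s + \<delta>) * q \<le> G s" by simp
      moreover have "S * q \<le> G (s + \<delta>) * q" using S(3)[of "s + \<delta>"] elim \<delta> \<open>1 < q\<close> by (intro mult_right_mono) auto
      ultimately show False using elim by linarith
    qed
  qed
qed

text \<open>
  A good time \<open>r\<close> shortly before \<open>t\<close> controls the quotient at \<open>t\<close>: the energy does not increase,
  and \<open>v\<close> moves little in \<open>L\<^sup>p\<close> between \<open>r\<close> and \<open>t\<close>. The length \<open>\<delta>\<close> is chosen such that this
  movement is at most the fraction \<open>h\<close> of the norm of \<open>v r\<close>.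
\<close>

lemma quotient_eventually_small:
  assumes h: "0 < h" "h < 1"
  shows "\<forall>\<^sub>F t in at_top. E t / pint M p (v t) \<le> (\<Lambda> + h) / (1 - h) powr p"
proof -
  have Lh: "0 < \<Lambda> + h" using Lambda_positive h by simp
  \<comment> \<open>With this length \<open>pint_increment\<close> gives exactly the bound \<open>h powr p * pint (v r)\<close> for the
    movement.\<close>
  define \<delta> where "\<delta> = (h powr p / (\<Lambda> + h)) powr (1 / (p - 1))"
  have \<delta>: "0 < \<delta>" "\<delta> powr (p - 1) * (\<Lambda> + h) = h powr p"
    using Lh h p_gt_1 by (auto simp: \<delta>_def powr_powr)
  have "\<forall>\<^sub>F s in at_top. 0 \<le> s \<and> (\<exists>r. s < r \<and> r < s + \<delta> \<and> E r < (\<Lambda> + h) * pint M p (v r))"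
    by (rule eventually_conj[OF eventually_ge_at_top quotient_small_somewhere[OF h(1) \<delta>(1)]])
  then obtain s0 where s0: "\<And>s. s0 \<le> s \<Longrightarrow> 0 \<le> s \<and> (\<exists>r. s < r \<and> r < s + \<delta> \<and> E r < (\<Lambda> + h) * pint M p (v r))"
    unfolding eventually_at_top_linorder by blast
  show ?thesis
  proof (rule eventually_mono[OF eventually_ge_at_top[of "s0 + \<delta>"]])
    fix t assume "s0 + \<delta> \<le> t"
    then have ts: "s0 \<le> t - \<delta>" by simp
    obtain r where r: "0 \<le> t - \<delta>" "t - \<delta> < r" "r < t" "E r < (\<Lambda> + h) * pint M p (v r)"
      using s0[OF ts] by auto
    have r0: "0 \<le> r" and t0: "0 \<le> t" using r \<delta> by auto
    define I where "I = (LINT \<tau>|lborel. indicator {r<..<t} \<tau> * D \<tau>)"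
    have I0: "0 \<le> I" unfolding I_def by (intro integral_nonneg_AE AE_I2) simp
    have "I \<le> p * I" using mult_right_mono[OF p_facts(1) I0] by simp
    then have I: "I \<le> E r" using energy_inequality[OF r0 r(3)] E_nonneg[of t] unfolding I_def[symmetric] by linarith
    have "pint M p (\<lambda>x. v t x - v r x) \<le> (t - r) powr (p - 1) * I"
      unfolding I_def by (rule pint_increment[OF r0 r(3)])
    also have "\<dots> \<le> \<delta> powr (p - 1) * ((\<Lambda> + h) * pint M p (v r))"
      using r I I0 p_gt_1 by (intro mult_mono powr_mono2) auto
    also have "\<dots> = h powr p * pint M p (v r)" unfolding mult.assoc[symmetric] \<delta>(2) ..
    also have "\<dots> = (h * pnorm M p (v r)) powr p" using h by (simp add: powr_mult pnorm_powr)
    finally have "pnorm M p (\<lambda>x. v t x - v r x) \<le> h * pnorm M p (v r)"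
      using h by (intro pnorm_le) auto
    moreover have "\<bar>pnorm M p (v t) - pnorm M p (v r)\<bar> \<le> pnorm M p (\<lambda>x. v t x - v r x)"
      by (rule pnorm_triangle_diff[OF v_Lp v_Lp]) (use r0 t0 in simp_all)
    ultimately have "(1 - h) * pnorm M p (v r) \<le> pnorm M p (v t)" by (simp add: algebra_simps)
    then have "((1 - h) * pnorm M p (v r)) powr p \<le> pnorm M p (v t) powr p"
      using h by (intro powr_mono2) auto
    then have low: "(1 - h) powr p * pint M p (v r) \<le> pint M p (v t)"
      using h by (simp add: powr_mult pnorm_powr)
    have h1: "0 < (1 - h) powr p" using h by simp
    have "E t * (1 - h) powr p \<le> ((\<Lambda> + h) * pint M p (v r)) * (1 - h) powr p"
      using E_antimono[OF r0, of t] r by (intro mult_right_mono) auto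
    also have "\<dots> = (\<Lambda> + h) * ((1 - h) powr p * pint M p (v r))" by simp
    also have "\<dots> \<le> (\<Lambda> + h) * pint M p (v t)" using low Lh by (intro mult_left_mono) auto
    finally show "E t / pint M p (v t) \<le> (\<Lambda> + h) / (1 - h) powr p"
      using pint_v_pos[OF t0] h1 by (simp add: field_simps)
  qed
qed

lemma quotient_tendsto_Lambda: "((\<lambda>t. E t / pint M p (v t)) \<longlongrightarrow> \<Lambda>) at_top"
proof (rule order_tendstoI)
  fix a assume a: "a < \<Lambda>"
  show "\<forall>\<^sub>F t in at_top. a < E t / pint M p (v t)"
  proof (rule eventually_mono[OF eventually_ge_at_top[of 0]])
    fix t :: real assume t: "0 \<le> t"
    have "\<Lambda> \<le> E t / pint M p (v t)" using Lambda_le_E[OF t] pint_v_pos[OF t] by (simp add: pos_le_divide_eq)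
    then show "a < E t / pint M p (v t)" using a by linarith
  qed
next
  fix a assume a: "\<Lambda> < a"
  have "((\<lambda>h. (\<Lambda> + h) / (1 - h) powr p) \<longlongrightarrow> \<Lambda>) (at_right 0)"
    by (auto intro!: tendsto_eq_intros)
  then have "\<forall>\<^sub>F h in at_right 0. (\<Lambda> + h) / (1 - h) powr p < a" using a by (rule order_tendstoD(2))
  moreover have "\<forall>\<^sub>F h in at_right (0::real). h \<in> {0<..<1}" by (rule eventually_at_right_real) simp
  ultimately have "\<forall>\<^sub>F h in at_right 0. (\<Lambda> + h) / (1 - h) powr p < a \<and> h \<in> {0<..<1}" by (rule eventually_conj)
  then obtain h where h: "(\<Lambda> + h) / (1 - h) powr p < a" "0 < h" "h < 1"
    using eventually_happens'[OF trivial_limit_at_right_real] by fastforce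
  show "\<forall>\<^sub>F t in at_top. E t / pint M p (v t) < a"
    using quotient_eventually_small[OF h(2,3)]
  proof eventually_elim
    case (elim t)
    then show ?case using h(1) by linarith
  qed
qed

text \<open>
  The rescaled solution has energy tending to \<open>S > 0\<close> and, along a subsequence, an \<open>L\<^sup>p\<close> limit \<open>u\<close>
  with \<open>\<Lambda> * pint u = S\<close>. As the midpoint of two late members also is close to \<open>u\<close> in \<open>L\<^sup>p\<close>, its energy
  is asymptotically at least \<open>\<Lambda> * pint u = S\<close>, and uniform convexity makes the gradients converge.
\<close>

lemma rescaled_subsequence_converges:
  fixes \<tau> :: "nat \<Rightarrow> real"
  assumes pos: "\<And>k. 0 < \<tau> k" and lim: "filterlim \<tau> at_top sequentially"
  shows "\<exists>r. strict_mono r \<and> (\<exists>u. ground_state \<Omega> p u \<and>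
    converges_W01p \<Omega> p (\<lambda>k x. exp (\<Upsilon> * \<tau> (r k)) *\<^sub>R v (\<tau> (r k)) x) u)"
proof -
  obtain S where S: "0 < S" "(G \<longlongrightarrow> S) at_top" "\<And>t. 0 \<le> t \<Longrightarrow> S \<le> G t" by (rule G_limit) (rule that)
  have \<tau>0: "0 \<le> \<tau> k" for k using pos[of k] by simp
  define w where "w k = (\<lambda>x. exp (\<Upsilon> * \<tau> k) *\<^sub>R v (\<tau> k) x)" for k
  have scale: "(\<lambda>x. a *\<^sub>R u x) \<in> W01p \<Omega> p" if "u \<in> W01p \<Omega> p" for u :: "real ^ 'n \<Rightarrow> real ^ 'm" and a
    using W01p_lincomb(1)[OF that that, of a 0] by simp
  have w: "w k \<in> W01p \<Omega> p" for k unfolding w_def by (rule scale[OF v_W01p[OF \<tau>0]])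
  have e: "exp (\<Upsilon> * t) powr p = exp (p * \<Upsilon> * t)" for t by (simp add: powr_def mult_ac)
  have wG: "energy \<Omega> p (w k) = G (\<tau> k)" for k
    unfolding w_def G_def E_def using energy_scaleR[OF W01pD[OF v_W01p[OF \<tau>0[of k]]], of "exp (\<Upsilon> * \<tau> k)"] by (simp add: e)
  have wP: "pint M p (w k) = G (\<tau> k) / (E (\<tau> k) / pint M p (v (\<tau> k)))" for k
    unfolding w_def G_def using E_pos[OF \<tau>0[of k]] by (simp add: pint_scaleR e)
  have GS: "(\<lambda>k. G (\<tau> k)) \<longlonglongrightarrow> S" by (rule filterlim_compose[OF S(2) lim])
  have PS: "(\<lambda>k. pint M p (w k)) \<longlonglongrightarrow> S / \<Lambda>"
    unfolding wP using Lambda_positive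
    by (intro tendsto_divide GS filterlim_compose[OF quotient_tendsto_Lambda lim]) auto
  have "pnorm M p (wgrad \<Omega> (w k)) \<le> G 0 powr (1 / p)" for k
    unfolding pnorm_def energy_eq[symmetric] wG
    using G_antimono[OF order_refl \<tau>0[of k]] S(1) S(3)[OF \<tau>0[of k]] by (intro powr_mono2) auto
  from rellich[of w, OF w this] obtain r u where r: "strict_mono (r :: nat \<Rightarrow> nat)" and u: "u \<in> Lp M p"
    "(\<lambda>k. pnorm M p (\<lambda>x. w (r k) x - u x)) \<longlonglongrightarrow> 0" by blast
  have wL: "w k \<in> Lp M p" for k by (rule W01p_simps(1)[OF w])
  have "(\<lambda>k. pint M p (w (r k))) \<longlonglongrightarrow> pint M p u"
    by (rule tendsto_pint[OF wL u(1) p_facts(1) u(2)])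
  moreover have "(\<lambda>k. pint M p (w (r k))) \<longlonglongrightarrow> S / \<Lambda>"
    using LIMSEQ_subseq_LIMSEQ[OF PS r] by (simp add: o_def)
  ultimately have pu: "pint M p u = S / \<Lambda>" by (rule LIMSEQ_unique)
  have pun: "pnorm M p u powr p = S / \<Lambda>" by (simp add: pnorm_powr pu)
  note conv = W01p_converges_if_midpoints_large[of "\<lambda>k. w (r k)" u S, OF w u]
  have ES: "(\<lambda>k. energy \<Omega> p (w (r k))) \<longlonglongrightarrow> S"
    unfolding wG using LIMSEQ_subseq_LIMSEQ[OF GS r] by (simp add: o_def)
  have mid: "\<exists>N. \<forall>i\<ge>N. \<forall>j\<ge>N. S - \<eta> \<le> energy \<Omega> p (\<lambda>x. (1/2) *\<^sub>R w (r i) x + (1/2) *\<^sub>R w (r j) x)" if \<eta>: "0 < \<eta>" for \<eta>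
  proof -
    have "((\<lambda>d. \<Lambda> * \<bar>pnorm M p u - d\<bar> powr p) \<longlongrightarrow> \<Lambda> * \<bar>pnorm M p u - 0\<bar> powr p) (at_right 0)"
      by (intro tendsto_intros) auto
    moreover have "\<Lambda> * \<bar>pnorm M p u - 0\<bar> powr p = S" using pun Lambda_positive by simp
    ultimately have "((\<lambda>d. \<Lambda> * \<bar>pnorm M p u - d\<bar> powr p) \<longlongrightarrow> S) (at_right 0)" by simp
    then have "\<forall>\<^sub>F d in at_right 0. S - \<eta> < \<Lambda> * \<bar>pnorm M p u - d\<bar> powr p"
      using \<eta> by (intro order_tendstoD(1)[where a = "S - \<eta>"]) auto
    moreover have "0 < pnorm M p u" using pu S Lambda_positive by (simp add: pnorm_def)
    then have "\<forall>\<^sub>F d in at_right 0. d \<in> {0<..<pnorm M p u}" by (rule eventually_at_right_real)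
    ultimately have "\<forall>\<^sub>F d in at_right 0. S - \<eta> < \<Lambda> * \<bar>pnorm M p u - d\<bar> powr p \<and> d \<in> {0<..<pnorm M p u}"
      by (rule eventually_conj)
    then obtain d where d: "S - \<eta> < \<Lambda> * \<bar>pnorm M p u - d\<bar> powr p" "0 < d" "d < pnorm M p u"
      using eventually_happens'[OF trivial_limit_at_right_real] by fastforce
    have "\<forall>\<^sub>F k in sequentially. pnorm M p (\<lambda>x. w (r k) x - u x) < d"
      by (rule order_tendstoD(2)[OF u(2) d(2)])
    then obtain N where N: "\<And>k. N \<le> k \<Longrightarrow> pnorm M p (\<lambda>x. w (r k) x - u x) < d"
      unfolding eventually_sequentially by blast
    show ?thesis
    proof (intro exI[of _ N] allI impI)
      fix i j assume ij: "N \<le> i" "N \<le> j"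
      define m where "m = (\<lambda>x. (1/2) *\<^sub>R w (r i) x + (1/2) *\<^sub>R w (r j) x)"
      have m: "m \<in> W01p \<Omega> p" unfolding m_def by (rule W01p_lincomb(1)[OF w w])
      define a where "a k = (\<lambda>x. (1/2::real) *\<^sub>R (w (r k) x - u x))" for k
      have aL: "a k \<in> Lp M p" for k unfolding a_def by (intro Lp_scaleR Lp_diff wL u) simp
      have aN: "pnorm M p (a k) = 1/2 * pnorm M p (\<lambda>x. w (r k) x - u x)" for k
        unfolding a_def by (simp add: pnorm_scaleR)
      have mu: "(\<lambda>x. m x - u x) = (\<lambda>x. a i x + a j x)"
      proof
        fix x
        have "u x = (1/2) *\<^sub>R u x + (1/2) *\<^sub>R u x" by (simp add: scaleR_add_left[symmetric])
        then show "m x - u x = a i x + a j x" by (simp add: m_def a_def scaleR_diff_right)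
      qed
      have "pnorm M p (\<lambda>x. m x - u x) \<le> pnorm M p (a i) + pnorm M p (a j)"
        unfolding mu by (rule pnorm_add[OF aL aL]) simp
      also have "\<dots> \<le> d" using N[OF ij(1)] N[OF ij(2)] by (simp add: aN)
      finally have "pnorm M p u - d \<le> pnorm M p m"
        using pnorm_triangle_diff[OF W01p_simps(1)[OF m] u(1)] by simp
      then have "(pnorm M p u - d) powr p \<le> pnorm M p m powr p"
        using d by (intro powr_mono2) auto
      then have "\<Lambda> * (pnorm M p u - d) powr p \<le> \<Lambda> * pint M p m"
        using Lambda_positive by (intro mult_left_mono) (auto simp: pnorm_powr)
      also have "\<dots> \<le> energy \<Omega> p m" unfolding eigenvalue_def by (rule Lambda_le_energy[OF m])
      finally show "S - \<eta> \<le> energy \<Omega> p (\<lambda>x. (1/2) *\<^sub>R w (r i) x + (1/2) *\<^sub>R w (r j) x)"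
        using d by (simp add: m_def)
    qed
  qed
  note c = conv[OF ES mid]
  have "nonzero_on \<Omega> u" using nonzero_on_iff[OF u(1)] pu S(1) Lambda_positive by simp
  moreover have "rayleigh \<Omega> p u = \<Lambda>" using c(2) S(1) Lambda_positive by (simp add: rayleigh_eq pu)
  ultimately have "ground_state \<Omega> p u" using c(1) by (simp add: ground_state_def eigenvalue_def)
  moreover have "converges_W01p \<Omega> p (\<lambda>k. w (r k)) u"
    unfolding converges_W01p_def using w c(1,3) by blast
  ultimately show ?thesis using r unfolding w_def by blast
qed

end

theorem theorem1p3:
  fixes \<Omega> :: "(real ^ 'n::finite) set"
    and p :: real
    and g :: "real ^ 'n \<Rightarrow> real ^ 'm::finite"
    and v :: "real \<Rightarrow> real ^ 'n \<Rightarrow> real ^ 'm"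
  assumes "bounded_smooth_domain \<Omega>"
    and "1 < p"
    and "g \<in> W01p \<Omega> p"
    and "weak_solution \<Omega> p g v"
    and "Liminf at_top (\<lambda>t. ereal (exp (p * Upsilon TYPE('m) \<Omega> p * t) *
           (LINT x|lebesgue_on \<Omega>. norm (wgrad \<Omega> (v t) x) powr p))) > 0"
  shows "(\<forall>t\<ge>0. nonzero_on \<Omega> (v t)) \<and>
    ((\<lambda>t. (LINT x|lebesgue_on \<Omega>. norm (wgrad \<Omega> (v t) x) powr p) /
          (LINT x|lebesgue_on \<Omega>. norm (v t x) powr p)) \<longlongrightarrow> Lambda TYPE('m) \<Omega> p) at_top \<and>
    (\<forall>\<tau>::nat \<Rightarrow> real. incseq \<tau> \<and> (\<forall>k. \<tau> k > 0) \<and> filterlim \<tau> at_top sequentially \<longrightarrow>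
       (\<exists>r::nat \<Rightarrow> nat. strict_mono r \<and>
         (\<exists>u. ground_state \<Omega> p u \<and>
           converges_W01p \<Omega> p
             (\<lambda>k x. exp (Upsilon TYPE('m) \<Omega> p * \<tau> (r k)) *\<^sub>R v (\<tau> (r k)) x) u)))"
proof -
  obtain vt where cont: "continuous_Lp \<Omega> p v"
    and dt: "has_weak_deriv (\<Omega> \<times> {0<..}) (0, 1) (\<lambda>(x, t). v t x) (\<lambda>(x, t). vt t x)"
    and sol: "\<And>T. 0 < T \<Longrightarrow> (\<lambda>(x, t). vt t x) \<in> Lp_space (\<Omega> \<times> {0<..<T}) p \<and> v \<in> Linf_W01p \<Omega> p T \<and>
       (\<forall>w\<in>W01p \<Omega> p. AE t in lebesgue_on {0..T}.
          (LINT x|lebesgue_on \<Omega>. (norm (vt t x) powr (p - 2) *\<^sub>R vt t x) \<bullet> w x) +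
          (LINT x|lebesgue_on \<Omega>. (norm (wgrad \<Omega> (v t) x) powr (p - 2) *\<^sub>R wgrad \<Omega> (v t) x) \<bullet> wgrad \<Omega> w x) = 0)"
    using assms(4) unfolding weak_solution_def by blast
  obtain c where c: "0 < c" "ereal c < Liminf at_top (\<lambda>t. ereal (exp (p * Upsilon TYPE('m) \<Omega> p * t) * energy \<Omega> p (v t)))"
    using ereal_dense2[OF assms(5)] unfolding energy_def[symmetric] by auto
  have ev: "\<forall>\<^sub>F t in at_top. c \<le> exp (p * Upsilon TYPE('m) \<Omega> p * t) * energy \<Omega> p (v t)"
    using less_LiminfD[OF c(2)] by eventually_elim simp
  interpret nondegenerate_evolution \<Omega> p v vt "Lambda TYPE('m) \<Omega> p" "Upsilon TYPE('m) \<Omega> p"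
  proof unfold_locales
    show "open \<Omega>" "bounded \<Omega>" using assms(1) by (simp_all add: bounded_smooth_domain_def)
    show "\<exists>c>0. \<forall>\<^sub>F t in at_top. c \<le> exp (p * Upsilon TYPE('m) \<Omega> p * t) * energy \<Omega> p (v t)"
      using c(1) ev by blast
  qed (use assms(2) cont dt sol in simp_all)
  show ?thesis
    using v_nonzero quotient_tendsto_Lambda rescaled_subsequence_converges
    unfolding E_def energy_def pint_def by blast
qed

end
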